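(* Let $T$ be a stationary random transport on $\mathbb R^d$ such that $\Phi:=T(\cdot\times\mathbb R^d)$ is purely discrete and has a finite intensity $\gamma$. Let $L$ be a probability kernel from $\Omega\times\mathbb R^d$ to $\mathbb R^d$ satisfying $T(\mathrm d(x,y))=L(x,\mathrm dy)\,\Phi(\mathrm dx)$. Let $F\colon\mathbf M^1(\mathbb R^d)\to\Pi_d$ be a measurable mapping such that $$\int\pi'(\cdot)\,F(\pi)(\mathrm d\pi')=\pi(\cdot),\qquad F(\theta_x\pi)=\int\mathbf 1\{\theta_x\pi'\in\cdot\}\,F(\pi)(\mathrm d\pi'),\qquad x\in\mathbb R^d,\ \pi\in\mathbf M^1(\mathbb R^d).$$ Let $K$ be another probability kernel from $\Omega\times\mathbb R^d$ to $\mathbb R^d$ such that the family $\{K_x:x\in\Phi\}$ is conditionally independent given $T$, and $\mathbb P(K_x\in\cdot\mid T)=F(L_x)$, $x\in\Phi$, $\mathbb P$-a.s. Assume that $\mathbb E^\Phi_0\Phi\{0\}<\infty$ and that $K\Phi$ or $L\Phi$ is locally square-integrable. Then $$\hat\beta_{K\Phi}=\hat\beta_{L\Phi}+\hat\eta\cdot\lambda_d ,$$ where $$\hat\eta(k)=\gamma\,\mathbb E^\Phi_0\bigg[\bigg(\int|\hat\pi(k)|^2\,F(L_0)(\mathrm d\pi)-|\hat L_0(k)|^2\bigg)\Phi\{0\}\bigg],\quad k\in\mathbb R^d.$$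
   Context: $(\Omega,\mathcal A,\mathbb P)$ is a probability space, $\lambda_d$ Lebesgue measure on $\mathbb R^d$. A random measure is a random locally finite measure. A random transport is a random measure $T$ on $\mathbb R^d\times\mathbb R^d$ such that $T(\cdot\times\mathbb R^d)$ is locally finite; it is stationary if its distribution is invariant under all diagonal shifts $\theta_xT(B\times C):=T((B+x)\times(C+x))$, $x\in\mathbb R^d$. A random measure $\Phi$ on $\mathbb R^d$ is purely discrete if it can be written as $\Phi=\sum_{n\ge1}Y_n\delta_{X_n}$ with random $Y_n\ge0$ and $X_n\in\mathbb R^d$; $\Phi\{x\}:=\Phi(\{x\})$ and $x\in\Phi$ means $\Phi\{x\}>0$. Its intensity $\gamma:=\mathbb E\Phi([0,1]^d)$ is assumed positive and finite. $\mathbb E^\Phi_0$ is expectation with respect to the Palm probability measure of $\Phi$ on the canonical space of $T$: $\gamma\,\mathbb E^\Phi_0 g(T)=\mathbb E\int_{[0,1]^d}g(\theta_xT)\,\Phi(\mathrm dx)$ for measurable $g\ge0$, where $L_0$ and $\Phi\{0\}$ are regarded as functions of $T$ (with $L_0=T(\{0\}\times\cdot)/T(\{0\}\times\mathbb R^d)$ when $\Phi\{0\}>0$). In particular $\mathbb E^\Phi_0\Phi\{0\}=\gamma^{-1}\mathbb E\int_{[0,1]^d}\Phi\{x\}\,\Phi(\mathrm dx)$. A random measure $\Psi$ is locally square-integrable if $\mathbb E\Psi(B)^2<\infty$ for all bounded Borel $B$. For a probability kernel $K$ from $\Omega\times\mathbb R^d$ to $\mathbb R^d$, $K_x=K(x)$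 is the random probability measure $\omega\mapsto K(\omega,x,\cdot)$, and $K\Phi(\omega,\cdot):=\int K(\omega,x,\cdot)\,\Phi(\omega,\mathrm dx)$. The conditional statements about $\{K_x:x\in\Phi\}$ refer to the ($T$-measurably enumerated) atoms of $\Phi$. Under the hypotheses both $K\Phi$ and $L\Phi$ are stationary and locally square-integrable. $\mathbf M^1(\mathbb R^d)$ is the space of probability measures on $\mathbb R^d$ with the $\sigma$-field generated by the evaluations $\pi\mapsto\pi(B)$; $\Pi_d$ is the space of probability measures on $\mathbf M^1(\mathbb R^d)$ with the analogous $\sigma$-field; $\theta_x\pi:=\pi(\cdot+x)$. Fourier conventions: $\hat f(k)=\int f(x)e^{-i\langle k,x\rangle}\mathrm dx$, $\hat\pi(k)=\int e^{-i\langle k,x\rangle}\pi(\mathrm dx)$. For a stationary locally square-integrable random measure $\Psi$ with intensity $\gamma_\Psi$ put $\alpha_\Psi(B):=\mathbb E\int\mathbf 1\{x\in[0,1]^d,y-x\in B\}\,\Psi^2(\mathrm d(x,y))$ and $\beta_\Psi:=\alpha_\Psi-\gamma_\Psi^2\lambda_d$. The Bartlett spectral measure $\hat\beta_\Psi$ is the unique locally finite measure with $\int (f\star g)\,\mathrm d\beta_\Psi=(2\pi)^{-d}\int\hat f(k)\overline{\hat g(k)}\,\hat\beta_\Psi(\mathrm dk)$ for all bounded measurable $f,g\colon\mathbb R^d\to\mathbb R$ with bounded support, where $(f\star g)(y)=\int f(x)g(x-y)\,\mathrm dx$. $h\cdot\lambda_d$ denotes the measure with density $h$. *)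

theory Defs
  imports "HOL-Probability.Probability"
begin

text \<open>Euclidean space \<open>\<real>\<^sup>d\<close> is rendered by a type \<open>'a :: euclidean_space\<close>, Lebesgue measure by
  \<^const>\<open>lborel\<close>, and \<open>\<Omega>\<close> by a probability space \<open>P :: 'w measure\<close>. The space \<open>M\<^sup>1(\<real>\<^sup>d)\<close> with its
  evaluation \<open>\<sigma>\<close>-field is \<open>prob_algebra borel\<close>, and \<open>\<Pi>\<^sub>d\<close> is \<open>prob_algebra (prob_algebra borel)\<close>.\<close>

section \<open>Random measures\<close>

definition locally_finite_measure :: "'a::metric_space measure \<Rightarrow> bool" where
  "locally_finite_measure \<mu> \<longleftrightarrow>
     sets \<mu> = sets borel \<and> (\<forall>B\<in>sets borel. bounded B \<longrightarrow> emeasure \<mu> B < \<infinity>)"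

definition lf_measures :: "'a::metric_space measure measure" where
  "lf_measures =
     (SUP B\<in>sets borel. vimage_algebra {\<mu>. locally_finite_measure \<mu>} (\<lambda>\<mu>. emeasure \<mu> B) borel)"

definition random_measure :: "'w measure \<Rightarrow> ('w \<Rightarrow> 'a::metric_space measure) \<Rightarrow> bool" where
  "random_measure P \<Psi> \<longleftrightarrow> \<Psi> \<in> P \<rightarrow>\<^sub>M lf_measures"

definition purely_discrete :: "'w measure \<Rightarrow> ('w \<Rightarrow> 'a::euclidean_space measure) \<Rightarrow> bool" where
  "purely_discrete P \<Phi> \<longleftrightarrow>
     (\<exists>(Y :: nat \<Rightarrow> 'w \<Rightarrow> real) (X :: nat \<Rightarrow> 'w \<Rightarrow> 'a).
        (\<forall>n. Y n \<in> borel_measurable P \<and> (\<forall>\<omega>\<in>space P. 0 \<le> Y n \<omega>)) \<and>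
        (\<forall>n. X n \<in> borel_measurable P) \<and>
        (AE \<omega> in P. \<forall>B\<in>sets borel.
           emeasure (\<Phi> \<omega>) B = (\<Sum>n. ennreal (Y n \<omega>) * emeasure (return borel (X n \<omega>)) B)))"

definition unit_cube :: "'a::euclidean_space set" where
  "unit_cube = cbox 0 One"

definition intensity :: "'w measure \<Rightarrow> ('w \<Rightarrow> 'a::euclidean_space measure) \<Rightarrow> ennreal" where
  "intensity P \<Psi> = (\<integral>\<^sup>+\<omega>. emeasure (\<Psi> \<omega>) unit_cube \<partial>P)"

definition locally_square_integrable ::
    "'w measure \<Rightarrow> ('w \<Rightarrow> 'a::euclidean_space measure) \<Rightarrow> bool" where
  "locally_square_integrable P \<Psi> \<longleftrightarrow>
     (\<forall>B\<in>sets borel. bounded B \<longrightarrow> (\<integral>\<^sup>+\<omega>. (emeasure (\<Psi> \<omega>) B)\<^sup>2 \<partial>P) < \<infinity>)"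

section \<open>Random transports\<close>

definition first_marginal :: "('a::euclidean_space \<times> 'a) measure \<Rightarrow> 'a measure" where
  "first_marginal \<mu> = distr \<mu> borel fst"

definition random_transport ::
    "'w measure \<Rightarrow> ('w \<Rightarrow> ('a::euclidean_space \<times> 'a) measure) \<Rightarrow> bool" where
  "random_transport P T \<longleftrightarrow>
     random_measure P T \<and> (\<forall>\<omega>\<in>space P. locally_finite_measure (first_marginal (T \<omega>)))"

text \<open>Shifting: pushing forward under \<open>y \<mapsto> y - x\<close> gives \<open>\<theta>\<^sub>x\<pi>(B) = \<pi>(B + x)\<close>.\<close>

definition shift_measure :: "'a::euclidean_space \<Rightarrow> 'a measure \<Rightarrow> 'a measure" where
  "shift_measure x \<pi> = distr \<pi> borel (\<lambda>y. y - x)"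

definition diag_shift ::
    "'a::euclidean_space \<Rightarrow> ('a \<times> 'a) measure \<Rightarrow> ('a \<times> 'a) measure" where
  "diag_shift x \<mu> = distr \<mu> borel (\<lambda>(y, z). (y - x, z - x))"

definition stationary_transport ::
    "'w measure \<Rightarrow> ('w \<Rightarrow> ('a::euclidean_space \<times> 'a) measure) \<Rightarrow> bool" where
  "stationary_transport P T \<longleftrightarrow>
     random_transport P T \<and>
     (\<forall>x. distr P lf_measures (\<lambda>\<omega>. diag_shift x (T \<omega>)) = distr P lf_measures T)"

section \<open>Kernels\<close>

definition prob_kernel :: "'w measure \<Rightarrow> ('w \<times> 'a::euclidean_space \<Rightarrow> 'a measure) \<Rightarrow> bool" where
  "prob_kernel P K \<longleftrightarrow> K \<in> P \<Otimes>\<^sub>M borel \<rightarrow>\<^sub>M prob_algebra borel"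

text \<open>The monadic bind is used for measures \<open>\<Phi> \<omega>\<close> that need not be finite; it still is
  \<open>\<integral> K(\<omega>, x, \<cdot>) \<Phi>(\<omega>, dx)\<close>, by \<open>emeasure_bind\<close>.\<close>

definition kernel_apply ::
    "('w \<times> 'a::euclidean_space \<Rightarrow> 'a measure) \<Rightarrow> ('w \<Rightarrow> 'a measure) \<Rightarrow> 'w \<Rightarrow> 'a measure" where
  "kernel_apply K \<Phi> \<omega> = bind (\<Phi> \<omega>) (\<lambda>x. K (\<omega>, x))"

definition disintegrates ::
    "'w measure \<Rightarrow> ('w \<Rightarrow> ('a::euclidean_space \<times> 'a) measure) \<Rightarrow> ('w \<times> 'a \<Rightarrow> 'a measure)
      \<Rightarrow> ('w \<Rightarrow> 'a measure) \<Rightarrow> bool" where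
  "disintegrates P T L \<Phi> \<longleftrightarrow>
     (AE \<omega> in P. \<forall>A\<in>sets borel.
        emeasure (T \<omega>) A = (\<integral>\<^sup>+x. \<integral>\<^sup>+y. indicator A (x, y) \<partial>L (\<omega>, x) \<partial>\<Phi> \<omega>))"

section \<open>Conditioning\<close>

definition sigma_generated ::
    "'w measure \<Rightarrow> ('w \<Rightarrow> 'b::metric_space measure) \<Rightarrow> 'w measure" where
  "sigma_generated P T = vimage_algebra (space P) T lf_measures"

definition cond_probability :: "'w measure \<Rightarrow> 'w measure \<Rightarrow> 'w set \<Rightarrow> 'w \<Rightarrow> real" where
  "cond_probability P G A = real_cond_exp P G (indicator A)"

text \<open>Conditional independence given \<open>G\<close> of a family \<open>Y\<close> with a random, \<open>G\<close>-measurable index set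
  \<open>I\<close>: the product formula for a finite \<open>J\<close> is required on the event \<open>J \<subseteq> I\<close> only.\<close>

definition cond_indep_family ::
    "'w measure \<Rightarrow> 'w measure \<Rightarrow> 'b measure \<Rightarrow> ('w \<Rightarrow> 'i set) \<Rightarrow> ('i \<Rightarrow> 'w \<Rightarrow> 'b) \<Rightarrow> bool" where
  "cond_indep_family P G N I Y \<longleftrightarrow>
     (\<forall>J A. finite J \<longrightarrow> (\<forall>j\<in>J. A j \<in> sets N) \<longrightarrow>
        (AE \<omega> in P. J \<subseteq> I \<omega> \<longrightarrow>
           cond_probability P G {\<omega>\<in>space P. \<forall>j\<in>J. Y j \<omega> \<in> A j} \<omega> =
           (\<Prod>j\<in>J. cond_probability P G {\<omega>\<in>space P. Y j \<omega> \<in> A j} \<omega>)))"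

definition atoms :: "'a measure \<Rightarrow> 'a set" where
  "atoms \<mu> = {x. 0 < emeasure \<mu> {x}}"

definition atom_indices ::
    "('w \<Rightarrow> 'a measure) \<Rightarrow> (nat \<Rightarrow> 'w \<Rightarrow> 'a) \<Rightarrow> 'w \<Rightarrow> nat set" where
  "atom_indices \<Phi> X \<omega> = {n. X n \<omega> \<in> atoms (\<Phi> \<omega>)}"

text \<open>A \<open>G\<close>-measurable enumeration without repetitions of the atoms of \<open>\<Phi>\<close>. Since there may be
  only finitely many atoms, indices \<open>n\<close> for which \<open>X n \<omega>\<close> is no atom are allowed and disregarded.\<close>

definition enumerates_atoms ::
    "'w measure \<Rightarrow> 'w measure \<Rightarrow> ('w \<Rightarrow> 'a::euclidean_space measure) \<Rightarrow> (nat \<Rightarrow> 'w \<Rightarrow> 'a) \<Rightarrow> bool"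
where
  "enumerates_atoms P G \<Phi> X \<longleftrightarrow>
     (\<forall>n. X n \<in> borel_measurable G) \<and>
     (AE \<omega> in P. bij_betw (\<lambda>n. X n \<omega>) (atom_indices \<Phi> X \<omega>) (atoms (\<Phi> \<omega>)))"

section \<open>Palm measure\<close>

definition palm_measure ::
    "'w measure \<Rightarrow> ('w \<Rightarrow> ('a::euclidean_space \<times> 'a) measure) \<Rightarrow> ('a \<times> 'a) measure measure" where
  "palm_measure P T =
     measure_of (space lf_measures) (sets lf_measures)
       (\<lambda>A. (\<integral>\<^sup>+\<omega>. (\<integral>\<^sup>+x\<in>unit_cube. indicator A (diag_shift x (T \<omega>)) \<partial>first_marginal (T \<omega>)) \<partial>P)
              / intensity P (\<lambda>\<omega>. first_marginal (T \<omega>)))"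

text \<open>The conditional distribution \<open>L\<^sub>0 = T({0} \<times> \<cdot>) / T({0} \<times> \<real>\<^sup>d)\<close> as a function of \<open>T\<close>; it is
  meaningful when \<open>T({0} \<times> \<real>\<^sup>d)\<close> is positive (and finite).\<close>

definition origin_kernel :: "('a::euclidean_space \<times> 'a) measure \<Rightarrow> 'a measure" where
  "origin_kernel \<mu> = distr (uniform_measure \<mu> ({0} \<times> UNIV)) borel snd"

section \<open>Fourier transforms and the Bartlett spectral measure\<close>

definition fourier_fun :: "('a::euclidean_space \<Rightarrow> real) \<Rightarrow> 'a \<Rightarrow> complex" where
  "fourier_fun f k = (LINT x|lborel. complex_of_real (f x) * cis (- (k \<bullet> x)))"

definition fourier_measure :: "'a::euclidean_space measure \<Rightarrow> 'a \<Rightarrow> complex" where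
  "fourier_measure \<pi> k = (LINT x|\<pi>. cis (- (k \<bullet> x)))"

definition star_conv :: "('a::euclidean_space \<Rightarrow> real) \<Rightarrow> ('a \<Rightarrow> real) \<Rightarrow> 'a \<Rightarrow> real" where
  "star_conv f g y = (LINT x|lborel. f x * g (x - y))"

definition bounded_test_function :: "('a::euclidean_space \<Rightarrow> real) \<Rightarrow> bool" where
  "bounded_test_function f \<longleftrightarrow>
     f \<in> borel_measurable borel \<and> bounded (range f) \<and> bounded {x. f x \<noteq> 0}"

definition reduced_second_moment ::
    "'w measure \<Rightarrow> ('w \<Rightarrow> 'a::euclidean_space measure) \<Rightarrow> 'a measure" where
  "reduced_second_moment P \<Psi> =
     measure_of UNIV (sets borel)
       (\<lambda>B. \<integral>\<^sup>+\<omega>. (\<integral>\<^sup>+(x, y). indicator unit_cube x * indicator B (y - x)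
                       \<partial>(\<Psi> \<omega> \<Otimes>\<^sub>M \<Psi> \<omega>)) \<partial>P)"

text \<open>The integral of \<open>h\<close> with respect to the signed measure \<open>\<beta>\<^sub>\<Psi> = \<alpha>\<^sub>\<Psi> - \<gamma>\<^sub>\<Psi>\<^sup>2 \<lambda>\<^sub>d\<close>, which
  in general is not of finite total variation; \<open>h\<close> is a bounded function with bounded support.\<close>

definition covariance_integral ::
    "'w measure \<Rightarrow> ('w \<Rightarrow> 'a::euclidean_space measure) \<Rightarrow> ('a \<Rightarrow> real) \<Rightarrow> real" where
  "covariance_integral P \<Psi> h =
     (LINT y|reduced_second_moment P \<Psi>. h y) - (enn2real (intensity P \<Psi>))\<^sup>2 * (LINT y|lborel. h y)"

text \<open>Integrability is demanded explicitly, because the Bochner integral of a non-integrable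
  function is \<open>0\<close> by convention.\<close>

definition is_bartlett_spectral_measure ::
    "'w measure \<Rightarrow> ('w \<Rightarrow> 'a::euclidean_space measure) \<Rightarrow> 'a measure \<Rightarrow> bool" where
  "is_bartlett_spectral_measure P \<Psi> \<nu> \<longleftrightarrow>
     locally_finite_measure \<nu> \<and>
     (\<forall>f g. bounded_test_function f \<longrightarrow> bounded_test_function g \<longrightarrow>
        integrable \<nu> (\<lambda>k. fourier_fun f k * cnj (fourier_fun g k)) \<and>
        complex_of_real (covariance_integral P \<Psi> (star_conv f g)) =
          (LINT k|\<nu>. fourier_fun f k * cnj (fourier_fun g k)) / (2 * pi) ^ DIM('a))"

definition bartlett_spectral_measure ::
    "'w measure \<Rightarrow> ('w \<Rightarrow> 'a::euclidean_space measure) \<Rightarrow> 'a measure" where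
  "bartlett_spectral_measure P \<Psi> = (THE \<nu>. is_bartlett_spectral_measure P \<Psi> \<nu>)"

definition eta_hat ::
    "'w measure \<Rightarrow> ('w \<Rightarrow> ('a::euclidean_space \<times> 'a) measure) \<Rightarrow> ('a measure \<Rightarrow> 'a measure measure)
      \<Rightarrow> 'a \<Rightarrow> real" where
  "eta_hat P T F k =
     enn2real (intensity P (\<lambda>\<omega>. first_marginal (T \<omega>))) *
     (LINT \<mu>|palm_measure P T.
        ((LINT \<pi>|F (origin_kernel \<mu>). (cmod (fourier_measure \<pi> k))\<^sup>2)
          - (cmod (fourier_measure (origin_kernel \<mu>) k))\<^sup>2)
        * measure (first_marginal \<mu>) {0})"

end

theory Submission imports Defs begin

text \<open>Expand the second moment of \<open>K\<Phi>\<close> over pairs of atoms of \<open>\<Phi>\<close>. Since \<open>F(\<pi>)\<close> has barycentre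
  \<open>\<pi>\<close>, conditional independence makes the terms of distinct atoms agree with those of \<open>L\<Phi>\<close>; on the
  diagonal \<open>L\<^sub>x \<otimes> L\<^sub>x\<close> is replaced by the \<open>F(L\<^sub>x)\<close>-mixture of \<open>\<pi> \<otimes> \<pi>\<close>. By the refined Campbell theorem
  the two diagonals have the form \<open>\<integral>\<integral> H(z, z + w) dz D(dw)\<close> with finite measures \<open>D\<^sub>F\<close> and \<open>D\<^sub>L\<close>, so that
  \<open>\<alpha>\<^sub>K + D\<^sub>L = \<alpha>\<^sub>L + D\<^sub>F\<close>, and the Fourier transform of \<open>D\<^sub>F - D\<^sub>L\<close> is the excess density, which is
  nonnegative by the Cauchy-Schwarz inequality.

  Spectral measures are handled through Gaussians: \<open>\<nu>\<close> is spectral for \<open>\<beta> = \<alpha> - c\<lambda>\<close> if the Gaussian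
  smoothings of \<open>\<beta>\<close> are the Fourier transforms of the Gaussian dampings of \<open>\<nu>\<close>. This relation is
  additive, extends to all bounded test functions by heat regularization, and has a solution \<open>\<nu>\<close> by
  vague compactness once the Fourier transform of every Gaussian damping of \<open>\<beta>\<close> is nonnegative. For
  \<open>L\<Phi>\<close> the latter expresses that the integrals of a Gaussian times \<open>cos\<langle>k, x\<rangle>\<close> and \<open>sin\<langle>k, x\<rangle>\<close>
  have nonnegative variances.\<close>

section \<open>Gaussian functions on Euclidean space\<close>

text \<open>\<open>bartlett_spectral_measure\<close> is a definite description, so existence and
  uniqueness of a spectral measure have to be proved for both processes before the equation says
  anything. Existence is shown once, for L\<Phi>: this is the second marginal of T, so stationarity
  of T applies to it directly. Every fact about K\<Phi> is then transferred through the identity of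
  second moments: square integrability, intensity, growth of \<open>\<alpha> K\<close>, and finally
  its spectral measure, which is constructed as a sum.

  The analytic obstacle is that \<beta> is neither finite nor positive, while the transforms of
  admissible test functions, such as indicators, need not be integrable; so neither the theory of
  finite measures nor plain Fourier inversion applies directly. Gaussians times characters are
  integrable on both sides, and the transform maps this class to itself. The second moment identity
  is kept additive because its terms may be infinite until square integrability is known, and it is
  the identity itself that transfers square integrability between L\<Phi> and K\<Phi>.\<close>

definition gauss :: "real \<Rightarrow> 'a::euclidean_space \<Rightarrow> real" where
  "gauss t x = exp (- (t * (norm x)\<^sup>2 / 2))"

lemma gauss_measurable [measurable]: "gauss t \<in> borel_measurable borel"
  unfolding gauss_def by measurable

lemma continuous_on_gauss [continuous_intros]:
  "continuous_on S f \<Longrightarrow> continuous_on S (\<lambda>x. gauss t (f x))"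
  unfolding gauss_def by (intro continuous_intros) auto

lemma gauss_pos: "0 < gauss t x" and gauss_nonneg [simp]: "0 \<le> gauss t x"
  by (simp_all add: gauss_def)

lemma gauss_le_1: "0 \<le> t \<Longrightarrow> gauss t x \<le> 1"
  by (simp add: gauss_def)

lemma gauss_minus [simp]: "gauss t (- x) = gauss t x"
  by (simp add: gauss_def)

lemma gauss_add: "gauss (s + t) x = gauss s x * gauss t x"
  by (simp add: gauss_def flip: exp_add) (simp add: algebra_simps add_divide_distrib)

lemma gauss_antimono: "s \<le> t \<Longrightarrow> gauss t x \<le> gauss s x"
  by (auto simp: gauss_def intro!: divide_right_mono mult_right_mono)

lemma gauss_scaleR: "gauss t (c *\<^sub>R x) = gauss (t * c\<^sup>2) x"
  by (simp add: gauss_def power_mult_distrib algebra_simps)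

lemma cis_measurable [measurable (raw)]:
  "f \<in> borel_measurable M \<Longrightarrow> (\<lambda>x. cis (f x)) \<in> borel_measurable M"
proof -
  assume f: "f \<in> borel_measurable M"
  have "continuous_on UNIV cis" by (intro continuous_on_cis continuous_on_id)
  from borel_measurable_continuous_on[OF this f] show ?thesis .
qed

text \<open>This is the characteristic function of the standard normal law at \<open>a / c\<close>
  with \<open>c = sqrt t\<close>, after substituting \<open>c * x\<close> and multiplying the factor
  \<open>sqrt (2 * pi)\<close> back in.\<close>

lemma has_bochner_integral_gauss_real:
  fixes a t :: real
  assumes t: "0 < t"
  shows "has_bochner_integral lborel (\<lambda>x. cis (a * x) * of_real (exp (- (t * x\<^sup>2 / 2))))
           (of_real (sqrt (2 * pi / t) * exp (- (a\<^sup>2 / t / 2))))"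
proof -
  interpret D: real_distribution std_normal_distribution by (rule real_dist_normal_dist)
  have 1: "has_bochner_integral lborel (\<lambda>x. cis (b * x) * of_real (std_normal_density x))
     (of_real (exp (- (b\<^sup>2) / 2)))" for b
  proof -
    have "integrable std_normal_distribution (\<lambda>x. cis (b * x))"
      by (rule D.integrable_const_bound[where B=1]) (auto)
    then have "integrable lborel (\<lambda>x. std_normal_density x *\<^sub>R cis (b * x))"
      by (subst (asm) integrable_density) auto
    moreover have "(LINT x|lborel. std_normal_density x *\<^sub>R cis (b * x)) = of_real (exp (- (b\<^sup>2) / 2))"
      using fun_cong[OF char_std_normal_distribution, of b]
      unfolding char_def by (subst (asm) integral_density) (auto simp: cis_conv_exp scaleR_conv_of_real)
    ultimately show ?thesis
      by (simp add: has_bochner_integral_iff scaleR_conv_of_real mult.commute)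
  qed
  define c where "c = sqrt t"
  have c: "0 < c" "c\<^sup>2 = t" using t by (auto simp: c_def)
  let ?f = "\<lambda>x. cis (a / c * x) * complex_of_real (std_normal_density x)"
  have i: "integrable lborel ?f" using 1 has_bochner_integral_iff by blast
  have "integrable lborel (\<lambda>x. ?f (0 + c * x))"
    using i c by (subst lborel_integrable_real_affine_iff) auto
  moreover have "(LINT x|lborel. ?f (0 + c * x)) = of_real (exp (- (a/c)\<^sup>2 / 2) / c)"
    using lborel_integral_real_affine[of c ?f 0] has_bochner_integral_integral_eq[OF 1, of "a/c"] c
    by (simp add: field_simps scaleR_conv_of_real)
  ultimately have 2: "has_bochner_integral lborel (\<lambda>x. ?f (0 + c * x)) (of_real (exp (- (a/c)\<^sup>2 / 2) / c))"
    by (simp add: has_bochner_integral_iff)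
  have "has_bochner_integral lborel (\<lambda>x. of_real (sqrt (2 * pi)) * ?f (0 + c * x))
    (of_real (sqrt (2 * pi)) * of_real (exp (- (a/c)\<^sup>2 / 2) / c))"
    by (rule has_bochner_integral_mult_right) (use 2 in auto)
  also have "(\<lambda>x. of_real (sqrt (2 * pi)) * ?f (0 + c * x)) =
     (\<lambda>x. cis (a * x) * of_real (exp (- (t * x\<^sup>2 / 2))))"
    using c by (auto simp: std_normal_density_def fun_eq_iff power_mult_distrib real_sqrt_mult)
  also have "of_real (sqrt (2 * pi)) * of_real (exp (- (a/c)\<^sup>2 / 2) / c) =
     complex_of_real (sqrt (2 * pi / t) * exp (- (a\<^sup>2 / t / 2)))"
    using c by (auto simp: c_def power_divide real_sqrt_divide)
  finally show ?thesis .
qed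

lemma gauss_prod: "gauss t (\<Sum>b\<in>Basis. f b *\<^sub>R b) = (\<Prod>b\<in>Basis. exp (- (t * (f b)\<^sup>2 / 2)))"
proof -
  have "(norm (\<Sum>b\<in>Basis. f b *\<^sub>R (b::'a)))\<^sup>2 = (\<Sum>b\<in>Basis. (f b)\<^sup>2)"
    by (subst power2_norm_eq_inner, subst euclidean_inner) (auto simp: power2_eq_square inner_sum_left_Basis)
  then show ?thesis
    by (simp add: gauss_def sum_distrib_left sum_divide_distrib sum_negf flip: exp_sum)
qed

lemma cis_sum: "finite I \<Longrightarrow> cis (\<Sum>i\<in>I. f i) = (\<Prod>i\<in>I. cis (f i))"
  by (induction rule: finite_induct) (auto simp: cis_mult[symmetric])

text \<open>Both the character and the Gaussian factor over \<open>Basis\<close>, so the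
  one-dimensional formula multiplies up along the product description \<open>lborel_eq\<close>. The
  value is even in \<open>k\<close>, so the sign in the character is immaterial here.\<close>

lemma has_bochner_integral_gauss:
  fixes k :: "'a::euclidean_space"
  assumes t: "0 < t"
  shows "has_bochner_integral lborel (\<lambda>x. cis (k \<bullet> x) * of_real (gauss t x))
           (of_real (sqrt (2 * pi / t) ^ DIM('a) * gauss (1 / t) k))"
proof -
  interpret product_sigma_finite "\<lambda>_::'a. lborel :: real measure" ..
  let ?g = "\<lambda>b x. cis ((k \<bullet> b) * x) * complex_of_real (exp (- (t * x\<^sup>2 / 2)))"
  have i: "integrable lborel (?g b)" for b
    using has_bochner_integral_gauss_real[OF t] has_bochner_integral_iff by blast
  have eq: "cis (k \<bullet> (\<Sum>b\<in>Basis. (f b :: real) *\<^sub>R b)) * of_real (gauss t (\<Sum>b\<in>(Basis::'a set). f b *\<^sub>R b))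
     = (\<Prod>b\<in>Basis. ?g b (f b))" for f
    by (simp add: gauss_prod prod.distrib inner_sum_right cis_sum mult.commute)
  have 1: "integrable (\<Pi>\<^sub>M b\<in>Basis. lborel) (\<lambda>f. \<Prod>b\<in>Basis. ?g b (f b))"
    by (rule product_integrable_prod) (use i in auto)
  have 2: "integral\<^sup>L (\<Pi>\<^sub>M b\<in>Basis. lborel) (\<lambda>f. \<Prod>b\<in>Basis. ?g b (f b)) = (\<Prod>b\<in>Basis. integral\<^sup>L lborel (?g b))"
    by (rule product_integral_prod) (use i in auto)
  have 3: "(\<Prod>b\<in>Basis. integral\<^sup>L lborel (?g b)) =
    of_real (sqrt (2 * pi / t) ^ DIM('a) * gauss (1 / t) k)"
  proof -
    have "(\<Prod>b\<in>Basis. integral\<^sup>L lborel (?g b)) = (\<Prod>b\<in>Basis. of_real (sqrt (2 * pi / t) * exp (- ((k \<bullet> b)\<^sup>2 / t / 2))))"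
      by (intro prod.cong refl has_bochner_integral_integral_eq has_bochner_integral_gauss_real t)
    also have "\<dots> = of_real (sqrt (2 * pi / t) ^ DIM('a) * gauss (1 / t) (\<Sum>b\<in>Basis. (k \<bullet> b) *\<^sub>R b))"
      unfolding gauss_prod by (simp add: prod.distrib flip: of_real_prod)
    finally show ?thesis by (simp add: euclidean_representation)
  qed
  show ?thesis
    unfolding has_bochner_integral_iff
    by (subst (1 2) lborel_eq) (use 1 2 3 in \<open>simp add: integrable_distr_eq integral_distr eq\<close>)
qed

lemma integrable_gauss: "0 < t \<Longrightarrow> integrable lborel (gauss t :: 'a::euclidean_space \<Rightarrow> real)"
  and integral_gauss: "0 < t \<Longrightarrow> (LINT x|lborel. gauss t (x::'a)) = sqrt (2 * pi / t) ^ DIM('a)"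
proof -
  assume t: "0 < t"
  have "has_bochner_integral lborel (\<lambda>x::'a. complex_of_real (gauss t x))
           (of_real (sqrt (2 * pi / t) ^ DIM('a) * gauss (1 / t) (0::'a)))"
    using has_bochner_integral_gauss[OF t, of "0::'a"] by simp
  then have "has_bochner_integral lborel (\<lambda>x::'a. complex_of_real (gauss t x))
           (of_real (sqrt (2 * pi / t) ^ DIM('a)))"
    by (simp add: gauss_def[of "1/t" 0])
  then have "integrable lborel (\<lambda>x. complex_of_real (gauss t (x::'a)))"
     and *: "(LINT x|lborel. complex_of_real (gauss t (x::'a))) = of_real (sqrt (2 * pi / t) ^ DIM('a))"
    by (auto simp: has_bochner_integral_iff)
  then show "integrable lborel (gauss t :: 'a \<Rightarrow> real)" by (simp add: complex_of_real_integrable_eq)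
  show "(LINT x|lborel. gauss t (x::'a)) = sqrt (2 * pi / t) ^ DIM('a)"
    using * unfolding integral_complex_of_real of_real_eq_iff .
qed

lemma nn_integral_gauss:
  "0 < t \<Longrightarrow> (\<integral>\<^sup>+x. gauss t (x::'a::euclidean_space) \<partial>lborel) = ennreal (sqrt (2 * pi / t) ^ DIM('a))"
  by (subst nn_integral_eq_integral) (auto simp: integrable_gauss integral_gauss)

section \<open>Reflections and translations of Lebesgue measure\<close>

lemma distr_lborel_minus: "distr lborel borel uminus = (lborel :: 'a::euclidean_space measure)"
  by (subst lborel_affine[of "-1" 0]) (auto simp: density_1 distr_distr comp_def)

lemma distr_lborel_add: "distr lborel borel (\<lambda>x. x + c) = (lborel :: 'a::euclidean_space measure)"
  using lborel_distr_plus[of c] by (simp add: add.commute[of _ c])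

lemma distr_lborel_diff: "distr lborel borel (\<lambda>x. x - c) = (lborel :: 'a::euclidean_space measure)"
  using distr_lborel_add[of "-c"] by simp

lemma distr_lborel_rdiff: "distr lborel borel (\<lambda>x. c - x) = (lborel :: 'a::euclidean_space measure)"
proof -
  have "distr (distr lborel borel uminus) borel (\<lambda>x. x + c) = (lborel :: 'a measure)"
    by (simp add: distr_lborel_minus distr_lborel_add)
  then show ?thesis by (subst (asm) distr_distr) (auto simp: comp_def)
qed

lemma nn_integral_lborel_subst:
  fixes f :: "'a::euclidean_space \<Rightarrow> ennreal"
  assumes [measurable]: "f \<in> borel_measurable borel"
  shows "(\<integral>\<^sup>+x. f (x + c) \<partial>lborel) = (\<integral>\<^sup>+x. f x \<partial>lborel)"
    and "(\<integral>\<^sup>+x. f (x - c) \<partial>lborel) = (\<integral>\<^sup>+x. f x \<partial>lborel)"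
    and "(\<integral>\<^sup>+x. f (c - x) \<partial>lborel) = (\<integral>\<^sup>+x. f x \<partial>lborel)"
  by (subst (2) distr_lborel_add[of c, symmetric], simp add: nn_integral_distr,
      subst (2) distr_lborel_diff[of c, symmetric], simp add: nn_integral_distr,
      subst (2) distr_lborel_rdiff[of c, symmetric], simp add: nn_integral_distr)

lemma integral_lborel_subst:
  fixes f :: "'a::euclidean_space \<Rightarrow> 'b::{banach,second_countable_topology}"
  assumes [measurable]: "f \<in> borel_measurable borel"
  shows "(LINT x|lborel. f (x + c)) = (LINT x|lborel. f x)"
    and "(LINT x|lborel. f (x - c)) = (LINT x|lborel. f x)"
    and "(LINT x|lborel. f (c - x)) = (LINT x|lborel. f x)"
  by (subst (2) distr_lborel_add[of c, symmetric], simp add: integral_distr,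
      subst (2) distr_lborel_diff[of c, symmetric], simp add: integral_distr,
      subst (2) distr_lborel_rdiff[of c, symmetric], simp add: integral_distr)

lemma integrable_lborel_subst:
  fixes f :: "'a::euclidean_space \<Rightarrow> 'b::{banach,second_countable_topology}"
  assumes [measurable]: "f \<in> borel_measurable borel"
  shows "integrable lborel (\<lambda>x. f (x + c)) \<longleftrightarrow> integrable lborel f"
    and "integrable lborel (\<lambda>x. f (x - c)) \<longleftrightarrow> integrable lborel f"
    and "integrable lborel (\<lambda>x. f (c - x)) \<longleftrightarrow> integrable lborel f"
  by (subst (2) distr_lborel_add[of c, symmetric], simp add: integrable_distr_eq,
      subst (2) distr_lborel_diff[of c, symmetric], simp add: integrable_distr_eq,
      subst (2) distr_lborel_rdiff[of c, symmetric], simp add: integrable_distr_eq)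

text \<open>The name is borrowed: growth such as that of \<open>exp (norm x)\<close> is allowed,
  beyond what tempered distributions permit. Finite Gaussian integrals at every rate are what makes
  both sides of \<open>gauss_dual\<close> meaningful, and the condition survives sums.\<close>

definition tempered :: "'a::euclidean_space measure \<Rightarrow> bool" where
  "tempered \<alpha> \<longleftrightarrow> sets \<alpha> = sets borel \<and> (\<forall>s>0. (\<integral>\<^sup>+x. gauss s x \<partial>\<alpha>) < \<infinity>)"

lemma tempered_sets: "tempered \<alpha> \<Longrightarrow> sets \<alpha> = sets borel" "tempered \<alpha> \<Longrightarrow> space \<alpha> = UNIV"
  using sets_eq_imp_space_eq[of \<alpha> borel] by (auto simp: tempered_def)

lemma tempered_integrable:
  assumes "tempered \<alpha>" "0 < s"
  shows "integrable \<alpha> (gauss s)"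
proof -
  have [measurable_cong]: "sets \<alpha> = sets borel" using assms by (simp add: tempered_def)
  show ?thesis
    by (rule integrableI_bounded) (use assms in \<open>auto simp: tempered_def\<close>)
qed

lemma tempered_lborel: "tempered lborel"
  by (simp add: tempered_def nn_integral_gauss)

lemma tempered_finite:
  assumes "finite_measure \<alpha>" "sets \<alpha> = sets borel"
  shows "tempered \<alpha>"
  unfolding tempered_def
proof (intro conjI allI impI)
  fix s :: real assume "0 < s"
  interpret finite_measure \<alpha> by fact
  have "(\<integral>\<^sup>+x. gauss s x \<partial>\<alpha>) \<le> (\<integral>\<^sup>+x. 1 \<partial>\<alpha>)"
    using \<open>0 < s\<close> gauss_le_1[of s] by (intro nn_integral_mono) auto
  also have "\<dots> < \<infinity>" by (simp flip: less_top)
  finally show "(\<integral>\<^sup>+x. gauss s x \<partial>\<alpha>) < \<infinity>" .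
qed fact

lemma gauss_ge_cball: "0 \<le> t \<Longrightarrow> x \<in> cball 0 r \<Longrightarrow> exp (- (t * r\<^sup>2 / 2)) \<le> gauss t x"
  by (auto simp: gauss_def intro!: mult_left_mono divide_right_mono power_mono)

text \<open>A Gaussian is bounded below on each ball, so a Markov-type estimate turns its finite
  integral into local finiteness.\<close>

lemma tempered_emeasure_bounded:
  assumes \<alpha>: "tempered \<alpha>" and B: "bounded B" "B \<in> sets borel"
  shows "emeasure \<alpha> B < \<infinity>"
proof -
  have [measurable_cong]: "sets \<alpha> = sets borel" using assms by (simp add: tempered_def)
  note B(2)[measurable]
  obtain r where r: "B \<subseteq> cball 0 r" using B(1) unfolding bounded_iff by (auto simp: subset_eq)
  have "ennreal (exp (- (1 * r\<^sup>2 / 2))) * emeasure \<alpha> B = (\<integral>\<^sup>+x. ennreal (exp (- (1 * r\<^sup>2 / 2))) * indicator B x \<partial>\<alpha>)"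
    by (simp add: nn_integral_cmult_indicator)
  also have "\<dots> \<le> (\<integral>\<^sup>+x. gauss 1 x \<partial>\<alpha>)"
  proof (intro nn_integral_mono)
    fix x show "ennreal (exp (- (1 * r\<^sup>2 / 2))) * indicator B x \<le> ennreal (gauss 1 x)"
      using r gauss_ge_cball[of 1 x r] by (auto simp: indicator_def intro!: ennreal_leI)
  qed
  also have "\<dots> < \<infinity>" using \<alpha> by (auto simp: tempered_def)
  finally have "ennreal (exp (- (1 * r\<^sup>2 / 2))) * emeasure \<alpha> B < \<infinity>" .
  then show ?thesis by (auto simp: ennreal_mult_less_top)
qed

lemma locally_finite_measure_sigma_finite:
  fixes \<mu> :: "'a::euclidean_space measure"
  assumes "locally_finite_measure \<mu>"
  shows "sigma_finite_measure \<mu>"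
proof
  have s: "sets \<mu> = sets borel" "space \<mu> = UNIV"
    using assms sets_eq_imp_space_eq[of \<mu> borel] by (auto simp: locally_finite_measure_def)
  show "\<exists>A. countable A \<and> A \<subseteq> sets \<mu> \<and> \<Union>A = space \<mu> \<and> (\<forall>a\<in>A. emeasure \<mu> a \<noteq> \<infinity>)"
  proof (intro exI conjI ballI)
    show "\<Union> (range (\<lambda>n. cball 0 (real n) :: 'a set)) = space \<mu>"
      using s by (auto simp: real_arch_simple)
    show "emeasure \<mu> a \<noteq> \<infinity>" if "a \<in> range (\<lambda>n. cball 0 (real n))" for a
      using assms that by (auto simp: locally_finite_measure_def less_top)
  qed (use s in auto)
qed

lemma tempered_locally_finite: "tempered \<alpha> \<Longrightarrow> locally_finite_measure \<alpha>"
  by (auto simp: locally_finite_measure_def tempered_sets dest: tempered_emeasure_bounded)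

lemma tempered_sigma_finite: "tempered \<alpha> \<Longrightarrow> sigma_finite_measure \<alpha>"
  by (intro locally_finite_measure_sigma_finite tempered_locally_finite)

section \<open>Gaussian regularization\<close>

lemma integrable_dominated:
  fixes f :: "'a \<Rightarrow> 'b::{banach,second_countable_topology}"
  assumes "integrable M g" "f \<in> borel_measurable M" "\<And>x. norm (f x) \<le> g x"
  shows "integrable M f"
  by (rule Bochner_Integration.integrable_bound[OF assms(1,2)])
     (use order_trans[OF assms(3) abs_ge_self] in auto)

lemma integral_lborel_affine:
  fixes f :: "'a::euclidean_space \<Rightarrow> 'b::{banach,second_countable_topology}"
  assumes [measurable]: "f \<in> borel_measurable borel" and c: "0 < c"
  shows "(LINT x|lborel. f x) = c ^ DIM('a) *\<^sub>R (LINT x|lborel. f (t + c *\<^sub>R x))"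
  using c by (subst lborel_affine[of c t])
    (auto simp: integral_density integral_distr abs_of_pos simp flip: integral_scaleR_right)

text \<open>Convolution with the normal density of variance \<open>t\<close> in each coordinate,
  that is, heat flow up to time \<open>t / 2\<close>.\<close>

definition heat :: "real \<Rightarrow> ('a::euclidean_space \<Rightarrow> real) \<Rightarrow> 'a \<Rightarrow> real" where
  "heat t h w = (LINT u|lborel. h u * gauss (1 / t) (w - u)) / sqrt (2 * pi * t) ^ DIM('a)"

text \<open>The substitution \<open>u = w + sqrt t *\<^sub>R v\<close> moves \<open>t\<close> from
  the kernel into the argument of \<open>h\<close>. With the kernel fixed, the limit of vanishing
  \<open>t\<close> and bounds uniform in \<open>t\<close> can be read off.\<close>

lemma heat_alt:
  assumes [measurable]: "h \<in> borel_measurable borel" and t: "0 < t"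
  shows "heat t h (w :: 'a::euclidean_space) =
    (LINT v|lborel. h (w + sqrt t *\<^sub>R v) * gauss 1 v) / sqrt (2 * pi) ^ DIM('a)"
proof -
  have "gauss (1 / t) (- sqrt t *\<^sub>R v) = gauss 1 v" for v :: 'a
    using t by (simp only: gauss_scaleR) (simp add: power2_eq_square)
  then have "gauss (1 / t) (w - (w + sqrt t *\<^sub>R v)) = gauss 1 v" for v :: 'a
    by simp
  then show ?thesis
    unfolding heat_def
    using t by (subst integral_lborel_affine[of _ "sqrt t" w]) (auto simp: real_sqrt_mult power_mult_distrib)
qed

lemma heat_tendsto:
  fixes h :: "'a::euclidean_space \<Rightarrow> real"
  assumes h: "continuous_on UNIV h" "\<And>x. \<bar>h x\<bar> \<le> B"
    and t: "\<And>n. 0 < t n" "t \<longlonglongrightarrow> 0"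
  shows "(\<lambda>n. heat (t n) h w) \<longlonglongrightarrow> h w"
proof -
  have [measurable]: "h \<in> borel_measurable borel" using h(1) by (rule borel_measurable_continuous_onI)
  have "(\<lambda>n. LINT v|lborel. h (w + sqrt (t n) *\<^sub>R v) * gauss 1 v) \<longlonglongrightarrow> (LINT v|lborel. h w * gauss 1 (v::'a))"
  proof (rule integral_dominated_convergence)
    show "integrable lborel (\<lambda>v. B * gauss 1 (v::'a))" using integrable_gauss[of 1, where 'a='a] by simp
    show "AE v in lborel. (\<lambda>n. h (w + sqrt (t n) *\<^sub>R v) * gauss 1 v) \<longlonglongrightarrow> h w * gauss 1 v"
    proof (rule AE_I2)
      fix v :: 'a
      have "(\<lambda>n. w + sqrt (t n) *\<^sub>R v) \<longlonglongrightarrow> w + sqrt 0 *\<^sub>R v"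
        by (intro tendsto_intros t)
      then have "(\<lambda>n. w + sqrt (t n) *\<^sub>R v) \<longlonglongrightarrow> w" by simp
      from continuous_on_tendsto_compose[OF h(1) this]
      show "(\<lambda>n. h (w + sqrt (t n) *\<^sub>R v) * gauss 1 v) \<longlonglongrightarrow> h w * gauss 1 v"
        by (intro tendsto_mult tendsto_const) auto
    qed
    show "AE v in lborel. norm (h (w + sqrt (t n) *\<^sub>R v) * gauss 1 v) \<le> B * gauss 1 v" for n
      using h(2) by (auto simp: abs_mult intro!: mult_right_mono)
  qed auto
  then have "(\<lambda>n. (LINT v|lborel. h (w + sqrt (t n) *\<^sub>R v) * gauss 1 v) / sqrt (2 * pi) ^ DIM('a))
     \<longlonglongrightarrow> (LINT v|lborel. h w * gauss 1 (v::'a)) / sqrt (2 * pi) ^ DIM('a)"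
    by (intro tendsto_divide tendsto_const) auto
  also have "(LINT v|lborel. h w * gauss 1 (v::'a)) / sqrt (2 * pi) ^ DIM('a) = h w"
    by (simp add: integral_gauss)
  finally show ?thesis using t(1) by (simp add: heat_alt)
qed

lemma norm_power2_add_le: "(norm (x + y))\<^sup>2 \<le> 2 * (norm x)\<^sup>2 + 2 * (norm (y::'a::real_normed_vector))\<^sup>2"
proof -
  have "(norm (x + y))\<^sup>2 \<le> (norm x + norm y)\<^sup>2" by (intro power_mono norm_triangle_ineq) auto
  also have "\<dots> \<le> 2 * (norm x)\<^sup>2 + 2 * (norm y)\<^sup>2"
    using zero_le_power2[of "norm x - norm y"] by (simp add: power2_sum power2_diff)
  finally show ?thesis .
qed

text \<open>A majorant independent of \<open>t\<close> is needed to let \<open>t\<close> vanish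
  under a measure that is only tempered. Where \<open>h\<close> is nonzero, \<open>norm w\<close> is
  controlled by \<open>R\<close> and \<open>norm v\<close>, so half of the exponent of
  \<open>gauss 1 v\<close> can be traded for \<open>gauss (1/4) w\<close> at the price
  \<open>exp (R\<^sup>2 / 4)\<close>. The factor \<open>sqrt 2 ^ DIM('a)\<close> compares the
  integral of the remaining \<open>gauss (1/2)\<close> with the normalizer.\<close>

lemma heat_bound:
  fixes h :: "'a::euclidean_space \<Rightarrow> real"
  assumes [measurable]: "h \<in> borel_measurable borel" and hB: "\<And>x. \<bar>h x\<bar> \<le> B"
    and hR: "\<And>x. h x \<noteq> 0 \<Longrightarrow> norm x \<le> R" and t: "0 < t" "t \<le> 1"
  shows "\<bar>heat t h w\<bar> \<le> B * exp (R\<^sup>2 / 4) * sqrt 2 ^ DIM('a) * gauss (1/4) w"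
proof -
  have B: "0 \<le> B" using hB[of 0] by linarith
  have pt: "norm (h (w + sqrt t *\<^sub>R v) * gauss 1 v) \<le> B * exp (R\<^sup>2 / 4) * gauss (1/4) w * gauss (1/2) v" for v
  proof (cases "h (w + sqrt t *\<^sub>R v) = 0")
    case True then show ?thesis using B by simp
  next
    case False
    have "(norm w)\<^sup>2 \<le> 2 * (norm (w + sqrt t *\<^sub>R v))\<^sup>2 + 2 * (norm (- (sqrt t *\<^sub>R v)))\<^sup>2"
      using norm_power2_add_le[of "w + sqrt t *\<^sub>R v" "- (sqrt t *\<^sub>R v)"] by simp
    also have "(norm (w + sqrt t *\<^sub>R v))\<^sup>2 \<le> R\<^sup>2" using hR[OF False] by (intro power_mono) auto
    also have "(norm (- (sqrt t *\<^sub>R v)))\<^sup>2 \<le> (norm v)\<^sup>2"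
      using t by (auto simp: power_mult_distrib intro!: mult_left_le_one_le)
    finally have w: "(norm w)\<^sup>2 \<le> 2 * R\<^sup>2 + 2 * (norm v)\<^sup>2" by simp
    have "gauss 1 v \<le> exp (R\<^sup>2 / 4) * gauss (1/4) w * gauss (1/2) v"
      using w by (simp add: gauss_def flip: exp_add)
    then have "\<bar>h (w + sqrt t *\<^sub>R v)\<bar> * gauss 1 v \<le> B * (exp (R\<^sup>2 / 4) * gauss (1/4) w * gauss (1/2) v)"
      using hB B by (intro mult_mono) auto
    then show ?thesis by (simp add: abs_mult mult.assoc)
  qed
  have "norm (LINT v|lborel. h (w + sqrt t *\<^sub>R v) * gauss 1 v) \<le>
      (LINT v|lborel. B * exp (R\<^sup>2 / 4) * gauss (1/4) w * gauss (1/2) (v::'a))"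
  proof (rule Bochner_Integration.integral_norm_bound_integral)
    show i: "integrable lborel (\<lambda>v. B * exp (R\<^sup>2 / 4) * gauss (1/4) w * gauss (1/2) (v::'a))"
      by (intro integrable_mult_right integrable_gauss) auto
    show "integrable lborel (\<lambda>v. h (w + sqrt t *\<^sub>R v) * gauss 1 v)"
      by (rule integrable_dominated[OF i]) (use pt in auto)
  qed (use pt in auto)
  also have "\<dots> = B * exp (R\<^sup>2 / 4) * gauss (1/4) w * (sqrt 2 ^ DIM('a) * sqrt (2 * pi) ^ DIM('a))"
    by (simp add: integral_gauss flip: power_mult_distrib real_sqrt_mult)
  finally show ?thesis
    using t by (simp add: heat_alt divide_le_eq field_simps)
qed

lemma heat_measurable [measurable]:
  assumes [measurable]: "h \<in> borel_measurable borel"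
  shows "heat t h \<in> borel_measurable borel"
  unfolding heat_def by measurable

lemma heat_integral_tendsto:
  fixes h :: "'a::euclidean_space \<Rightarrow> real"
  assumes \<alpha>: "tempered \<alpha>"
    and h: "continuous_on UNIV h" "\<And>x. \<bar>h x\<bar> \<le> B" "\<And>x. h x \<noteq> 0 \<Longrightarrow> norm x \<le> R"
    and t: "\<And>n. 0 < t n" "\<And>n. t n \<le> 1" "t \<longlonglongrightarrow> 0"
  shows "(\<lambda>n. LINT w|\<alpha>. heat (t n) h w) \<longlonglongrightarrow> (LINT w|\<alpha>. h w)"
proof -
  have [measurable]: "h \<in> borel_measurable borel" using h(1) by (rule borel_measurable_continuous_onI)
  have [measurable_cong]: "sets \<alpha> = sets borel" using \<alpha> by (simp add: tempered_def)
  show ?thesis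
  proof (rule integral_dominated_convergence)
    show "integrable \<alpha> (\<lambda>w. B * exp (R\<^sup>2 / 4) * sqrt 2 ^ DIM('a) * gauss (1/4) w)"
      using \<alpha> by (intro integrable_mult_right tempered_integrable) auto
    show "AE w in \<alpha>. (\<lambda>n. heat (t n) h w) \<longlonglongrightarrow> h w"
      using heat_tendsto[OF h(1,2) t(1,3)] by auto
    show "AE w in \<alpha>. norm (heat (t n) h w) \<le> B * exp (R\<^sup>2 / 4) * sqrt 2 ^ DIM('a) * gauss (1/4) w" for n
      using heat_bound[of h B R "t n"] h t by auto
  qed auto
qed

lemma integrable_bounded_support:
  fixes h :: "'a::euclidean_space \<Rightarrow> real"
  assumes \<alpha>: "tempered \<alpha>" and [measurable]: "h \<in> borel_measurable borel" and hB: "\<And>x. \<bar>h x\<bar> \<le> B"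
    and hR: "\<And>x. h x \<noteq> 0 \<Longrightarrow> norm x \<le> R"
  shows "integrable \<alpha> h"
proof -
  have [measurable_cong]: "sets \<alpha> = sets borel" using \<alpha> by (simp add: tempered_def)
  have B: "0 \<le> B" using hB[of 0] by linarith
  have "integrable \<alpha> (\<lambda>x. B * indicator (cball 0 R) x)"
    using tempered_emeasure_bounded[OF \<alpha>, of "cball 0 R"] by (auto simp: tempered_sets[OF \<alpha>])
  then show ?thesis
    by (rule Bochner_Integration.integrable_bound) (use hB hR B in \<open>auto simp: indicator_def\<close>)
qed

text \<open>Halving the rate absorbs a bounded shift, by \<open>norm_power2_add_le\<close>; hence
  shifted Gaussians are still integrable against a tempered measure.\<close>

lemma gauss_shift_le:
  assumes "norm u \<le> R" "0 \<le> s"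
  shows "gauss s (w - u) \<le> exp (s * R\<^sup>2 / 2) * gauss (s / 2) w"
proof -
  have "(norm w)\<^sup>2 \<le> 2 * (norm (w - u))\<^sup>2 + 2 * (norm u)\<^sup>2"
    using norm_power2_add_le[of "w - u" u] by simp
  also have "(norm u)\<^sup>2 \<le> R\<^sup>2" using assms by (intro power_mono) auto
  finally have "s * (norm w)\<^sup>2 \<le> s * (2 * (norm (w - u))\<^sup>2 + 2 * R\<^sup>2)"
    using assms by (intro mult_left_mono) auto
  then show ?thesis by (simp add: gauss_def algebra_simps flip: exp_add)
qed

lemma integral_gauss_le_bounded:
  assumes \<alpha>: "tempered \<alpha>" and s: "0 < s"
  shows "integrable \<alpha> (\<lambda>w. gauss s (w - u))"
proof -
  have [measurable_cong]: "sets \<alpha> = sets borel" using \<alpha> by (simp add: tempered_def)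
  have "integrable \<alpha> (\<lambda>w. exp (s * (norm u)\<^sup>2 / 2) * gauss (s / 2) w)"
    using \<alpha> s by (intro integrable_mult_right tempered_integrable) auto
  then show ?thesis
    by (rule Bochner_Integration.integrable_bound) (use gauss_shift_le[of u "norm u" s] s in auto)
qed

lemma (in pair_sigma_finite) integrable_product:
  fixes f :: "_ \<Rightarrow> real" and g :: "_ \<Rightarrow> real"
  assumes f: "integrable M1 f" and g: "integrable M2 g"
  shows "integrable (M1 \<Otimes>\<^sub>M M2) (\<lambda>(x, y). f x * g y)"
proof (rule Fubini_integrable)
  note [measurable] = borel_measurable_integrable[OF f] borel_measurable_integrable[OF g]
  show "(\<lambda>(x, y). f x * g y) \<in> borel_measurable (M1 \<Otimes>\<^sub>M M2)" by measurable
qed (use f g in \<open>auto simp: abs_mult\<close>)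

text \<open>Exchanging the integrals expresses the integral of \<open>heat t h\<close> through the
  Gaussian smoothings of \<alpha> at the points \<open>u\<close>, which is the information that
  \<open>gauss_dual\<close>, or equality of characteristic functions, provides.\<close>

lemma heat_Fubini:
  fixes h :: "'a::euclidean_space \<Rightarrow> real"
  assumes \<alpha>: "tempered \<alpha>" and [measurable]: "h \<in> borel_measurable borel" and hB: "\<And>x. \<bar>h x\<bar> \<le> B"
    and hR: "\<And>x. h x \<noteq> 0 \<Longrightarrow> norm x \<le> R" and t: "0 < t"
  shows "(LINT w|\<alpha>. heat t h w) =
     (LINT u|lborel. h u * (LINT w|\<alpha>. gauss (1 / t) (w - u))) / sqrt (2 * pi * t) ^ DIM('a)"
    and "integrable lborel (\<lambda>u. h u * (LINT w|\<alpha>. gauss (1 / t) (w - u)))"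
proof -
  have [measurable_cong]: "sets \<alpha> = sets borel" using \<alpha> by (simp add: tempered_def)
  interpret A: sigma_finite_measure \<alpha> by (rule tempered_sigma_finite[OF \<alpha>])
  interpret pair_sigma_finite lborel \<alpha> ..
  have B: "0 \<le> B" using hB[of 0] by linarith
  let ?C = "B * exp (1 / t * R\<^sup>2 / 2)"
  have 1: "integrable (lborel \<Otimes>\<^sub>M \<alpha>) (\<lambda>(u, w). (?C * indicator (cball (0::'a) R) u) * gauss (1 / t / 2) w)"
    by (rule integrable_product[OF integrable_bounded_support[OF tempered_lborel, of _ ?C R]
          tempered_integrable[OF \<alpha>]])
      (use t B in \<open>auto simp: indicator_def\<close>)
  have 2: "integrable (lborel \<Otimes>\<^sub>M \<alpha>) (\<lambda>(u, w). h u * gauss (1 / t) (w - u))"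
  proof (rule integrable_dominated[OF 1])
    show "norm (case p of (u, w) \<Rightarrow> h u * gauss (1 / t) (w - u)) \<le>
      (case p of (u, w) \<Rightarrow> (?C * indicator (cball (0::'a) R) u) * gauss (1 / t / 2) w)" for p
    proof (cases p)
      case (Pair u w)
      have "\<bar>h u\<bar> * gauss (1 / t) (w - u) \<le> (?C * indicator (cball 0 R) u) * gauss (1 / t / 2) w"
      proof (cases "h u = 0")
        case False
        then have "norm u \<le> R" by (rule hR)
        then have "\<bar>h u\<bar> * gauss (1 / t) (w - u) \<le> B * (exp (1 / t * R\<^sup>2 / 2) * gauss (1 / t / 2) w)"
          using t B hB by (intro mult_mono gauss_shift_le) auto
        then show ?thesis using B \<open>norm u \<le> R\<close> by (simp add: mult.assoc)
      qed (use B in simp)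
      then show ?thesis by (simp add: Pair abs_mult)
    qed
  qed simp
  have "(LINT w|\<alpha>. LINT u|lborel. h u * gauss (1 / t) (w - u)) =
        (LINT u|lborel. LINT w|\<alpha>. h u * gauss (1 / t) (w - u))"
    using Fubini_integral[of "\<lambda>u w. h u * gauss (1 / t) (w - u)"] 2 by simp
  then show "(LINT w|\<alpha>. heat t h w) =
     (LINT u|lborel. h u * (LINT w|\<alpha>. gauss (1 / t) (w - u))) / sqrt (2 * pi * t) ^ DIM('a)"
    by (simp add: heat_def)
  show "integrable lborel (\<lambda>u. h u * (LINT w|\<alpha>. gauss (1 / t) (w - u)))"
    using integrable_fst'[OF 2] by simp
qed

section \<open>The Gaussian form of spectral duality\<close>

text \<open>Parseval's relation tested on a Gaussian times a character: the Fourier transform of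
  \<open>cis (k \<bullet> y) * gauss t k\<close> in \<open>k\<close> is a multiple of the Gaussian
  of rate \<open>1 / t\<close> centred at \<open>y\<close>. The signed measure is kept as the pair
  of \<alpha> and \<open>c\<close>, since its total variation may be infinite.\<close>

definition gauss_dual :: "'a::euclidean_space measure \<Rightarrow> real \<Rightarrow> 'a measure \<Rightarrow> bool" where
  "gauss_dual \<alpha> c \<nu> \<longleftrightarrow> (\<forall>t>0. \<forall>y.
     (LINT k|\<nu>. cis (k \<bullet> y) * of_real (gauss t k)) =
     of_real (sqrt (2 * pi / t) ^ DIM('a) *
       ((LINT x|\<alpha>. gauss (1 / t) (x - y)) - c * (LINT x|lborel. gauss (1 / t) (x - y)))))"

lemma fourier_fun_bounded:
  fixes h :: "'a::euclidean_space \<Rightarrow> real"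
  assumes h: "integrable lborel h"
  shows "cmod (fourier_fun h k) \<le> (LINT x|lborel. \<bar>h x\<bar>)"
proof -
  have "cmod (fourier_fun h k) \<le> (LINT x|lborel. cmod (complex_of_real (h x) * cis (- (k \<bullet> x))))"
    unfolding fourier_fun_def by (rule integral_norm_bound)
  also have "\<dots> = (LINT x|lborel. \<bar>h x\<bar>)" by (simp add: norm_mult)
  finally show ?thesis .
qed

lemma fourier_fun_measurable [measurable]:
  assumes [measurable]: "h \<in> borel_measurable borel"
  shows "fourier_fun h \<in> borel_measurable borel"
  unfolding fourier_fun_def by measurable

text \<open>Integrating the duality at \<open>y = u\<close> against \<open>h u\<close> produces
  \<open>fourier_fun h\<close> on the spectral side and, through \<open>heat_Fubini\<close>, the
  heat flow of \<open>h\<close> on the other.\<close>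

lemma gauss_dual_heat:
  fixes h :: "'a::euclidean_space \<Rightarrow> real"
  assumes \<alpha>: "tempered \<alpha>" and \<nu>: "tempered \<nu>" and dual: "gauss_dual \<alpha> c \<nu>"
    and [measurable]: "h \<in> borel_measurable borel" and hB: "\<And>x. \<bar>h x\<bar> \<le> B"
    and hR: "\<And>x. h x \<noteq> 0 \<Longrightarrow> norm x \<le> R" and t: "0 < t"
  shows "(LINT k|\<nu>. fourier_fun h k * of_real (gauss t k)) =
     of_real ((2 * pi) ^ DIM('a) * ((LINT w|\<alpha>. heat t h w) - c * (LINT w|lborel. heat t h w)))"
proof -
  have [measurable_cong]: "sets \<nu> = sets borel" using \<nu> by (simp add: tempered_def)
  interpret A: sigma_finite_measure \<nu> by (rule tempered_sigma_finite[OF \<nu>])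
  interpret pair_sigma_finite lborel \<nu> ..
  have h: "integrable lborel h"
    by (rule integrable_bounded_support[OF tempered_lborel, of h B R]) (use hB hR in auto)
  have 1: "integrable (lborel \<Otimes>\<^sub>M \<nu>) (\<lambda>(u, k). of_real (h u) * cis (- (k \<bullet> u)) * complex_of_real (gauss t k))"
    using integrable_product[OF h tempered_integrable[OF \<nu> t]]
    by (rule Bochner_Integration.integrable_bound) (auto simp: norm_mult)
  have "(LINT k|\<nu>. fourier_fun h k * of_real (gauss t k)) =
      (LINT k|\<nu>. LINT u|lborel. of_real (h u) * cis (- (k \<bullet> u)) * of_real (gauss t k))"
    unfolding fourier_fun_def by (subst integral_mult_left_zero) simp
  also have "\<dots> = (LINT u|lborel. LINT k|\<nu>. of_real (h u) * cis (- (k \<bullet> u)) * of_real (gauss t k))"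
    using Fubini_integral[of "\<lambda>u k. of_real (h u) * cis (- (k \<bullet> u)) * complex_of_real (gauss t k)"] 1 by simp
  also have "\<dots> = (LINT u|lborel. of_real (h u * (sqrt (2 * pi / t) ^ DIM('a) *
       ((LINT x|\<alpha>. gauss (1 / t) (x - u)) - c * (LINT x|lborel. gauss (1 / t) (x - u))))))"
  proof (intro Bochner_Integration.integral_cong refl)
    fix u :: 'a
    \<comment> \<open>The character carries a minus sign here, unlike in \<open>gauss_dual\<close>;
      conjugation bridges this because the right side of the duality is real.\<close>
    have "(LINT k|\<nu>. of_real (h u) * cis (- (k \<bullet> u)) * of_real (gauss t k)) =
      of_real (h u) * cnj (LINT k|\<nu>. cis (k \<bullet> u) * of_real (gauss t k))"
    proof -
      have "(LINT k|\<nu>. cis (- (k \<bullet> u)) * complex_of_real (gauss t k)) =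
          (LINT k|\<nu>. cnj (cis (k \<bullet> u) * of_real (gauss t k)))"
        by (rule Bochner_Integration.integral_cong) (simp_all add: cis_cnj)
      also have "\<dots> = cnj (LINT k|\<nu>. cis (k \<bullet> u) * of_real (gauss t k))"
        by (rule Bochner_Integration.integral_cnj)
      finally show ?thesis by (simp add: mult.assoc)
    qed
    also have "\<dots> = of_real (h u * (sqrt (2 * pi / t) ^ DIM('a) *
       ((LINT x|\<alpha>. gauss (1 / t) (x - u)) - c * (LINT x|lborel. gauss (1 / t) (x - u)))))"
      using dual t unfolding gauss_dual_def by (subst dual[unfolded gauss_dual_def, rule_format, OF t]) simp
    finally show "(LINT k|\<nu>. of_real (h u) * cis (- (k \<bullet> u)) * of_real (gauss t k)) = \<dots>" .
  qed
  also have "\<dots> = of_real (LINT u|lborel. sqrt (2 * pi / t) ^ DIM('a) * (h u * (LINT x|\<alpha>. gauss (1 / t) (x - u))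
       - c * (h u * (LINT x|lborel. gauss (1 / t) (x - u)))))"
    unfolding integral_complex_of_real by (intro arg_cong[where f=of_real] Bochner_Integration.integral_cong refl) (simp add: algebra_simps)
  also have "(LINT u|lborel. sqrt (2 * pi / t) ^ DIM('a) * (h u * (LINT x|\<alpha>. gauss (1 / t) (x - u))
       - c * (h u * (LINT x|lborel. gauss (1 / t) (x - u))))) = sqrt (2 * pi / t) ^ DIM('a) *
       ((LINT u|lborel. h u * (LINT x|\<alpha>. gauss (1 / t) (x - u))) - c * (LINT u|lborel. h u * (LINT x|lborel. gauss (1 / t) (x - u))))"
    using heat_Fubini(2)[OF \<alpha> _ hB hR t] heat_Fubini(2)[OF tempered_lborel _ hB hR t] by simp
  also have "\<dots> = sqrt (2 * pi / t) ^ DIM('a) * sqrt (2 * pi * t) ^ DIM('a) *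
     ((LINT w|\<alpha>. heat t h w) - c * (LINT w|lborel. heat t h w))"
    using heat_Fubini(1)[OF \<alpha> _ hB hR t] heat_Fubini(1)[OF tempered_lborel _ hB hR t] t
    by (simp add: algebra_simps)
  \<comment> \<open>The Gaussian constant and the heat normalizer combine to exactly the factor of
    the inversion formula.\<close>
  also have "sqrt (2 * pi / t) ^ DIM('a) * sqrt (2 * pi * t) ^ DIM('a) = (2 * pi) ^ DIM('a)"
  proof -
    have "sqrt (2 * pi / t) * sqrt (2 * pi * t) = sqrt ((2 * pi)\<^sup>2)"
      unfolding real_sqrt_mult[symmetric] using t by (simp add: power2_eq_square)
    also have "\<dots> = 2 * pi" by (simp only: real_sqrt_abs) simp
    finally show ?thesis by (simp only: power_mult_distrib[symmetric])
  qed
  finally show ?thesis .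
qed

section \<open>The correlation of two test functions\<close>

lemma cnj_measurable [measurable (raw)]:
  "f \<in> borel_measurable M \<Longrightarrow> (\<lambda>x. cnj (f x)) \<in> borel_measurable M"
  by (rule borel_measurable_continuous_on[of cnj]) (intro continuous_intros)

lemma bounded_test_functionD:
  assumes "bounded_test_function (f :: 'a::euclidean_space \<Rightarrow> real)"
  shows "f \<in> borel_measurable borel"
    and "\<exists>B>0. \<forall>x. \<bar>f x\<bar> \<le> B" and "\<exists>R>0. \<forall>x. f x \<noteq> 0 \<longrightarrow> norm x \<le> R"
  using assms by (auto simp: bounded_test_function_def bounded_pos)

lemma star_conv_measurable [measurable]:
  assumes [measurable]: "f \<in> borel_measurable borel" "g \<in> borel_measurable borel"
  shows "star_conv f g \<in> borel_measurable borel"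
  unfolding star_conv_def by measurable

lemma star_conv_bounded:
  fixes f g :: "'a::euclidean_space \<Rightarrow> real"
  assumes f: "integrable lborel f" and g [measurable]: "g \<in> borel_measurable borel" "\<And>x. \<bar>g x\<bar> \<le> B"
  shows "\<bar>star_conv f g y\<bar> \<le> (LINT x|lborel. \<bar>f x\<bar>) * B"
proof -
  note [measurable] = borel_measurable_integrable[OF f]
  have pt: "\<bar>f x * g (x - y)\<bar> \<le> \<bar>f x\<bar> * B" for x
    using g(2) by (auto simp: abs_mult intro!: mult_left_mono)
  have "norm (star_conv f g y) \<le> (LINT x|lborel. \<bar>f x\<bar> * B)"
    unfolding star_conv_def
  proof (rule Bochner_Integration.integral_norm_bound_integral)
    show i: "integrable lborel (\<lambda>x. \<bar>f x\<bar> * B)" using f by simp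
    show "integrable lborel (\<lambda>x. f x * g (x - y))"
      by (rule integrable_dominated[OF i]) (use pt in auto)
  qed (use pt in auto)
  then show ?thesis by simp
qed

lemma star_conv_support:
  fixes f g :: "'a::euclidean_space \<Rightarrow> real"
  assumes "\<And>x. f x \<noteq> 0 \<Longrightarrow> norm x \<le> R" "\<And>x. g x \<noteq> 0 \<Longrightarrow> norm x \<le> S" "star_conv f g y \<noteq> 0"
  shows "norm y \<le> R + S"
proof (rule ccontr)
  assume y: "\<not> norm y \<le> R + S"
  have z: "f x * g (x - y) = 0" for x
  proof (rule ccontr)
    assume "f x * g (x - y) \<noteq> 0"
    then have "norm x \<le> R" "norm (x - y) \<le> S" using assms by auto
    moreover have "norm y \<le> norm x + norm (x - y)"
      using norm_triangle_ineq4[of x "x - y"] by simp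
    ultimately show False using y by simp
  qed
  have "star_conv f g y = (LINT x|(lborel::'a measure). 0)"
    unfolding star_conv_def by (intro Bochner_Integration.integral_cong refl) (rule z)
  with assms(3) show False by simp
qed

text \<open>Continuity: \<open>g\<close> is an almost everywhere limit of continuous functions, so \<open>star_conv f g\<close> is a
  locally uniform limit of continuous functions.\<close>

lemma star_conv_continuous:
  fixes f g :: "'a::euclidean_space \<Rightarrow> real"
  assumes f: "bounded_test_function f" and g: "bounded_test_function g"
  shows "continuous_on UNIV (star_conv f g)"
proof -
  obtain A R where f [measurable]: "f \<in> borel_measurable borel" and fA: "\<And>x. \<bar>f x\<bar> \<le> A" "0 < A"
    and fR: "\<And>x. f x \<noteq> 0 \<Longrightarrow> norm x \<le> R" "0 < R"
    using bounded_test_functionD[OF f] by metis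
  obtain B S where g [measurable]: "g \<in> borel_measurable borel" and gB: "\<And>x. \<bar>g x\<bar> \<le> B" "0 < B"
    using bounded_test_functionD[OF g] by metis
  have fi: "integrable lborel f"
    by (rule integrable_bounded_support[OF tempered_lborel, of f A R]) (use fA fR in auto)
  have "g measurable_on UNIV"
    by (rule lebesgue_measurable_imp_measurable_on) (auto intro: measurable_completion)
  then obtain N q where N: "negligible N" and q: "\<And>n. continuous_on UNIV (q n)"
    and lim: "\<And>x. x \<notin> N \<Longrightarrow> (\<lambda>n. q n x) \<longlonglongrightarrow> g x"
    unfolding measurable_on_def by auto
  \<comment> \<open>Truncation at \<open>B\<close> keeps the limit, as \<open>g\<close> is bounded
    by \<open>B\<close>, and supplies a bound uniform in \<open>n\<close>.\<close>
  define p where "p n x = max (- B) (min B (q n x))" for n x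
  have pc: "continuous_on UNIV (p n)" for n
    unfolding p_def by (intro continuous_intros q)
  then have [measurable]: "p n \<in> borel_measurable borel" for n
    by (rule borel_measurable_continuous_onI)
  have pB: "\<bar>p n x\<bar> \<le> B" for n x using gB(2) by (auto simp: p_def)
  have plim: "(\<lambda>n. p n x) \<longlonglongrightarrow> g x" if "x \<notin> N" for x
  proof -
    have "(\<lambda>n. p n x) \<longlonglongrightarrow> max (- B) (min B (g x))"
      unfolding p_def by (intro tendsto_intros lim that)
    then show ?thesis using gB(1)[of x] by (simp add: abs_le_iff min_absorb2 max_absorb2)
  qed
  have cont: "continuous_on UNIV (star_conv f (p n))" for n
    unfolding continuous_on_sequentially comp_def
  proof (intro allI ballI impI, elim conjE)
    fix X a assume X: "X \<longlonglongrightarrow> (a::'a)"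
    show "(\<lambda>m. star_conv f (p n) (X m)) \<longlonglongrightarrow> star_conv f (p n) a"
      unfolding star_conv_def
    proof (rule integral_dominated_convergence[where w="\<lambda>x. \<bar>f x\<bar> * B"])
      show "AE x in lborel. (\<lambda>m. f x * p n (x - X m)) \<longlonglongrightarrow> f x * p n (x - a)"
      proof (rule AE_I2)
        fix x
        have "(\<lambda>m. x - X m) \<longlonglongrightarrow> x - a" by (intro tendsto_intros X)
        from continuous_on_tendsto_compose[OF pc this]
        show "(\<lambda>m. f x * p n (x - X m)) \<longlonglongrightarrow> f x * p n (x - a)"
          by (intro tendsto_mult tendsto_const) auto
      qed
      show "AE x in lborel. norm (f x * p n (x - X m)) \<le> \<bar>f x\<bar> * B" for m
        using pB by (auto simp: abs_mult intro!: mult_left_mono)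
    qed (use fi in auto)
  qed
  have "continuous_on (ball 0 M) (star_conv f g)" for M
  proof -
    \<comment> \<open>If \<open>f x\<close> is nonzero and \<open>y\<close> lies in the ball, then
      \<open>x - y\<close> stays in \<open>cball 0 (R + M)\<close>; one L1 distance on that ball
      therefore controls the error for all such \<open>y\<close>.\<close>
    define e where "e n = A * (LINT z|lborel. indicator (cball 0 (R + M)) z * \<bar>g z - p n z\<bar>)" for n
    have [measurable]: "cball (0::'a) (R + M) \<in> sets borel" by (intro borel_closed closed_cball)
    have ind: "integrable lborel (\<lambda>z. indicator (cball (0::'a) (R + M)) z * (2 * B))"
      using emeasure_lborel_cball_finite[of "0::'a" "R+M"] by auto
    have pt: "indicator (cball 0 (R + M)) z * \<bar>g z - p n z\<bar> \<le> indicator (cball 0 (R + M)) z * (2 * B)" for z n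
      using gB(1)[of z] pB[of n z] by (intro mult_left_mono) auto
    have "(\<lambda>n. LINT z|lborel. indicator (cball 0 (R + M)) z * \<bar>g z - p n z\<bar>) \<longlonglongrightarrow> (LINT z|(lborel::'a measure). (0::real))"
    proof (rule integral_dominated_convergence[OF _ _ ind])
      have "AE z in lebesgue. z \<notin> N" using N by (metis AE_not_in negligible_iff_null_sets)
      then have "AE z in lebesgue. (\<lambda>n. indicator (cball 0 (R + M)) z * \<bar>g z - p n z\<bar>) \<longlonglongrightarrow> 0"
      proof (eventually_elim)
        case (elim z)
        have "(\<lambda>n. indicator (cball 0 (R + M)) z * \<bar>g z - p n z\<bar>) \<longlonglongrightarrow> indicator (cball 0 (R + M)) z * \<bar>g z - g z\<bar>"
          by (intro tendsto_intros plim elim)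
        then show ?case by simp
      qed
      then show "AE z in lborel. (\<lambda>n. indicator (cball 0 (R + M)) z * \<bar>g z - p n z\<bar>) \<longlonglongrightarrow> 0"
        by (simp add: AE_completion_iff)
    qed (use pt in auto)
    then have e0: "e \<longlonglongrightarrow> 0" unfolding e_def by (auto intro: tendsto_mult_right_zero)
    have le: "\<bar>star_conv f (p n) y - star_conv f g y\<bar> \<le> e n" if y: "y \<in> ball 0 M" for n y
    proof -
      have i: "integrable lborel (\<lambda>x. f x * k (x - y))" if "k \<in> borel_measurable borel" "\<And>x. \<bar>k x\<bar> \<le> B" for k
        by (rule integrable_dominated[OF integrable_mult_left[OF integrable_abs[OF fi], of B]])
           (use that in \<open>auto simp: abs_mult intro!: mult_left_mono\<close>)
      have ig: "integrable lborel (\<lambda>z. A * (indicator (cball 0 (R + M)) z * \<bar>g z - p n z\<bar>))"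
        by (rule integrable_mult_right, rule integrable_dominated[OF ind]) (use pt[of _ n] in auto)
      have "star_conv f (p n) y - star_conv f g y = (LINT x|lborel. f x * p n (x - y) - f x * g (x - y))"
        unfolding star_conv_def by (rule Bochner_Integration.integral_diff[symmetric]; rule i) (use pB gB in auto)
      also have "norm \<dots> \<le> (LINT x|lborel. A * (indicator (cball 0 (R + M)) (x - y) * \<bar>g (x - y) - p n (x - y)\<bar>))"
      proof (rule Bochner_Integration.integral_norm_bound_integral)
        show "integrable lborel (\<lambda>x. f x * p n (x - y) - f x * g (x - y))"
          by (rule Bochner_Integration.integrable_diff; rule i) (use pB gB in auto)
        show "integrable lborel (\<lambda>x. A * (indicator (cball 0 (R + M)) (x - y) * \<bar>g (x - y) - p n (x - y)\<bar>))"
          using integrable_lborel_subst(2)[of "\<lambda>z. A * (indicator (cball 0 (R + M)) z * \<bar>g z - p n z\<bar>)" y] ig by simp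
        show "norm (f x * p n (x - y) - f x * g (x - y)) \<le> A * (indicator (cball 0 (R + M)) (x - y) * \<bar>g (x - y) - p n (x - y)\<bar>)" for x
        proof (cases "f x = 0")
          case False
          then have "norm (x - y) \<le> R + M" using fR(1)[OF False] y norm_triangle_ineq4[of x y] by simp
          moreover have "norm (f x * p n (x - y) - f x * g (x - y)) = \<bar>f x\<bar> * \<bar>g (x - y) - p n (x - y)\<bar>"
            by (simp add: abs_mult abs_minus_commute flip: right_diff_distrib)
          ultimately show ?thesis using fA by (auto intro!: mult_right_mono)
        qed (use fA in auto)
      qed
      also have "\<dots> = (LINT z|lborel. A * (indicator (cball 0 (R + M)) z * \<bar>g z - p n z\<bar>))"
        by (rule integral_lborel_subst(2)) auto
      also have "\<dots> = e n" by (simp add: e_def)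
      finally show ?thesis by simp
    qed
    have "uniform_limit (ball 0 M) (\<lambda>n. star_conv f (p n)) (star_conv f g) sequentially"
      unfolding uniform_limit_iff
    proof (intro allI impI)
      fix \<epsilon> :: real assume "0 < \<epsilon>"
      with e0 have "\<forall>\<^sub>F n in sequentially. e n < \<epsilon>" by (auto intro: order_tendstoD)
      then show "\<forall>\<^sub>F n in sequentially. \<forall>x\<in>ball 0 M. dist (star_conv f (p n) x) (star_conv f g x) < \<epsilon>"
        by eventually_elim (use le_less_trans[OF le] in \<open>auto simp: dist_real_def\<close>)
    qed
    then show ?thesis
      by (rule uniform_limit_theorem[rotated]) (auto intro!: always_eventually continuous_on_subset[OF cont])
  qed
  then have "continuous_on (\<Union>n. ball 0 (real n)) (star_conv f g)"
    by (intro continuous_on_open_UN) auto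
  also have "(\<Union>n. ball 0 (real n)) = (UNIV :: 'a set)"
    by (auto simp: reals_Archimedean2)
  finally show ?thesis .
qed

text \<open>\<open>star_conv\<close> is a correlation, not a convolution: the substitution
  \<open>y = x - z\<close> splits the character into one in \<open>x\<close> and one of opposite
  sign in \<open>z\<close>, and the latter yields the conjugate because \<open>g\<close> is
  real.\<close>

lemma fourier_fun_star_conv:
  fixes f g :: "'a::euclidean_space \<Rightarrow> real"
  assumes f: "integrable lborel f" and g: "integrable lborel g"
    and [measurable]: "f \<in> borel_measurable borel" "g \<in> borel_measurable borel"
  shows "fourier_fun (star_conv f g) k = fourier_fun f k * cnj (fourier_fun g k)"
proof -
  let ?F = "\<lambda>x y. complex_of_real (f x) * of_real (g (x - y)) * cis (- (k \<bullet> y))"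
  have "integrable (lborel \<Otimes>\<^sub>M lborel) (\<lambda>(x, y). ?F x y)"
  proof (rule lborel_pair.Fubini_integrable)
    have *: "(LINT y|lborel. \<bar>g (x - y)\<bar>) = (LINT y|lborel. \<bar>g y\<bar>)" for x
      using integral_lborel_subst(3)[of "\<lambda>x. \<bar>g x\<bar>" x] by simp
    have "integrable lborel (\<lambda>x. \<bar>f x\<bar> * (LINT y|lborel. \<bar>g y\<bar>))"
      by (intro integrable_mult_left integrable_abs f)
    then show "integrable lborel (\<lambda>x. LINT y|lborel. norm (case (x, y) of (x, y) \<Rightarrow> ?F x y))"
      by (simp add: norm_mult *)
    have "integrable lborel (\<lambda>y. complex_of_real (f x) * of_real (g (x - y)) * cis (- (k \<bullet> y)))" for x
    proof -
      have "integrable lborel (\<lambda>y. f x * g (x - y))"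
        using integrable_lborel_subst(3)[of g x] g by simp
      then show ?thesis by (rule Bochner_Integration.integrable_bound) (auto simp: norm_mult abs_mult)
    qed
    then show "AE x in lborel. integrable lborel (\<lambda>y. case (x, y) of (x, y) \<Rightarrow> ?F x y)" by simp
  qed auto
  then have "(LINT y|lborel. LINT x|lborel. ?F x y) = (LINT x|lborel. LINT y|lborel. ?F x y)"
    by (rule lborel_pair.Fubini_integral)
  also have "(LINT y|lborel. LINT x|lborel. ?F x y) = fourier_fun (star_conv f g) k"
  proof -
    have "(LINT x|lborel. ?F x y) = of_real (LINT x|lborel. f x * g (x - y)) * cis (- (k \<bullet> y))" for y
      unfolding integral_complex_of_real[symmetric] by (subst integral_mult_left_zero[symmetric]) simp
    then show ?thesis by (simp add: fourier_fun_def star_conv_def)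
  qed
  also have "(LINT x|lborel. LINT y|lborel. ?F x y) = fourier_fun f k * cnj (fourier_fun g k)"
  proof -
    have "(LINT y|lborel. ?F x y) = complex_of_real (f x) * cis (- (k \<bullet> x)) * cnj (fourier_fun g k)" for x
    proof -
      have "(LINT y|lborel. ?F x y) = (LINT z|lborel. ?F x (x - z))"
        by (rule integral_lborel_subst(3)[symmetric]) auto
      also have "\<dots> = (LINT z|lborel. complex_of_real (f x) * cis (- (k \<bullet> x)) * (of_real (g z) * cis (k \<bullet> z)))"
        by (intro Bochner_Integration.integral_cong refl) (simp add: inner_diff_right cis_mult)
      also have "\<dots> = complex_of_real (f x) * cis (- (k \<bullet> x)) * (LINT z|lborel. cnj (of_real (g z) * cis (- (k \<bullet> z))))"
        by (simp add: cis_cnj)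
      finally show ?thesis by (simp add: fourier_fun_def del: complex_cnj_mult)
    qed
    then show ?thesis by (simp add: fourier_fun_def)
  qed
  finally show ?thesis .
qed

section \<open>From Gaussians to arbitrary test functions\<close>

text \<open>The obstacle is integrability of the undamped product under \<nu>, since transforms of
  discontinuous test functions decay slowly. With equal functions the integrand is nonnegative, and
  Fatou's lemma yields integrability from the damped integrals, which converge by heat
  regularization; the mixed case is dominated by the two squares.\<close>

theorem gauss_dual_spectral:
  fixes f g :: "'a::euclidean_space \<Rightarrow> real"
  assumes \<alpha>: "tempered \<alpha>" and \<nu>: "tempered \<nu>" and dual: "gauss_dual \<alpha> c \<nu>"
    and f: "bounded_test_function f" and g: "bounded_test_function g"
  shows "integrable \<nu> (\<lambda>k. fourier_fun f k * cnj (fourier_fun g k))"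
    and "complex_of_real ((LINT y|\<alpha>. star_conv f g y) - c * (LINT y|lborel. star_conv f g y)) =
          (LINT k|\<nu>. fourier_fun f k * cnj (fourier_fun g k)) / (2 * pi) ^ DIM('a)"
proof -
  have [measurable_cong]: "sets \<nu> = sets borel" using \<nu> by (simp add: tempered_def)
  define t :: "nat \<Rightarrow> real" where "t n = inverse (Suc n)" for n
  have t: "0 < t n" "t n \<le> 1" for n by (auto simp: t_def divide_simps)
  have t0: "t \<longlonglongrightarrow> 0" unfolding t_def by (rule LIMSEQ_inverse_real_of_nat)
  have gt: "(\<lambda>n. gauss (t n) k) \<longlonglongrightarrow> 1" for k :: 'a
  proof -
    have "(\<lambda>n. gauss (t n) k) \<longlonglongrightarrow> exp (- (0 * (norm k)\<^sup>2 / 2))"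
      unfolding gauss_def by (intro tendsto_intros t0) auto
    then show ?thesis by simp
  qed
  \<comment> \<open>Stated for arbitrary pairs because it is used both for one function with itself
    and for the given \<open>f\<close> and \<open>g\<close>.\<close>
  have main: "(\<lambda>n. LINT k|\<nu>. fourier_fun f k * cnj (fourier_fun g k) * of_real (gauss (t n) k)) \<longlonglongrightarrow>
    of_real ((2 * pi) ^ DIM('a) * ((LINT y|\<alpha>. star_conv f g y) - c * (LINT y|lborel. star_conv f g y)))"
    if f: "bounded_test_function f" and g: "bounded_test_function g" for f g
  proof -
    obtain A R where [measurable]: "f \<in> borel_measurable borel" and fA: "\<And>x. \<bar>f x\<bar> \<le> A" "0 < A"
      and fR: "\<And>x. f x \<noteq> 0 \<Longrightarrow> norm x \<le> R" "0 < R"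
      using bounded_test_functionD[OF f] by metis
    obtain B S where [measurable]: "g \<in> borel_measurable borel" and gB: "\<And>x. \<bar>g x\<bar> \<le> B" "0 < B"
      and gS: "\<And>x. g x \<noteq> 0 \<Longrightarrow> norm x \<le> S" "0 < S"
      using bounded_test_functionD[OF g] by metis
    have fi: "integrable lborel f"
      by (rule integrable_bounded_support[OF tempered_lborel, of f A R]) (use fA fR in auto)
    have gi: "integrable lborel g"
      by (rule integrable_bounded_support[OF tempered_lborel, of g B S]) (use gB gS in auto)
    let ?h = "star_conv f g"
    have hB: "\<bar>?h x\<bar> \<le> (LINT x|lborel. \<bar>f x\<bar>) * B" for x
      by (rule star_conv_bounded) (use fi gB in auto)
    have hR: "norm x \<le> R + S" if "?h x \<noteq> 0" for x
      using star_conv_support[OF fR(1) gS(1) that] by simp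
    have hc: "continuous_on UNIV ?h" by (rule star_conv_continuous[OF f g])
    have "(\<lambda>n. (LINT w|\<alpha>. heat (t n) ?h w) - c * (LINT w|lborel. heat (t n) ?h w)) \<longlonglongrightarrow>
       (LINT y|\<alpha>. ?h y) - c * (LINT y|lborel. ?h y)"
      by (intro tendsto_intros heat_integral_tendsto[OF _ hc hB hR t t0] \<alpha> tempered_lborel)
    then have "(\<lambda>n. complex_of_real ((2 * pi) ^ DIM('a) * ((LINT w|\<alpha>. heat (t n) ?h w) - c * (LINT w|lborel. heat (t n) ?h w)))) \<longlonglongrightarrow>
       of_real ((2 * pi) ^ DIM('a) * ((LINT y|\<alpha>. ?h y) - c * (LINT y|lborel. ?h y)))"
      by (intro tendsto_of_real tendsto_mult tendsto_const)
    moreover have "(LINT k|\<nu>. fourier_fun f k * cnj (fourier_fun g k) * of_real (gauss (t n) k)) =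
      of_real ((2 * pi) ^ DIM('a) * ((LINT w|\<alpha>. heat (t n) ?h w) - c * (LINT w|lborel. heat (t n) ?h w)))" for n
      using gauss_dual_heat[OF \<alpha> \<nu> dual, of ?h, OF _ hB hR t(1)] fourier_fun_star_conv[OF fi gi] by simp
    ultimately show ?thesis by simp
  qed
  have bdd: "\<exists>C. \<forall>k. cmod (fourier_fun f k) \<le> C" "f \<in> borel_measurable borel"
    if f: "bounded_test_function f" for f :: "'a \<Rightarrow> real"
  proof -
    obtain A R where fm [measurable]: "f \<in> borel_measurable borel" and fA: "\<And>x. \<bar>f x\<bar> \<le> A" "0 < A"
      and fR: "\<And>x. f x \<noteq> 0 \<Longrightarrow> norm x \<le> R" "0 < R"
      using bounded_test_functionD[OF f] by metis
    show "f \<in> borel_measurable borel" by fact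
    have fi: "integrable lborel f"
      by (rule integrable_bounded_support[OF tempered_lborel, of f A R]) (use fA fR in auto)
    show "\<exists>C. \<forall>k. cmod (fourier_fun f k) \<le> C" using fourier_fun_bounded[OF fi] by blast
  qed
  have sq: "integrable \<nu> (\<lambda>k. (cmod (fourier_fun f k))\<^sup>2)" if f: "bounded_test_function f" for f :: "'a \<Rightarrow> real"
  proof (rule integrableI_bounded)
    have fm [measurable]: "f \<in> borel_measurable borel" using bdd(2)[OF f] .
    show "(\<lambda>k. (cmod (fourier_fun f k))\<^sup>2) \<in> borel_measurable \<nu>" by measurable
    obtain C where C: "cmod (fourier_fun f k) \<le> C" for k using bdd(1)[OF f] by blast
    let ?q = "\<lambda>n k. (cmod (fourier_fun f k))\<^sup>2 * gauss (t n) k"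
    let ?l = "(2 * pi) ^ DIM('a) * ((LINT y|\<alpha>. star_conv f f y) - c * (LINT y|lborel. star_conv f f y))"
    have i: "integrable \<nu> (?q n)" for n
    proof (rule Bochner_Integration.integrable_bound)
      show "integrable \<nu> (\<lambda>k. C\<^sup>2 * gauss (t n) k)"
        using \<nu> t(1) by (intro integrable_mult_right tempered_integrable)
    qed (auto simp: abs_mult intro!: mult_right_mono power_mono C)
    have "(\<lambda>n. LINT k|\<nu>. complex_of_real (?q n k)) \<longlonglongrightarrow> of_real ?l"
      using main[OF f f] by (simp add: complex_norm_square del: of_real_power)
    then have "(\<lambda>n. LINT k|\<nu>. ?q n k) \<longlonglongrightarrow> ?l"
      unfolding integral_complex_of_real tendsto_of_real_iff .
    then have lim: "(\<lambda>n. ennreal (LINT k|\<nu>. ?q n k)) \<longlonglongrightarrow> ennreal ?l"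
      by (intro tendsto_ennrealI)
    have "(\<integral>\<^sup>+k. ennreal (norm ((cmod (fourier_fun f k))\<^sup>2)) \<partial>\<nu>) = (\<integral>\<^sup>+k. liminf (\<lambda>n. ennreal (?q n k)) \<partial>\<nu>)"
    proof (intro nn_integral_cong)
      fix k
      have "(\<lambda>n. ?q n k) \<longlonglongrightarrow> (cmod (fourier_fun f k))\<^sup>2 * 1" by (intro tendsto_intros gt)
      then have l: "(\<lambda>n. ennreal (?q n k)) \<longlonglongrightarrow> ennreal ((cmod (fourier_fun f k))\<^sup>2)" by (intro tendsto_ennrealI) simp
      show "ennreal (norm ((cmod (fourier_fun f k))\<^sup>2)) = liminf (\<lambda>n. ennreal (?q n k))"
        using lim_imp_Liminf[OF _ l] by simp
    qed
    also have "\<dots> \<le> liminf (\<lambda>n. \<integral>\<^sup>+k. ?q n k \<partial>\<nu>)"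
      by (rule nn_integral_liminf) auto
    also have "\<dots> = liminf (\<lambda>n. ennreal (LINT k|\<nu>. ?q n k))"
      using i by (subst nn_integral_eq_integral) auto
    also have "\<dots> = ennreal ?l" using lim_imp_Liminf[OF _ lim] by simp
    finally show "(\<integral>\<^sup>+k. ennreal (norm ((cmod (fourier_fun f k))\<^sup>2)) \<partial>\<nu>) < \<infinity>"
      by (rule le_less_trans) simp
  qed
  note [measurable] = bdd(2)[OF f] bdd(2)[OF g]
  let ?w = "\<lambda>k. (cmod (fourier_fun f k))\<^sup>2 + (cmod (fourier_fun g k))\<^sup>2"
  have w: "integrable \<nu> ?w" using sq f g by simp
  have le: "norm (fourier_fun f k * cnj (fourier_fun g k)) \<le> ?w k" for k
  proof -
    let ?a = "cmod (fourier_fun f k)" and ?b = "cmod (fourier_fun g k)"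
    have "2 * (?a * ?b) \<le> ?a\<^sup>2 + ?b\<^sup>2" using zero_le_power2[of "?a - ?b"] by (simp add: power2_diff)
    moreover have "0 \<le> ?a * ?b" by simp
    ultimately have "?a * ?b \<le> ?a\<^sup>2 + ?b\<^sup>2" by linarith
    then show ?thesis by (simp add: norm_mult)
  qed
  show "integrable \<nu> (\<lambda>k. fourier_fun f k * cnj (fourier_fun g k))"
    by (rule integrable_dominated[OF w]) (use le in auto)
  have "(\<lambda>n. LINT k|\<nu>. fourier_fun f k * cnj (fourier_fun g k) * of_real (gauss (t n) k)) \<longlonglongrightarrow>
    (LINT k|\<nu>. fourier_fun f k * cnj (fourier_fun g k) * of_real 1)"
  proof (rule integral_dominated_convergence[OF _ _ w])
    show "AE k in \<nu>. (\<lambda>n. fourier_fun f k * cnj (fourier_fun g k) * of_real (gauss (t n) k)) \<longlonglongrightarrow>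
       fourier_fun f k * cnj (fourier_fun g k) * of_real 1"
      by (intro AE_I2 tendsto_intros gt)
    have *: "norm (fourier_fun f k * cnj (fourier_fun g k) * of_real (gauss (t n) k)) \<le> ?w k" for k n
    proof -
      have "norm (fourier_fun f k * cnj (fourier_fun g k) * of_real (gauss (t n) k)) \<le>
        norm (fourier_fun f k * cnj (fourier_fun g k)) * 1"
        using gauss_le_1[of "t n" k] less_imp_le[OF t(1)[of n]] by (subst norm_mult, intro mult_left_mono) auto
      then show ?thesis using le[of k] by simp
    qed
    then show "AE k in \<nu>. norm (fourier_fun f k * cnj (fourier_fun g k) * of_real (gauss (t n) k)) \<le> ?w k" for n
      by simp
  qed auto
  from LIMSEQ_unique[OF this main[OF f g]]
  show "complex_of_real ((LINT y|\<alpha>. star_conv f g y) - c * (LINT y|lborel. star_conv f g y)) =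
          (LINT k|\<nu>. fourier_fun f k * cnj (fourier_fun g k)) / (2 * pi) ^ DIM('a)"
    by (simp add: field_simps)
qed

section \<open>Characteristic functions determine finite measures\<close>

lemma measure_eqI_box:
  fixes M N :: "'a::euclidean_space measure"
  assumes "sets M = sets borel" "sets N = sets borel"
    and "\<And>a b. emeasure M (box a b) = emeasure N (box a b)" "\<And>a b. emeasure M (box a b) \<noteq> \<infinity>"
  shows "M = N"
proof (rule measure_eqI_generator_eq)
  let ?E = "range (\<lambda>(a, b). box a b::'a set)"
  show "Int_stable ?E" by (auto simp: Int_stable_def box_Int_box)
  show "?E \<subseteq> Pow UNIV" "sets M = sigma_sets UNIV ?E" "sets N = sigma_sets UNIV ?E"
    by (simp_all add: borel_eq_box assms)
  let ?A = "\<lambda>n::nat. box (- (real n *\<^sub>R One)) (real n *\<^sub>R One) :: 'a set"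
  show "range ?A \<subseteq> ?E" "(\<Union>i. ?A i) = UNIV" unfolding UN_box_eq_UNIV by auto
qed (use assms in auto)

text \<open>The indicator of an open box is the pointwise limit of \<open>n\<close> times the
  distance to the complement, capped at 1; these functions are continuous and vanish outside the
  box.\<close>

lemma measure_eqI_continuous:
  fixes M N :: "'a::euclidean_space measure"
  assumes "finite_measure M" "finite_measure N" and s: "sets M = sets borel" "sets N = sets borel"
    and eq: "\<And>h :: 'a \<Rightarrow> real. continuous_on UNIV h \<Longrightarrow> (\<And>x. \<bar>h x\<bar> \<le> 1) \<Longrightarrow> bounded {x. h x \<noteq> 0} \<Longrightarrow>
      (LINT x|M. h x) = (LINT x|N. h x)"
  shows "M = N"
proof (rule measure_eqI_box[OF s])
  interpret M: finite_measure M by fact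
  interpret N: finite_measure N by fact
  note [measurable_cong] = s
  fix a b :: 'a
  show "emeasure M (box a b) \<noteq> \<infinity>" by simp
  define D where "D = - box a b"
  \<comment> \<open>The complement has to be nonempty: \<open>infdist\<close> to the empty set is 0
    by convention, which would make all \<open>h n\<close> vanish.\<close>
  have "box a b \<noteq> UNIV" using bounded_box[of a b] not_bounded_UNIV by metis
  then have D: "closed D" "D \<noteq> {}" unfolding D_def
    by (intro closed_Compl open_box, metis (no_types) Compl_UNIV_eq Compl_eq_Compl_iff)
  define h where "h n x = min 1 (real n * infdist x D)" for n x
  have hc: "continuous_on UNIV (h n)" for n
    unfolding h_def by (intro continuous_intros)
  then have [measurable]: "h n \<in> borel_measurable borel" for n by (rule borel_measurable_continuous_onI)
  have h1: "0 \<le> h n x" "h n x \<le> 1" for n x by (auto simp: h_def infdist_nonneg)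
  have hs: "h n x = 0" if "x \<notin> box a b" for n x
    using that by (simp add: h_def D_def infdist_zero)
  have lim: "(\<lambda>n. h n x) \<longlonglongrightarrow> indicator (box a b) x" for x
  proof (cases "x \<in> box a b")
    case True
    then have "infdist x D > 0"
      using in_closed_iff_infdist_zero[OF D, of x] infdist_nonneg[of x D] by (auto simp: D_def less_le)
    then have "\<forall>\<^sub>F n in sequentially. 1 / infdist x D \<le> real n"
      using filterlim_real_sequentially by (simp add: filterlim_at_top)
    then have "\<forall>\<^sub>F n in sequentially. h n x = 1"
      by eventually_elim (use \<open>infdist x D > 0\<close> in \<open>auto simp: h_def field_simps min_def\<close>)
    then show ?thesis using True by (auto intro: tendsto_eventually)
  qed (simp add: hs)
  have conv: "(\<lambda>n. LINT x|Q. h n x) \<longlonglongrightarrow> (LINT x|Q. indicator (box a b) x)"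
    if Q: "finite_measure Q" "sets Q = sets borel" for Q
  proof -
    interpret finite_measure Q by fact
    note [measurable_cong] = Q(2)
    show ?thesis
      by (rule integral_dominated_convergence[where w="\<lambda>_. 1"]) (use lim h1 in auto)
  qed
  have "(LINT x|M. h n x) = (LINT x|N. h n x)" for n
  proof (rule eq[OF hc])
    show "bounded {x. h n x \<noteq> 0}"
      by (rule bounded_subset[OF bounded_box[of a b]]) (use hs in auto)
  qed (use h1 in \<open>auto simp: abs_le_iff intro: order_trans[of _ 0]\<close>)
  then have "(LINT x|M. indicator (box a b) x) = (LINT x|N. indicator (box a b) x :: real)"
    using LIMSEQ_unique[OF conv[OF assms(1) s(1)]] conv[OF assms(2) s(2)] by simp
  then show "emeasure M (box a b) = emeasure N (box a b)"
    using s by (simp add: M.emeasure_eq_measure N.emeasure_eq_measure)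
qed

text \<open>Fourier inversion damped by a Gaussian: after Fubini the inner integral over
  \<open>k\<close> is the Gaussian transform at \<open>x - u\<close>. Finiteness of the measure
  gives integrability on the product.\<close>

lemma integral_gauss_characteristic:
  fixes M :: "'a::euclidean_space measure"
  assumes "finite_measure M" and s: "sets M = sets borel" and t: "0 < t"
  shows "(LINT k|lborel. cis (- (k \<bullet> u)) * of_real (gauss t k) * (LINT x|M. cis (k \<bullet> x))) =
     of_real (sqrt (2 * pi / t) ^ DIM('a) * (LINT x|M. gauss (1 / t) (x - u)))"
    and "integrable lborel (\<lambda>k. cis (- (k \<bullet> u)) * of_real (gauss t k) * (LINT x|M. cis (k \<bullet> x)))"
proof -
  interpret M: finite_measure M by fact
  interpret pair_sigma_finite lborel M ..
  note [measurable_cong] = s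
  let ?F = "\<lambda>k x. cis (k \<bullet> (x - u)) * complex_of_real (gauss t k)"
  have "integrable (lborel \<Otimes>\<^sub>M M) (\<lambda>(k, x). gauss t k * 1 :: real)"
    using t by (intro integrable_product integrable_gauss) auto
  then have i: "integrable (lborel \<Otimes>\<^sub>M M) (\<lambda>(k, x). ?F k x)"
    by (rule integrable_dominated) (auto simp: norm_mult)
  have eq: "cis (- (k \<bullet> u)) * of_real (gauss t k) * (LINT x|M. cis (k \<bullet> x)) = (LINT x|M. ?F k x)" for k
  proof -
    have "?F k x = (cis (- (k \<bullet> u)) * of_real (gauss t k)) * cis (k \<bullet> x)" for x
    proof -
      have "cis (k \<bullet> (x - u)) = cis (- (k \<bullet> u)) * cis (k \<bullet> x)"
        by (simp add: cis_mult inner_diff_right)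
      then show ?thesis by (simp add: mult_ac)
    qed
    then show ?thesis by (simp only: integral_mult_right_zero)
  qed
  have "(LINT k|lborel. cis (- (k \<bullet> u)) * of_real (gauss t k) * (LINT x|M. cis (k \<bullet> x))) =
      (LINT k|lborel. LINT x|M. ?F k x)"
    unfolding eq ..
  also have "\<dots> = (LINT x|M. LINT k|lborel. ?F k x)"
    by (rule Fubini_integral[symmetric, OF i])
  also have "\<dots> = (LINT x|M. of_real (sqrt (2 * pi / t) ^ DIM('a) * gauss (1 / t) (x - u)))"
    using has_bochner_integral_integral_eq[OF has_bochner_integral_gauss[where 'a='a, OF t]]
    by (intro Bochner_Integration.integral_cong refl) (simp add: inner_commute[of _ "_ - u"])
  finally show "(LINT k|lborel. cis (- (k \<bullet> u)) * of_real (gauss t k) * (LINT x|M. cis (k \<bullet> x))) =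
     of_real (sqrt (2 * pi / t) ^ DIM('a) * (LINT x|M. gauss (1 / t) (x - u)))"
    unfolding integral_complex_of_real by simp
  show "integrable lborel (\<lambda>k. cis (- (k \<bullet> u)) * of_real (gauss t k) * (LINT x|M. cis (k \<bullet> x)))"
    unfolding eq by (rule integrable_fst[OF i])
qed

text \<open>The characteristic function determines every Gaussian smoothing of the measure, hence
  the integrals of all \<open>heat t h\<close>, and the limit of vanishing \<open>t\<close> recovers
  the integral of \<open>h\<close> itself.\<close>

theorem measure_eqI_characteristic:
  fixes M N :: "'a::euclidean_space measure"
  assumes fin: "finite_measure M" "finite_measure N" and s: "sets M = sets borel" "sets N = sets borel"
    and eq: "\<And>k. (LINT x|M. cis (k \<bullet> x)) = (LINT x|N. cis (k \<bullet> x))"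
  shows "M = N"
proof (rule measure_eqI_continuous[OF fin s])
  fix h :: "'a \<Rightarrow> real" assume h: "continuous_on UNIV h" "\<And>x. \<bar>h x\<bar> \<le> 1" "bounded {x. h x \<noteq> 0}"
  then have [measurable]: "h \<in> borel_measurable borel" by (intro borel_measurable_continuous_onI)
  obtain R where R: "\<And>x. h x \<noteq> 0 \<Longrightarrow> norm x \<le> R" using h(3) unfolding bounded_iff by auto
  define t :: "nat \<Rightarrow> real" where "t n = inverse (Suc n)" for n
  have t: "0 < t n" "t n \<le> 1" for n by (auto simp: t_def divide_simps)
  have t0: "t \<longlonglongrightarrow> 0" unfolding t_def by (rule LIMSEQ_inverse_real_of_nat)
  have "of_real (sqrt (2 * pi / r) ^ DIM('a) * (LINT x|M. gauss (1 / r) (x - u))) =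
    complex_of_real (sqrt (2 * pi / r) ^ DIM('a) * (LINT x|N. gauss (1 / r) (x - u)))" if "0 < r" for r u
    using integral_gauss_characteristic(1)[OF fin(1) s(1) that, of u]
      integral_gauss_characteristic(1)[OF fin(2) s(2) that, of u] by (simp only: eq)
  then have "(LINT x|M. gauss (1 / r) (x - u)) = (LINT x|N. gauss (1 / r) (x - u))" if "0 < r" for r u
    using that by (subst (asm) of_real_eq_iff) auto
  then have "(LINT w|M. heat (t n) h w) = (LINT w|N. heat (t n) h w)" for n
    using heat_Fubini(1)[OF tempered_finite[OF fin(1) s(1)] _ h(2) R t(1)]
      heat_Fubini(1)[OF tempered_finite[OF fin(2) s(2)] _ h(2) R t(1)] t(1) by simp
  moreover have "(\<lambda>n. LINT w|M. heat (t n) h w) \<longlonglongrightarrow> (LINT w|M. h w)"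
    by (rule heat_integral_tendsto[OF tempered_finite[OF fin(1) s(1)] h(1,2) R t t0])
  moreover have "(\<lambda>n. LINT w|N. heat (t n) h w) \<longlonglongrightarrow> (LINT w|N. h w)"
    by (rule heat_integral_tendsto[OF tempered_finite[OF fin(2) s(2)] h(1,2) R t t0])
  ultimately show "(LINT x|M. h x) = (LINT x|N. h x)" using LIMSEQ_unique by auto
qed

section \<open>Uniqueness of the spectral measure\<close>

text \<open>On the ball the phase is at most 1, below \<open>pi / 3\<close>, so the cosine stays
  above 1/2 and the real part is positive. Small balls thus give test functions whose transforms
  have no zeros on a prescribed bounded set of frequencies.\<close>

lemma fourier_fun_cball_nonzero:
  fixes k :: "'a::euclidean_space"
  assumes r: "0 < r" and kr: "norm k * r \<le> 1"
  shows "fourier_fun (indicator (cball 0 r)) k \<noteq> 0"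
proof -
  let ?I = "indicator (cball (0::'a) r) :: 'a \<Rightarrow> real"
  have fin: "emeasure lborel (cball (0::'a) r) < \<infinity>" by (rule emeasure_lborel_cball_finite)
  have i: "integrable lborel ?I" using fin by simp
  have ic: "integrable lborel (\<lambda>x. complex_of_real (?I x) * cis (- (k \<bullet> x)))"
    using i by (rule integrable_dominated) (auto simp: norm_mult indicator_def)
  have Re: "Re (fourier_fun ?I k) = (LINT x|lborel. ?I x * cos (k \<bullet> x))"
    unfolding fourier_fun_def using ic by (subst integral_Re[symmetric]) auto
  have ge: "(LINT x|lborel. ?I x * (1 / 2)) \<le> (LINT x|lborel. ?I x * cos (k \<bullet> x))"
  proof (rule integral_mono)
    show "integrable lborel (\<lambda>x. ?I x * cos (k \<bullet> x))"
      using i by (rule integrable_dominated) (auto simp: abs_mult indicator_def)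
    fix x
    show "?I x * (1 / 2) \<le> ?I x * cos (k \<bullet> x)"
    proof (cases "x \<in> cball 0 r")
      case True
      then have "norm k * norm x \<le> norm k * r" by (intro mult_left_mono) auto
      then have kx: "\<bar>k \<bullet> x\<bar> \<le> 1" using Cauchy_Schwarz_ineq2[of k x] kr by linarith
      have "cos (pi / 3) \<le> cos \<bar>k \<bullet> x\<bar>"
        using kx pi_gt3 by (intro cos_monotone_0_pi_le) auto
      then show ?thesis using True by (simp add: cos_60)
    qed simp
  qed (use i in auto)
  have "(LINT x|lborel. ?I x * (1 / 2)) = measure lborel (cball (0::'a) r) / 2" by simp
  moreover have "measure lborel (cball (0::'a) r) > 0"
  proof -
    have "measure lborel (ball (0::'a) r) \<le> measure lborel (cball (0::'a) r)"
      using fin by (intro measure_mono_fmeasurable) (auto simp: fmeasurable_def)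
    then show ?thesis using content_ball_pos[OF r, of "0::'a"] by simp
  qed
  ultimately have "0 < Re (fourier_fun ?I k)" using Re ge by linarith
  then show ?thesis by (metis less_irrefl zero_complex.sel(1))
qed

text \<open>Weighted by the squared modulus of a transform, a spectral measure becomes finite, and
  its characteristic function can be read off from the covariances of translates of \<open>f\<close>
  with \<open>f\<close>. So the weighted measures agree, and on each box the weight of a suitable
  \<open>f\<close> has no zero and can be divided out.\<close>

theorem is_bartlett_spectral_measure_unique:
  fixes \<Psi> :: "'w \<Rightarrow> 'a::euclidean_space measure"
  assumes "is_bartlett_spectral_measure P \<Psi> \<nu>" "is_bartlett_spectral_measure P \<Psi> \<nu>'"
  shows "\<nu> = \<nu>'"
proof -
  have key: "density \<nu> (\<lambda>k. (cmod (fourier_fun f k))\<^sup>2) = density \<nu>' (\<lambda>k. (cmod (fourier_fun f k))\<^sup>2)"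
    if f: "bounded_test_function f" for f
  proof -
    have [measurable]: "f \<in> borel_measurable borel" using f by (simp add: bounded_test_function_def)
    \<comment> \<open>Translating \<open>f\<close> by \<open>y\<close> multiplies its transform by
      \<open>cis (k \<bullet> y)\<close>; this is how the defining identity gives access to every
      value of a characteristic function.\<close>
    define g where "g y x = f (x + y)" for y x
    have g: "bounded_test_function (g y)" for y
    proof -
      have "{x. f (x + y) \<noteq> 0} = (\<lambda>x. x - y) ` {x. f x \<noteq> 0}"
        by (auto simp: image_iff) (metis add_diff_cancel)
      moreover have "bounded ((\<lambda>x. x - y) ` {x. f x \<noteq> 0})"
        using f by (auto simp: bounded_test_function_def intro!: bounded_minus_comp bounded_translation_minus)
      moreover have "range (g y) \<subseteq> range f" by (auto simp: g_def)
      moreover have "g y \<in> borel_measurable borel" unfolding g_def by measurable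
      ultimately show ?thesis
        using f by (auto simp: bounded_test_function_def g_def intro: bounded_subset)
    qed
    have fg: "fourier_fun (g y) k = cis (k \<bullet> y) * fourier_fun f k" for y k
    proof -
      have "fourier_fun (g y) k = (LINT x|lborel. complex_of_real (f (x + y)) * cis (- (k \<bullet> (x + y - y))))"
        by (simp add: fourier_fun_def g_def)
      also have "\<dots> = (LINT x|lborel. complex_of_real (f x) * cis (- (k \<bullet> (x - y))))"
        by (rule integral_lborel_subst(1)) auto
      also have "\<dots> = (LINT x|lborel. cis (k \<bullet> y) * (complex_of_real (f x) * cis (- (k \<bullet> x))))"
        by (intro Bochner_Integration.integral_cong refl) (simp add: inner_diff_right cis_mult)
      finally show ?thesis by (simp add: fourier_fun_def)
    qed
    have prod: "fourier_fun (g y) k * cnj (fourier_fun f k) = of_real ((cmod (fourier_fun f k))\<^sup>2) * cis (k \<bullet> y)" for y k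
      by (simp add: fg complex_norm_square del: of_real_power)
    have D: "finite_measure (density \<rho> (\<lambda>k. (cmod (fourier_fun f k))\<^sup>2))"
      and E: "(LINT k|density \<rho> (\<lambda>k. (cmod (fourier_fun f k))\<^sup>2). cis (y \<bullet> k)) =
         complex_of_real (covariance_integral P \<Psi> (star_conv (g y) f)) * (2 * pi) ^ DIM('a)"
      and s: "sets \<rho> = sets borel"
      if \<rho>: "is_bartlett_spectral_measure P \<Psi> \<rho>" for \<rho> y
    proof -
      show s: "sets \<rho> = sets borel"
        using \<rho> by (auto simp: is_bartlett_spectral_measure_def locally_finite_measure_def)
      note [measurable_cong] = s
      have sp: "integrable \<rho> (\<lambda>k. fourier_fun f k * cnj (fourier_fun g k)) \<and>
        complex_of_real (covariance_integral P \<Psi> (star_conv f g)) =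
          (LINT k|\<rho>. fourier_fun f k * cnj (fourier_fun g k)) / (2 * pi) ^ DIM('a)"
        if "bounded_test_function f" "bounded_test_function g" for f g
        using \<rho> that by (auto simp: is_bartlett_spectral_measure_def)
      have "integrable \<rho> (\<lambda>k. complex_of_real ((cmod (fourier_fun f k))\<^sup>2))"
        using sp[OF f f] by (simp add: complex_norm_square del: of_real_power)
      then have "integrable \<rho> (\<lambda>k. (cmod (fourier_fun f k))\<^sup>2)"
        unfolding complex_of_real_integrable_eq .
      then show "finite_measure (density \<rho> (\<lambda>k. (cmod (fourier_fun f k))\<^sup>2))"
        by (intro finite_measureI) (auto simp: emeasure_density integrable_iff_bounded less_top cong: nn_integral_cong)
      have "(LINT k|density \<rho> (\<lambda>k. (cmod (fourier_fun f k))\<^sup>2). cis (y \<bullet> k)) =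
        (LINT k|\<rho>. fourier_fun (g y) k * cnj (fourier_fun f k))"
        by (subst integral_density) (auto simp: prod inner_commute scaleR_conv_of_real)
      then show "(LINT k|density \<rho> (\<lambda>k. (cmod (fourier_fun f k))\<^sup>2). cis (y \<bullet> k)) =
         complex_of_real (covariance_integral P \<Psi> (star_conv (g y) f)) * (2 * pi) ^ DIM('a)"
        using sp[OF g[of y] f] by (simp add: field_simps)
    qed
    show ?thesis
      by (rule measure_eqI_characteristic) (use D E s assms in auto)
  qed
  have s: "sets \<nu> = sets borel" "sets \<nu>' = sets borel"
    using assms by (auto simp: is_bartlett_spectral_measure_def locally_finite_measure_def)
  show ?thesis
  proof (rule measure_eqI_box[OF s])
    fix a b :: 'a
    show "emeasure \<nu> (box a b) \<noteq> \<infinity>"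
      using assms(1) bounded_box[of a b]
      by (auto simp: is_bartlett_spectral_measure_def locally_finite_measure_def less_top[symmetric] simp flip: less_top)
    obtain R where R: "0 < R" "\<And>k. k \<in> box a b \<Longrightarrow> norm k \<le> R"
      using bounded_box[of a b] unfolding bounded_pos by auto
    \<comment> \<open>The radius \<open>1 / R\<close> keeps \<open>norm k\<close> times the radius
      at most 1 on the whole box.\<close>
    define f :: "'a \<Rightarrow> real" where "f = indicator (cball 0 (1 / R))"
    have f: "bounded_test_function f"
      unfolding bounded_test_function_def
    proof (intro conjI)
      show "bounded (range f)" by (rule boundedI[of _ 1]) (auto simp: f_def indicator_def)
      show "bounded {x. f x \<noteq> 0}" by (rule bounded_subset[OF bounded_cball[of 0 "1/R"]]) (auto simp: f_def indicator_def)
      show "f \<in> borel_measurable borel"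
        unfolding f_def by (intro borel_measurable_indicator borel_closed closed_cball)
    qed
    have [measurable]: "f \<in> borel_measurable borel" using f by (simp add: bounded_test_function_def)
    have nz: "fourier_fun f k \<noteq> 0" if "k \<in> box a b" for k
      unfolding f_def using R(1) R(2)[OF that] by (intro fourier_fun_cball_nonzero) (auto simp: field_simps)
    let ?q = "\<lambda>k. indicator (box a b) k / ennreal ((cmod (fourier_fun f k))\<^sup>2)"
    have "emeasure \<rho> (box a b) = (\<integral>\<^sup>+k. ?q k \<partial>density \<rho> (\<lambda>k. (cmod (fourier_fun f k))\<^sup>2))"
      if s: "sets \<rho> = sets borel" for \<rho>
    proof -
      note [measurable_cong] = s
      have "emeasure \<rho> (box a b) = (\<integral>\<^sup>+k. indicator (box a b) k \<partial>\<rho>)" by (simp add: s)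
      also have "\<dots> = (\<integral>\<^sup>+k. ennreal ((cmod (fourier_fun f k))\<^sup>2) * ?q k \<partial>\<rho>)"
        using nz by (intro nn_integral_cong) (auto simp: indicator_def ennreal_times_divide intro!: ennreal_divide_self[symmetric])
      also have "\<dots> = (\<integral>\<^sup>+k. ?q k \<partial>density \<rho> (\<lambda>k. (cmod (fourier_fun f k))\<^sup>2))"
        by (rule nn_integral_density[symmetric]) auto
      finally show ?thesis .
    qed
    then show "emeasure \<nu> (box a b) = emeasure \<nu>' (box a b)"
      using s key[OF f] by simp
  qed
qed

section \<open>Vague compactness on Euclidean space\<close>

lemma binary_expansion:
  fixes x :: real
  assumes "x \<in> {0..1}"
  shows "\<exists>b. (\<forall>j. b j \<in> {0, 1}) \<and> (\<Sum>j. b j * (1 / 2) ^ Suc j) = x"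
proof (cases "x = 1")
  \<comment> \<open>At 1 the floor formula of the other case would give only zeros; the expansion
    with all digits 1 is used instead.\<close>
  case True
  then show ?thesis using power_half_series by (intro exI[of _ "\<lambda>_. 1"]) (simp add: sums_iff)
next
  case False
  then have x: "0 \<le> x" "x < 1" using assms by auto
  define b where "b j = real_of_int (\<lfloor>2 ^ Suc j * x\<rfloor> mod 2)" for j :: nat
  have partial: "(\<Sum>j<n. b j * (1 / 2) ^ Suc j) = real_of_int \<lfloor>2 ^ n * x\<rfloor> / 2 ^ n" for n
  proof (induction n)
    case 0
    have "\<lfloor>x\<rfloor> = 0" using x by (simp add: floor_eq_iff)
    then show ?case by simp
  next
    case (Suc n)
    define y where "y = 2 ^ n * x"
    have "\<lfloor>2 * y\<rfloor> = 2 * \<lfloor>y\<rfloor> \<or> \<lfloor>2 * y\<rfloor> = 2 * \<lfloor>y\<rfloor> + 1" by linarith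
    then have "real_of_int \<lfloor>2 * y\<rfloor> = 2 * real_of_int \<lfloor>y\<rfloor> + real_of_int (\<lfloor>2 * y\<rfloor> mod 2)" by auto
    then show ?case using Suc by (simp add: b_def y_def field_simps)
  qed
  have "(\<lambda>n. real_of_int \<lfloor>2 ^ n * x\<rfloor> / 2 ^ n) \<longlonglongrightarrow> x"
  proof (rule tendsto_sandwich[OF always_eventually always_eventually])
    show "\<forall>n. x - (1 / 2) ^ n \<le> real_of_int \<lfloor>2 ^ n * x\<rfloor> / 2 ^ n"
    proof
      fix n :: nat
      have "2 ^ n * x - 1 \<le> real_of_int \<lfloor>2 ^ n * x\<rfloor>" by linarith
      then have "(2 ^ n * x - 1) / 2 ^ n \<le> real_of_int \<lfloor>2 ^ n * x\<rfloor> / 2 ^ n" by (intro divide_right_mono) auto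
      then show "x - (1 / 2) ^ n \<le> real_of_int \<lfloor>2 ^ n * x\<rfloor> / 2 ^ n" by (simp add: diff_divide_distrib power_one_over)
    qed
    show "\<forall>n. real_of_int \<lfloor>2 ^ n * x\<rfloor> / 2 ^ n \<le> x" by (simp add: field_simps)
    have "(\<lambda>n. x - (1 / 2 :: real) ^ n) \<longlonglongrightarrow> x - 0" by (intro tendsto_intros LIMSEQ_power_zero) auto
    then show "(\<lambda>n. x - (1 / 2 :: real) ^ n) \<longlonglongrightarrow> x" by simp
  qed simp
  then have "(\<lambda>j. b j * (1 / 2) ^ Suc j) sums x" unfolding sums_def partial .
  moreover have "b j \<in> {0, 1}" for j unfolding b_def by auto
  ultimately show ?thesis by (intro exI[of _ b]) (auto simp: sums_iff)
qed

text \<open>Tychonoff's theorem for countably many two-point sets.\<close>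

lemma compact_binary_sequences: "compact {b :: nat \<Rightarrow> real. \<forall>n. b n \<in> {0, 1}}"
proof -
  have "compactin (product_topology (\<lambda>_::nat. euclidean) UNIV) (PiE UNIV (\<lambda>_. {0, 1 :: real}))"
    by (simp add: compactin_PiE)
  also have "PiE UNIV (\<lambda>_. {0, 1 :: real}) = {b. \<forall>n. b n \<in> {0, 1}}" by (auto simp: PiE_def Pi_def)
  finally show ?thesis by (simp add: euclidean_product_topology)
qed

text \<open>The index map \<open>p\<close> lets one statement serve both codings: the identity for
  the ternary series, and a pairing function that selects the digits of one coordinate. Summable
  weights make the partial sums converge uniformly.\<close>

lemma continuous_on_suminf_coordinates:
  fixes w :: "nat \<Rightarrow> real"
  assumes "summable w" "\<And>n. 0 \<le> w n"
  shows "continuous_on {b :: nat \<Rightarrow> real. \<forall>n. b n \<in> {0, 1}} (\<lambda>b. \<Sum>n. b (p n) * w n)"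
proof (rule uniform_limit_theorem)
  show "uniform_limit {b :: nat \<Rightarrow> real. \<forall>n. b n \<in> {0, 1}} (\<lambda>n b. \<Sum>i<n. b (p i) * w i)
     (\<lambda>b. \<Sum>n. b (p n) * w n) sequentially"
  proof (rule Weierstrass_m_test)
    fix n and b :: "nat \<Rightarrow> real" assume "b \<in> {b. \<forall>n. b n \<in> {0, 1}}"
    then have "b (p n) = 0 \<or> b (p n) = 1" by auto
    then show "norm (b (p n) * w n) \<le> w n" using assms(2)[of n] by auto
  qed fact
  show "\<forall>\<^sub>F n in sequentially. continuous_on {b :: nat \<Rightarrow> real. \<forall>n. b n \<in> {0, 1}} (\<lambda>b. \<Sum>i<n. b (p i) * w i)"
    by (intro always_eventually allI continuous_intros continuous_on_product_then_coordinatewise continuous_on_id)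
qed simp

text \<open>At the first differing index \<open>N\<close> the terms differ by
  \<open>(1/3) ^ N\<close>, while all later terms together contribute at most half of that. In base
  2 the later terms could compensate exactly, hence base 3.\<close>

lemma inj_on_ternary: "inj_on (\<lambda>b. \<Sum>n. b n * (1 / 3) ^ n) {b :: nat \<Rightarrow> real. \<forall>n. b n \<in> {0, 1}}"
proof (rule inj_onI, rule ccontr)
  fix b c :: "nat \<Rightarrow> real"
  assume b: "b \<in> {b. \<forall>n. b n \<in> {0, 1}}" and c: "c \<in> {b. \<forall>n. b n \<in> {0, 1}}"
    and eq: "(\<Sum>n. b n * (1 / 3) ^ n) = (\<Sum>n. c n * (1 / 3) ^ n)" and "b \<noteq> c"
  then have "\<exists>n. b n \<noteq> c n" by auto
  then obtain N where N: "b N \<noteq> c N" "\<And>m. m < N \<Longrightarrow> b m = c m"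
    using exists_least_iff[of "\<lambda>n. b n \<noteq> c n"] by blast
  have s: "summable (\<lambda>n. d n * (1 / 3) ^ n)" if "\<And>n. \<bar>d n\<bar> \<le> 1" for d :: "nat \<Rightarrow> real"
    by (rule summable_comparison_test'[OF summable_geometric[of "1/3 :: real"]])
       (use that in \<open>auto simp: abs_mult power_abs intro!: mult_left_le_one_le divide_right_mono\<close>)
  have bc: "\<bar>b n\<bar> \<le> 1" "\<bar>c n\<bar> \<le> 1" "\<bar>b n - c n\<bar> \<le> 1" for n
  proof -
    have "b n = 0 \<or> b n = 1" "c n = 0 \<or> c n = 1" using b c by auto
    then show "\<bar>b n\<bar> \<le> 1" "\<bar>c n\<bar> \<le> 1" "\<bar>b n - c n\<bar> \<le> 1" by auto
  qed
  let ?d = "\<lambda>n. (b n - c n) * (1 / 3) ^ n"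
  have sd: "summable ?d" using s[of "\<lambda>n. b n - c n"] bc by auto
  have "(\<Sum>n. ?d n) = (\<Sum>n. b n * (1 / 3) ^ n) - (\<Sum>n. c n * (1 / 3) ^ n)"
    unfolding left_diff_distrib by (rule suminf_diff[symmetric]; rule s) (use bc in auto)
  then have "0 = (\<Sum>n. ?d n)" using eq by simp
  also have "\<dots> = (\<Sum>n. ?d (n + Suc N)) + (\<Sum>n<Suc N. ?d n)"
    by (rule suminf_split_initial_segment[OF sd])
  also have "(\<Sum>n<Suc N. ?d n) = ?d N" using N(2) by simp
  finally have "\<bar>?d N\<bar> = \<bar>\<Sum>n. ?d (n + Suc N)\<bar>" by linarith
  also have "\<dots> \<le> (\<Sum>n. (1 / 3) ^ Suc N * (1 / 3) ^ n)"
  proof (rule norm_suminf_le[where 'a=real, unfolded real_norm_def])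
    show "\<bar>?d (n + Suc N)\<bar> \<le> (1 / 3) ^ Suc N * (1 / 3) ^ n" for n
    proof -
      have "\<bar>?d (n + Suc N)\<bar> \<le> 1 * (1 / 3) ^ (n + Suc N)"
        unfolding abs_mult using bc(3)[of "n + Suc N"] by (intro mult_mono) (auto simp: power_abs)
      then show ?thesis by (simp add: power_add mult_ac)
    qed
    show "summable (\<lambda>n. (1 / 3) ^ Suc N * (1 / 3 :: real) ^ n)" by (intro summable_mult summable_geometric) auto
  qed
  also have "\<dots> = (1 / 3) ^ Suc N * (3 / 2)"
    by (subst suminf_mult) (auto simp: suminf_geometric intro: summable_geometric)
  also have "\<dots> < (1 / 3) ^ N" by simp
  finally have "\<bar>b N - c N\<bar> * (1 / 3) ^ N < (1 / 3) ^ N" by (simp add: abs_mult power_abs)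
  then have "\<bar>b N - c N\<bar> < 1" by simp
  moreover have "b N = 0 \<or> b N = 1" "c N = 0 \<or> c N = 1" using b c by auto
  ultimately show False using N(1) by auto
qed

text \<open>A Cantor set is mapped onto a cube by distributing the digits of its points over the coordinates.
  Through this map, compactness on \<open>\<real>\<^sup>d\<close> is reduced to Helly's theorem on the line.\<close>

lemma compact_real_onto_cball:
  "\<exists>(C :: real set) (p :: real \<Rightarrow> 'a::euclidean_space). compact C \<and> continuous_on C p \<and> cball 0 1 \<subseteq> p ` C"
proof -
  let ?Z = "{b :: nat \<Rightarrow> real. \<forall>n. b n \<in> {0, 1}}"
  define e where "e b = (\<Sum>n. b n * (1 / 3) ^ n)" for b :: "nat \<Rightarrow> real"
  define x where "x i b = (\<Sum>n. b (prod_encode (to_nat_on (Basis::'a set) i, n)) * (1 / 2) ^ Suc n)"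
    for i :: 'a and b :: "nat \<Rightarrow> real"
  define q where "q b = (\<Sum>i\<in>Basis. (2 * x i b - 1) *\<^sub>R i)" for b :: "nat \<Rightarrow> real"
  have ec: "continuous_on ?Z e"
    unfolding e_def by (rule continuous_on_suminf_coordinates[where p="\<lambda>n. n"]) (auto intro: summable_geometric)
  have "continuous_on ?Z (x i)" for i
    unfolding x_def by (rule continuous_on_suminf_coordinates) (auto intro!: summable_mult summable_geometric)
  then have qc: "continuous_on ?Z q"
    unfolding q_def by (intro continuous_intros)
  have inj: "inj_on e ?Z" unfolding e_def by (rule inj_on_ternary)
  \<comment> \<open>A continuous injection on a compact set has a continuous inverse, so real
    numbers can stand for digit sequences.\<close>
  have ic: "continuous_on (e ` ?Z) (inv_into ?Z e)"
    by (rule continuous_on_inv[OF ec compact_binary_sequences]) (use inv_into_f_f[OF inj] in auto)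
  have "cball 0 1 \<subseteq> q ` ?Z"
  proof
    fix z :: 'a assume z: "z \<in> cball 0 1"
    have "\<exists>b. (\<forall>j. b j \<in> {0, 1}) \<and> (\<Sum>j. b j * (1 / 2) ^ Suc j) = (z \<bullet> i + 1) / 2" if "i \<in> Basis" for i
      using z Basis_le_norm[OF that, of z] by (intro binary_expansion) auto
    then obtain b where b: "\<And>i j. i \<in> Basis \<Longrightarrow> b i j \<in> {0, 1}"
        "\<And>i. i \<in> Basis \<Longrightarrow> (\<Sum>j. b i j * (1 / 2) ^ Suc j) = (z \<bullet> i + 1) / 2"
      by metis
    \<comment> \<open>The digits of all coordinates are interleaved in one sequence through
      \<open>prod_encode\<close>; positions belonging to no basis vector get 0.\<close>
    define B where "B m = (let (k, j) = prod_decode m in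
       if k \<in> to_nat_on (Basis::'a set) ` Basis then b (from_nat_into (Basis::'a set) k) j else 0)" for m
    have B: "B (prod_encode (to_nat_on (Basis::'a set) i, n)) = b i n" if "i \<in> Basis" for i n
      using that by (simp add: B_def countable_finite)
    have "B \<in> ?Z"
      using b(1) by (auto simp: B_def split: prod.splits) (metis countable_finite finite_Basis from_nat_into_to_nat_on insertE singletonD)+
    moreover have "q B = z"
    proof -
      have "2 * x i B - 1 = z \<bullet> i" if "i \<in> Basis" for i
        using b(2)[OF that] by (simp add: x_def B[OF that])
      then have "q B = (\<Sum>i\<in>Basis. (z \<bullet> i) *\<^sub>R i)" unfolding q_def by (intro sum.cong) simp_all
      then show ?thesis by (simp add: euclidean_representation)
    qed
    ultimately show "z \<in> q ` ?Z" by blast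
  qed
  moreover have "(q \<circ> inv_into ?Z e) ` (e ` ?Z) = q ` ?Z"
    unfolding image_image using inv_into_f_f[OF inj] by (intro image_cong) auto
  moreover have "continuous_on (e ` ?Z) (q \<circ> inv_into ?Z e)"
    by (intro continuous_on_compose[OF ic] continuous_on_subset[OF qc]) (use inv_into_f_f[OF inj] in auto)
  moreover have "compact (e ` ?Z)" by (rule compact_continuous_image[OF ec compact_binary_sequences])
  ultimately show ?thesis by (intro exI[of _ "e ` ?Z"] exI[of _ "q \<circ> inv_into ?Z e"]) simp
qed

text \<open>Choosing the least preimage makes the selection measurable: it is at most
  \<open>a\<close> exactly when \<phi> hits the image of \<open>C \<inter> {..a}\<close>, which is
  compact, so sublevel sets are closed. The least preimage exists because the fibres of
  \<open>p\<close> in \<open>C\<close> are closed.\<close>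

lemma compact_real_section:
  fixes p :: "real \<Rightarrow> 'a::euclidean_space" and \<phi> :: "'b::topological_space \<Rightarrow> 'a"
  assumes C: "compact C" "continuous_on C p" and \<phi>: "continuous_on UNIV \<phi>" "range \<phi> \<subseteq> p ` C"
  obtains s where "s \<in> borel_measurable borel" "\<And>k. s k \<in> C" "\<And>k. p (s k) = \<phi> k"
proof
  define s where "s k = Inf {c \<in> C. p c = \<phi> k}" for k
  have s: "s k \<in> {c \<in> C. p c = \<phi> k}" and bd: "bdd_below {c \<in> C. p c = \<phi> k}" for k
  proof -
    show bd: "bdd_below {c \<in> C. p c = \<phi> k}"
      using bounded_imp_bdd_below[OF compact_imp_bounded[OF C(1)]] by (rule bdd_below_mono) auto
    have "closed {c \<in> C. p c = \<phi> k}"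
      using continuous_closedin_preimage_constant[OF C(2), of "\<phi> k"] compact_imp_closed[OF C(1)]
      by (rule closedin_closed_trans)
    moreover have "{c \<in> C. p c = \<phi> k} \<noteq> {}" using \<phi>(2) by (auto simp: image_iff subset_eq) metis
    ultimately show "s k \<in> {c \<in> C. p c = \<phi> k}"
      unfolding s_def by (intro closed_contains_Inf bd)
  qed
  then show "s k \<in> C" "p (s k) = \<phi> k" for k by auto
  show "s \<in> borel_measurable borel"
  proof (rule borel_measurableI_le)
    fix a
    have "{k \<in> space borel. s k \<le> a} = \<phi> -` (p ` (C \<inter> {..a}))"
    proof (intro set_eqI iffI)
      fix k assume "k \<in> \<phi> -` (p ` (C \<inter> {..a}))"
      then obtain c where "c \<in> C" "c \<le> a" "p c = \<phi> k" by auto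
      then have "s k \<le> c" unfolding s_def by (intro cInf_lower bd) auto
      with \<open>c \<le> a\<close> show "k \<in> {k \<in> space borel. s k \<le> a}" by simp
    next
      fix k assume "k \<in> {k \<in> space borel. s k \<le> a}"
      then have "s k \<in> C \<inter> {..a}" "\<phi> k = p (s k)" using s[of k] by auto
      then show "k \<in> \<phi> -` (p ` (C \<inter> {..a}))" by (intro vimageI2) (auto simp del: Int_iff)
    qed
    moreover have "compact (p ` (C \<inter> {..a}))"
      by (intro compact_continuous_image continuous_on_subset[OF C(2)] compact_Int_closed C) auto
    then have "closed (\<phi> -` (p ` (C \<inter> {..a})))"
      using \<phi>(1) by (intro closed_vimage compact_imp_closed)
    ultimately show "{k \<in> space borel. s k \<le> a} \<in> sets borel" by (simp add: borel_closed)
  qed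
qed

text \<open>The map \<open>z /\<^sub>R (1 - norm z)\<close> stretches the open unit ball onto the
  whole space, and approaching the sphere means going to infinity; a function vanishing at infinity
  therefore extends continuously by 0.\<close>

lemma continuous_on_extend_infinity:
  fixes f :: "'a::euclidean_space \<Rightarrow> complex"
  assumes f: "continuous_on UNIV f" and f0: "(f \<longlongrightarrow> 0) at_infinity"
  shows "continuous_on UNIV (\<lambda>z. if norm z < 1 then f (z /\<^sub>R (1 - norm z)) else 0)" (is "continuous_on UNIV ?F")
proof (intro continuous_at_imp_continuous_on ballI)
  fix a :: 'a
  show "isCont ?F a"
  proof (cases "norm a < 1")
    case True
    have "continuous_on (ball 0 1) (\<lambda>z. f (z /\<^sub>R (1 - norm z)))"
      by (intro continuous_on_compose2[OF f] continuous_intros) auto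
    then have "continuous_on (ball 0 1) ?F" by (rule continuous_on_cong[THEN iffD1, rotated -1]) auto
    then show ?thesis using True by (simp add: continuous_on_eq_continuous_at)
  next
    case False
    show ?thesis
      unfolding continuous_at_eps_delta
    proof (intro allI impI)
      fix \<epsilon> :: real assume "0 < \<epsilon>"
      then obtain b where b: "\<And>x. b \<le> norm x \<Longrightarrow> norm (f x) < \<epsilon>"
        using f0 by (force simp: Lim_at_infinity)
      define R where "R = max b 1"
      have R: "0 < R" "b \<le> R" by (auto simp: R_def)
      show "\<exists>d>0. \<forall>x'. dist x' a < d \<longrightarrow> dist (?F x') (?F a) < \<epsilon>"
      \<comment> \<open>A point of the ball with norm above \<open>R / (1 + R)\<close> has stretched
        norm above \<open>R\<close>. As \<open>norm a\<close> is at least 1, this radius forces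
        \<open>norm z\<close> above that threshold.\<close>
      proof (intro exI[of _ "1 - R / (1 + R)"] conjI allI impI)
        show "0 < 1 - R / (1 + R)" using R by (simp add: field_simps)
        fix z assume "dist z a < 1 - R / (1 + R)"
        then have "norm a - norm z < 1 - R / (1 + R)"
          using norm_triangle_ineq3[of z a] by (simp add: dist_norm)
        then have z: "R / (1 + R) < norm z" using False by linarith
        show "dist (?F z) (?F a) < \<epsilon>"
        proof (cases "norm z < 1")
          case True
          have "R \<le> norm z / (1 - norm z)"
            using z True R by (simp add: field_simps)
          also have "\<dots> = norm (z /\<^sub>R (1 - norm z))" using True by (simp add: divide_inverse_commute)
          finally have "norm (f (z /\<^sub>R (1 - norm z))) < \<epsilon>" using R by (intro b) linarith
          then show ?thesis using True False by simp
        qed (use False \<open>0 < \<epsilon>\<close> in simp)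
      qed
    qed
  qed
qed

text \<open>The space is squeezed into the unit ball by \<phi> and lifted to the line by the
  measurable section \<open>s\<close>; there all laws live on the compact set \<open>C\<close>, so
  they are tight and Helly's theorem applies. Mass that the limit puts over the unit sphere has
  escaped to infinity and is dropped from \<nu>; functions vanishing at infinity do not see
  it.\<close>

theorem vague_compactness:
  fixes \<mu> :: "nat \<Rightarrow> 'a::euclidean_space measure"
  assumes fin: "\<And>n. finite_measure (\<mu> n)" and sets: "\<And>n. sets (\<mu> n) = sets borel"
    and mass: "\<And>n. measure (\<mu> n) UNIV \<le> M"
  obtains r \<nu> where "strict_mono r" "finite_measure \<nu>" "sets \<nu> = sets borel"
    "\<And>f :: 'a \<Rightarrow> complex. continuous_on UNIV f \<Longrightarrow> (f \<longlongrightarrow> 0) at_infinity \<Longrightarrow>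
       (\<lambda>n. LINT x|\<mu> (r n). f x) \<longlonglongrightarrow> (LINT x|\<nu>. f x)"
proof -
  obtain C and p :: "real \<Rightarrow> 'a" where C: "compact C" "continuous_on C p" and pC: "cball 0 1 \<subseteq> p ` C"
    using compact_real_onto_cball by blast
  define \<phi> where "\<phi> k = k /\<^sub>R (1 + norm k)" for k :: 'a
  have n1: "1 + norm k \<noteq> 0" for k :: 'a by (metis add_pos_nonneg less_irrefl norm_ge_zero zero_less_one)
  have \<phi>c: "continuous_on UNIV \<phi>" unfolding \<phi>_def by (intro continuous_intros) (use n1 in auto)
  have \<phi>1: "norm (\<phi> k) < 1" for k
  proof -
    have "0 < 1 + norm k" by (metis add_pos_nonneg norm_ge_zero zero_less_one)
    then show ?thesis by (simp add: \<phi>_def field_simps)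
  qed
  have \<phi>inv: "\<phi> k /\<^sub>R (1 - norm (\<phi> k)) = k" for k
  proof -
    have "0 < 1 + norm k" by (metis add_pos_nonneg norm_ge_zero zero_less_one)
    then have "1 - norm (\<phi> k) = inverse (1 + norm k)" by (simp add: \<phi>_def field_simps)
    then show ?thesis using \<open>0 < 1 + norm k\<close> by (simp add: \<phi>_def)
  qed
  have "\<phi> k \<in> p ` C" for k using \<phi>1[of k] pC by (meson less_imp_le mem_cball_0 subsetD)
  then have "range \<phi> \<subseteq> p ` C" by blast
  then obtain s where s [measurable]: "s \<in> borel_measurable borel" and sC: "\<And>k. s k \<in> C" and ps: "\<And>k. p (s k) = \<phi> k"
    using compact_real_section[OF C \<phi>c] by blast
  have Cb [measurable]: "C \<in> sets borel" using C(1) by (simp add: borel_compact)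
  define m where "m n = measure (\<mu> n) UNIV" for n
  have m: "m n \<in> {0..M}" for n using mass by (simp add: m_def)
  \<comment> \<open>The total masses are made convergent first, so that the normalized laws can be
    treated as probability distributions and rescaled by \<open>l\<close> at the end.\<close>
  obtain l q where q: "strict_mono q" "(m \<circ> q) \<longlonglongrightarrow> l"
    using m compact_Icc[of 0 M] unfolding compact_def by (metis (no_types, lifting))
  have l: "0 \<le> l" using m by (intro LIMSEQ_le_const[OF q(2)]) auto
  \<comment> \<open>For mass 0 any law on \<open>C\<close> will do, since it is later multiplied by
    0.\<close>
  define \<rho> where "\<rho> n = (if m n = 0 then return borel (s 0) else distr (density (\<mu> n) (\<lambda>_. 1 / m n)) borel s)" for n
  have sp [simp]: "space (\<mu> n) = UNIV" for n using sets_eq_imp_space_eq[OF sets] by simp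
  note [measurable_cong] = sets
  have \<rho>: "real_distribution (\<rho> n)" for n
  proof (cases "m n = 0")
    case False
    interpret finite_measure "\<mu> n" by (rule fin)
    have "emeasure (density (\<mu> n) (\<lambda>_. ennreal (1 / m n))) UNIV = ennreal (1 / m n) * ennreal (m n)"
      by (simp add: emeasure_density nn_integral_cmult m_def emeasure_eq_measure sets)
    also have "\<dots> = 1" using False m[of n] by (simp flip: ennreal_mult)
    finally have "prob_space (density (\<mu> n) (\<lambda>_. ennreal (1 / m n)))" by (intro prob_spaceI) simp
    then have "prob_space (\<rho> n)" using False unfolding \<rho>_def by (auto intro!: prob_space.prob_space_distr)
    then show ?thesis
      unfolding real_distribution_def real_distribution_axioms_def by (simp add: \<rho>_def)
  qed (auto simp: \<rho>_def real_distribution_def real_distribution_axioms_def prob_space_return)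
  have \<rho>int: "(LINT k|\<mu> n. g (s k)) = m n * (LINT c|\<rho> n. g c)" if [measurable]: "g \<in> borel_measurable borel"
    for g :: "real \<Rightarrow> complex" and n
  proof (cases "m n = 0")
    case True
    interpret finite_measure "\<mu> n" by (rule fin)
    have "emeasure (\<mu> n) (space (\<mu> n)) = 0" using True by (simp add: m_def emeasure_eq_measure)
    then have "AE k in \<mu> n. g (s k) = 0" by (intro AE_I[of _ _ "space (\<mu> n)"]) auto
    then have "(LINT k|\<mu> n. g (s k)) = (LINT k|\<mu> n. 0)" by (intro integral_cong_AE) auto
    then show ?thesis using True by simp
  next
    case False
    then show ?thesis using m[of n]
      by (simp add: \<rho>_def integral_distr integral_density scaleR_conv_of_real)
  qed
  have AE\<rho>: "AE c in \<rho> n. c \<in> C" for n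
  proof (cases "m n = 0")
    case False
    then have eq: "\<rho> n = distr (density (\<mu> n) (\<lambda>_. 1 / m n)) borel s" by (simp add: \<rho>_def)
    show ?thesis
      unfolding eq
      by (subst AE_distr_iff) (use sC Cb in auto)
  next
    case True
    then have eq: "\<rho> n = return borel (s 0)" by (simp add: \<rho>_def)
    show ?thesis
      unfolding eq by (subst AE_return) (use sC Cb in \<open>auto simp: pred_def\<close>)
  qed
  have "tight \<rho>"
    unfolding tight_def
  proof (intro conjI allI impI \<rho>)
    fix \<epsilon> :: real assume "0 < \<epsilon>"
    obtain B where B: "0 < B" "\<And>c. c \<in> C \<Longrightarrow> \<bar>c\<bar> \<le> B"
      using compact_imp_bounded[OF C(1)] unfolding bounded_pos by auto
    show "\<exists>a b. a < b \<and> (\<forall>n. 1 - \<epsilon> < measure (\<rho> n) {a<..b})"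
    proof (rule exI[of _ "- B - 1"], rule exI[of _ B], intro conjI allI)
      fix n
      interpret real_distribution "\<rho> n" by (rule \<rho>)
      have "AE c in \<rho> n. c \<in> {- B - 1<..B}" using AE\<rho>[of n] by eventually_elim (use B(2) in force)
      then have "measure (\<rho> n) {- B - 1<..B} = 1" by (subst prob_eq_1) auto
      then show "1 - \<epsilon> < measure (\<rho> n) {- B - 1<..B}" using \<open>0 < \<epsilon>\<close> by simp
    qed (use B in simp)
  qed
  from tight_imp_convergent_subsubsequence[OF this q(1)]
  obtain r' \<rho>' where r': "strict_mono r'" and \<rho>': "real_distribution \<rho>'" and conv: "weak_conv_m (\<rho> \<circ> q \<circ> r') \<rho>'"
    by blast
  interpret L: real_distribution \<rho>' by (rule \<rho>')
  have lim: "(\<lambda>n. LINT c|\<rho> (q (r' n)). g c) \<longlonglongrightarrow> (LINT c|\<rho>'. g c)"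
    if "continuous_on UNIV g" "\<And>c. norm (g c) \<le> B" for g :: "real \<Rightarrow> complex" and B
    using weak_conv_imp_integral_bdd_continuous_conv[of "\<rho> \<circ> q \<circ> r'" \<rho>' g B] \<rho> \<rho>' conv that
    by (auto simp: continuous_on_eq_continuous_at)
  \<comment> \<open>The limit law inherits concentration on \<open>C\<close>: the capped distance to
    \<open>C\<close> is bounded and continuous and has integral 0 along the sequence.\<close>
  have AE': "AE c in \<rho>'. c \<in> C"
  proof -
    let ?g = "\<lambda>c. min 1 (infdist c C)"
    have Cne: "C \<noteq> {}" using sC by auto
    have g: "0 \<le> ?g c" "?g c \<le> 1" for c by (auto simp: infdist_nonneg)
    have gc: "continuous_on UNIV ?g" by (intro continuous_intros)
    then have [measurable]: "?g \<in> borel_measurable borel" by (rule borel_measurable_continuous_onI)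
    have "(LINT c|\<rho> n. complex_of_real (?g c)) = (LINT c|\<rho> n. 0)" for n
    proof (rule integral_cong_AE)
      interpret real_distribution "\<rho> n" by (rule \<rho>)
      show "(\<lambda>c. complex_of_real (?g c)) \<in> borel_measurable (\<rho> n)" by measurable
      show "AE c in \<rho> n. complex_of_real (?g c) = 0" using AE\<rho>[of n] by eventually_elim simp
    qed simp
    then have "(\<lambda>n. 0) \<longlonglongrightarrow> (LINT c|\<rho>'. complex_of_real (?g c))"
      using lim[of "\<lambda>c. complex_of_real (?g c)" 1] g gc by (simp add: continuous_on_of_real)
    then have "(LINT c|\<rho>'. complex_of_real (?g c)) = 0" using LIMSEQ_unique tendsto_const by blast
    then have "(LINT c|\<rho>'. ?g c) = 0" unfolding integral_complex_of_real by simp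
    moreover have "integrable \<rho>' ?g"
      by (rule L.integrable_const_bound[of _ 1]) (use g in auto)
    ultimately have "AE c in \<rho>'. ?g c = 0" using g by (subst (asm) integral_nonneg_eq_0_iff_AE) auto
    then show ?thesis
      by eventually_elim (use in_closed_iff_infdist_zero[OF compact_imp_closed[OF C(1)] Cne] in \<open>auto simp: min_def split: if_splits\<close>)
  qed
  have [measurable]: "(\<lambda>c. if c \<in> C then p c else 0) \<in> borel_measurable borel"
    by (rule borel_measurable_continuous_on_if[OF Cb C(2)]) auto
  define P where "P c = (if c \<in> C then p c else 0)" for c
  have Pm [measurable]: "P \<in> borel_measurable borel" unfolding P_def by measurable
  define \<psi> where "\<psi> c = P c /\<^sub>R (1 - norm (P c))" for c
  have \<psi>m [measurable]: "\<psi> \<in> borel_measurable borel" unfolding \<psi>_def by measurable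
  \<comment> \<open>The indicator removes the part over the unit sphere, and the factor
    \<open>l\<close> restores the limiting mass.\<close>
  define \<nu> where "\<nu> = distr (density \<rho>' (\<lambda>c. ennreal (l * indicator {..<1} (norm (P c))))) borel \<psi>"
  show thesis
  proof (rule that[of "q \<circ> r'" \<nu>])
    show "strict_mono (q \<circ> r')" using q(1) r' by (rule strict_mono_o)
    show "sets \<nu> = sets borel" by (simp add: \<nu>_def)
    show "finite_measure \<nu>"
    proof (rule finite_measureI)
      have "emeasure \<nu> (space \<nu>) = (\<integral>\<^sup>+c. ennreal (l * indicator {..<1} (norm (P c))) \<partial>\<rho>')"
        by (simp add: \<nu>_def emeasure_distr emeasure_density)
      also have "\<dots> \<le> (\<integral>\<^sup>+c. ennreal l \<partial>\<rho>')"
        using l by (intro nn_integral_mono ennreal_leI) (auto simp: indicator_def)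
      also have "\<dots> < \<infinity>" using L.emeasure_space_1 by simp
      finally show "emeasure \<nu> (space \<nu>) \<noteq> \<infinity>" by simp
    qed
    fix f :: "'a \<Rightarrow> complex" assume f: "continuous_on UNIV f" and f0: "(f \<longlongrightarrow> 0) at_infinity"
    have [measurable]: "f \<in> borel_measurable borel" using f by (rule borel_measurable_continuous_onI)
    define F where "F z = (if norm z < 1 then f (z /\<^sub>R (1 - norm z)) else 0)" for z
    have Fc: "continuous_on UNIV F" unfolding F_def by (rule continuous_on_extend_infinity[OF f f0])
    have Fpc: "continuous_on C (F \<circ> p)"
      using C(2) continuous_on_subset[OF Fc] by (intro continuous_on_compose) auto
    obtain B where B: "0 < B" "\<And>c. c \<in> C \<Longrightarrow> norm ((F \<circ> p) c) \<le> B"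
      using compact_imp_bounded[OF compact_continuous_image[OF Fpc C(1)]] unfolding bounded_pos by auto
    \<comment> \<open>Weak convergence tests continuous functions on the whole line, whereas
      \<open>F \<circ> p\<close> is continuous on \<open>C\<close> only; Tietze's extension keeps
      the bound.\<close>
    obtain g where g: "continuous_on UNIV g" "\<And>c. c \<in> C \<Longrightarrow> g c = (F \<circ> p) c" "\<And>c. norm (g c) \<le> B"
      using Tietze[OF Fpc, of UNIV B] B compact_imp_closed[OF C(1)] by auto
    have [measurable]: "g \<in> borel_measurable borel" using g(1) by (rule borel_measurable_continuous_onI)
    have gs: "g (s k) = f k" for k
      using g(2)[OF sC[of k]] \<phi>1[of k] \<phi>inv[of k] by (simp add: ps F_def)
    have "(\<lambda>n. complex_of_real (m (q (r' n))) * (LINT c|\<rho> (q (r' n)). g c)) \<longlonglongrightarrow> of_real l * (LINT c|\<rho>'. g c)"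
      using LIMSEQ_subseq_LIMSEQ[OF q(2) r'] by (intro tendsto_mult lim[OF g(1,3)] tendsto_of_real) (simp add: comp_def)
    moreover have "(LINT k|\<mu> n. f k) = of_real (m n) * (LINT c|\<rho> n. g c)" for n
      using \<rho>int[of g n] by (simp add: gs)
    moreover have "(LINT k|\<nu>. f k) = of_real l * (LINT c|\<rho>'. g c)"
    proof -
      have "(LINT k|\<nu>. f k) = (LINT c|\<rho>'. (l * indicator {..<1} (norm (P c))) *\<^sub>R f (\<psi> c))"
        unfolding \<nu>_def by (subst integral_distr, simp, simp, subst integral_density) (use l in auto)
      also have "\<dots> = (LINT c|\<rho>'. of_real l * g c)"
      proof (rule integral_cong_AE)
        show "AE c in \<rho>'. (l * indicator {..<1} (norm (P c))) *\<^sub>R f (\<psi> c) = of_real l * g c"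
          using AE' by eventually_elim (auto simp: g(2) F_def P_def \<psi>_def scaleR_conv_of_real)
      qed auto
      finally show ?thesis by simp
    qed
    ultimately show "(\<lambda>n. LINT x|\<mu> ((q \<circ> r') n). f x) \<longlonglongrightarrow> (LINT x|\<nu>. f x)" by simp
  qed
qed

section \<open>Existence of the spectral measure\<close>

lemma gauss_tendsto_0_at_infinity:
  assumes a: "0 < a"
  shows "((\<lambda>k :: 'a::euclidean_space. gauss a k) \<longlongrightarrow> 0) at_infinity"
  unfolding Lim_at_infinity
proof (intro allI impI)
  fix e :: real assume e: "0 < e"
  show "\<exists>b. \<forall>x :: 'a. b \<le> norm x \<longrightarrow> dist (gauss a x) 0 < e"
  \<comment> \<open>From \<open>exp x \<ge> 1 + x\<close> it suffices that the exponent is at least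
    \<open>1 / e\<close>. A norm of at least 1 lies below its square, which turns the bound on the
    norm into one on the exponent.\<close>
  proof (intro exI[of _ "max 1 (2 / (a * e))"] allI impI)
    fix x :: 'a assume x: "max 1 (2 / (a * e)) \<le> norm x"
    then have "norm x * 1 \<le> norm x * norm x" by (intro mult_left_mono) auto
    with x have "2 / (a * e) \<le> (norm x)\<^sup>2" by (simp add: power2_eq_square)
    then have "a / 2 * (2 / (a * e)) \<le> a / 2 * (norm x)\<^sup>2" using a by (intro mult_left_mono) auto
    then have le: "1 / e \<le> a * (norm x)\<^sup>2 / 2" using a by simp
    have "1 / e < exp (a * (norm x)\<^sup>2 / 2)"
      using exp_ge_add_one_self[of "a * (norm x)\<^sup>2 / 2"] le by linarith
    then have "inverse (exp (a * (norm x)\<^sup>2 / 2)) < inverse (1 / e)"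
      using e by (intro less_imp_inverse_less) auto
    then have "gauss a x < e" unfolding gauss_def exp_minus using e by (simp add: inverse_eq_divide)
    then show "dist (gauss a x) 0 < e" by (simp add: dist_real_def)
  qed
qed

lemma tempered_density_bounded:
  fixes \<eta> :: "'a::euclidean_space \<Rightarrow> real"
  assumes [measurable]: "\<eta> \<in> borel_measurable borel" and \<eta>: "\<And>k. \<eta> k \<le> C"
  shows "tempered (density lborel \<eta>)"
  unfolding tempered_def
proof (intro conjI allI impI)
  fix s :: real assume s: "0 < s"
  have "(\<integral>\<^sup>+k. gauss s (k::'a) \<partial>density lborel \<eta>) = (\<integral>\<^sup>+k. ennreal (\<eta> k) * gauss s k \<partial>lborel)"
    by (rule nn_integral_density) auto
  also have "\<dots> \<le> (\<integral>\<^sup>+k. ennreal C * gauss s (k::'a) \<partial>lborel)"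
    using \<eta> by (intro nn_integral_mono mult_right_mono ennreal_leI) auto
  also have "\<dots> < \<infinity>"
    by (subst nn_integral_cmult) (auto simp: nn_integral_gauss s ennreal_mult_less_top)
  finally show "(\<integral>\<^sup>+k. gauss s k \<partial>density lborel \<eta>) < \<infinity>" .
qed simp

text \<open>For finite measures the transform is a function, and where the combination is
  nonnegative it is the density of a measure in duality; this is damped Fourier inversion. The
  factor \<open>c\<close> covers two uses: damped \<alpha> minus \<open>c\<close> times damped
  Lebesgue measure, and \<open>DF\<close> minus \<open>DL\<close> with \<open>c = 1\<close>.\<close>

lemma finite_fourier_dual:
  fixes D1 D2 :: "'a::euclidean_space measure"
  assumes fin: "finite_measure D1" "finite_measure D2" and sets: "sets D1 = sets borel" "sets D2 = sets borel"
    and [measurable]: "\<eta> \<in> borel_measurable borel" and nonneg: "\<And>k. 0 \<le> \<eta> k"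
    and \<eta>: "\<And>k. complex_of_real (\<eta> k) = (LINT x|D1. cis (- (k \<bullet> x))) - of_real c * (LINT x|D2. cis (- (k \<bullet> x)))"
    and t: "0 < t"
  shows "(LINT k|density lborel \<eta>. cis (k \<bullet> y) * of_real (gauss t k)) =
     of_real (sqrt (2 * pi / t) ^ DIM('a) * ((LINT x|D1. gauss (1 / t) (x - y)) - c * (LINT x|D2. gauss (1 / t) (x - y))))"
proof -
  have *: "integrable lborel (\<lambda>k. cis (k \<bullet> y) * of_real (gauss t k) * (LINT x|D. cis (- (k \<bullet> x))))"
    "(LINT k|lborel. cis (k \<bullet> y) * of_real (gauss t k) * (LINT x|D. cis (- (k \<bullet> x)))) =
     of_real (sqrt (2 * pi / t) ^ DIM('a) * (LINT x|D. gauss (1 / t) (x - y)))"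
    if D: "finite_measure D" "sets D = sets borel" for D :: "'a measure"
  proof -
    interpret finite_measure D by fact
    note [measurable_cong] = D(2)
    \<comment> \<open>This is the integrand of \<open>integral_gauss_characteristic\<close>;
      reflecting \<open>k\<close> turns it into the one wanted here.\<close>
    let ?f = "\<lambda>k. cis (- (k \<bullet> y)) * of_real (gauss t k) * (LINT x|D. cis (k \<bullet> x))"
    have [measurable]: "?f \<in> borel_measurable borel" by measurable
    show "integrable lborel (\<lambda>k. cis (k \<bullet> y) * of_real (gauss t k) * (LINT x|D. cis (- (k \<bullet> x))))"
      using integrable_lborel_subst(3)[of ?f 0] integral_gauss_characteristic(2)[OF D t, of y] by simp
    show "(LINT k|lborel. cis (k \<bullet> y) * of_real (gauss t k) * (LINT x|D. cis (- (k \<bullet> x)))) =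
     of_real (sqrt (2 * pi / t) ^ DIM('a) * (LINT x|D. gauss (1 / t) (x - y)))"
      using integral_lborel_subst(3)[of ?f 0] integral_gauss_characteristic(1)[OF D t, of y] by simp
  qed
  have "(LINT k|density lborel \<eta>. cis (k \<bullet> y) * of_real (gauss t k)) =
      (LINT k|lborel. of_real (\<eta> k) * (cis (k \<bullet> y) * of_real (gauss t k)))"
    using nonneg by (subst integral_density) (auto simp: scaleR_conv_of_real)
  also have "\<dots> = (LINT k|lborel. cis (k \<bullet> y) * of_real (gauss t k) * (LINT x|D1. cis (- (k \<bullet> x))) -
      of_real c * (cis (k \<bullet> y) * of_real (gauss t k) * (LINT x|D2. cis (- (k \<bullet> x)))))"
    by (intro Bochner_Integration.integral_cong refl) (simp add: \<eta> algebra_simps)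
  also have "\<dots> = of_real (sqrt (2 * pi / t) ^ DIM('a) * (LINT x|D1. gauss (1 / t) (x - y))) -
      of_real c * of_real (sqrt (2 * pi / t) ^ DIM('a) * (LINT x|D2. gauss (1 / t) (x - y)))"
    by (subst Bochner_Integration.integral_diff) (use *[OF fin(1) sets(1)] *[OF fin(2) sets(2)] in auto)
  finally show ?thesis by (simp add: algebra_simps)
qed

lemma finite_density_gauss:
  assumes "tempered \<alpha>" "0 < \<epsilon>"
  shows "finite_measure (density \<alpha> (gauss \<epsilon>))"
proof (rule finite_measureI)
  have [measurable_cong]: "sets \<alpha> = sets borel" using assms by (simp add: tempered_def)
  have i: "(\<integral>\<^sup>+x. gauss \<epsilon> x \<partial>\<alpha>) < \<infinity>" using assms by (simp add: tempered_def)
  show "emeasure (density \<alpha> (gauss \<epsilon>)) (space (density \<alpha> (gauss \<epsilon>))) \<noteq> \<infinity>"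
    using i by (simp add: emeasure_density less_top cong: nn_integral_cong)
qed

text \<open>A single rate \<open>t\<close> suffices: the Gaussian weights give finite measures with
  equal characteristic functions, and the weight, being strictly positive, can be divided
  out.\<close>

lemma gauss_transform_unique:
  fixes M N :: "'a::euclidean_space measure"
  assumes s: "sets M = sets borel" "sets N = sets borel"
    and i: "(\<integral>\<^sup>+k. gauss t k \<partial>M) < \<infinity>" "(\<integral>\<^sup>+k. gauss t k \<partial>N) < \<infinity>"
    and eq: "\<And>y. (LINT k|M. cis (k \<bullet> y) * of_real (gauss t k)) = (LINT k|N. cis (k \<bullet> y) * of_real (gauss t k))"
  shows "M = N"
proof -
  have *: "finite_measure (density Q (gauss t))" "density (density Q (gauss t)) (\<lambda>k. 1 / gauss t k) = Q"
      "(LINT k|density Q (gauss t). cis (y \<bullet> k)) = (LINT k|Q. cis (k \<bullet> y) * of_real (gauss t k))"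
    if Q: "sets Q = sets borel" "(\<integral>\<^sup>+k. gauss t k \<partial>Q) < \<infinity>" for Q :: "'a measure" and y
  proof -
    note [measurable_cong] = Q(1)
    show "finite_measure (density Q (gauss t))"
      by (rule finite_measureI) (use Q(2) in \<open>simp add: emeasure_density less_top cong: nn_integral_cong\<close>)
    have "density (density Q (gauss t)) (\<lambda>k. 1 / gauss t k) = density Q (\<lambda>k. ennreal (gauss t k) * ennreal (1 / gauss t k))"
      by (rule density_density_eq) auto
    also have "(\<lambda>k::'a. ennreal (gauss t k) * ennreal (1 / gauss t k)) = (\<lambda>_. 1)"
      by (simp add: fun_eq_iff less_imp_neq[OF gauss_pos, symmetric] flip: ennreal_mult)
    finally show "density (density Q (gauss t)) (\<lambda>k. 1 / gauss t k) = Q" by (simp add: density_1)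
    show "(LINT k|density Q (gauss t). cis (y \<bullet> k)) = (LINT k|Q. cis (k \<bullet> y) * of_real (gauss t k))"
      by (subst integral_density) (auto simp: scaleR_conv_of_real inner_commute mult.commute)
  qed
  have "density M (gauss t) = density N (gauss t)"
    by (rule measure_eqI_characteristic) (use * s i eq in auto)
  then show ?thesis using *(2)[OF s(1) i(1)] *(2)[OF s(2) i(2)] by metis
qed

text \<open>Damping by \<open>gauss (\<epsilon> n)\<close> makes both \<alpha> and Lebesgue measure
  finite, and \<open>pos\<close> says that the transform \<open>h n\<close> of the damped difference
  is a density. These densities obey a duality whose right sides converge to the desired ones;
  compactness supplies the limit measure.\<close>

theorem gauss_dual_exists:
  fixes \<alpha> :: "'a::euclidean_space measure"
  assumes \<alpha>: "tempered \<alpha>"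
    and pos: "\<And>\<epsilon> k. 0 < \<epsilon> \<Longrightarrow> \<exists>h\<ge>0. complex_of_real h =
      (LINT x|\<alpha>. cis (- (k \<bullet> x)) * of_real (gauss \<epsilon> x)) - of_real c * (LINT x|lborel. cis (- (k \<bullet> x)) * of_real (gauss \<epsilon> x))"
  shows "\<exists>\<nu>. tempered \<nu> \<and> gauss_dual \<alpha> c \<nu>"
proof -
  have s\<alpha> [measurable_cong]: "sets \<alpha> = sets borel" using \<alpha> by (simp add: tempered_def)
  define \<epsilon> :: "nat \<Rightarrow> real" where "\<epsilon> n = inverse (Suc n)" for n
  have \<epsilon>: "0 < \<epsilon> n" for n by (auto simp: \<epsilon>_def)
  have \<epsilon>0: "\<epsilon> \<longlonglongrightarrow> 0" unfolding \<epsilon>_def by (rule LIMSEQ_inverse_real_of_nat)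
  define A where "A n = density \<alpha> (gauss (\<epsilon> n))" for n
  define A' :: "nat \<Rightarrow> 'a measure" where "A' n = density lborel (gauss (\<epsilon> n))" for n
  have A: "finite_measure (A n)" "finite_measure (A' n)" "sets (A n) = sets borel" "sets (A' n) = sets borel" for n
    unfolding A_def A'_def by (auto intro!: finite_density_gauss \<alpha> tempered_lborel \<epsilon> s\<alpha>)
  have cA: "(LINT x|A n. cis (- (k \<bullet> x))) = (LINT x|\<alpha>. cis (- (k \<bullet> x)) * of_real (gauss (\<epsilon> n) x))"
     "(LINT x|A' n. cis (- (k \<bullet> x))) = (LINT x|lborel. cis (- (k \<bullet> x)) * of_real (gauss (\<epsilon> n) x))" for n k
    unfolding A_def A'_def by (auto simp: integral_density scaleR_conv_of_real mult.commute)
  define h where "h n k = Re ((LINT x|A n. cis (- (k \<bullet> x))) - of_real c * (LINT x|A' n. cis (- (k \<bullet> x))))" for n k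
  have h: "complex_of_real (h n k) = (LINT x|A n. cis (- (k \<bullet> x))) - of_real c * (LINT x|A' n. cis (- (k \<bullet> x)))"
    and h0: "0 \<le> h n k" for n k
  proof -
    obtain h' where h': "0 \<le> h'" "complex_of_real h' =
        (LINT x|A n. cis (- (k \<bullet> x))) - of_real c * (LINT x|A' n. cis (- (k \<bullet> x)))"
      using pos[OF \<epsilon>[of n], of k] unfolding cA by blast
    have "h n k = h'" unfolding h_def h'(2)[symmetric] by simp
    with h' show "complex_of_real (h n k) =
        (LINT x|A n. cis (- (k \<bullet> x))) - of_real c * (LINT x|A' n. cis (- (k \<bullet> x)))" "0 \<le> h n k"
      by simp_all
  qed
  have [measurable]: "h n \<in> borel_measurable borel" for n
  proof -
    interpret X: finite_measure "A n" by (rule A)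
    interpret Y: finite_measure "A' n" by (rule A)
    note [measurable_cong] = A(3,4)[of n]
    show ?thesis unfolding h_def by measurable
  qed
  define Lim where "Lim t y = sqrt (2 * pi / t) ^ DIM('a) *
     ((LINT x|\<alpha>. gauss (1 / t) (x - y)) - c * (LINT x|lborel. gauss (1 / t) (x - y)))" for t and y :: 'a
  define R where "R n t y = sqrt (2 * pi / t) ^ DIM('a) *
     ((LINT x|A n. gauss (1 / t) (x - y)) - c * (LINT x|A' n. gauss (1 / t) (x - y)))" for n t and y :: 'a
  have dual: "(LINT k|density lborel (h n). cis (k \<bullet> y) * of_real (gauss t k)) = of_real (R n t y)" if "0 < t" for n t y
    unfolding R_def by (rule finite_fourier_dual) (use A h h0 that in auto)
  have RLim: "(\<lambda>n. R n t y) \<longlonglongrightarrow> Lim t y" if t: "0 < t" for t y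
  proof -
    have *: "(\<lambda>n. LINT x|density \<beta> (gauss (\<epsilon> n)). gauss (1 / t) (x - y)) \<longlonglongrightarrow> (LINT x|\<beta>. gauss (1 / t) (x - y))"
      if \<beta>: "tempered \<beta>" for \<beta> :: "'a measure"
    proof -
      have [measurable_cong]: "sets \<beta> = sets borel" using \<beta> by (simp add: tempered_def)
      have "(\<lambda>n. LINT x|\<beta>. gauss (\<epsilon> n) x * gauss (1 / t) (x - y)) \<longlonglongrightarrow> (LINT x|\<beta>. 1 * gauss (1 / t) (x - y))"
      proof (rule integral_dominated_convergence)
        show "integrable \<beta> (\<lambda>x. gauss (1 / t) (x - y))" using \<beta> t by (intro integral_gauss_le_bounded) auto
        show "AE x in \<beta>. (\<lambda>n. gauss (\<epsilon> n) x * gauss (1 / t) (x - y)) \<longlonglongrightarrow> 1 * gauss (1 / t) (x - y)"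
        proof (intro AE_I2 tendsto_mult tendsto_const)
          fix x :: 'a
          have "(\<lambda>n. gauss (\<epsilon> n) x) \<longlonglongrightarrow> exp (- (0 * (norm x)\<^sup>2 / 2))"
            unfolding gauss_def by (intro tendsto_intros \<epsilon>0) auto
          then show "(\<lambda>n. gauss (\<epsilon> n) x) \<longlonglongrightarrow> 1" by simp
        qed
        show "AE x in \<beta>. norm (gauss (\<epsilon> n) x * gauss (1 / t) (x - y)) \<le> gauss (1 / t) (x - y)" for n
          using gauss_le_1[where 'a='a, of "\<epsilon> n"] \<epsilon>[of n]
          by (auto simp: abs_mult intro!: mult_left_le_one_le)
        show "(\<lambda>x. 1 * gauss (1 / t) (x - y)) \<in> borel_measurable \<beta>" by measurable
        show "(\<lambda>x. gauss (\<epsilon> n) x * gauss (1 / t) (x - y)) \<in> borel_measurable \<beta>" for n by measurable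
      qed
      moreover have "(LINT x|density \<beta> (gauss (\<epsilon> n)). gauss (1 / t) (x - y)) =
          (LINT x|\<beta>. gauss (\<epsilon> n) x * gauss (1 / t) (x - y))" for n
        by (subst integral_density) auto
      ultimately show ?thesis by simp
    qed
    show ?thesis unfolding R_def Lim_def A_def A'_def
      by (intro tendsto_mult tendsto_diff tendsto_const * \<alpha> tempered_lborel)
  qed
  \<comment> \<open>Compactness asks for bounded mass, so the spectral densities are first weighted
    with \<open>gauss s\<close>. Once the weight is divided out of the limit, the duality is
    available in the range \<open>t > s\<close>.\<close>
  have ex: "\<exists>N :: 'a measure. sets N = sets borel \<and> (\<integral>\<^sup>+k. gauss s k \<partial>N) < \<infinity> \<and>
     (\<forall>t>s. \<forall>y. (LINT k|N. cis (k \<bullet> y) * of_real (gauss t k)) = of_real (Lim t y))" if s: "0 < s" for s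
  proof -
    define \<mu> where "\<mu> n = density lborel (\<lambda>k::'a. ennreal (h n k * gauss s k))" for n
    have bdd: "\<exists>C. \<forall>k. h n k \<le> C" for n
    proof -
      interpret X: finite_measure "A n" by (rule A)
      interpret Y: finite_measure "A' n" by (rule A)
      note [measurable_cong] = A(3,4)[of n]
      have "h n k \<le> measure (A n) (space (A n)) + \<bar>c\<bar> * measure (A' n) (space (A' n))" for k
      proof -
        have "h n k \<le> cmod ((LINT x|A n. cis (- (k \<bullet> x))) - of_real c * (LINT x|A' n. cis (- (k \<bullet> x))))"
          unfolding h_def by (rule complex_Re_le_cmod)
        also have "\<dots> \<le> cmod (LINT x|A n. cis (- (k \<bullet> x))) + \<bar>c\<bar> * cmod (LINT x|A' n. cis (- (k \<bullet> x)))"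
          using norm_triangle_ineq4[of "LINT x|A n. cis (- (k \<bullet> x))" "of_real c * (LINT x|A' n. cis (- (k \<bullet> x)))"]
          by (simp add: norm_mult)
        also have "\<dots> \<le> measure (A n) (space (A n)) + \<bar>c\<bar> * measure (A' n) (space (A' n))"
          using integral_norm_bound[of "A n" "\<lambda>x. cis (- (k \<bullet> x))"] integral_norm_bound[of "A' n" "\<lambda>x. cis (- (k \<bullet> x))"]
          by (intro add_mono mult_left_mono) auto
        finally show ?thesis .
      qed
      then show ?thesis by blast
    qed
    have sm: "sets (\<mu> n) = sets borel" for n by (simp add: \<mu>_def)
    have tn: "tempered (density lborel (h n))" for n
      using bdd[of n] by (auto intro: tempered_density_bounded)
    have \<mu>dens: "\<mu> n = density (density lborel (h n)) (gauss s)" for n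
      unfolding \<mu>_def by (subst density_density_eq) (auto simp: ennreal_mult h0)
    have fm: "finite_measure (\<mu> n)" for n
      unfolding \<mu>dens by (rule finite_density_gauss[OF tn s])
    have \<mu>int: "(LINT k|\<mu> n. f k) = (LINT k|density lborel (h n). f k * of_real (gauss s k))"
      if [measurable]: "f \<in> borel_measurable borel" for f :: "'a \<Rightarrow> complex" and n
      unfolding \<mu>dens by (subst integral_density) (auto simp: scaleR_conv_of_real mult.commute)
    \<comment> \<open>The duality at \<open>y = 0\<close> computes the mass, and convergence of its
      right side bounds it uniformly in \<open>n\<close>.\<close>
    have mass: "measure (\<mu> n) UNIV = R n s 0" for n
    proof -
      interpret finite_measure "\<mu> n" by (rule fm)
      have "complex_of_real (measure (\<mu> n) UNIV) = (LINT k|\<mu> n. 1)" by (simp add: \<mu>_def scaleR_conv_of_real)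
      also have "\<dots> = (LINT k|density lborel (h n). 1 * of_real (gauss s k))" by (rule \<mu>int) simp
      also have "\<dots> = (LINT k|density lborel (h n). cis (k \<bullet> 0) * of_real (gauss s k))" by simp
      also have "\<dots> = of_real (R n s 0)" by (rule dual[OF s])
      finally show ?thesis by (simp only: of_real_eq_iff)
    qed
    have "Bseq (\<lambda>n. R n s 0)" using RLim[OF s] convergentI convergent_imp_Bseq by blast
    then obtain M where M: "\<And>n. R n s 0 \<le> M" by (auto simp: Bseq_def abs_le_iff)
    obtain r \<nu> where r: "strict_mono r" and \<nu>: "finite_measure \<nu>" "sets \<nu> = sets borel"
      and conv: "\<And>f :: 'a \<Rightarrow> complex. continuous_on UNIV f \<Longrightarrow> (f \<longlongrightarrow> 0) at_infinity \<Longrightarrow>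
       (\<lambda>n. LINT x|\<mu> (r n). f x) \<longlonglongrightarrow> (LINT x|\<nu>. f x)"
      using vague_compactness[of \<mu> M] fm sm mass M by metis
    note [measurable_cong] = \<nu>(2)
    interpret finite_measure \<nu> by fact
    have sp: "space \<nu> = UNIV" using sets_eq_imp_space_eq[OF \<nu>(2)] by simp
    \<comment> \<open>The surplus rate \<open>t - s > 0\<close> makes the test function vanish at
      infinity.\<close>
    have lim: "(LINT k|\<nu>. cis (k \<bullet> y) * of_real (gauss (t - s) k)) = of_real (Lim t y)" if t: "s < t" for t y
    proof -
      let ?f = "\<lambda>k. cis (k \<bullet> y) * complex_of_real (gauss (t - s) k)"
      have "(?f \<longlongrightarrow> 0) at_infinity"
        by (rule Lim_null_comparison[OF _ gauss_tendsto_0_at_infinity[of "t - s"]]) (use t in \<open>auto simp: norm_mult\<close>)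
      moreover have "continuous_on UNIV ?f" by (intro continuous_intros)
      ultimately have "(\<lambda>n. LINT k|\<mu> (r n). ?f k) \<longlonglongrightarrow> (LINT k|\<nu>. ?f k)" by (intro conv)
      moreover have "(LINT k|\<mu> n. ?f k) = of_real (R n t y)" for n
      proof -
        have "gauss (t - s) k * gauss s k = gauss t k" for k :: 'a using gauss_add[of "t - s" s k] by simp
        then have e: "?f k * of_real (gauss s k) = cis (k \<bullet> y) * of_real (gauss t k)" for k
          by (simp only: mult.assoc of_real_mult[symmetric])
        have "(LINT k|\<mu> n. ?f k) = (LINT k|density lborel (h n). ?f k * of_real (gauss s k))"
          by (rule \<mu>int) measurable
        also have "\<dots> = of_real (R n t y)" unfolding e using s t by (intro dual) simp
        finally show ?thesis .
      qed
      moreover have "(\<lambda>n. complex_of_real (R (r n) t y)) \<longlonglongrightarrow> of_real (Lim t y)"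
        using LIMSEQ_subseq_LIMSEQ[OF RLim[of t y] r] t s by (intro tendsto_of_real) (simp add: comp_def)
      ultimately show ?thesis by (simp only:) (rule LIMSEQ_unique)
    qed
    have gg': "1 / gauss s k * gauss t k = gauss (t - s) k" for t and k :: 'a
    proof -
      have "gauss t k = gauss (t - s) k * gauss s k" using gauss_add[of "t - s" s k] by simp
      then have "1 / gauss s k * gauss t k = 1 / gauss s k * (gauss (t - s) k * gauss s k)" by (simp only:)
      also have "\<dots> = gauss (t - s) k" by (simp add: less_imp_neq[OF gauss_pos, symmetric])
      finally show ?thesis .
    qed
    show ?thesis
    proof (intro exI[of _ "density \<nu> (\<lambda>k. ennreal (1 / gauss s k))"] conjI allI impI)
      show "sets (density \<nu> (\<lambda>k. ennreal (1 / gauss s k))) = sets borel" by (simp add: \<nu>)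
      have "(\<integral>\<^sup>+k. gauss s k \<partial>density \<nu> (\<lambda>k. ennreal (1 / gauss s k))) = (\<integral>\<^sup>+k. ennreal (1 / gauss s k * gauss s k) \<partial>\<nu>)"
        by (subst nn_integral_density) (auto simp flip: ennreal_mult)
      also have "\<dots> = emeasure \<nu> UNIV" by (simp add: sp less_imp_neq[OF gauss_pos, symmetric])
      also have "\<dots> < \<infinity>" by (simp flip: less_top)
      finally show "(\<integral>\<^sup>+k. gauss s k \<partial>density \<nu> (\<lambda>k. ennreal (1 / gauss s k))) < \<infinity>" .
      fix t y assume t: "s < t"
      have "(LINT k|density \<nu> (\<lambda>k. ennreal (1 / gauss s k)). cis (k \<bullet> y) * of_real (gauss t k)) =
         (LINT k|\<nu>. (1 / gauss s k) *\<^sub>R (cis (k \<bullet> y) * of_real (gauss t k)))"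
        by (rule integral_density) auto
      also have "\<dots> = (LINT k|\<nu>. cis (k \<bullet> y) * of_real (gauss (t - s) k))"
        by (intro Bochner_Integration.integral_cong refl) (simp add: scaleR_conv_of_real gg'[symmetric])
      finally show "(LINT k|density \<nu> (\<lambda>k. ennreal (1 / gauss s k)). cis (k \<bullet> y) * of_real (gauss t k)) = of_real (Lim t y)"
        using lim[OF t] by simp
    qed
  qed
  obtain N :: "'a measure" where N: "sets N = sets borel" "(\<integral>\<^sup>+k. gauss 1 k \<partial>N) < \<infinity>"
     and Nlim: "\<And>t y. 1 < t \<Longrightarrow> (LINT k|N. cis (k \<bullet> y) * of_real (gauss t k)) = of_real (Lim t y)"
    using ex[of 1] by auto
  have le: "(\<integral>\<^sup>+k. gauss t k \<partial>Q) < \<infinity>" if "(\<integral>\<^sup>+k. gauss s k \<partial>Q) < \<infinity>" "s \<le> t" for s t and Q :: "'a measure"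
    using that(1) by (rule le_less_trans[rotated]) (intro nn_integral_mono ennreal_leI gauss_antimono that)
  have small: "(\<integral>\<^sup>+k. gauss s k \<partial>N) < \<infinity> \<and> (\<forall>t>s. \<forall>y. (LINT k|N. cis (k \<bullet> y) * of_real (gauss t k)) = of_real (Lim t y))"
    if s: "0 < s" "s \<le> 1" for s
  proof -
    obtain Q :: "'a measure" where Q: "sets Q = sets borel" "(\<integral>\<^sup>+k. gauss s k \<partial>Q) < \<infinity>"
     and Qlim: "\<And>t y. s < t \<Longrightarrow> (LINT k|Q. cis (k \<bullet> y) * of_real (gauss t k)) = of_real (Lim t y)"
      using ex[OF s(1)] by auto
    \<comment> \<open>The limits found for different \<open>s\<close> are one measure: at rate 2,
      above both 1 and \<open>s\<close>, both transforms are known and equal.\<close>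
    have "N = Q"
    proof (rule gauss_transform_unique[OF N(1) Q(1)])
      show "(\<integral>\<^sup>+k. gauss 2 k \<partial>N) < \<infinity>" by (rule le[OF N(2)]) simp
      show "(\<integral>\<^sup>+k. gauss 2 k \<partial>Q) < \<infinity>" by (rule le[OF Q(2)]) (use s in simp)
      show "(LINT k|N. cis (k \<bullet> y) * of_real (gauss 2 k)) = (LINT k|Q. cis (k \<bullet> y) * of_real (gauss 2 k))" for y
        using Nlim[of 2 y] Qlim[of 2 y] s by simp
    qed
    then show ?thesis using Q(2) Qlim by (simp only:) blast
  qed
  have "tempered N"
    unfolding tempered_def
  proof (intro conjI allI impI N(1))
    fix s :: real assume "0 < s"
    then show "(\<integral>\<^sup>+k. gauss s k \<partial>N) < \<infinity>"
      by (intro le[OF small[THEN conjunct1], of "min s 1"]) auto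
  qed
  moreover have "gauss_dual \<alpha> c N"
    unfolding gauss_dual_def
  proof (intro allI impI)
    fix t :: real and y :: 'a assume t: "0 < t"
    have "(LINT k|N. cis (k \<bullet> y) * of_real (gauss t k)) = of_real (Lim t y)"
      by (rule small[of "min (t / 2) 1", THEN conjunct2, rule_format]) (use t in auto)
    then show "(LINT k|N. cis (k \<bullet> y) * of_real (gauss t k)) = of_real (sqrt (2 * pi / t) ^ DIM('a) *
       ((LINT x|\<alpha>. gauss (1 / t) (x - y)) - c * (LINT x|lborel. gauss (1 / t) (x - y))))"
      unfolding Lim_def .
  qed
  ultimately show ?thesis by blast
qed

section \<open>Mixtures of measures\<close>

text \<open>The averaged measure, with its sigma-field prescribed by \<open>N\<close>. The values of
  \<kappa> may have infinite mass, and \<open>P\<close> may be a counting measure, as in the double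
  sum over atoms in \<open>second_moment\<close>.\<close>

definition mixture :: "'w measure \<Rightarrow> ('w \<Rightarrow> 'b measure) \<Rightarrow> 'b measure \<Rightarrow> 'b measure" where
  "mixture P \<kappa> N = measure_of (space N) (sets N) (\<lambda>A. \<integral>\<^sup>+\<omega>. emeasure (\<kappa> \<omega>) A \<partial>P)"

lemma sets_mixture [simp]: "sets (mixture P \<kappa> N) = sets N"
  and space_mixture [simp]: "space (mixture P \<kappa> N) = space N"
  by (simp_all add: mixture_def)

lemma measurable_mixture [simp]: "measurable (mixture P \<kappa> N) L = measurable N L"
  by (rule measurable_cong_sets) simp_all

lemma measurable_nn_integral_kernel:
  assumes \<kappa>: "\<And>\<omega>. \<omega> \<in> space P \<Longrightarrow> sets (\<kappa> \<omega>) = sets N"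
    and meas: "\<And>A. A \<in> sets N \<Longrightarrow> (\<lambda>\<omega>. emeasure (\<kappa> \<omega>) A) \<in> borel_measurable P"
    and f: "f \<in> borel_measurable N"
  shows "(\<lambda>\<omega>. \<integral>\<^sup>+x. f x \<partial>\<kappa> \<omega>) \<in> borel_measurable P"
proof -
  have m: "g \<in> borel_measurable (\<kappa> \<omega>)" if "\<omega> \<in> space P" "g \<in> borel_measurable N" for g :: "_ \<Rightarrow> ennreal" and \<omega>
    using that measurable_cong_sets[OF \<kappa>[OF that(1)] refl] by blast
  show ?thesis
  using f
proof induct
  case (cong f g)
  have "(\<integral>\<^sup>+x. f x \<partial>\<kappa> \<omega>) = (\<integral>\<^sup>+x. g x \<partial>\<kappa> \<omega>)" if "\<omega> \<in> space P" for \<omega>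
    using sets_eq_imp_space_eq[OF \<kappa>[OF that]] cong(3) by (intro nn_integral_cong) simp
  then show ?case using cong(4) by (simp cong: measurable_cong)
next
  case (set A)
  have "(\<integral>\<^sup>+x. indicator A x \<partial>\<kappa> \<omega>) = emeasure (\<kappa> \<omega>) A" if "\<omega> \<in> space P" for \<omega>
    using set \<kappa>[OF that] by simp
  then show ?case using meas[OF set] by (simp cong: measurable_cong)
next
  case (mult u c)
  have "(\<integral>\<^sup>+x. c * u x \<partial>\<kappa> \<omega>) = c * (\<integral>\<^sup>+x. u x \<partial>\<kappa> \<omega>)" if "\<omega> \<in> space P" for \<omega>
    using mult that by (intro nn_integral_cmult m)
  then show ?case using mult by (simp cong: measurable_cong)
next
  case (add u v)
  have "(\<integral>\<^sup>+x. v x + u x \<partial>\<kappa> \<omega>) = (\<integral>\<^sup>+x. v x \<partial>\<kappa> \<omega>) + (\<integral>\<^sup>+x. u x \<partial>\<kappa> \<omega>)" if "\<omega> \<in> space P" for \<omega>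
    using add that by (intro nn_integral_add m)
  then show ?case using add by (simp cong: measurable_cong)
next
  case (seq U)
  have "(\<integral>\<^sup>+x. (SUP i. U i) x \<partial>\<kappa> \<omega>) = (SUP i. \<integral>\<^sup>+x. U i x \<partial>\<kappa> \<omega>)" if "\<omega> \<in> space P" for \<omega>
    unfolding SUP_apply using seq that
    by (intro nn_integral_monotone_convergence_SUP m)
  then show ?case using seq by (simp cong: measurable_cong)
qed
qed

lemma emeasure_mixture:
  assumes \<kappa>: "\<And>\<omega>. \<omega> \<in> space P \<Longrightarrow> sets (\<kappa> \<omega>) = sets N"
    and meas: "\<And>A. A \<in> sets N \<Longrightarrow> (\<lambda>\<omega>. emeasure (\<kappa> \<omega>) A) \<in> borel_measurable P"
    and A: "A \<in> sets N"
  shows "emeasure (mixture P \<kappa> N) A = (\<integral>\<^sup>+\<omega>. emeasure (\<kappa> \<omega>) A \<partial>P)"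
  unfolding mixture_def
proof (rule emeasure_measure_of_sigma)
  show "sigma_algebra (space N) (sets N)" by (rule sets.sigma_algebra_axioms)
  show "positive (sets N) (\<lambda>A. \<integral>\<^sup>+\<omega>. emeasure (\<kappa> \<omega>) A \<partial>P)" by (simp add: positive_def)
  show "countably_additive (sets N) (\<lambda>A. \<integral>\<^sup>+\<omega>. emeasure (\<kappa> \<omega>) A \<partial>P)"
  proof (rule countably_additiveI)
    fix A :: "nat \<Rightarrow> _" assume A: "range A \<subseteq> sets N" "disjoint_family A"
    have "(\<Sum>i. \<integral>\<^sup>+\<omega>. emeasure (\<kappa> \<omega>) (A i) \<partial>P) = (\<integral>\<^sup>+\<omega>. (\<Sum>i. emeasure (\<kappa> \<omega>) (A i)) \<partial>P)"
      using A by (intro nn_integral_suminf[symmetric] meas) auto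
    also have "\<dots> = (\<integral>\<^sup>+\<omega>. emeasure (\<kappa> \<omega>) (\<Union>i. A i) \<partial>P)"
      using A \<kappa> by (intro nn_integral_cong suminf_emeasure) auto
    finally show "(\<Sum>i. \<integral>\<^sup>+\<omega>. emeasure (\<kappa> \<omega>) (A i) \<partial>P) = (\<integral>\<^sup>+\<omega>. emeasure (\<kappa> \<omega>) (\<Union>i. A i) \<partial>P)" .
  qed
qed fact

lemma nn_integral_mixture:
  assumes \<kappa>: "\<And>\<omega>. \<omega> \<in> space P \<Longrightarrow> sets (\<kappa> \<omega>) = sets N"
    and meas: "\<And>A. A \<in> sets N \<Longrightarrow> (\<lambda>\<omega>. emeasure (\<kappa> \<omega>) A) \<in> borel_measurable P"
    and f: "f \<in> borel_measurable N"
  shows "(\<integral>\<^sup>+x. f x \<partial>mixture P \<kappa> N) = (\<integral>\<^sup>+\<omega>. \<integral>\<^sup>+x. f x \<partial>\<kappa> \<omega> \<partial>P)"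
proof -
  have m: "g \<in> borel_measurable (\<kappa> \<omega>)" if "\<omega> \<in> space P" "g \<in> borel_measurable N" for g :: "_ \<Rightarrow> ennreal" and \<omega>
    using that measurable_cong_sets[OF \<kappa>[OF that(1)] refl] by blast
  show ?thesis
  using f
proof induct
  note ker = measurable_nn_integral_kernel[of P \<kappa>, OF \<kappa> meas]
  case (cong f g)
  have "(\<integral>\<^sup>+\<omega>. \<integral>\<^sup>+x. f x \<partial>\<kappa> \<omega> \<partial>P) = (\<integral>\<^sup>+\<omega>. \<integral>\<^sup>+x. g x \<partial>\<kappa> \<omega> \<partial>P)"
    using sets_eq_imp_space_eq[OF \<kappa>] cong(3) by (intro nn_integral_cong) simp
  moreover have "(\<integral>\<^sup>+x. f x \<partial>mixture P \<kappa> N) = (\<integral>\<^sup>+x. g x \<partial>mixture P \<kappa> N)"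
    using cong(3) by (intro nn_integral_cong) simp
  ultimately show ?case using cong(4) by simp
next
  case (set A)
  have "(\<integral>\<^sup>+\<omega>. \<integral>\<^sup>+x. indicator A x \<partial>\<kappa> \<omega> \<partial>P) = (\<integral>\<^sup>+\<omega>. emeasure (\<kappa> \<omega>) A \<partial>P)"
    using set \<kappa> by (intro nn_integral_cong) simp
  then show ?case using set emeasure_mixture[of P \<kappa> N, OF \<kappa> meas set] by simp
next
  note ker = measurable_nn_integral_kernel[of P \<kappa>, OF \<kappa> meas]
  case (mult u c)
  have "(\<integral>\<^sup>+\<omega>. \<integral>\<^sup>+x. c * u x \<partial>\<kappa> \<omega> \<partial>P) = (\<integral>\<^sup>+\<omega>. c * (\<integral>\<^sup>+x. u x \<partial>\<kappa> \<omega>) \<partial>P)"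
    using mult by (intro nn_integral_cong nn_integral_cmult m)
  also have "\<dots> = c * (\<integral>\<^sup>+\<omega>. \<integral>\<^sup>+x. u x \<partial>\<kappa> \<omega> \<partial>P)"
    by (intro nn_integral_cmult ker mult)
  finally show ?case using mult by (subst nn_integral_cmult) auto
next
  note ker = measurable_nn_integral_kernel[of P \<kappa>, OF \<kappa> meas]
  case (add u v)
  have "(\<integral>\<^sup>+\<omega>. \<integral>\<^sup>+x. v x + u x \<partial>\<kappa> \<omega> \<partial>P) = (\<integral>\<^sup>+\<omega>. (\<integral>\<^sup>+x. v x \<partial>\<kappa> \<omega>) + (\<integral>\<^sup>+x. u x \<partial>\<kappa> \<omega>) \<partial>P)"
    using add by (intro nn_integral_cong nn_integral_add m)
  also have "\<dots> = (\<integral>\<^sup>+\<omega>. \<integral>\<^sup>+x. v x \<partial>\<kappa> \<omega> \<partial>P) + (\<integral>\<^sup>+\<omega>. \<integral>\<^sup>+x. u x \<partial>\<kappa> \<omega> \<partial>P)"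
    by (intro nn_integral_add ker add)
  finally show ?case using add by (subst nn_integral_add) auto
next
  note ker = measurable_nn_integral_kernel[of P \<kappa>, OF \<kappa> meas]
  case (seq U)
  have "(\<integral>\<^sup>+\<omega>. \<integral>\<^sup>+x. (SUP i. U i) x \<partial>\<kappa> \<omega> \<partial>P) = (\<integral>\<^sup>+\<omega>. (SUP i. \<integral>\<^sup>+x. U i x \<partial>\<kappa> \<omega>) \<partial>P)"
    unfolding SUP_apply using seq
    by (intro nn_integral_cong nn_integral_monotone_convergence_SUP m)
  also have "\<dots> = (SUP i. \<integral>\<^sup>+\<omega>. \<integral>\<^sup>+x. U i x \<partial>\<kappa> \<omega> \<partial>P)"
  proof (rule nn_integral_monotone_convergence_SUP)
    show "incseq (\<lambda>i \<omega>. \<integral>\<^sup>+x. U i x \<partial>\<kappa> \<omega>)"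
      using incseqD[OF seq(4)] by (auto simp: incseq_def le_fun_def intro!: nn_integral_mono)
  qed (intro ker seq)
  also have "\<dots> = (SUP i. \<integral>\<^sup>+x. U i x \<partial>mixture P \<kappa> N)" using seq by simp
  also have "\<dots> = (\<integral>\<^sup>+x. (SUP i. U i) x \<partial>mixture P \<kappa> N)"
    unfolding SUP_apply using seq
    by (intro nn_integral_monotone_convergence_SUP[symmetric]) auto
  finally show ?case ..
qed
qed

text \<open>The hypothesis says that two weighted mixtures agree on every set of \<open>N\<close>,
  hence as measures, even infinite ones, and so on every nonnegative function. It turns conditional
  laws of events into conditional expectations of functions of a random kernel.\<close>

lemma nn_integral_kernel_eqI:
  assumes \<kappa>: "\<And>\<omega>. \<omega> \<in> space P \<Longrightarrow> sets (\<kappa> \<omega>) = sets N" "\<And>\<omega>. \<omega> \<in> space P \<Longrightarrow> sets (\<kappa>' \<omega>) = sets N"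
    and meas: "\<And>A. A \<in> sets N \<Longrightarrow> (\<lambda>\<omega>. emeasure (\<kappa> \<omega>) A) \<in> borel_measurable P"
      "\<And>A. A \<in> sets N \<Longrightarrow> (\<lambda>\<omega>. emeasure (\<kappa>' \<omega>) A) \<in> borel_measurable P"
    and U [measurable]: "U \<in> borel_measurable P" "V \<in> borel_measurable P"
    and eq: "\<And>A. A \<in> sets N \<Longrightarrow> (\<integral>\<^sup>+\<omega>. U \<omega> * emeasure (\<kappa> \<omega>) A \<partial>P) = (\<integral>\<^sup>+\<omega>. V \<omega> * emeasure (\<kappa>' \<omega>) A \<partial>P)"
    and f: "f \<in> borel_measurable N"
  shows "(\<integral>\<^sup>+\<omega>. U \<omega> * (\<integral>\<^sup>+x. f x \<partial>\<kappa> \<omega>) \<partial>P) = (\<integral>\<^sup>+\<omega>. V \<omega> * (\<integral>\<^sup>+x. f x \<partial>\<kappa>' \<omega>) \<partial>P)"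
proof -
  note [measurable] = meas
  have eqm: "mixture (density P U) \<kappa> N = mixture (density P V) \<kappa>' N"
  proof (rule measure_eqI)
    fix A assume "A \<in> sets (mixture (density P U) \<kappa> N)"
    then have A: "A \<in> sets N" by simp
    have "emeasure (mixture (density P U) \<kappa> N) A = (\<integral>\<^sup>+\<omega>. U \<omega> * emeasure (\<kappa> \<omega>) A \<partial>P)"
      using \<kappa>(1) A by (subst emeasure_mixture) (auto simp: nn_integral_density)
    also have "\<dots> = (\<integral>\<^sup>+\<omega>. V \<omega> * emeasure (\<kappa>' \<omega>) A \<partial>P)" by (rule eq[OF A])
    also have "\<dots> = emeasure (mixture (density P V) \<kappa>' N) A"
      using \<kappa>(2) A by (subst emeasure_mixture) (auto simp: nn_integral_density)
    finally show "emeasure (mixture (density P U) \<kappa> N) A = emeasure (mixture (density P V) \<kappa>' N) A" .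
  qed simp
  have "(\<integral>\<^sup>+\<omega>. U \<omega> * (\<integral>\<^sup>+x. f x \<partial>\<kappa> \<omega>) \<partial>P) = (\<integral>\<^sup>+x. f x \<partial>mixture (density P U) \<kappa> N)"
    using \<kappa> meas f measurable_nn_integral_kernel[of P \<kappa> N f]
    by (subst nn_integral_mixture) (auto simp: nn_integral_density)
  also have "\<dots> = (\<integral>\<^sup>+\<omega>. V \<omega> * (\<integral>\<^sup>+x. f x \<partial>\<kappa>' \<omega>) \<partial>P)"
    unfolding eqm using \<kappa> meas f measurable_nn_integral_kernel[of P \<kappa>' N f]
    by (subst nn_integral_mixture) (auto simp: nn_integral_density)
  finally show ?thesis .
qed

section \<open>The space of locally finite measures\<close>

lemma space_lf_measures: "space lf_measures = {\<mu>. locally_finite_measure \<mu>}"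
  by (auto simp: lf_measures_def space_Sup_eq_UN)

lemma measurable_emeasure_lf [measurable]:
  "B \<in> sets borel \<Longrightarrow> (\<lambda>\<mu>. emeasure \<mu> B) \<in> borel_measurable lf_measures"
  by (auto intro!: measurable_Sup1 measurable_vimage_algebra1 simp: lf_measures_def)

lemma measurable_lfI:
  assumes "\<And>x. x \<in> space M \<Longrightarrow> locally_finite_measure (\<kappa> x)"
    and "\<And>B. B \<in> sets borel \<Longrightarrow> (\<lambda>x. emeasure (\<kappa> x) B) \<in> borel_measurable M"
  shows "\<kappa> \<in> M \<rightarrow>\<^sub>M lf_measures"
  using assms by (auto intro!: measurable_Sup2 measurable_vimage_algebra2 simp: lf_measures_def)

lemma measurable_lfD:
  assumes "\<kappa> \<in> M \<rightarrow>\<^sub>M lf_measures"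
  shows "x \<in> space M \<Longrightarrow> locally_finite_measure (\<kappa> x)"
    and "x \<in> space M \<Longrightarrow> sets (\<kappa> x) = sets borel" and "x \<in> space M \<Longrightarrow> space (\<kappa> x) = UNIV"
    and "B \<in> sets borel \<Longrightarrow> (\<lambda>x. emeasure (\<kappa> x) B) \<in> borel_measurable M"
proof -
  show 1: "x \<in> space M \<Longrightarrow> locally_finite_measure (\<kappa> x)"
    using measurable_space[OF assms] by (simp add: space_lf_measures)
  then show 2: "x \<in> space M \<Longrightarrow> sets (\<kappa> x) = sets borel" by (simp add: locally_finite_measure_def)
  then show "x \<in> space M \<Longrightarrow> space (\<kappa> x) = UNIV" using sets_eq_imp_space_eq[of "\<kappa> x" borel] by simp
  show "B \<in> sets borel \<Longrightarrow> (\<lambda>x. emeasure (\<kappa> x) B) \<in> borel_measurable M"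
    using measurable_compose[OF assms measurable_emeasure_lf] .
qed

text \<open>Restricting to the ball of radius \<open>n\<close> and dividing by 1 plus its mass gives
  sub-probability kernels, for which measurability is standard; the added 1 avoids division by zero.
  The original integral is the supremum over \<open>n\<close>.\<close>

lemma measurable_nn_integral_lf:
  fixes \<kappa> :: "'m \<Rightarrow> 'b::euclidean_space measure"
  assumes \<kappa>: "\<kappa> \<in> M \<rightarrow>\<^sub>M lf_measures" and f [measurable]: "(\<lambda>(x, y). f x y) \<in> borel_measurable (M \<Otimes>\<^sub>M borel)"
  shows "(\<lambda>x. \<integral>\<^sup>+y. f x y \<partial>\<kappa> x) \<in> borel_measurable M"
proof -
  let ?B = "\<lambda>n::nat. cball (0::'b) (real n)"
  have [measurable]: "?B n \<in> sets borel" for n by (intro borel_closed closed_cball)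
  define c where "c n x = emeasure (\<kappa> x) (?B n)" for n x
  have [measurable]: "c n \<in> borel_measurable M" for n unfolding c_def by (rule measurable_lfD(4)[OF \<kappa>]) simp
  have cfin: "c n x < \<infinity>" if "x \<in> space M" for n x
    using measurable_lfD(1)[OF \<kappa> that] by (auto simp: c_def locally_finite_measure_def)
  define \<kappa>' where "\<kappa>' n x = density (\<kappa> x) (\<lambda>y. indicator (?B n) y / (1 + c n x))" for n x
  have em: "emeasure (\<kappa>' n x) A = emeasure (\<kappa> x) (A \<inter> ?B n) / (1 + c n x)" if "x \<in> space M" "A \<in> sets borel" for n x A
  proof -
    have [measurable_cong]: "sets (\<kappa> x) = sets borel" by (rule measurable_lfD(2)[OF \<kappa> that(1)])
    have "emeasure (\<kappa>' n x) A = (\<integral>\<^sup>+y. indicator (A \<inter> ?B n) y * (1 / (1 + c n x)) \<partial>\<kappa> x)"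
      unfolding \<kappa>'_def using that by (subst emeasure_density) (auto intro!: nn_integral_cong simp: indicator_def divide_ennreal_def)
    also have "\<dots> = emeasure (\<kappa> x) (A \<inter> ?B n) * (1 / (1 + c n x))"
      using that by (subst nn_integral_multc) auto
    finally show ?thesis by (simp add: divide_ennreal_def)
  qed
  have \<kappa>'[measurable]: "\<kappa>' n \<in> M \<rightarrow>\<^sub>M subprob_algebra borel" for n
  proof (rule measurable_subprob_algebra)
    fix x assume x: "x \<in> space M"
    show "sets (\<kappa>' n x) = sets borel" using measurable_lfD(2)[OF \<kappa> x] by (simp add: \<kappa>'_def)
    then have sp: "space (\<kappa>' n x) = UNIV" using sets_eq_imp_space_eq[of "\<kappa>' n x" borel] by simp
    have "emeasure (\<kappa>' n x) UNIV = c n x / (1 + c n x)" using em[OF x, of UNIV n] by (simp add: c_def)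
    also have "\<dots> \<le> 1"
      using cfin[OF x, of n] by (intro divide_le_posI_ennreal) (auto simp: add_pos_nonneg)
    finally show "subprob_space (\<kappa>' n x)" using sp by (intro subprob_spaceI) auto
  next
    fix A :: "'b set" assume A [measurable]: "A \<in> sets borel"
    have [measurable]: "(\<lambda>x. emeasure (\<kappa> x) (A \<inter> ?B n)) \<in> borel_measurable M"
      by (rule measurable_lfD(4)[OF \<kappa>]) simp
    have "(\<lambda>x. emeasure (\<kappa> x) (A \<inter> ?B n) / (1 + c n x)) \<in> borel_measurable M" by measurable
    then show "(\<lambda>x. emeasure (\<kappa>' n x) A) \<in> borel_measurable M"
      using em A by (simp cong: measurable_cong)
  qed
  have "(\<integral>\<^sup>+y. f x y \<partial>\<kappa> x) = (SUP n. (1 + c n x) * (\<integral>\<^sup>+y. f x y \<partial>\<kappa>' n x))" if x: "x \<in> space M" for x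
  proof -
    have [measurable_cong]: "sets (\<kappa> x) = sets borel" by (rule measurable_lfD(2)[OF \<kappa> x])
    have [measurable]: "f x \<in> borel_measurable borel" using measurable_Pair2[OF f x] by simp
    have *: "(1 + c n x) * (\<integral>\<^sup>+y. f x y \<partial>\<kappa>' n x) = (\<integral>\<^sup>+y. f x y * indicator (?B n) y \<partial>\<kappa> x)" for n
    proof -
      have c0: "1 + c n x \<noteq> 0" "1 + c n x \<noteq> \<top>" using cfin[OF x, of n] by (auto simp: less_top add_pos_nonneg)
      have "(1 + c n x) * (\<integral>\<^sup>+y. f x y \<partial>\<kappa>' n x) = (\<integral>\<^sup>+y. (1 + c n x) * (indicator (?B n) y / (1 + c n x) * f x y) \<partial>\<kappa> x)"
        unfolding \<kappa>'_def by (subst nn_integral_density) (auto simp: nn_integral_cmult)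
      also have "\<dots> = (\<integral>\<^sup>+y. f x y * indicator (?B n) y \<partial>\<kappa> x)"
      proof (intro nn_integral_cong)
        fix y
        have "(1 + c n x) * (1 / (1 + c n x)) = 1"
          unfolding ennreal_times_divide mult_1_right by (rule ennreal_divide_self[OF c0(1) top.not_eq_extremum[THEN iffD1, OF c0(2)]])
        then have e: "((1 + c n x) * (1 / (1 + c n x))) * f x y = f x y" by (simp only: mult_1_left)
        show "(1 + c n x) * (indicator (?B n) y / (1 + c n x) * f x y) = f x y * indicator (?B n) y"
        proof (cases "y \<in> ?B n")
          case True
          then show ?thesis using e by (simp only: indicator_simps mult.assoc mult_1_right)
        qed simp
      qed
      finally show ?thesis .
    qed
    have "(\<integral>\<^sup>+y. f x y \<partial>\<kappa> x) = (\<integral>\<^sup>+y. (SUP n. f x y * indicator (?B n) y) \<partial>\<kappa> x)"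
    proof (intro nn_integral_cong)
      fix y :: 'b
      obtain n where "norm y \<le> real n" using real_arch_simple by blast
      then have "f x y = f x y * indicator (?B n) y" by simp
      then have "f x y \<le> (SUP n. f x y * indicator (?B n) y)" by (metis SUP_upper UNIV_I)
      moreover have "(SUP n. f x y * indicator (?B n) y) \<le> f x y"
        by (intro SUP_least) (auto simp: indicator_def)
      ultimately show "f x y = (SUP n. f x y * indicator (?B n) y)" by (rule antisym)
    qed
    also have "\<dots> = (SUP n. \<integral>\<^sup>+y. f x y * indicator (?B n) y \<partial>\<kappa> x)"
      by (intro nn_integral_monotone_convergence_SUP) (auto simp: incseq_def le_fun_def indicator_def)
    finally show ?thesis using * by simp
  qed
  moreover have "(\<lambda>x. SUP n. (1 + c n x) * (\<integral>\<^sup>+y. f x y \<partial>\<kappa>' n x)) \<in> borel_measurable M"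
  proof -
    have "(\<lambda>x. \<integral>\<^sup>+y. f x y \<partial>\<kappa>' n x) \<in> borel_measurable M" for n
      by (rule nn_integral_measurable_subprob_algebra2[OF f \<kappa>'])
    then show ?thesis by measurable
  qed
  ultimately show ?thesis by (simp cong: measurable_cong)
qed

lemma locally_finite_distr:
  fixes \<mu> :: "'b::euclidean_space measure" and h :: "'b \<Rightarrow> 'c::metric_space"
  assumes "locally_finite_measure \<mu>" "h \<in> borel_measurable borel" "\<And>B. bounded B \<Longrightarrow> bounded (h -` B)"
  shows "locally_finite_measure (distr \<mu> borel h)"
  unfolding locally_finite_measure_def
proof (intro conjI ballI impI)
  have s: "sets \<mu> = sets borel" and sp: "space \<mu> = UNIV"
    using assms sets_eq_imp_space_eq[of \<mu> borel] by (auto simp: locally_finite_measure_def)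
  have h: "h \<in> \<mu> \<rightarrow>\<^sub>M borel" using assms(2) measurable_cong_sets[OF s refl] by blast
  fix B :: "'c set" assume B: "B \<in> sets borel" "bounded B"
  have "h -` B \<in> sets borel" using measurable_sets[OF assms(2) B(1)] by simp
  then show "emeasure (distr \<mu> borel h) B < \<infinity>"
    using assms(1) B assms(3)[OF B(2)] h by (simp add: emeasure_distr sp locally_finite_measure_def)
qed simp

section \<open>Shifts\<close>

lemma measurable_fst_borel [measurable]:
    "fst \<in> (borel :: ('a::second_countable_topology \<times> 'b::second_countable_topology) measure) \<rightarrow>\<^sub>M borel"
  and measurable_snd_borel [measurable]:
    "snd \<in> (borel :: ('a::second_countable_topology \<times> 'b::second_countable_topology) measure) \<rightarrow>\<^sub>M borel"
  unfolding borel_prod[symmetric] by measurable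

lemma bounded_diag_shift_vimage:
  fixes B :: "('a::real_normed_vector \<times> 'a) set"
  assumes "bounded B"
  shows "bounded ((\<lambda>(y, z). (y - x, z - x)) -` B)"
proof -
  have "(\<lambda>(y, z). (y - x, z - x)) -` B \<subseteq> (\<lambda>p. p + (x, x)) ` B"
    by (auto simp: image_iff) (metis add_Pair diff_add_cancel)
  moreover have "bounded ((\<lambda>p. p + (x, x)) ` B)"
    using bounded_translation[OF assms, of "(x, x)"] by (simp add: add.commute)
  ultimately show ?thesis by (rule bounded_subset[rotated])
qed

lemma borel_measurable_diag_shift:
  "(\<lambda>(y, z). (y - x, z - x)) \<in> borel \<rightarrow>\<^sub>M (borel :: ('a::euclidean_space \<times> 'a) measure)"
  unfolding borel_prod[symmetric] by measurable

lemma diag_shift_locally_finite: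
  "locally_finite_measure \<mu> \<Longrightarrow> locally_finite_measure (diag_shift x \<mu>)"
  unfolding diag_shift_def
  by (rule locally_finite_distr) (auto intro: bounded_diag_shift_vimage borel_measurable_diag_shift)

lemma sets_diag_shift [simp]: "sets (diag_shift x \<mu>) = sets borel"
  and space_diag_shift [simp]: "space (diag_shift x \<mu>) = UNIV"
  by (simp_all add: diag_shift_def)

lemma nn_integral_diag_shift:
  assumes \<mu>: "sets \<mu> = sets borel" and f: "f \<in> borel_measurable borel"
  shows "(\<integral>\<^sup>+p. f p \<partial>diag_shift x \<mu>) = (\<integral>\<^sup>+p. f (fst p - x, snd p - x) \<partial>\<mu>)"
proof -
  have "(\<lambda>(y, z). (y - x, z - x)) \<in> \<mu> \<rightarrow>\<^sub>M borel"
    using borel_measurable_diag_shift measurable_cong_sets[OF \<mu> refl] by blast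
  then show ?thesis
    unfolding diag_shift_def by (subst nn_integral_distr) (use f in \<open>simp_all add: case_prod_beta'\<close>)
qed

lemma diag_shift_measurable [measurable]:
  "(\<lambda>(x, \<mu>). diag_shift (x::'a::euclidean_space) \<mu>) \<in> borel \<Otimes>\<^sub>M lf_measures \<rightarrow>\<^sub>M lf_measures"
proof (rule measurable_lfI)
  fix B :: "('a \<times> 'a) set" assume B [measurable]: "B \<in> sets borel"
  have [measurable]: "B \<in> sets (borel \<Otimes>\<^sub>M borel)" using B unfolding borel_prod[symmetric] .
  have snd: "snd \<in> (borel :: 'a measure) \<Otimes>\<^sub>M lf_measures \<rightarrow>\<^sub>M lf_measures" by measurable
  have "(\<lambda>z. \<integral>\<^sup>+p. indicator B (fst p - fst z, snd p - fst z) \<partial>snd z)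
      \<in> borel_measurable ((borel :: 'a measure) \<Otimes>\<^sub>M (lf_measures :: ('a \<times> 'a) measure measure))"
    by (rule measurable_nn_integral_lf[OF snd]) (unfold borel_prod[symmetric], measurable)
  moreover have "emeasure (case z of (x, \<mu>) \<Rightarrow> diag_shift x \<mu>) B = (\<integral>\<^sup>+p. indicator B (fst p - fst z, snd p - fst z) \<partial>snd z)"
    if "z \<in> space ((borel :: 'a measure) \<Otimes>\<^sub>M (lf_measures :: ('a \<times> 'a) measure measure))" for z
  proof -
    have "sets (snd z) = sets borel"
      using that by (auto simp: space_pair_measure space_lf_measures locally_finite_measure_def)
    then have "(\<integral>\<^sup>+p. indicator B p \<partial>diag_shift (fst z) (snd z)) = (\<integral>\<^sup>+p. indicator B (fst p - fst z, snd p - fst z) \<partial>snd z)"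
      by (rule nn_integral_diag_shift) measurable
    then show ?thesis by (simp add: case_prod_beta')
  qed
  ultimately show "(\<lambda>z. emeasure (case z of (x, \<mu>) \<Rightarrow> diag_shift x \<mu>) B)
      \<in> borel_measurable ((borel :: 'a measure) \<Otimes>\<^sub>M (lf_measures :: ('a \<times> 'a) measure measure))"
    by (simp cong: measurable_cong)
qed (auto simp: space_pair_measure space_lf_measures diag_shift_locally_finite)

lemma diag_shift_diag_shift:
  assumes "sets \<mu> = sets borel"
  shows "diag_shift x (diag_shift y \<mu>) = diag_shift (x + y) (\<mu> :: ('a::euclidean_space \<times> 'a) measure)"
proof -
  have m: "(\<lambda>(z, w). (z - y, w - y)) \<in> \<mu> \<rightarrow>\<^sub>M borel"
    using borel_measurable_diag_shift measurable_cong_sets[OF assms refl] by blast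
  show ?thesis
    unfolding diag_shift_def
    by (subst distr_distr[OF borel_measurable_diag_shift m])
       (simp add: comp_def case_prod_beta' diff_diff_eq add.commute)
qed

lemma sets_first_marginal [simp]: "sets (first_marginal \<mu>) = sets borel"
  and space_first_marginal [simp]: "space (first_marginal \<mu>) = UNIV"
  by (simp_all add: first_marginal_def)

lemma nn_integral_first_marginal:
  fixes \<mu> :: "('a::euclidean_space \<times> 'a) measure"
  assumes \<mu>: "sets \<mu> = sets borel" and f: "f \<in> borel_measurable borel"
  shows "(\<integral>\<^sup>+x. f x \<partial>first_marginal \<mu>) = (\<integral>\<^sup>+p. f (fst p) \<partial>\<mu>)"
proof -
  have "fst \<in> \<mu> \<rightarrow>\<^sub>M borel" using measurable_fst_borel measurable_cong_sets[OF \<mu> refl] by blast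
  then show ?thesis unfolding first_marginal_def by (subst nn_integral_distr) (use f in auto)
qed

lemma nn_integral_first_marginal_diag_shift:
  fixes \<mu> :: "('a::euclidean_space \<times> 'a) measure"
  assumes \<mu>: "sets \<mu> = sets borel" and f [measurable]: "f \<in> borel_measurable borel"
  shows "(\<integral>\<^sup>+z. f z \<partial>first_marginal (diag_shift x \<mu>)) = (\<integral>\<^sup>+z. f (z - x) \<partial>first_marginal \<mu>)"
proof -
  have 1: "(\<lambda>p. f (fst p)) \<in> borel_measurable (borel :: ('a \<times> 'a) measure)"
    using measurable_compose[OF measurable_fst_borel f] .
  have 2: "(\<lambda>z. f (z - x)) \<in> borel_measurable borel" by measurable
  show ?thesis
    by (simp add: nn_integral_first_marginal[OF _ f] nn_integral_first_marginal[OF \<mu> 2] nn_integral_diag_shift[OF \<mu> 1])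
qed

lemma emeasure_first_marginal_diag_shift:
  fixes \<mu> :: "('a::euclidean_space \<times> 'a) measure"
  assumes \<mu>: "sets \<mu> = sets borel"
  shows "emeasure (first_marginal (diag_shift x \<mu>)) {0} = emeasure (first_marginal \<mu>) {x}"
proof -
  have "emeasure (first_marginal (diag_shift x \<mu>)) {0} = (\<integral>\<^sup>+z. indicator {0} z \<partial>first_marginal (diag_shift x \<mu>))"
    by simp
  also have "\<dots> = (\<integral>\<^sup>+z. indicator {0} (z - x) \<partial>first_marginal \<mu>)"
    by (rule nn_integral_first_marginal_diag_shift[OF \<mu>]) simp
  also have "\<dots> = (\<integral>\<^sup>+z. indicator {x} z \<partial>first_marginal \<mu>)"
    by (intro nn_integral_cong) (auto simp: indicator_def)
  finally show ?thesis by simp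
qed

text \<open>Local finiteness of the marginal is assumed separately, since a strip over a bounded set
  is unbounded and may carry infinite mass.\<close>

lemma first_marginal_measurable:
  fixes \<kappa> :: "'m \<Rightarrow> ('a::euclidean_space \<times> 'a) measure"
  assumes \<kappa>: "\<kappa> \<in> M \<rightarrow>\<^sub>M lf_measures" and lf: "\<And>x. x \<in> space M \<Longrightarrow> locally_finite_measure (first_marginal (\<kappa> x))"
  shows "(\<lambda>x. first_marginal (\<kappa> x)) \<in> M \<rightarrow>\<^sub>M lf_measures"
proof (rule measurable_lfI[OF lf])
  fix B :: "'a set" assume B: "B \<in> sets borel"
  then have "B \<times> UNIV \<in> sets (borel :: ('a \<times> 'a) measure)" unfolding borel_prod[symmetric] by measurable
  moreover have "emeasure (first_marginal (\<kappa> x)) B = emeasure (\<kappa> x) (B \<times> UNIV)" if "x \<in> space M" for x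
  proof -
    have "fst \<in> \<kappa> x \<rightarrow>\<^sub>M borel"
      using measurable_fst_borel measurable_cong_sets[OF measurable_lfD(2)[OF \<kappa> that] refl] by blast
    then show ?thesis
      unfolding first_marginal_def using B measurable_lfD(3)[OF \<kappa> that]
      by (subst emeasure_distr) (auto intro!: arg_cong2[where f=emeasure])
  qed
  ultimately show "(\<lambda>x. emeasure (first_marginal (\<kappa> x)) B) \<in> borel_measurable M"
    using measurable_lfD(4)[OF \<kappa>] by (simp cong: measurable_cong)
qed

section \<open>Shift-invariant measures on a product\<close>

lemma unit_cube_sets [measurable]: "unit_cube \<in> sets borel"
  unfolding unit_cube_def by (rule borel_closed[OF closed_cbox])

lemma nn_integral_unit_cube:
  "(\<integral>\<^sup>+y. indicator unit_cube (x - y :: 'a::euclidean_space) \<partial>lborel) = (1 :: ennreal)"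
proof -
  have "(\<integral>\<^sup>+y. indicator unit_cube (x - y) \<partial>lborel) = (\<integral>\<^sup>+y. indicator unit_cube (y::'a) \<partial>lborel :: ennreal)"
    using nn_integral_lborel_subst(3)[of "indicator unit_cube" x] borel_measurable_indicator[OF unit_cube_sets] by blast
  also have "\<dots> = 1" by (simp add: unit_cube_def emeasure_lborel_cbox_eq)
  finally show ?thesis .
qed

text \<open>The integral of \<open>indicator unit_cube (x - y)\<close> over \<open>y\<close> is 1
  and can be inserted. After exchanging integrals, invariance moves the shift by \<open>y\<close>
  from the cube to the argument of \<open>u\<close>. So the measure is Lebesgue measure times the
  mark distribution found over the unit cube.\<close>

theorem nn_integral_shift_invariant:
  fixes M :: "('a::euclidean_space \<times> 's) measure"
  assumes "sigma_finite_measure M" and sets: "sets M = sets (borel \<Otimes>\<^sub>M S)"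
    and inv: "\<And>z. distr M (borel \<Otimes>\<^sub>M S) (\<lambda>(x, s). (x + z, s)) = M"
    and u [measurable]: "u \<in> borel_measurable (borel \<Otimes>\<^sub>M S)"
  shows "(\<integral>\<^sup>+p. u p \<partial>M) = (\<integral>\<^sup>+p. indicator unit_cube (fst p) * (\<integral>\<^sup>+z. u (z, snd p) \<partial>lborel) \<partial>M)"
proof -
  interpret M: sigma_finite_measure M by fact
  interpret pair_sigma_finite lborel M ..
  have sm: "sets (lborel \<Otimes>\<^sub>M M) = sets (borel \<Otimes>\<^sub>M (borel \<Otimes>\<^sub>M S))"
    by (intro sets_pair_measure_cong) (auto simp: sets)
  note m = measurable_cong_sets[OF sm refl, THEN equalityD2, THEN subsetD]
  note m' = measurable_cong_sets[OF sets refl, THEN equalityD2, THEN subsetD]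
  have "(\<integral>\<^sup>+p. indicator unit_cube (fst p) * (\<integral>\<^sup>+z. u (z, snd p) \<partial>lborel) \<partial>M) =
     (\<integral>\<^sup>+p. \<integral>\<^sup>+y. indicator unit_cube (fst p) * u (fst p + y, snd p) \<partial>lborel \<partial>M)"
  proof (intro nn_integral_cong)
    fix p assume "p \<in> space M"
    then have "p \<in> space (borel \<Otimes>\<^sub>M S)" using sets_eq_imp_space_eq[OF sets] by blast
    then have p: "snd p \<in> space S" by (simp add: space_pair_measure mem_Times_iff)
    then have [measurable]: "(\<lambda>z. u (z, snd p)) \<in> borel_measurable borel"
      by (rule measurable_Pair1[OF u])
    have "(\<integral>\<^sup>+z. u (z, snd p) \<partial>lborel) = (\<integral>\<^sup>+y. u (y + fst p, snd p) \<partial>lborel)"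
      by (rule nn_integral_lborel_subst(1)[symmetric, of "\<lambda>z. u (z, snd p)" "fst p"]) fact
    then show "indicator unit_cube (fst p) * (\<integral>\<^sup>+z. u (z, snd p) \<partial>lborel) =
        (\<integral>\<^sup>+y. indicator unit_cube (fst p) * u (fst p + y, snd p) \<partial>lborel)"
      by (subst nn_integral_cmult) (auto simp: add.commute)
  qed
  also have "\<dots> = (\<integral>\<^sup>+y. \<integral>\<^sup>+p. indicator unit_cube (fst p) * u (fst p + y, snd p) \<partial>M \<partial>lborel)"
    by (rule Fubini', rule m) measurable
  also have "\<dots> = (\<integral>\<^sup>+y. \<integral>\<^sup>+p. indicator unit_cube (fst p - y) * u p \<partial>M \<partial>lborel)"
  proof (rule nn_integral_cong)
    fix y :: 'a
    have "(\<integral>\<^sup>+p. indicator unit_cube (fst p - y) * u p \<partial>M) =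
       (\<integral>\<^sup>+p. indicator unit_cube (fst p - y) * u p \<partial>distr M (borel \<Otimes>\<^sub>M S) (\<lambda>(x, s). (x + y, s)))"
      by (simp add: inv)
    also have "\<dots> = (\<integral>\<^sup>+p. indicator unit_cube (fst p) * u (fst p + y, snd p) \<partial>M)"
      by (subst nn_integral_distr, rule m') (measurable, simp add: case_prod_beta')
    finally show "(\<integral>\<^sup>+p. indicator unit_cube (fst p) * u (fst p + y, snd p) \<partial>M) =
      (\<integral>\<^sup>+p. indicator unit_cube (fst p - y) * u p \<partial>M)" ..
  qed
  also have "\<dots> = (\<integral>\<^sup>+p. \<integral>\<^sup>+y. indicator unit_cube (fst p - y) * u p \<partial>lborel \<partial>M)"
    by (rule Fubini'[symmetric], rule m) measurable
  also have "\<dots> = (\<integral>\<^sup>+p. u p \<partial>M)"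
    by (subst nn_integral_multc) (auto simp: nn_integral_unit_cube)
  finally show ?thesis ..
qed

section \<open>Palm calculus\<close>

text \<open>Cubes anchored at a countable dense set cover the space: a dense point in the open box
  between \<open>x - One\<close> and \<open>x\<close> anchors a cube containing
  \<open>x\<close>.\<close>

lemma sigma_finite_unit_cubes:
  fixes M :: "('a::euclidean_space \<times> 's) measure"
  assumes sets: "sets M = sets (borel \<Otimes>\<^sub>M S)"
    and fin: "\<And>z. emeasure M (cbox z (z + One) \<times> space S) < \<infinity>"
  shows "sigma_finite_measure M"
proof
  obtain D :: "'a set" where D: "countable D" "\<And>X. open X \<Longrightarrow> X \<noteq> {} \<Longrightarrow> \<exists>d\<in>D. d \<in> X"
    using countable_dense_setE by blast
  show "\<exists>A. countable A \<and> A \<subseteq> sets M \<and> \<Union>A = space M \<and> (\<forall>a\<in>A. emeasure M a \<noteq> \<infinity>)"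
  proof (intro exI conjI ballI)
    let ?A = "(\<lambda>z. cbox z (z + One) \<times> space S) ` D"
    show "countable ?A" using D(1) by simp
    show "?A \<subseteq> sets M" unfolding sets by (auto intro!: pair_measureI)
    show "\<Union>?A = space M"
    proof -
      have "\<exists>z\<in>D. x \<in> cbox z (z + One)" for x :: 'a
      proof -
        have "box (x - One) x \<noteq> {}" by (simp add: box_ne_empty inner_diff_left)
        then obtain z where z: "z \<in> D" "z \<in> box (x - One) x" using D(2)[OF open_box] by blast
        then have "x \<in> cbox z (z + One)" by (force simp: mem_box inner_diff_left inner_add_left)
        with z show ?thesis by blast
      qed
      then show ?thesis using sets_eq_imp_space_eq[OF sets] by (auto simp: space_pair_measure)
    qed
    show "emeasure M a \<noteq> \<infinity>" if "a \<in> ?A" for a using that fin by (auto simp: less_top)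
  qed
qed

section \<open>Stationary transports and their re-centred Campbell measure\<close>

locale transport = prob_space P for P :: "'w measure" +
  fixes T :: "'w \<Rightarrow> ('a::euclidean_space \<times> 'a) measure"
  assumes stationary: "stationary_transport P T"
begin

abbreviation \<Phi> :: "'w \<Rightarrow> 'a measure" where "\<Phi> \<omega> \<equiv> first_marginal (T \<omega>)"

lemma T_measurable [measurable]: "T \<in> P \<rightarrow>\<^sub>M lf_measures"
  using stationary by (simp add: stationary_transport_def random_transport_def random_measure_def)

lemma \<Phi>_locally_finite: "\<omega> \<in> space P \<Longrightarrow> locally_finite_measure (\<Phi> \<omega>)"
  using stationary by (simp add: stationary_transport_def random_transport_def)

lemma \<Phi>_measurable [measurable]: "\<Phi> \<in> P \<rightarrow>\<^sub>M lf_measures"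
  by (rule first_marginal_measurable[OF T_measurable \<Phi>_locally_finite])

lemma sets_T: "\<omega> \<in> space P \<Longrightarrow> sets (T \<omega>) = sets borel"
  by (rule measurable_lfD(2)[OF T_measurable])

lemma diag_shift_T_measurable [measurable]: "(\<lambda>\<omega>. diag_shift x (T \<omega>)) \<in> P \<rightarrow>\<^sub>M lf_measures"
proof -
  have "(\<lambda>\<omega>. (x, T \<omega>)) \<in> P \<rightarrow>\<^sub>M borel \<Otimes>\<^sub>M lf_measures" by measurable
  from measurable_compose[OF this diag_shift_measurable] show ?thesis by simp
qed

lemma diag_shift_T_measurable2 [measurable]:
  "(\<lambda>(\<omega>, x). diag_shift x (T \<omega>)) \<in> P \<Otimes>\<^sub>M borel \<rightarrow>\<^sub>M lf_measures"
proof -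
  have "(\<lambda>(\<omega>, x). (x, T \<omega>)) \<in> P \<Otimes>\<^sub>M borel \<rightarrow>\<^sub>M borel \<Otimes>\<^sub>M lf_measures" by measurable
  from measurable_compose[OF this diag_shift_measurable] show ?thesis by (simp add: case_prod_beta')
qed

lemma nn_integral_stationary:
  assumes V: "V \<in> borel_measurable lf_measures"
  shows "(\<integral>\<^sup>+\<omega>. V (diag_shift x (T \<omega>)) \<partial>P) = (\<integral>\<^sup>+\<omega>. V (T \<omega>) \<partial>P)"
proof -
  have "(\<integral>\<^sup>+\<omega>. V (diag_shift x (T \<omega>)) \<partial>P) = (\<integral>\<^sup>+\<mu>. V \<mu> \<partial>distr P lf_measures (\<lambda>\<omega>. diag_shift x (T \<omega>)))"
    using V by (subst nn_integral_distr) auto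
  also have "\<dots> = (\<integral>\<^sup>+\<mu>. V \<mu> \<partial>distr P lf_measures T)"
    using stationary by (simp add: stationary_transport_def)
  also have "\<dots> = (\<integral>\<^sup>+\<omega>. V (T \<omega>) \<partial>P)"
    using V by (subst nn_integral_distr) auto
  finally show ?thesis .
qed

lemma measurable_nn_integral_\<Phi>:
  assumes "(\<lambda>(\<omega>, x). f \<omega> x) \<in> borel_measurable (P \<Otimes>\<^sub>M borel)"
  shows "(\<lambda>\<omega>. \<integral>\<^sup>+x. f \<omega> x \<partial>\<Phi> \<omega>) \<in> borel_measurable P"
  by (rule measurable_nn_integral_lf[OF \<Phi>_measurable assms])

text \<open>The Campbell measure of a point of \<Phi> together with the transport seen from it.
  Recording the re-centred transport instead of \<open>T\<close> makes stationarity an invariance in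
  the first coordinate alone.\<close>

definition pointed :: "('a \<times> ('a \<times> 'a) measure) measure" where
  "pointed = mixture P (\<lambda>\<omega>. distr (\<Phi> \<omega>) (borel \<Otimes>\<^sub>M lf_measures) (\<lambda>x. (x, diag_shift x (T \<omega>)))) (borel \<Otimes>\<^sub>M lf_measures)"

lemma pair_diag_shift_measurable:
  "\<omega> \<in> space P \<Longrightarrow> (\<lambda>x. (x, diag_shift x (T \<omega>))) \<in> \<Phi> \<omega> \<rightarrow>\<^sub>M borel \<Otimes>\<^sub>M lf_measures"
proof -
  assume \<omega>: "\<omega> \<in> space P"
  have "(\<lambda>x. diag_shift x (T \<omega>)) \<in> borel \<rightarrow>\<^sub>M lf_measures"
    using measurable_Pair2[OF diag_shift_T_measurable2 \<omega>] by simp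
  then have "(\<lambda>x. (x, diag_shift x (T \<omega>))) \<in> borel \<rightarrow>\<^sub>M borel \<Otimes>\<^sub>M lf_measures" by measurable
  then show ?thesis by (simp add: measurable_cong_sets[OF sets_first_marginal refl])
qed

lemma pointed_kernel_measurable:
  assumes u: "u \<in> borel_measurable (borel \<Otimes>\<^sub>M lf_measures)"
  shows "(\<lambda>\<omega>. \<integral>\<^sup>+x. u (x, diag_shift x (T \<omega>)) \<partial>\<Phi> \<omega>) \<in> borel_measurable P"
proof (rule measurable_nn_integral_\<Phi>)
  have "(\<lambda>(\<omega>, x). (x, diag_shift x (T \<omega>))) \<in> P \<Otimes>\<^sub>M borel \<rightarrow>\<^sub>M borel \<Otimes>\<^sub>M lf_measures" by measurable
  from measurable_compose[OF this u]
  show "(\<lambda>(\<omega>, x). u (x, diag_shift x (T \<omega>))) \<in> borel_measurable (P \<Otimes>\<^sub>M borel)" by (simp add: case_prod_beta')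
qed

lemma emeasure_pointed_kernel_measurable:
  assumes A: "A \<in> sets (borel \<Otimes>\<^sub>M lf_measures)"
  shows "(\<lambda>\<omega>. emeasure (distr (\<Phi> \<omega>) (borel \<Otimes>\<^sub>M lf_measures) (\<lambda>x. (x, diag_shift x (T \<omega>)))) A) \<in> borel_measurable P"
proof -
  have "emeasure (distr (\<Phi> \<omega>) (borel \<Otimes>\<^sub>M lf_measures) (\<lambda>x. (x, diag_shift x (T \<omega>)))) A =
     (\<integral>\<^sup>+x. indicator A (x, diag_shift x (T \<omega>)) \<partial>\<Phi> \<omega>)" if "\<omega> \<in> space P" for \<omega>
    using nn_integral_distr[OF pair_diag_shift_measurable[OF that], of "indicator A"] A by simp
  then show ?thesis using pointed_kernel_measurable[of "indicator A"] A by (simp cong: measurable_cong)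
qed

lemma nn_integral_pointed:
  assumes u: "u \<in> borel_measurable (borel \<Otimes>\<^sub>M lf_measures)"
  shows "(\<integral>\<^sup>+p. u p \<partial>pointed) = (\<integral>\<^sup>+\<omega>. \<integral>\<^sup>+x. u (x, diag_shift x (T \<omega>)) \<partial>\<Phi> \<omega> \<partial>P)"
  unfolding pointed_def
  by (subst nn_integral_mixture)
     (auto intro!: emeasure_pointed_kernel_measurable u nn_integral_cong nn_integral_distr pair_diag_shift_measurable)

lemma sets_pointed [simp]: "sets pointed = sets (borel \<Otimes>\<^sub>M lf_measures)"
  by (simp add: pointed_def)

text \<open>Moving the point by \<open>z\<close> without changing the transport seen from it amounts
  to shifting \<open>T\<close> by \<open>- z\<close>, which preserves the law. The auxiliary
  \<open>V\<close> writes the inner integral as a function of \<open>T\<close> alone, so that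
  stationarity can be applied.\<close>

lemma distr_pointed: "distr pointed (borel \<Otimes>\<^sub>M lf_measures) (\<lambda>(x, s). (x + z, s)) = pointed"
proof (rule measure_eqI)
  fix A assume "A \<in> sets (distr pointed (borel \<Otimes>\<^sub>M lf_measures) (\<lambda>(x, s). (x + z, s)))"
  then have A [measurable]: "A \<in> sets (borel \<Otimes>\<^sub>M lf_measures)" by simp
  define V where "V \<mu> = (\<integral>\<^sup>+p. indicator A (fst p, diag_shift (fst p) \<mu>) \<partial>\<mu>)" for \<mu> :: "('a \<times> 'a) measure"
  have [measurable]: "V \<in> borel_measurable lf_measures"
    unfolding V_def
  proof (rule measurable_nn_integral_lf)
    have "(\<lambda>(\<mu>, p). (fst p :: 'a, \<mu>)) \<in> (lf_measures :: ('a \<times> 'a) measure measure) \<Otimes>\<^sub>M (borel :: ('a \<times> 'a) measure) \<rightarrow>\<^sub>M borel \<Otimes>\<^sub>M lf_measures"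
      by measurable
    from measurable_compose[OF this diag_shift_measurable]
    have [measurable]: "(\<lambda>(\<mu>, p). diag_shift (fst p :: 'a) \<mu>) \<in> lf_measures \<Otimes>\<^sub>M (borel :: ('a \<times> 'a) measure) \<rightarrow>\<^sub>M lf_measures"
      by (simp add: case_prod_beta')
    have "(\<lambda>(\<mu>, p). (fst p :: 'a, diag_shift (fst p) \<mu>)) \<in> lf_measures \<Otimes>\<^sub>M (borel :: ('a \<times> 'a) measure) \<rightarrow>\<^sub>M borel \<Otimes>\<^sub>M lf_measures"
      by measurable
    from measurable_compose[OF this borel_measurable_indicator[OF A]]
    show "(\<lambda>(\<mu>, p). indicator A (fst p :: 'a, diag_shift (fst p) \<mu>) :: ennreal) \<in> borel_measurable (lf_measures \<Otimes>\<^sub>M (borel :: ('a \<times> 'a) measure))"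
      by (simp add: case_prod_beta')
  qed simp
  have mA: "(\<lambda>x. indicator A (x + c, diag_shift (x + d) \<mu>)) \<in> borel_measurable (borel :: 'a measure)"
    if \<mu>: "\<mu> \<in> space lf_measures" for \<mu> c d
  proof -
    have "(\<lambda>x. (x + d, \<mu>)) \<in> borel \<rightarrow>\<^sub>M borel \<Otimes>\<^sub>M lf_measures" using \<mu> by measurable
    from measurable_compose[OF this diag_shift_measurable]
    have [measurable]: "(\<lambda>x. diag_shift (x + d) \<mu>) \<in> borel \<rightarrow>\<^sub>M lf_measures" by simp
    show ?thesis by measurable
  qed
  have "emeasure pointed A = (\<integral>\<^sup>+p. indicator A p \<partial>pointed)" by simp
  also have "\<dots> = (\<integral>\<^sup>+\<omega>. \<integral>\<^sup>+x. indicator A (x, diag_shift x (T \<omega>)) \<partial>\<Phi> \<omega> \<partial>P)"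
    by (rule nn_integral_pointed) measurable
  also have "\<dots> = (\<integral>\<^sup>+\<omega>. V (T \<omega>) \<partial>P)"
  proof (rule nn_integral_cong)
    fix \<omega> assume \<omega>: "\<omega> \<in> space P"
    then show "(\<integral>\<^sup>+x. indicator A (x, diag_shift x (T \<omega>)) \<partial>\<Phi> \<omega>) = V (T \<omega>)"
      unfolding V_def using mA[of "T \<omega>" 0 0] measurable_space[OF T_measurable \<omega>]
      by (intro nn_integral_first_marginal sets_T) simp_all
  qed
  also have "\<dots> = (\<integral>\<^sup>+\<omega>. V (diag_shift (- z) (T \<omega>)) \<partial>P)"
    by (rule nn_integral_stationary[symmetric]) measurable
  also have "\<dots> = (\<integral>\<^sup>+\<omega>. \<integral>\<^sup>+x. indicator A (x + z, diag_shift x (T \<omega>)) \<partial>\<Phi> \<omega> \<partial>P)"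
  proof (rule nn_integral_cong)
    fix \<omega> assume \<omega>: "\<omega> \<in> space P"
    let ?\<mu> = "diag_shift (- z) (T \<omega>)"
    have \<mu>: "?\<mu> \<in> space lf_measures" using measurable_space[OF diag_shift_T_measurable \<omega>] .
    have "V ?\<mu> = (\<integral>\<^sup>+p. indicator A (fst p + z, diag_shift (fst p + z) ?\<mu>) \<partial>T \<omega>)"
      unfolding V_def
      by (subst nn_integral_diag_shift[OF sets_T[OF \<omega>]])
         (use measurable_compose[OF measurable_fst_borel mA[OF \<mu>, of 0 0]] in simp_all)
    also have "\<dots> = (\<integral>\<^sup>+p. indicator A (fst p + z, diag_shift (fst p) (T \<omega>)) \<partial>T \<omega>)"
      by (simp add: diag_shift_diag_shift[OF sets_T[OF \<omega>]])
    also have "\<dots> = (\<integral>\<^sup>+x. indicator A (x + z, diag_shift x (T \<omega>)) \<partial>\<Phi> \<omega>)"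
      using mA[of "T \<omega>" z 0] measurable_space[OF T_measurable \<omega>]
      by (intro nn_integral_first_marginal[symmetric] sets_T \<omega>) simp_all
    finally show "V ?\<mu> = (\<integral>\<^sup>+x. indicator A (x + z, diag_shift x (T \<omega>)) \<partial>\<Phi> \<omega>)" .
  qed
  also have "\<dots> = (\<integral>\<^sup>+p. indicator A (fst p + z, snd p) \<partial>pointed)"
  proof -
    have "(\<lambda>p. indicator A (fst p + z, snd p) :: ennreal) \<in> borel_measurable ((borel :: 'a measure) \<Otimes>\<^sub>M lf_measures)"
      by measurable
    from nn_integral_pointed[OF this] show ?thesis by simp
  qed
  also have "\<dots> = (\<integral>\<^sup>+p. indicator A p \<partial>distr pointed (borel \<Otimes>\<^sub>M lf_measures) (\<lambda>(x, s). (x + z, s)))"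
  proof -
    have "(\<lambda>(x, s). (x + z, s)) \<in> pointed \<rightarrow>\<^sub>M borel \<Otimes>\<^sub>M lf_measures"
      unfolding measurable_cong_sets[OF sets_pointed refl] by measurable
    then show ?thesis by (subst nn_integral_distr) (auto simp: case_prod_beta')
  qed
  finally show "emeasure (distr pointed (borel \<Otimes>\<^sub>M lf_measures) (\<lambda>(x, s). (x + z, s))) A = emeasure pointed A"
    by simp
qed simp

text \<open>The Palm measure before division by the intensity. The intensity in front of
  \<open>eta_hat\<close> cancels against that division, so the computations stay on this
  level.\<close>

definition palm_unnormalized :: "('a \<times> 'a) measure measure" where
  "palm_unnormalized = distr (density pointed (\<lambda>p. indicator unit_cube (fst p))) lf_measures snd"

lemma nn_integral_palm_unnormalized:
  assumes g: "g \<in> borel_measurable lf_measures"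
  shows "(\<integral>\<^sup>+\<mu>. g \<mu> \<partial>palm_unnormalized) = (\<integral>\<^sup>+\<omega>. \<integral>\<^sup>+x. indicator unit_cube x * g (diag_shift x (T \<omega>)) \<partial>\<Phi> \<omega> \<partial>P)"
proof -
  have m: "f \<in> borel_measurable (borel \<Otimes>\<^sub>M lf_measures) \<Longrightarrow> f \<in> borel_measurable pointed" for f :: "_ \<Rightarrow> ennreal"
    using measurable_cong_sets[OF sets_pointed refl] by blast
  have "snd \<in> pointed \<rightarrow>\<^sub>M lf_measures" unfolding measurable_cong_sets[OF sets_pointed refl] by measurable
  then have "(\<integral>\<^sup>+\<mu>. g \<mu> \<partial>palm_unnormalized) = (\<integral>\<^sup>+p. indicator unit_cube (fst p) * g (snd p) \<partial>pointed)"
    unfolding palm_unnormalized_def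
    by (subst nn_integral_distr, simp_all add: g, subst nn_integral_density)
       (auto intro!: m measurable_compose[OF measurable_snd g] borel_measurable_indicator
          measurable_compose[OF measurable_fst borel_measurable_indicator[OF unit_cube_sets]])
  also have "\<dots> = (\<integral>\<^sup>+\<omega>. \<integral>\<^sup>+x. indicator unit_cube x * g (diag_shift x (T \<omega>)) \<partial>\<Phi> \<omega> \<partial>P)"
  proof -
    have "(\<lambda>p. indicator unit_cube (fst p) * g (snd p)) \<in> borel_measurable ((borel :: 'a measure) \<Otimes>\<^sub>M lf_measures)"
      using g by measurable
    from nn_integral_pointed[OF this] show ?thesis by simp
  qed
  finally show ?thesis .
qed

lemma sets_palm_unnormalized [simp]: "sets palm_unnormalized = sets lf_measures"
  and space_palm_unnormalized [simp]: "space palm_unnormalized = space lf_measures"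
  by (simp_all add: palm_unnormalized_def)

text \<open>\<open>measure_of\<close> returns the intended set function only if that function is a
  measure; exhibiting it as the values of a scaled measure settles this.\<close>

lemma palm_measure_eq: "palm_measure P T = scale_measure (1 / intensity P \<Phi>) palm_unnormalized"
proof -
  have "palm_measure P T = measure_of (space lf_measures) (sets lf_measures)
     (emeasure (scale_measure (1 / intensity P \<Phi>) palm_unnormalized))"
    unfolding palm_measure_def
  proof (rule measure_of_eq)
    show "sets (lf_measures :: ('a \<times> 'a) measure measure) \<subseteq> Pow (space lf_measures)" by (rule sets.space_closed)
    fix A :: "('a \<times> 'a) measure set" assume "A \<in> sigma_sets (space lf_measures) (sets lf_measures)"
    then have A: "A \<in> sets lf_measures" by (simp add: sets.sigma_sets_eq)
    have "emeasure palm_unnormalized A = (\<integral>\<^sup>+\<mu>. indicator A \<mu> \<partial>palm_unnormalized)" using A by simp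
    also have "\<dots> = (\<integral>\<^sup>+\<omega>. \<integral>\<^sup>+x. indicator unit_cube x * indicator A (diag_shift x (T \<omega>)) \<partial>\<Phi> \<omega> \<partial>P)"
      by (rule nn_integral_palm_unnormalized) (use A in simp)
    finally show "(\<integral>\<^sup>+\<omega>. (\<integral>\<^sup>+x\<in>unit_cube. indicator A (diag_shift x (T \<omega>)) \<partial>\<Phi> \<omega>) \<partial>P) / intensity P \<Phi> =
        emeasure (scale_measure (1 / intensity P \<Phi>) palm_unnormalized) A"
      by (simp add: divide_ennreal_def mult.commute)
  qed
  also have "\<dots> = scale_measure (1 / intensity P \<Phi>) palm_unnormalized"
    using measure_of_of_measure[of "scale_measure (1 / intensity P \<Phi>) palm_unnormalized"]
      sets_eq_imp_space_eq[of "scale_measure (1 / intensity P \<Phi>) palm_unnormalized" lf_measures] by simp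
  finally show ?thesis .
qed

lemma emeasure_pointed_cube: "emeasure pointed (cbox z (z + One) \<times> space lf_measures) = intensity P \<Phi>"
proof -
  have A: "cbox z (z + One) \<times> space lf_measures \<in> sets (borel \<Otimes>\<^sub>M (lf_measures :: ('a \<times> 'a) measure measure))"
    by (intro pair_measureI) auto
  have m: "(\<lambda>(x, s). (x + z, s)) \<in> pointed \<rightarrow>\<^sub>M borel \<Otimes>\<^sub>M lf_measures"
    unfolding measurable_cong_sets[OF sets_pointed refl] by measurable
  have "emeasure pointed (cbox z (z + One) \<times> space lf_measures) =
      emeasure (distr pointed (borel \<Otimes>\<^sub>M lf_measures) (\<lambda>(x, s). (x + z, s))) (cbox z (z + One) \<times> space lf_measures)"
    by (simp add: distr_pointed)
  also have "\<dots> = emeasure pointed ((\<lambda>(x, s). (x + z, s)) -` (cbox z (z + One) \<times> space lf_measures) \<inter> space pointed)"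
    by (rule emeasure_distr[OF m A])
  also have "(\<lambda>(x, s). (x + z, s)) -` (cbox z (z + One) \<times> space lf_measures) \<inter> space pointed = unit_cube \<times> space lf_measures"
    using sets_eq_imp_space_eq[OF sets_pointed]
    by (auto simp: space_pair_measure unit_cube_def mem_box inner_add_left)
  also have "emeasure pointed (unit_cube \<times> space lf_measures) = (\<integral>\<^sup>+p. indicator (unit_cube \<times> space lf_measures) p \<partial>pointed)"
    by (subst nn_integral_indicator) (auto intro!: pair_measureI)
  also have "\<dots> = (\<integral>\<^sup>+\<omega>. \<integral>\<^sup>+x. indicator (unit_cube \<times> space lf_measures) (x, diag_shift x (T \<omega>)) \<partial>\<Phi> \<omega> \<partial>P)"
    by (rule nn_integral_pointed) (auto intro!: borel_measurable_indicator pair_measureI)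
  also have "\<dots> = (\<integral>\<^sup>+\<omega>. \<integral>\<^sup>+x. indicator unit_cube x \<partial>\<Phi> \<omega> \<partial>P)"
    using measurable_lfD(1)[OF T_measurable]
    by (intro nn_integral_cong) (auto simp: indicator_def space_lf_measures diag_shift_locally_finite)
  finally show ?thesis by (simp add: intensity_def)
qed

end

locale finite_intensity_transport = transport P T
  for P :: "'w measure" and T :: "'w \<Rightarrow> ('a::euclidean_space \<times> 'a) measure" +
  assumes intensity_pos: "0 < intensity P (\<lambda>\<omega>. first_marginal (T \<omega>))"
    and intensity_finite: "intensity P (\<lambda>\<omega>. first_marginal (T \<omega>)) < \<infinity>"
begin

text \<open>The refined Campbell theorem: shift invariance of \<open>pointed\<close> is put through
  \<open>nn_integral_shift_invariant\<close>, with sigma-finiteness from the finite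
  intensity.\<close>

lemma Campbell:
  assumes u: "u \<in> borel_measurable (borel \<Otimes>\<^sub>M lf_measures)"
  shows "(\<integral>\<^sup>+\<omega>. \<integral>\<^sup>+x. u (x, diag_shift x (T \<omega>)) \<partial>\<Phi> \<omega> \<partial>P) = (\<integral>\<^sup>+\<mu>. \<integral>\<^sup>+z. u (z, \<mu>) \<partial>lborel \<partial>palm_unnormalized)"
proof -
  have sf: "sigma_finite_measure pointed"
    by (rule sigma_finite_unit_cubes[OF sets_pointed]) (use emeasure_pointed_cube intensity_finite in simp)
  have g: "(\<lambda>\<mu>. \<integral>\<^sup>+z. u (z, \<mu>) \<partial>lborel) \<in> borel_measurable lf_measures"
    using u by measurable
  have "(\<integral>\<^sup>+\<omega>. \<integral>\<^sup>+x. u (x, diag_shift x (T \<omega>)) \<partial>\<Phi> \<omega> \<partial>P) = (\<integral>\<^sup>+p. u p \<partial>pointed)"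
    by (rule nn_integral_pointed[OF u, symmetric])
  also have "\<dots> = (\<integral>\<^sup>+p. indicator unit_cube (fst p) * (\<integral>\<^sup>+z. u (z, snd p) \<partial>lborel) \<partial>pointed)"
    by (rule nn_integral_shift_invariant[OF sf sets_pointed distr_pointed u])
  also have "\<dots> = (\<integral>\<^sup>+\<omega>. \<integral>\<^sup>+x. indicator unit_cube x * (\<integral>\<^sup>+z. u (z, diag_shift x (T \<omega>)) \<partial>lborel) \<partial>\<Phi> \<omega> \<partial>P)"
  proof -
    have "(\<lambda>p. indicator unit_cube (fst p) * (\<integral>\<^sup>+z. u (z, snd p) \<partial>lborel)) \<in> borel_measurable ((borel :: 'a measure) \<Otimes>\<^sub>M lf_measures)"
      using measurable_compose[OF measurable_snd g] by measurable
    from nn_integral_pointed[OF this] show ?thesis by simp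
  qed
  also have "\<dots> = (\<integral>\<^sup>+\<mu>. \<integral>\<^sup>+z. u (z, \<mu>) \<partial>lborel \<partial>palm_unnormalized)"
    by (rule nn_integral_palm_unnormalized[OF g, symmetric])
  finally show ?thesis .
qed

end

section \<open>Integrals of bounded functions against mixtures\<close>

lemma sets_prob_algebra_kernel:
  assumes "\<kappa> \<in> P \<rightarrow>\<^sub>M prob_algebra N" "\<omega> \<in> space P"
  shows "sets (\<kappa> \<omega>) = sets N" "prob_space (\<kappa> \<omega>)" "space (\<kappa> \<omega>) = space N"
  using measurable_space[OF assms] sets_eq_imp_space_eq[of "\<kappa> \<omega>" N] by (auto simp: space_prob_algebra)

lemma emeasure_prob_algebra_kernel:
  assumes "\<kappa> \<in> P \<rightarrow>\<^sub>M prob_algebra N" "A \<in> sets N"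
  shows "(\<lambda>\<omega>. emeasure (\<kappa> \<omega>) A) \<in> borel_measurable P"
  using measurable_compose[OF measurable_prob_algebraD[OF assms(1)] measurable_emeasure_subprob_algebra[OF assms(2)]] .

lemma nn_integral_prob_algebra_kernel:
  assumes "\<kappa> \<in> P \<rightarrow>\<^sub>M prob_algebra N" "f \<in> borel_measurable N"
  shows "(\<lambda>\<omega>. \<integral>\<^sup>+x. f x \<partial>\<kappa> \<omega>) \<in> borel_measurable P"
  using measurable_compose[OF measurable_prob_algebraD[OF assms(1)] nn_integral_measurable_subprob_algebra[OF assms(2)]] .

lemma nn_integral_mixture_prob:
  assumes \<kappa>: "\<kappa> \<in> P \<rightarrow>\<^sub>M prob_algebra N" and f: "f \<in> borel_measurable N"
  shows "(\<integral>\<^sup>+x. f x \<partial>mixture P \<kappa> N) = (\<integral>\<^sup>+\<omega>. \<integral>\<^sup>+x. f x \<partial>\<kappa> \<omega> \<partial>P)"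
  by (rule nn_integral_mixture[OF sets_prob_algebra_kernel(1)[OF \<kappa>] emeasure_prob_algebra_kernel[OF \<kappa>] f])

lemma emeasure_mixture_prob:
  assumes \<kappa>: "\<kappa> \<in> P \<rightarrow>\<^sub>M prob_algebra N" and A: "A \<in> sets N"
  shows "emeasure (mixture P \<kappa> N) A = (\<integral>\<^sup>+\<omega>. emeasure (\<kappa> \<omega>) A \<partial>P)"
  by (rule emeasure_mixture[OF sets_prob_algebra_kernel(1)[OF \<kappa>] emeasure_prob_algebra_kernel[OF \<kappa>] A])

lemma emeasure_space_mixture_prob:
  assumes \<kappa>: "\<kappa> \<in> P \<rightarrow>\<^sub>M prob_algebra N"
  shows "emeasure (mixture P \<kappa> N) (space N) = emeasure P (space P)"
proof -
  have "emeasure (\<kappa> \<omega>) (space N) = 1" if "\<omega> \<in> space P" for \<omega>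
    using prob_space.emeasure_space_1[OF sets_prob_algebra_kernel(2)[OF \<kappa> that]] sets_prob_algebra_kernel(3)[OF \<kappa> that] by simp
  then show ?thesis
    by (subst emeasure_mixture_prob[OF \<kappa>]) (auto cong: nn_integral_cong)
qed

text \<open>Adding the bound \<open>B\<close> makes the integrand nonnegative, so the mixture
  formula for nonnegative integrals applies; the constant contributes equally on both sides because
  the kernels are probability measures.\<close>

lemma integral_mixture_real:
  fixes f :: "'b \<Rightarrow> real"
  assumes fin: "finite_measure P" and \<kappa>: "\<kappa> \<in> P \<rightarrow>\<^sub>M prob_algebra N"
    and f [measurable]: "f \<in> borel_measurable N" and B: "\<And>x. \<bar>f x\<bar> \<le> B"
  shows "(LINT x|mixture P \<kappa> N. f x) = (LINT \<omega>|P. LINT x|\<kappa> \<omega>. f x)"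
    and "integrable P (\<lambda>\<omega>. LINT x|\<kappa> \<omega>. f x)"
proof -
  interpret P: finite_measure P by fact
  have mass: "emeasure (mixture P \<kappa> N) (space (mixture P \<kappa> N)) = emeasure P (space P)"
    using emeasure_space_mixture_prob[OF \<kappa>] by simp
  interpret M: finite_measure "mixture P \<kappa> N"
    by (rule finite_measureI) (unfold mass, simp)
  have [measurable]: "(\<lambda>\<omega>. LINT x|\<kappa> \<omega>. g x) \<in> borel_measurable P" if "g \<in> borel_measurable N" for g :: "'b \<Rightarrow> real"
    using measurable_compose[OF measurable_prob_algebraD[OF \<kappa>] integral_measurable_subprob_algebra[OF that]] .
  define g where "g x = f x + B" for x
  have [measurable]: "g \<in> borel_measurable N" unfolding g_def by measurable
  have g0: "0 \<le> g x" for x using B[of x] by (simp add: g_def abs_le_iff)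
  have ker: "integrable (\<kappa> \<omega>) f" "(LINT x|\<kappa> \<omega>. g x) = (LINT x|\<kappa> \<omega>. f x) + B" "\<bar>LINT x|\<kappa> \<omega>. f x\<bar> \<le> B"
    "ennreal (LINT x|\<kappa> \<omega>. g x) = (\<integral>\<^sup>+x. g x \<partial>\<kappa> \<omega>)" if \<omega>: "\<omega> \<in> space P" for \<omega>
  proof -
    interpret K: prob_space "\<kappa> \<omega>" by (rule sets_prob_algebra_kernel(2)[OF \<kappa> \<omega>])
    have mm: "h \<in> borel_measurable (\<kappa> \<omega>)" if "h \<in> borel_measurable N" for h :: "'b \<Rightarrow> real"
      using that measurable_cong_sets[OF sets_prob_algebra_kernel(1)[OF \<kappa> \<omega>] refl] by blast
    show i: "integrable (\<kappa> \<omega>) f"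
      by (rule K.integrable_const_bound[of _ B]) (use B mm[OF f] in auto)
    show "(LINT x|\<kappa> \<omega>. g x) = (LINT x|\<kappa> \<omega>. f x) + B"
      unfolding g_def using i by (subst Bochner_Integration.integral_add) (auto simp: K.prob_space)
    have "\<bar>LINT x|\<kappa> \<omega>. f x\<bar> \<le> (LINT x|\<kappa> \<omega>. \<bar>f x\<bar>)" by (rule integral_abs_bound)
    also have "\<dots> \<le> (LINT x|\<kappa> \<omega>. B)" using i B by (intro integral_mono) auto
    finally show "\<bar>LINT x|\<kappa> \<omega>. f x\<bar> \<le> B" by (simp add: K.prob_space)
    show "ennreal (LINT x|\<kappa> \<omega>. g x) = (\<integral>\<^sup>+x. g x \<partial>\<kappa> \<omega>)"
      using g0 i by (intro nn_integral_eq_integral[symmetric]) (auto simp: g_def)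
  qed
  show ip: "integrable P (\<lambda>\<omega>. LINT x|\<kappa> \<omega>. f x)"
    by (rule P.integrable_const_bound[of _ B]) (use ker(3) in auto)
  have im: "integrable (mixture P \<kappa> N) f"
    by (rule M.integrable_const_bound[of _ B]) (use B in auto)
  have "(LINT x|mixture P \<kappa> N. g x) = enn2real (\<integral>\<^sup>+x. g x \<partial>mixture P \<kappa> N)"
    using g0 by (intro integral_eq_nn_integral) auto
  also have "\<dots> = enn2real (\<integral>\<^sup>+\<omega>. ennreal (LINT x|\<kappa> \<omega>. g x) \<partial>P)"
    by (subst nn_integral_mixture_prob[OF \<kappa>]) (auto simp: ker(4) cong: nn_integral_cong)
  also have "\<dots> = (LINT \<omega>|P. LINT x|\<kappa> \<omega>. g x)"
    using g0 by (intro integral_eq_nn_integral[symmetric]) (auto intro!: AE_I2 integral_nonneg_AE)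
  also have "\<dots> = (LINT \<omega>|P. (LINT x|\<kappa> \<omega>. f x) + B)"
    by (intro Bochner_Integration.integral_cong refl ker(2))
  also have "\<dots> = (LINT \<omega>|P. LINT x|\<kappa> \<omega>. f x) + measure P (space P) * B"
    using ip by (subst Bochner_Integration.integral_add) auto
  also have "(LINT x|mixture P \<kappa> N. g x) = (LINT x|mixture P \<kappa> N. f x) + measure P (space P) * B"
    unfolding g_def using im mass by (subst Bochner_Integration.integral_add) (auto simp: measure_def)
  finally show "(LINT x|mixture P \<kappa> N. f x) = (LINT \<omega>|P. LINT x|\<kappa> \<omega>. f x)" by simp
qed

lemma integral_mixture:
  fixes f :: "'b \<Rightarrow> complex"
  assumes fin: "finite_measure P" and \<kappa>: "\<kappa> \<in> P \<rightarrow>\<^sub>M prob_algebra N"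
    and f [measurable]: "f \<in> borel_measurable N" and B: "\<And>x. cmod (f x) \<le> B"
  shows "(LINT x|mixture P \<kappa> N. f x) = (LINT \<omega>|P. LINT x|\<kappa> \<omega>. f x)"
    and "integrable P (\<lambda>\<omega>. LINT x|\<kappa> \<omega>. f x)"
proof -
  interpret P: finite_measure P by fact
  have mass: "emeasure (mixture P \<kappa> N) (space (mixture P \<kappa> N)) = emeasure P (space P)"
    using emeasure_space_mixture_prob[OF \<kappa>] by simp
  interpret M: finite_measure "mixture P \<kappa> N"
    by (rule finite_measureI) (unfold mass, simp)
  have R: "\<bar>Re (f x)\<bar> \<le> B" "\<bar>Im (f x)\<bar> \<le> B" for x
    using B[of x] abs_Re_le_cmod[of "f x"] abs_Im_le_cmod[of "f x"] by linarith+
  have i: "integrable (\<kappa> \<omega>) f" if \<omega>: "\<omega> \<in> space P" for \<omega>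
  proof -
    interpret K: prob_space "\<kappa> \<omega>" by (rule sets_prob_algebra_kernel(2)[OF \<kappa> \<omega>])
    have "f \<in> borel_measurable (\<kappa> \<omega>)"
      using f measurable_cong_sets[OF sets_prob_algebra_kernel(1)[OF \<kappa> \<omega>] refl] by blast
    then show ?thesis by (intro K.integrable_const_bound[of _ B]) (use B in auto)
  qed
  have re: "Re (LINT x|\<kappa> \<omega>. f x) = (LINT x|\<kappa> \<omega>. Re (f x))" "Im (LINT x|\<kappa> \<omega>. f x) = (LINT x|\<kappa> \<omega>. Im (f x))"
    if "\<omega> \<in> space P" for \<omega> using i[OF that] by (simp_all add: integral_Re integral_Im)
  have "integrable P (\<lambda>\<omega>. complex_of_real (LINT x|\<kappa> \<omega>. Re (f x)) + \<i> * complex_of_real (LINT x|\<kappa> \<omega>. Im (f x)))"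
    using integral_mixture_real(2)[OF fin \<kappa>, of "\<lambda>x. Re (f x)" B] integral_mixture_real(2)[OF fin \<kappa>, of "\<lambda>x. Im (f x)" B] R
    by (intro Bochner_Integration.integrable_add integrable_mult_right) (auto simp: complex_of_real_integrable_eq)
  also have "?this \<longleftrightarrow> integrable P (\<lambda>\<omega>. LINT x|\<kappa> \<omega>. f x)"
    by (intro Bochner_Integration.integrable_cong refl) (simp add: complex_eq_iff re)
  finally show ip: "integrable P (\<lambda>\<omega>. LINT x|\<kappa> \<omega>. f x)" .
  have im: "integrable (mixture P \<kappa> N) f"
    by (rule M.integrable_const_bound[of _ B]) (use B in auto)
  show "(LINT x|mixture P \<kappa> N. f x) = (LINT \<omega>|P. LINT x|\<kappa> \<omega>. f x)"
  proof (rule complex_eqI)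
    have "Re (LINT x|mixture P \<kappa> N. f x) = (LINT x|mixture P \<kappa> N. Re (f x))" using im by (simp add: integral_Re)
    also have "\<dots> = (LINT \<omega>|P. LINT x|\<kappa> \<omega>. Re (f x))"
      by (rule integral_mixture_real(1)[OF fin \<kappa> _ R(1)]) measurable
    also have "\<dots> = (LINT \<omega>|P. Re (LINT x|\<kappa> \<omega>. f x))" by (intro Bochner_Integration.integral_cong refl) (simp add: re)
    finally show "Re (LINT x|mixture P \<kappa> N. f x) = Re (LINT \<omega>|P. LINT x|\<kappa> \<omega>. f x)" using ip by (simp add: integral_Re)
    have "Im (LINT x|mixture P \<kappa> N. f x) = (LINT x|mixture P \<kappa> N. Im (f x))" using im by (simp add: integral_Im)
    also have "\<dots> = (LINT \<omega>|P. LINT x|\<kappa> \<omega>. Im (f x))"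
      by (rule integral_mixture_real(1)[OF fin \<kappa> _ R(2)]) measurable
    also have "\<dots> = (LINT \<omega>|P. Im (LINT x|\<kappa> \<omega>. f x))" by (intro Bochner_Integration.integral_cong refl) (simp add: re)
    finally show "Im (LINT x|mixture P \<kappa> N. f x) = Im (LINT \<omega>|P. LINT x|\<kappa> \<omega>. f x)" using ip by (simp add: integral_Im)
  qed
qed

section \<open>The conditional distribution at the origin\<close>

text \<open>\<^const>\<open>origin_kernel\<close> made total: a probability measure also where conditioning is impossible.\<close>

definition origin_kernel_total :: "('a::euclidean_space \<times> 'a) measure \<Rightarrow> 'a measure" where
  "origin_kernel_total \<mu> = (if 0 < emeasure \<mu> ({0} \<times> UNIV) \<and> emeasure \<mu> ({0} \<times> UNIV) < \<infinity>
     then origin_kernel \<mu> else return borel 0)"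

lemma origin_strip_sets [measurable]: "B \<in> sets borel \<Longrightarrow> {x::'a::euclidean_space} \<times> B \<in> sets (borel :: ('a \<times> 'a) measure)"
  unfolding borel_prod[symmetric] by (intro pair_measureI) auto

lemma emeasure_origin_kernel:
  fixes \<mu> :: "('a::euclidean_space \<times> 'a) measure"
  assumes \<mu>: "sets \<mu> = sets borel" and B: "B \<in> sets borel"
  shows "emeasure (origin_kernel \<mu>) B = emeasure \<mu> ({0} \<times> B) / emeasure \<mu> ({0} \<times> UNIV)"
proof -
  have sp: "space \<mu> = UNIV" using sets_eq_imp_space_eq[OF \<mu>] by simp
  have "snd \<in> uniform_measure \<mu> ({0} \<times> UNIV) \<rightarrow>\<^sub>M borel"
    using measurable_snd_borel measurable_cong_sets[of "uniform_measure \<mu> ({0} \<times> UNIV)" borel] \<mu> by auto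
  then have "emeasure (origin_kernel \<mu>) B = emeasure (uniform_measure \<mu> ({0} \<times> UNIV)) (UNIV \<times> B)"
    unfolding origin_kernel_def using B sp by (subst emeasure_distr) (auto intro!: arg_cong2[where f=emeasure])
  also have "UNIV \<times> B \<in> sets \<mu>"
    using B unfolding \<mu> borel_prod[symmetric] by (intro pair_measureI) auto
  then have "emeasure (uniform_measure \<mu> ({0} \<times> UNIV)) (UNIV \<times> B) = emeasure \<mu> (({0} \<times> UNIV) \<inter> (UNIV \<times> B)) / emeasure \<mu> ({0} \<times> UNIV)"
    using origin_strip_sets[of UNIV 0] \<mu> by (subst emeasure_uniform_measure) auto
  finally show ?thesis by (simp add: Times_Int_Times)
qed

lemma origin_kernel_total_measurable [measurable]:
  "origin_kernel_total \<in> (lf_measures :: ('a::euclidean_space \<times> 'a) measure measure) \<rightarrow>\<^sub>M prob_algebra borel"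
proof (rule measurable_prob_algebraI)
  have s: "sets \<mu> = sets borel" if "\<mu> \<in> space lf_measures" for \<mu> :: "('a \<times> 'a) measure"
    using that by (simp add: space_lf_measures locally_finite_measure_def)
  show p: "prob_space (origin_kernel_total \<mu>)" if "\<mu> \<in> space lf_measures" for \<mu> :: "('a \<times> 'a) measure"
  proof (cases "0 < emeasure \<mu> ({0} \<times> UNIV) \<and> emeasure \<mu> ({0} \<times> UNIV) < \<infinity>")
    case True
    have "emeasure (origin_kernel \<mu>) UNIV = 1"
      using True by (subst emeasure_origin_kernel[OF s[OF that]]) (auto intro!: ennreal_divide_self)
    then show ?thesis using True
      by (auto simp: origin_kernel_total_def origin_kernel_def intro!: prob_spaceI)
  qed (auto simp: origin_kernel_total_def prob_space_return)
  show "origin_kernel_total \<in> (lf_measures :: ('a \<times> 'a) measure measure) \<rightarrow>\<^sub>M subprob_algebra borel"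
  proof (rule measurable_subprob_algebra)
    fix \<mu> :: "('a \<times> 'a) measure" assume "\<mu> \<in> space lf_measures"
    then show "subprob_space (origin_kernel_total \<mu>)" by (intro prob_space_imp_subprob_space p)
    show "sets (origin_kernel_total \<mu>) = sets borel" by (simp add: origin_kernel_total_def origin_kernel_def)
  next
    fix B :: "'a set" assume B: "B \<in> sets borel"
    have [measurable]: "(\<lambda>\<mu> :: ('a \<times> 'a) measure. emeasure \<mu> ({0} \<times> B)) \<in> borel_measurable lf_measures"
      "(\<lambda>\<mu> :: ('a \<times> 'a) measure. emeasure \<mu> ({0} \<times> UNIV)) \<in> borel_measurable lf_measures"
      using B by (intro measurable_emeasure_lf origin_strip_sets; simp)+
    have "(\<lambda>\<mu> :: ('a \<times> 'a) measure. if 0 < emeasure \<mu> ({0} \<times> UNIV) \<and> emeasure \<mu> ({0} \<times> UNIV) < \<infinity>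
        then emeasure \<mu> ({0} \<times> B) / emeasure \<mu> ({0} \<times> UNIV) else indicator B (0::'a)) \<in> borel_measurable lf_measures"
      by measurable
    also have "?this \<longleftrightarrow> (\<lambda>\<mu> :: ('a \<times> 'a) measure. emeasure (origin_kernel_total \<mu>) B) \<in> borel_measurable lf_measures"
      using s B by (intro measurable_cong) (auto simp: origin_kernel_total_def emeasure_origin_kernel)
    finally show "(\<lambda>\<mu> :: ('a \<times> 'a) measure. emeasure (origin_kernel_total \<mu>) B) \<in> borel_measurable lf_measures" .
  qed
qed

section \<open>Atoms of the source and the kernel seen from an atom\<close>

locale disintegrated_transport = finite_intensity_transport P T
  for P :: "'w measure" and T :: "'w \<Rightarrow> ('a::euclidean_space \<times> 'a) measure" +
  fixes L :: "'w \<times> 'a \<Rightarrow> 'a measure"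
  assumes discrete: "purely_discrete P (\<lambda>\<omega>. first_marginal (T \<omega>))"
    and L_kernel: "prob_kernel P L"
    and disint: "disintegrates P T L (\<lambda>\<omega>. first_marginal (T \<omega>))"
begin

abbreviation kernels :: "('w \<times> 'a \<Rightarrow> 'a measure) set" where
  "kernels \<equiv> P \<Otimes>\<^sub>M borel \<rightarrow>\<^sub>M prob_algebra borel"

lemma L_measurable [measurable]: "L \<in> kernels"
  using L_kernel by (simp add: prob_kernel_def)

lemma kernel_section:
  assumes "Q \<in> kernels" "\<omega> \<in> space P"
  shows "(\<lambda>x. Q (\<omega>, x)) \<in> borel \<rightarrow>\<^sub>M prob_algebra borel"
    and "sets (Q (\<omega>, x)) = sets borel" "prob_space (Q (\<omega>, x))" "space (Q (\<omega>, x)) = UNIV"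
    and "(\<lambda>x. Q (\<omega>, x)) \<in> \<Phi> \<omega> \<rightarrow>\<^sub>M prob_algebra borel"
proof -
  show 1: "(\<lambda>x. Q (\<omega>, x)) \<in> borel \<rightarrow>\<^sub>M prob_algebra borel"
    using measurable_Pair2[OF assms] by simp
  show "sets (Q (\<omega>, x)) = sets borel" "prob_space (Q (\<omega>, x))" "space (Q (\<omega>, x)) = UNIV"
    using sets_prob_algebra_kernel[OF 1, of x] by auto
  show "(\<lambda>x. Q (\<omega>, x)) \<in> \<Phi> \<omega> \<rightarrow>\<^sub>M prob_algebra borel"
    using 1 measurable_cong_sets[OF sets_first_marginal refl] by blast
qed

text \<open>The series representation concentrates \<Phi> on the countable set of its points
  \<open>X n\<close>, and the points of that set without mass form a countable null set. Statements
  for almost every point of \<Phi> may therefore assume that the point is an atom.\<close>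

lemma AE_countable_atoms: "AE \<omega> in P. \<exists>A. countable A \<and> (AE x in \<Phi> \<omega>. x \<in> A) \<and> (AE x in \<Phi> \<omega>. 0 < emeasure (\<Phi> \<omega>) {x})"
proof -
  obtain Y :: "nat \<Rightarrow> 'w \<Rightarrow> real" and X :: "nat \<Rightarrow> 'w \<Rightarrow> 'a" where
    *: "AE \<omega> in P. \<forall>B\<in>sets borel. emeasure (\<Phi> \<omega>) B = (\<Sum>n. ennreal (Y n \<omega>) * emeasure (return borel (X n \<omega>)) B)"
    using discrete unfolding purely_discrete_def by blast
  from * show ?thesis
  proof eventually_elim
    case (elim \<omega>)
    let ?A = "range (\<lambda>n. X n \<omega>)"
    have A: "countable ?A" by simp
    then have Am: "?A \<in> sets borel" by (auto intro: sets.countable)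
    have "emeasure (\<Phi> \<omega>) (- ?A) = (\<Sum>n. ennreal (Y n \<omega>) * emeasure (return borel (X n \<omega>)) (- ?A))"
      using elim Am by auto
    also have "\<dots> = 0" using Am by (auto simp: indicator_def)
    finally have AEA: "AE x in \<Phi> \<omega>. x \<in> ?A"
      using Am by (intro AE_I[of _ _ "- ?A"]) auto
    have c: "countable {x \<in> ?A. emeasure (\<Phi> \<omega>) {x} = 0}" by (rule countable_subset[OF _ A]) auto
    have "emeasure (\<Phi> \<omega>) {x \<in> ?A. emeasure (\<Phi> \<omega>) {x} = 0} = (\<integral>\<^sup>+x. emeasure (\<Phi> \<omega>) {x} \<partial>count_space {x \<in> ?A. emeasure (\<Phi> \<omega>) {x} = 0})"
      by (intro emeasure_countable_singleton c) auto
    also have "\<dots> = (\<integral>\<^sup>+x. 0 \<partial>count_space {x \<in> ?A. emeasure (\<Phi> \<omega>) {x} = 0})"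
      by (intro nn_integral_cong) auto
    finally have "AE x in \<Phi> \<omega>. x \<notin> {x \<in> ?A. emeasure (\<Phi> \<omega>) {x} = 0}"
      using c by (intro AE_not_in null_setsI) (auto intro: sets.countable)
    with AEA have "AE x in \<Phi> \<omega>. 0 < emeasure (\<Phi> \<omega>) {x}" by eventually_elim (auto simp: zero_less_iff_neq_zero)
    with AEA A show ?case by blast
  qed
qed

text \<open>The disintegration is given on sets; reading it as equality of \<open>T \<omega>\<close>
  with a mixture of the kernels \<open>?\<kappa>\<close> carries it to functions.\<close>

lemma nn_integral_T:
  assumes "\<omega> \<in> space P" and T: "\<And>A. A \<in> sets borel \<Longrightarrow> emeasure (T \<omega>) A = (\<integral>\<^sup>+x. \<integral>\<^sup>+y. indicator A (x, y) \<partial>L (\<omega>, x) \<partial>\<Phi> \<omega>)"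
    and f: "f \<in> borel_measurable borel"
  shows "(\<integral>\<^sup>+p. f p \<partial>T \<omega>) = (\<integral>\<^sup>+x. \<integral>\<^sup>+y. f (x, y) \<partial>L (\<omega>, x) \<partial>\<Phi> \<omega>)"
proof -
  let ?\<kappa> = "\<lambda>x. distr (L (\<omega>, x)) borel (Pair x)"
  note Ls = kernel_section[OF L_measurable assms(1)]
  have P: "Pair x \<in> L (\<omega>, x) \<rightarrow>\<^sub>M borel" for x
    unfolding measurable_cong_sets[OF Ls(2) refl] borel_prod[symmetric] by measurable
  have nn: "(\<integral>\<^sup>+p. g p \<partial>?\<kappa> x) = (\<integral>\<^sup>+y. g (x, y) \<partial>L (\<omega>, x))" if "g \<in> borel_measurable borel" for g and x
    using that by (subst nn_integral_distr[OF P]) auto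
  have \<kappa>: "?\<kappa> \<in> \<Phi> \<omega> \<rightarrow>\<^sub>M prob_algebra borel"
  proof (rule measurable_distr_prob_space2[OF Ls(5)])
    show "(\<lambda>(x, y). (x, y)) \<in> \<Phi> \<omega> \<Otimes>\<^sub>M (borel :: 'a measure) \<rightarrow>\<^sub>M borel"
    proof -
      have "sets (\<Phi> \<omega> \<Otimes>\<^sub>M (borel :: 'a measure)) = sets (borel :: ('a \<times> 'a) measure)"
        unfolding borel_prod[symmetric] by (intro sets_pair_measure_cong) auto
      from measurable_ident_sets[OF this] show ?thesis by (simp add: id_def)
    qed
  qed
  have "T \<omega> = mixture (\<Phi> \<omega>) ?\<kappa> borel"
  proof (rule measure_eqI)
    show "sets (T \<omega>) = sets (mixture (\<Phi> \<omega>) ?\<kappa> borel)" using sets_T[OF assms(1)] by simp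
    fix A assume "A \<in> sets (T \<omega>)"
    then have A: "A \<in> sets borel" using sets_T[OF assms(1)] by simp
    have "emeasure (mixture (\<Phi> \<omega>) ?\<kappa> borel) A = (\<integral>\<^sup>+x. \<integral>\<^sup>+p. indicator A p \<partial>?\<kappa> x \<partial>\<Phi> \<omega>)"
      using A by (subst emeasure_mixture_prob[OF \<kappa>]) auto
    also have "\<dots> = emeasure (T \<omega>) A" unfolding T[OF A] using A by (intro nn_integral_cong nn) auto
    finally show "emeasure (T \<omega>) A = emeasure (mixture (\<Phi> \<omega>) ?\<kappa> borel) A" ..
  qed
  then have "(\<integral>\<^sup>+p. f p \<partial>T \<omega>) = (\<integral>\<^sup>+p. f p \<partial>mixture (\<Phi> \<omega>) ?\<kappa> borel)" by simp
  also have "\<dots> = (\<integral>\<^sup>+x. \<integral>\<^sup>+p. f p \<partial>?\<kappa> x \<partial>\<Phi> \<omega>)" by (rule nn_integral_mixture_prob[OF \<kappa> f])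
  also have "\<dots> = (\<integral>\<^sup>+x. \<integral>\<^sup>+y. f (x, y) \<partial>L (\<omega>, x) \<partial>\<Phi> \<omega>)" by (intro nn_integral_cong nn f)
  finally show ?thesis .
qed

lemma AE_nn_integral_T:
  "AE \<omega> in P. \<forall>f\<in>borel_measurable borel. (\<integral>\<^sup>+p. f p \<partial>T \<omega>) = (\<integral>\<^sup>+x. \<integral>\<^sup>+y. f (x, y) \<partial>L (\<omega>, x) \<partial>\<Phi> \<omega>)"
  using disint AE_space unfolding disintegrates_def by eventually_elim (auto intro: nn_integral_T)

text \<open>At an atom \<open>x\<close> the strip over \<open>x\<close> carries
  \<open>L (\<omega>, x)\<close> times the mass of the atom, and dividing by this positive finite
  mass recovers the kernel. This links \<open>L\<close>, which lives on the probability space, with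
  the function of \<open>T\<close> that occurs in the Palm expectation.\<close>

lemma AE_origin_kernel:
  "AE \<omega> in P. AE x in \<Phi> \<omega>. 0 < emeasure (first_marginal (diag_shift x (T \<omega>))) {0} \<and>
     origin_kernel (diag_shift x (T \<omega>)) = origin_kernel_total (diag_shift x (T \<omega>)) \<and>
     origin_kernel_total (diag_shift x (T \<omega>)) = shift_measure x (L (\<omega>, x))"
  using AE_nn_integral_T AE_countable_atoms AE_space
proof eventually_elim
  case (elim \<omega>)
  note \<omega> = elim(3) and sT = sets_T[OF elim(3)]
  note Ls = kernel_section[OF L_measurable \<omega>]
  from elim(2) have "AE x in \<Phi> \<omega>. 0 < emeasure (\<Phi> \<omega>) {x}" by blast
  then show ?case
  proof (eventually_elim)
    fix x assume x: "0 < emeasure (\<Phi> \<omega>) {x}"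
    have fin: "emeasure (\<Phi> \<omega>) {x} < \<infinity>" using \<Phi>_locally_finite[OF \<omega>] by (auto simp: locally_finite_measure_def)
    let ?\<mu> = "diag_shift x (T \<omega>)"
    have strip: "emeasure ?\<mu> ({0} \<times> B) = emeasure (L (\<omega>, x)) ((\<lambda>z. z - x) -` B) * emeasure (\<Phi> \<omega>) {x}"
      if B: "B \<in> sets borel" for B
    proof -
      have C: "(\<lambda>z. z - x) -` B \<in> sets borel" using measurable_sets[of "\<lambda>z. z - x" borel borel B] B by simp
      have "emeasure ?\<mu> ({0} \<times> B) = (\<integral>\<^sup>+p. indicator ({0} \<times> B) p \<partial>?\<mu>)" using B by simp
      also have "\<dots> = (\<integral>\<^sup>+p. indicator ({0} \<times> B) (fst p - x, snd p - x) \<partial>T \<omega>)"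
        using B by (intro nn_integral_diag_shift sT borel_measurable_indicator origin_strip_sets)
      also have "\<dots> = (\<integral>\<^sup>+p. indicator ({x} \<times> ((\<lambda>z. z - x) -` B)) p \<partial>T \<omega>)"
        by (intro nn_integral_cong) (auto simp: indicator_def)
      also have "\<dots> = (\<integral>\<^sup>+x'. \<integral>\<^sup>+y. indicator ({x} \<times> ((\<lambda>z. z - x) -` B)) (x', y) \<partial>L (\<omega>, x') \<partial>\<Phi> \<omega>)"
        by (rule elim(1)[rule_format]) (intro borel_measurable_indicator origin_strip_sets C)
      also have "\<dots> = (\<integral>\<^sup>+x'. emeasure (L (\<omega>, x')) ((\<lambda>z. z - x) -` B) * indicator {x} x' \<partial>\<Phi> \<omega>)"
      proof (rule nn_integral_cong)
        fix x'
        have "(\<integral>\<^sup>+y. indicator ({x} \<times> ((\<lambda>z. z - x) -` B)) (x', y) \<partial>L (\<omega>, x')) =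
            (\<integral>\<^sup>+y. indicator {x} x' * indicator ((\<lambda>z. z - x) -` B) y \<partial>L (\<omega>, x'))"
          by (intro nn_integral_cong) (auto simp: indicator_def)
        also have "\<dots> = indicator {x} x' * emeasure (L (\<omega>, x')) ((\<lambda>z. z - x) -` B)"
          by (rule nn_integral_cmult_indicator) (simp add: Ls C)
        finally show "(\<integral>\<^sup>+y. indicator ({x} \<times> ((\<lambda>z. z - x) -` B)) (x', y) \<partial>L (\<omega>, x')) =
            emeasure (L (\<omega>, x')) ((\<lambda>z. z - x) -` B) * indicator {x} x'" by (simp add: mult.commute)
      qed
      also have "\<dots> = emeasure (L (\<omega>, x)) ((\<lambda>z. z - x) -` B) * emeasure (\<Phi> \<omega>) {x}"
        by (rule nn_integral_indicator_singleton) simp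
      finally show ?thesis .
    qed
    have L1: "emeasure (L (\<omega>, x)) UNIV = 1"
      using prob_space.emeasure_space_1[OF Ls(3)[of x]] Ls(4)[of x] by simp
    have tot: "emeasure ?\<mu> ({0} \<times> UNIV) = emeasure (\<Phi> \<omega>) {x}" using strip[of UNIV] L1 by simp
    then have eq: "origin_kernel_total ?\<mu> = origin_kernel ?\<mu>" using x fin by (simp add: origin_kernel_total_def)
    have "origin_kernel ?\<mu> = shift_measure x (L (\<omega>, x))"
    proof (rule measure_eqI)
      show "sets (origin_kernel ?\<mu>) = sets (shift_measure x (L (\<omega>, x)))" by (simp add: origin_kernel_def shift_measure_def)
      fix B assume "B \<in> sets (origin_kernel ?\<mu>)"
      then have B: "B \<in> sets borel" by (simp add: origin_kernel_def)
      have m: "(\<lambda>y. y - x) \<in> L (\<omega>, x) \<rightarrow>\<^sub>M borel" unfolding measurable_cong_sets[OF Ls(2) refl] by measurable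
      have "emeasure (origin_kernel ?\<mu>) B = emeasure (L (\<omega>, x)) ((\<lambda>z. z - x) -` B) * emeasure (\<Phi> \<omega>) {x} / emeasure (\<Phi> \<omega>) {x}"
        by (simp add: emeasure_origin_kernel[OF sets_diag_shift B] strip[OF B] tot)
      also have "\<dots> = emeasure (L (\<omega>, x)) ((\<lambda>z. z - x) -` B)"
        using x fin by (intro ennreal_mult_divide_eq) auto
      also have "\<dots> = emeasure (shift_measure x (L (\<omega>, x))) B"
        unfolding shift_measure_def by (subst emeasure_distr[OF m B]) (simp add: Ls)
      finally show "emeasure (origin_kernel ?\<mu>) B = emeasure (shift_measure x (L (\<omega>, x))) B" .
    qed
    then show "0 < emeasure (first_marginal ?\<mu>) {0} \<and> origin_kernel ?\<mu> = origin_kernel_total ?\<mu> \<and>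
      origin_kernel_total ?\<mu> = shift_measure x (L (\<omega>, x))"
      using eq x by (simp add: emeasure_first_marginal_diag_shift[OF sT])
  qed
qed

end

section \<open>Diagonal contributions and their Palm representation\<close>

lemma nn_integral_distr':
  assumes "g \<in> M \<rightarrow>\<^sub>M N" "f \<in> borel_measurable N"
  shows "(\<integral>\<^sup>+x. f x \<partial>distr M N g) = (\<integral>\<^sup>+x. f (g x) \<partial>M)"
  using assms by (intro nn_integral_distr) simp_all

abbreviation double :: "'a::euclidean_space measure \<Rightarrow> ('a \<times> 'a) measure" where
  "double \<pi> \<equiv> \<pi> \<Otimes>\<^sub>M \<pi>"

text \<open>The joint law of two points drawn independently from one common random measure with law
  \<open>F \<pi>\<close>; its deviation from \<open>double \<pi>\<close> is the source of the
  excess.\<close>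

definition mix_double :: "('a::euclidean_space measure \<Rightarrow> 'a measure measure) \<Rightarrow> 'a measure \<Rightarrow> ('a \<times> 'a) measure" where
  "mix_double F \<pi> = mixture (F \<pi>) double (borel \<Otimes>\<^sub>M borel)"

lemma pair_prob_algebra_measurable:
  assumes f: "f \<in> M \<rightarrow>\<^sub>M prob_algebra N" and g: "g \<in> M \<rightarrow>\<^sub>M prob_algebra N'"
  shows "(\<lambda>x. f x \<Otimes>\<^sub>M g x) \<in> M \<rightarrow>\<^sub>M prob_algebra (N \<Otimes>\<^sub>M N')"
proof (rule measurable_prob_algebraI)
  fix x assume x: "x \<in> space M"
  interpret F: prob_space "f x" by (rule sets_prob_algebra_kernel(2)[OF f x])
  interpret G: prob_space "g x" by (rule sets_prob_algebra_kernel(2)[OF g x])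
  interpret pair_prob_space "f x" "g x" ..
  show "prob_space (f x \<Otimes>\<^sub>M g x)" by (rule P.prob_space_axioms)
qed (rule measurable_pair_measure[OF measurable_prob_algebraD[OF f] measurable_prob_algebraD[OF g]])

lemma double_measurable [measurable]: "double \<in> prob_algebra borel \<rightarrow>\<^sub>M prob_algebra (borel \<Otimes>\<^sub>M borel)"
  by (rule pair_prob_algebra_measurable) simp_all

lemma mixture_prob_algebra_measurable:
  assumes Q: "Q \<in> M \<rightarrow>\<^sub>M prob_algebra N" and \<kappa>: "\<kappa> \<in> N \<rightarrow>\<^sub>M prob_algebra R"
  shows "(\<lambda>x. mixture (Q x) \<kappa> R) \<in> M \<rightarrow>\<^sub>M prob_algebra R"
proof (rule measurable_prob_algebraI)
  have \<kappa>': "\<kappa> \<in> Q x \<rightarrow>\<^sub>M prob_algebra R" if "x \<in> space M" for x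
    using \<kappa> measurable_cong_sets[OF sets_prob_algebra_kernel(1)[OF Q that] refl] by blast
  show p: "prob_space (mixture (Q x) \<kappa> R)" if x: "x \<in> space M" for x
  proof (rule prob_spaceI)
    interpret prob_space "Q x" by (rule sets_prob_algebra_kernel(2)[OF Q x])
    show "emeasure (mixture (Q x) \<kappa> R) (space (mixture (Q x) \<kappa> R)) = 1"
      using emeasure_space_mixture_prob[OF \<kappa>'[OF x]] emeasure_space_1 by simp
  qed
  show "(\<lambda>x. mixture (Q x) \<kappa> R) \<in> M \<rightarrow>\<^sub>M subprob_algebra R"
  proof (rule measurable_subprob_algebra)
    show "subprob_space (mixture (Q x) \<kappa> R)" if "x \<in> space M" for x
      by (rule prob_space_imp_subprob_space[OF p[OF that]])
    fix A assume A: "A \<in> sets R"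
    have "(\<lambda>x. \<integral>\<^sup>+y. emeasure (\<kappa> y) A \<partial>Q x) \<in> borel_measurable M"
      by (rule nn_integral_prob_algebra_kernel[OF Q emeasure_prob_algebra_kernel[OF \<kappa> A]])
    also have "?this \<longleftrightarrow> (\<lambda>x. emeasure (mixture (Q x) \<kappa> R) A) \<in> borel_measurable M"
      by (intro measurable_cong) (simp add: emeasure_mixture_prob[OF \<kappa>' A])
    finally show "(\<lambda>x. emeasure (mixture (Q x) \<kappa> R) A) \<in> borel_measurable M" .
  qed simp
qed

lemma mix_double_measurable:
  assumes "F \<in> prob_algebra borel \<rightarrow>\<^sub>M prob_algebra (prob_algebra borel)"
  shows "mix_double F \<in> prob_algebra borel \<rightarrow>\<^sub>M prob_algebra (borel \<Otimes>\<^sub>M borel)"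
  unfolding mix_double_def[abs_def] by (rule mixture_prob_algebra_measurable[OF assms double_measurable])

lemma space_prob_borel:
  assumes "\<pi> \<in> space (prob_algebra (borel :: 'a::euclidean_space measure))"
  shows "sets \<pi> = sets borel" "space \<pi> = UNIV" "prob_space \<pi>" "sets (double \<pi>) = sets (borel \<Otimes>\<^sub>M borel)"
proof -
  show s: "sets \<pi> = sets borel" and "prob_space \<pi>" using assms by (auto simp: space_prob_algebra)
  show "space \<pi> = UNIV" using sets_eq_imp_space_eq[OF s] by simp
  show "sets (double \<pi>) = sets (borel \<Otimes>\<^sub>M borel)" by (intro sets_pair_measure_cong s)
qed

lemma nn_integral_double:
  assumes \<pi>: "\<pi> \<in> space (prob_algebra (borel :: 'a::euclidean_space measure))"
    and H: "H \<in> borel_measurable (borel \<Otimes>\<^sub>M borel)"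
  shows "(\<integral>\<^sup>+p. H p \<partial>double \<pi>) = (\<integral>\<^sup>+u. \<integral>\<^sup>+v. H (u, v) \<partial>\<pi> \<partial>\<pi>)"
proof -
  interpret prob_space \<pi> by (rule space_prob_borel[OF \<pi>])
  show ?thesis
    by (rule nn_integral_fst[symmetric]) (use H measurable_cong_sets[OF space_prob_borel(4)[OF \<pi>] refl] in blast)
qed

lemma shift_measure_measurable [measurable]: "shift_measure x \<in> prob_algebra borel \<rightarrow>\<^sub>M prob_algebra borel"
  unfolding shift_measure_def[abs_def] by (rule measurable_distr_prob_space) measurable

definition shift_equivariant :: "('a::euclidean_space measure \<Rightarrow> ('a \<times> 'a) measure) \<Rightarrow> bool" where
  "shift_equivariant R \<longleftrightarrow> (\<forall>x. \<forall>\<pi>\<in>space (prob_algebra borel). \<forall>H\<in>borel_measurable (borel \<Otimes>\<^sub>M borel).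
     (\<integral>\<^sup>+p. H p \<partial>R (shift_measure x \<pi>)) = (\<integral>\<^sup>+p. H (fst p - x, snd p - x) \<partial>R \<pi>))"

lemma shift_equivariant_double: "shift_equivariant double"
  unfolding shift_equivariant_def
proof (intro allI ballI)
  fix x :: 'a and \<pi> :: "'a measure" and H :: "'a \<times> 'a \<Rightarrow> ennreal"
  assume \<pi>: "\<pi> \<in> space (prob_algebra borel)" and H [measurable]: "H \<in> borel_measurable (borel \<Otimes>\<^sub>M borel)"
  have s: "shift_measure x \<pi> \<in> space (prob_algebra borel)"
    using measurable_space[OF shift_measure_measurable \<pi>] .
  have m: "(\<lambda>y. y - x) \<in> \<pi> \<rightarrow>\<^sub>M borel" unfolding measurable_cong_sets[OF space_prob_borel(1)[OF \<pi>] refl] by measurable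
  interpret prob_space \<pi> by (rule space_prob_borel[OF \<pi>])
  have nn: "(\<integral>\<^sup>+u. g u \<partial>shift_measure x \<pi>) = (\<integral>\<^sup>+u. g (u - x) \<partial>\<pi>)" if "g \<in> borel_measurable borel" for g
    unfolding shift_measure_def by (rule nn_integral_distr'[OF m that])
  have sf: "sigma_finite_measure (shift_measure x \<pi>)"
    using space_prob_borel(3)[OF s] by (rule prob_space_imp_sigma_finite)
  have "(\<lambda>u. \<integral>\<^sup>+v. H (u, v) \<partial>shift_measure x \<pi>) \<in> borel_measurable borel"
  proof -
    have "H \<in> borel_measurable (borel \<Otimes>\<^sub>M shift_measure x \<pi>)"
      using H measurable_cong_sets[OF sets_pair_measure_cong[OF refl space_prob_borel(1)[OF s]] refl] by blast
    then show ?thesis using sigma_finite_measure.borel_measurable_nn_integral_fst[OF sf] by blast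
  qed
  then have "(\<integral>\<^sup>+p. H p \<partial>double (shift_measure x \<pi>)) = (\<integral>\<^sup>+u. \<integral>\<^sup>+v. H (u - x, v) \<partial>shift_measure x \<pi> \<partial>\<pi>)"
    unfolding nn_integral_double[OF s H] by (rule nn)
  also have "\<dots> = (\<integral>\<^sup>+u. \<integral>\<^sup>+v. H (u - x, v - x) \<partial>\<pi> \<partial>\<pi>)"
    by (intro nn_integral_cong nn) measurable
  also have "\<dots> = (\<integral>\<^sup>+p. H (fst p - x, snd p - x) \<partial>double \<pi>)"
    by (subst nn_integral_double[OF \<pi>]) simp_all
  finally show "(\<integral>\<^sup>+p. H p \<partial>double (shift_measure x \<pi>)) = (\<integral>\<^sup>+p. H (fst p - x, snd p - x) \<partial>double \<pi>)" .
qed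

lemma nn_integral_mix_double:
  assumes F: "F \<in> prob_algebra borel \<rightarrow>\<^sub>M prob_algebra (prob_algebra borel)"
    and \<pi>: "\<pi> \<in> space (prob_algebra borel)" and H: "H \<in> borel_measurable (borel \<Otimes>\<^sub>M borel)"
  shows "(\<integral>\<^sup>+p. H p \<partial>mix_double F \<pi>) = (\<integral>\<^sup>+\<pi>'. \<integral>\<^sup>+p. H p \<partial>double \<pi>' \<partial>F \<pi>)"
  unfolding mix_double_def
  by (rule nn_integral_mixture_prob[OF _ H])
     (use double_measurable measurable_cong_sets[OF sets_prob_algebra_kernel(1)[OF F \<pi>] refl] in blast)

lemma shift_equivariant_mix_double:
  assumes F: "F \<in> prob_algebra borel \<rightarrow>\<^sub>M prob_algebra (prob_algebra (borel :: 'a::euclidean_space measure))"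
    and shift: "\<And>\<pi> x. \<pi> \<in> space (prob_algebra borel) \<Longrightarrow> F (shift_measure x \<pi>) = distr (F \<pi>) (prob_algebra borel) (shift_measure x)"
  shows "shift_equivariant (mix_double F)"
  unfolding shift_equivariant_def
proof (intro allI ballI)
  fix x :: 'a and \<pi> :: "'a measure" and H :: "'a \<times> 'a \<Rightarrow> ennreal"
  assume \<pi>: "\<pi> \<in> space (prob_algebra borel)" and H [measurable]: "H \<in> borel_measurable (borel \<Otimes>\<^sub>M borel)"
  have s: "shift_measure x \<pi> \<in> space (prob_algebra borel)" using measurable_space[OF shift_measure_measurable \<pi>] .
  have sm: "shift_measure x \<in> F \<pi> \<rightarrow>\<^sub>M prob_algebra borel"
    using shift_measure_measurable measurable_cong_sets[OF sets_prob_algebra_kernel(1)[OF F \<pi>] refl] by blast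
  have Hx: "(\<lambda>p. H (fst p - x, snd p - x)) \<in> borel_measurable (borel \<Otimes>\<^sub>M borel)" by measurable
  have "(\<integral>\<^sup>+p. H p \<partial>mix_double F (shift_measure x \<pi>)) = (\<integral>\<^sup>+\<pi>'. \<integral>\<^sup>+p. H p \<partial>double \<pi>' \<partial>distr (F \<pi>) (prob_algebra borel) (shift_measure x))"
    unfolding nn_integral_mix_double[OF F s H] shift[OF \<pi>] ..
  also have "\<dots> = (\<integral>\<^sup>+\<pi>'. \<integral>\<^sup>+p. H p \<partial>double (shift_measure x \<pi>') \<partial>F \<pi>)"
    by (rule nn_integral_distr'[OF sm nn_integral_prob_algebra_kernel[OF double_measurable H]])
  also have "\<dots> = (\<integral>\<^sup>+\<pi>'. \<integral>\<^sup>+p. H (fst p - x, snd p - x) \<partial>double \<pi>' \<partial>F \<pi>)"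
    using shift_equivariant_double H sets_prob_algebra_kernel(3)[OF F \<pi>]
    unfolding shift_equivariant_def by (intro nn_integral_cong) blast
  also have "\<dots> = (\<integral>\<^sup>+p. H (fst p - x, snd p - x) \<partial>mix_double F \<pi>)"
    by (rule nn_integral_mix_double[OF F \<pi> Hx, symmetric])
  finally show "(\<integral>\<^sup>+p. H p \<partial>mix_double F (shift_measure x \<pi>)) = (\<integral>\<^sup>+p. H (fst p - x, snd p - x) \<partial>mix_double F \<pi>)" .
qed

section \<open>Diagonal terms under the mass-weighted Palm measure\<close>

context disintegrated_transport
begin

definition mass0 :: "('a \<times> 'a) measure \<Rightarrow> ennreal" where
  "mass0 \<mu> = emeasure (first_marginal \<mu>) {0}"

lemma mass0_eq: "\<mu> \<in> space lf_measures \<Longrightarrow> mass0 \<mu> = emeasure \<mu> ({0} \<times> UNIV)"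
proof -
  assume "\<mu> \<in> space lf_measures"
  then have s: "sets \<mu> = sets borel" by (simp add: space_lf_measures locally_finite_measure_def)
  have "fst \<in> \<mu> \<rightarrow>\<^sub>M borel" using measurable_fst_borel measurable_cong_sets[OF s refl] by blast
  then show ?thesis
    unfolding mass0_def first_marginal_def using sets_eq_imp_space_eq[OF s]
    by (subst emeasure_distr) (auto intro!: arg_cong2[where f=emeasure])
qed

lemma mass0_measurable [measurable]: "mass0 \<in> borel_measurable lf_measures"
  using measurable_emeasure_lf[OF origin_strip_sets[of UNIV 0]] by (simp add: mass0_eq cong: measurable_cong)

text \<open>Its total mass is the intensity times the Palm expectation of the mass at the origin,
  which the moment condition makes finite; all diagonal contributions become integrals against
  it.\<close>

definition palm_weighted :: "('a \<times> 'a) measure measure" where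
  "palm_weighted = density palm_unnormalized mass0"

lemma sets_palm_weighted [simp]: "sets palm_weighted = sets lf_measures"
  and space_palm_weighted [simp]: "space palm_weighted = space lf_measures"
  by (simp_all add: palm_weighted_def)

lemma measurable_palm [simp]: "measurable palm_unnormalized N = measurable lf_measures N"
    "measurable palm_weighted N = measurable lf_measures N"
  by (rule measurable_cong_sets; simp)+

text \<open>An expected sum over atoms with squared masses: one factor of the mass is explicit, the
  other comes from integrating over \<Phi>.\<close>

definition diagonal_moment :: "('a measure \<Rightarrow> ('a \<times> 'a) measure) \<Rightarrow> ('a \<times> 'a \<Rightarrow> ennreal) \<Rightarrow> ennreal" where
  "diagonal_moment R H = (\<integral>\<^sup>+\<omega>. \<integral>\<^sup>+x. emeasure (\<Phi> \<omega>) {x} * (\<integral>\<^sup>+p. H p \<partial>R (L (\<omega>, x))) \<partial>\<Phi> \<omega> \<partial>P)"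

text \<open>The law of second minus first point of a pair drawn by \<open>R\<close> from the kernel
  at the origin, averaged over \<open>palm_weighted\<close>. For \<open>mix_double F\<close> and
  \<open>double\<close> the transforms of these measures make up \<open>eta_hat\<close>.\<close>

definition difference_measure :: "('a measure \<Rightarrow> ('a \<times> 'a) measure) \<Rightarrow> 'a measure" where
  "difference_measure R = mixture palm_weighted (\<lambda>\<mu>. distr (R (origin_kernel_total \<mu>)) borel (\<lambda>p. snd p - fst p)) borel"

lemma difference_kernel_measurable:
  fixes R :: "'a measure \<Rightarrow> ('a \<times> 'a) measure"
  assumes R: "R \<in> prob_algebra borel \<rightarrow>\<^sub>M prob_algebra (borel \<Otimes>\<^sub>M borel)"
  shows "(\<lambda>\<mu>. distr (R (origin_kernel_total \<mu>)) borel (\<lambda>p. snd p - fst p)) \<in> palm_weighted \<rightarrow>\<^sub>M prob_algebra borel"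
proof -
  have RO: "(\<lambda>\<mu>. R (origin_kernel_total \<mu>)) \<in> lf_measures \<rightarrow>\<^sub>M prob_algebra (borel \<Otimes>\<^sub>M borel)"
    by (rule measurable_compose[OF origin_kernel_total_measurable R])
  have d: "(\<lambda>p. snd p - fst p) \<in> borel \<Otimes>\<^sub>M borel \<rightarrow>\<^sub>M (borel :: 'a measure)" by measurable
  show ?thesis
    using measurable_compose[OF RO measurable_distr_prob_space[OF d]] by simp
qed

text \<open>Re-centring at the atom turns \<open>L (\<omega>, x)\<close> into the kernel at the
  origin and \<open>H\<close> into a translate, so Campbell's formula replaces the atom by Lebesgue
  measure. Translating by the first point of the pair then leaves only the difference of the
  pair.\<close>

lemma diagonal_moment_eq:
  assumes R: "R \<in> prob_algebra borel \<rightarrow>\<^sub>M prob_algebra (borel \<Otimes>\<^sub>M borel)" and eqv: "shift_equivariant R"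
    and H [measurable]: "H \<in> borel_measurable (borel \<Otimes>\<^sub>M borel)"
  shows "diagonal_moment R H = (\<integral>\<^sup>+w. \<integral>\<^sup>+z. H (z, z + w) \<partial>lborel \<partial>difference_measure R)"
proof -
  have RO: "(\<lambda>\<mu>. R (origin_kernel_total \<mu>)) \<in> lf_measures \<rightarrow>\<^sub>M prob_algebra (borel \<Otimes>\<^sub>M borel)"
    by (rule measurable_compose[OF origin_kernel_total_measurable R])
  define u where "u q = mass0 (snd q) * (\<integral>\<^sup>+p. H (fst p + fst q, snd p + fst q) \<partial>R (origin_kernel_total (snd q)))" for q
  have u: "u \<in> borel_measurable (borel \<Otimes>\<^sub>M lf_measures)"
  proof -
    have "(\<lambda>q. \<integral>\<^sup>+p. H (fst p + fst q, snd p + fst q) \<partial>R (origin_kernel_total (snd q))) \<in> borel_measurable ((borel :: 'a measure) \<Otimes>\<^sub>M lf_measures)"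
    proof (rule nn_integral_measurable_subprob_algebra2[where N="borel \<Otimes>\<^sub>M borel"])
      show "(\<lambda>(q, p). H (fst p + fst q, snd p + fst q)) \<in> borel_measurable ((borel \<Otimes>\<^sub>M lf_measures) \<Otimes>\<^sub>M (borel \<Otimes>\<^sub>M borel))"
        by measurable
      show "(\<lambda>q. R (origin_kernel_total (snd q))) \<in> (borel :: 'a measure) \<Otimes>\<^sub>M lf_measures \<rightarrow>\<^sub>M subprob_algebra (borel \<Otimes>\<^sub>M borel)"
        by (rule measurable_prob_algebraD[OF measurable_compose[OF measurable_snd RO]])
    qed
    then show ?thesis unfolding u_def by measurable
  qed
  have "diagonal_moment R H = (\<integral>\<^sup>+\<omega>. \<integral>\<^sup>+x. u (x, diag_shift x (T \<omega>)) \<partial>\<Phi> \<omega> \<partial>P)"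
    unfolding diagonal_moment_def
  proof (rule nn_integral_cong_AE)
    show "AE \<omega> in P. (\<integral>\<^sup>+x. emeasure (\<Phi> \<omega>) {x} * (\<integral>\<^sup>+p. H p \<partial>R (L (\<omega>, x))) \<partial>\<Phi> \<omega>) = (\<integral>\<^sup>+x. u (x, diag_shift x (T \<omega>)) \<partial>\<Phi> \<omega>)"
      using AE_origin_kernel AE_space
    proof eventually_elim
      case (elim \<omega>)
      show ?case
      proof (rule nn_integral_cong_AE)
        from elim(1) show "AE x in \<Phi> \<omega>. emeasure (\<Phi> \<omega>) {x} * (\<integral>\<^sup>+p. H p \<partial>R (L (\<omega>, x))) = u (x, diag_shift x (T \<omega>))"
        proof eventually_elim
          fix x assume x: "0 < emeasure (first_marginal (diag_shift x (T \<omega>))) {0} \<and>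
             origin_kernel (diag_shift x (T \<omega>)) = origin_kernel_total (diag_shift x (T \<omega>)) \<and>
             origin_kernel_total (diag_shift x (T \<omega>)) = shift_measure x (L (\<omega>, x))"
          have Ls: "L (\<omega>, x) \<in> space (prob_algebra borel)"
            using kernel_section[OF L_measurable elim(2)] by (simp add: space_prob_algebra)
          have Hx: "(\<lambda>p. H (fst p + x, snd p + x)) \<in> borel_measurable (borel \<Otimes>\<^sub>M borel)" by measurable
          have "u (x, diag_shift x (T \<omega>)) = emeasure (\<Phi> \<omega>) {x} * (\<integral>\<^sup>+p. H (fst p + x, snd p + x) \<partial>R (shift_measure x (L (\<omega>, x))))"
            using x by (simp add: u_def mass0_def emeasure_first_marginal_diag_shift[OF sets_T[OF elim(2)]])
          also have "(\<integral>\<^sup>+p. H (fst p + x, snd p + x) \<partial>R (shift_measure x (L (\<omega>, x)))) = (\<integral>\<^sup>+p. H (fst p - x + x, snd p - x + x) \<partial>R (L (\<omega>, x)))"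
            using eqv[unfolded shift_equivariant_def, rule_format, OF Ls Hx, of x] by simp
          finally show "emeasure (\<Phi> \<omega>) {x} * (\<integral>\<^sup>+p. H p \<partial>R (L (\<omega>, x))) = u (x, diag_shift x (T \<omega>))" by simp
        qed
      qed
    qed
  qed
  also have "\<dots> = (\<integral>\<^sup>+\<mu>. \<integral>\<^sup>+z. u (z, \<mu>) \<partial>lborel \<partial>palm_unnormalized)" by (rule Campbell[OF u])
  also have "\<dots> = (\<integral>\<^sup>+\<mu>. mass0 \<mu> * (\<integral>\<^sup>+w. \<integral>\<^sup>+z. H (z, z + w) \<partial>lborel \<partial>distr (R (origin_kernel_total \<mu>)) borel (\<lambda>p. snd p - fst p)) \<partial>palm_unnormalized)"
  proof (rule nn_integral_cong)
    fix \<mu> :: "('a \<times> 'a) measure" assume "\<mu> \<in> space palm_unnormalized"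
    then have \<mu>: "\<mu> \<in> space lf_measures" by simp
    let ?Q = "R (origin_kernel_total \<mu>)"
    note Q = sets_prob_algebra_kernel[OF RO \<mu>]
    interpret Q: prob_space ?Q by (rule Q)
    interpret pair_sigma_finite lborel ?Q ..
    have cs: "sets (lborel \<Otimes>\<^sub>M ?Q) = sets (borel \<Otimes>\<^sub>M (borel \<Otimes>\<^sub>M borel))"
      by (intro sets_pair_measure_cong) (auto simp: Q)
    have m1: "(\<lambda>(z, p). H (fst p + z, snd p + z)) \<in> borel_measurable (lborel \<Otimes>\<^sub>M ?Q)"
      unfolding measurable_cong_sets[OF cs refl] by measurable
    have m2: "(\<lambda>p. H (fst p + z, snd p + z)) \<in> borel_measurable ?Q" for z
      unfolding measurable_cong_sets[OF Q(1) refl] by measurable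
    have m3: "(\<lambda>z. \<integral>\<^sup>+p. H (fst p + z, snd p + z) \<partial>?Q) \<in> borel_measurable lborel"
      using Q.borel_measurable_nn_integral_fst[OF m1] by simp
    have d: "(\<lambda>p. snd p - fst p) \<in> ?Q \<rightarrow>\<^sub>M borel" unfolding measurable_cong_sets[OF Q(1) refl] by measurable
    have h: "(\<lambda>w. \<integral>\<^sup>+z. H (z, z + w) \<partial>lborel) \<in> borel_measurable borel" by measurable
    have "(\<integral>\<^sup>+z. u (z, \<mu>) \<partial>lborel) = mass0 \<mu> * (\<integral>\<^sup>+z. \<integral>\<^sup>+p. H (fst p + z, snd p + z) \<partial>?Q \<partial>lborel)"
      unfolding u_def using m3 by (simp add: nn_integral_cmult)
    also have "(\<integral>\<^sup>+z. \<integral>\<^sup>+p. H (fst p + z, snd p + z) \<partial>?Q \<partial>lborel) = (\<integral>\<^sup>+p. \<integral>\<^sup>+z. H (fst p + z, snd p + z) \<partial>lborel \<partial>?Q)"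
      by (rule Fubini'[OF m1, symmetric])
    also have "\<dots> = (\<integral>\<^sup>+p. \<integral>\<^sup>+z. H (z, z + (snd p - fst p)) \<partial>lborel \<partial>?Q)"
    proof (rule nn_integral_cong)
      fix p :: "'a \<times> 'a"
      have "(\<lambda>z. H (z, z + (snd p - fst p))) \<in> borel_measurable borel" by measurable
      from nn_integral_lborel_subst(1)[OF this, of "fst p"]
      show "(\<integral>\<^sup>+z. H (fst p + z, snd p + z) \<partial>lborel) = (\<integral>\<^sup>+z. H (z, z + (snd p - fst p)) \<partial>lborel)"
        by (simp add: algebra_simps)
    qed
    also have "\<dots> = (\<integral>\<^sup>+w. \<integral>\<^sup>+z. H (z, z + w) \<partial>lborel \<partial>distr ?Q borel (\<lambda>p. snd p - fst p))"
      by (rule nn_integral_distr'[OF d h, symmetric])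
    finally show "(\<integral>\<^sup>+z. u (z, \<mu>) \<partial>lborel) = mass0 \<mu> * (\<integral>\<^sup>+w. \<integral>\<^sup>+z. H (z, z + w) \<partial>lborel \<partial>distr ?Q borel (\<lambda>p. snd p - fst p))" .
  qed
  also have "\<dots> = (\<integral>\<^sup>+w. \<integral>\<^sup>+z. H (z, z + w) \<partial>lborel \<partial>difference_measure R)"
  proof -
    have h: "(\<lambda>w. \<integral>\<^sup>+z. H (z, z + w) \<partial>lborel) \<in> borel_measurable borel" by measurable
    show ?thesis
      unfolding difference_measure_def nn_integral_mixture_prob[OF difference_kernel_measurable[OF R] h]
      unfolding palm_weighted_def
      using nn_integral_prob_algebra_kernel[OF difference_kernel_measurable[OF R] h]
      by (subst nn_integral_density) simp_all
  qed
  finally show ?thesis .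
qed

lemma sets_difference_measure [simp]: "sets (difference_measure R) = sets borel"
  by (simp add: difference_measure_def)

lemma finite_palm_weighted:
  assumes "(\<integral>\<^sup>+\<mu>. emeasure (first_marginal \<mu>) {0} \<partial>palm_measure P T) < \<infinity>"
  shows "finite_measure palm_weighted"
proof (rule finite_measureI)
  have "(\<integral>\<^sup>+\<mu>. mass0 \<mu> \<partial>palm_measure P T) = (1 / intensity P \<Phi>) * (\<integral>\<^sup>+\<mu>. mass0 \<mu> \<partial>palm_unnormalized)"
    unfolding palm_measure_eq by (rule nn_integral_scale_measure) simp
  then have "(1 / intensity P \<Phi>) * (\<integral>\<^sup>+\<mu>. mass0 \<mu> \<partial>palm_unnormalized) < \<infinity>" using assms by (simp add: mass0_def)
  moreover have "1 / intensity P \<Phi> \<noteq> 0" using intensity_finite by (simp add: ennreal_divide_eq_0_iff)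
  ultimately have fin: "(\<integral>\<^sup>+\<mu>. mass0 \<mu> \<partial>palm_unnormalized) < \<infinity>" by (auto simp: ennreal_mult_less_top)
  show "emeasure palm_weighted (space palm_weighted) \<noteq> \<infinity>"
  proof -
    have "emeasure palm_weighted (space palm_weighted) = (\<integral>\<^sup>+\<mu>. mass0 \<mu> * indicator (space lf_measures) \<mu> \<partial>palm_unnormalized)"
      by (simp add: palm_weighted_def emeasure_density)
    also have "\<dots> = (\<integral>\<^sup>+\<mu>. mass0 \<mu> \<partial>palm_unnormalized)" by (intro nn_integral_cong) simp
    finally have "emeasure palm_weighted (space palm_weighted) = (\<integral>\<^sup>+\<mu>. mass0 \<mu> \<partial>palm_unnormalized)" .
    with fin show ?thesis by simp
  qed
qed

lemma finite_difference_measure: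
  assumes fin: "finite_measure palm_weighted" and R: "R \<in> prob_algebra borel \<rightarrow>\<^sub>M prob_algebra (borel \<Otimes>\<^sub>M borel)"
  shows "finite_measure (difference_measure R)"
proof (rule finite_measureI)
  interpret finite_measure palm_weighted by fact
  show "emeasure (difference_measure R) (space (difference_measure R)) \<noteq> \<infinity>"
    unfolding difference_measure_def space_mixture emeasure_space_mixture_prob[OF difference_kernel_measurable[OF R]] by simp
qed

lemma fourier_difference_measure:
  assumes fin: "finite_measure palm_weighted" and R: "R \<in> prob_algebra borel \<rightarrow>\<^sub>M prob_algebra (borel \<Otimes>\<^sub>M borel)"
  shows "(LINT w|difference_measure R. cis (- (k \<bullet> w))) =
      (LINT \<mu>|palm_weighted. LINT p|R (origin_kernel_total \<mu>). cis (- (k \<bullet> (snd p - fst p))))" (is ?eq)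
    and "integrable palm_weighted (\<lambda>\<mu>. LINT p|R (origin_kernel_total \<mu>). cis (- (k \<bullet> (snd p - fst p))))" (is ?int)
proof -
  have RO: "(\<lambda>\<mu>. R (origin_kernel_total \<mu>)) \<in> lf_measures \<rightarrow>\<^sub>M prob_algebra (borel \<Otimes>\<^sub>M borel)"
    by (rule measurable_compose[OF origin_kernel_total_measurable R])
  have e: "(LINT w|distr (R (origin_kernel_total \<mu>)) borel (\<lambda>p. snd p - fst p). cis (- (k \<bullet> w))) =
      (LINT p|R (origin_kernel_total \<mu>). cis (- (k \<bullet> (snd p - fst p))))" if "\<mu> \<in> space palm_weighted" for \<mu>
  proof -
    have "\<mu> \<in> space lf_measures" using that by simp
    then have "(\<lambda>p. snd p - fst p) \<in> R (origin_kernel_total \<mu>) \<rightarrow>\<^sub>M borel"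
      unfolding measurable_cong_sets[OF sets_prob_algebra_kernel(1)[OF RO \<open>\<mu> \<in> space lf_measures\<close>] refl] by measurable
    then show ?thesis by (subst integral_distr) auto
  qed
  have c: "(\<lambda>w. cis (- (k \<bullet> w))) \<in> borel_measurable borel" "\<And>w. cmod (cis (- (k \<bullet> w))) \<le> 1" by simp_all
  show ?eq
    unfolding difference_measure_def integral_mixture(1)[OF fin difference_kernel_measurable[OF R] c]
    by (intro Bochner_Integration.integral_cong refl e)
  show ?int
    using integral_mixture(2)[OF fin difference_kernel_measurable[OF R] c]
    by (rule Bochner_Integration.integrable_cong[THEN iffD1, rotated -1]) (use e in auto)
qed

end

section \<open>The excess spectral density\<close>

lemma fourier_measure_measurable [measurable]:
  "(\<lambda>\<pi>. fourier_measure \<pi> k) \<in> borel_measurable (prob_algebra (borel :: 'a::euclidean_space measure))"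
  unfolding fourier_measure_def prob_algebra_def
  by (intro measurable_restrict_space1 integral_measurable_subprob_algebra) measurable

text \<open>The transform of the difference of two independent points with a common law is a
  transform times its own conjugate.\<close>

lemma fourier_double:
  assumes \<pi>: "\<pi> \<in> space (prob_algebra (borel :: 'a::euclidean_space measure))"
  shows "(LINT p|double \<pi>. cis (- (k \<bullet> (snd p - fst p)))) = of_real ((cmod (fourier_measure \<pi> k))\<^sup>2)"
proof -
  interpret prob_space \<pi> by (rule space_prob_borel[OF \<pi>])
  interpret pair_prob_space \<pi> \<pi> ..
  note [measurable_cong] = space_prob_borel(1)[OF \<pi>]
  have i: "integrable (double \<pi>) (\<lambda>p. cis (- (k \<bullet> (snd p - fst p))))"
    by (rule P.integrable_const_bound[of _ 1]) auto
  have "(LINT p|double \<pi>. cis (- (k \<bullet> (snd p - fst p)))) = (LINT u|\<pi>. LINT v|\<pi>. cis (- (k \<bullet> (v - u))))"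
    using integral_fst'[OF i] by simp
  also have "\<dots> = (LINT u|\<pi>. cis (k \<bullet> u) * fourier_measure \<pi> k)"
  proof (rule Bochner_Integration.integral_cong[OF refl])
    fix u
    have "(LINT v|\<pi>. cis (- (k \<bullet> (v - u)))) = (LINT v|\<pi>. cis (k \<bullet> u) * cis (- (k \<bullet> v)))"
      by (intro Bochner_Integration.integral_cong refl) (simp add: cis_mult inner_diff_right)
    then show "(LINT v|\<pi>. cis (- (k \<bullet> (v - u)))) = cis (k \<bullet> u) * fourier_measure \<pi> k"
      by (simp add: fourier_measure_def)
  qed
  also have "\<dots> = (LINT u|\<pi>. cnj (cis (- (k \<bullet> u)))) * fourier_measure \<pi> k" by (simp add: cis_cnj)
  also have "\<dots> = of_real ((cmod (fourier_measure \<pi> k))\<^sup>2)"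
    unfolding complex_norm_square by (simp add: fourier_measure_def mult.commute del: of_real_power)
  finally show ?thesis .
qed

lemma cmod_fourier_measure_le_1:
  assumes "prob_space \<pi>"
  shows "cmod (fourier_measure \<pi> k) \<le> 1"
proof -
  interpret prob_space \<pi> by fact
  have "cmod (fourier_measure \<pi> k) \<le> (LINT x|\<pi>. cmod (cis (- (k \<bullet> x))))"
    unfolding fourier_measure_def by (rule integral_norm_bound)
  then show ?thesis by (simp add: prob_space)
qed

definition mean_power :: "('a::euclidean_space measure \<Rightarrow> 'a measure measure) \<Rightarrow> 'a \<Rightarrow> 'a measure \<Rightarrow> real" where
  "mean_power F k \<pi> = (LINT \<pi>'|F \<pi>. (cmod (fourier_measure \<pi>' k))\<^sup>2)"

context
  fixes F :: "'a::euclidean_space measure \<Rightarrow> 'a measure measure"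
  assumes F: "F \<in> prob_algebra borel \<rightarrow>\<^sub>M prob_algebra (prob_algebra borel)"
begin

lemma fourier_mix_double:
  assumes \<pi>: "\<pi> \<in> space (prob_algebra borel)"
  shows "(LINT p|mix_double F \<pi>. cis (- (k \<bullet> (snd p - fst p)))) = of_real (mean_power F k \<pi>)"
proof -
  note Fp = sets_prob_algebra_kernel[OF F \<pi>]
  interpret prob_space "F \<pi>" by (rule Fp)
  have d: "double \<in> F \<pi> \<rightarrow>\<^sub>M prob_algebra (borel \<Otimes>\<^sub>M borel)"
    using double_measurable measurable_cong_sets[OF Fp(1) refl] by blast
  have "(LINT p|mix_double F \<pi>. cis (- (k \<bullet> (snd p - fst p)))) = (LINT \<pi>'|F \<pi>. LINT p|double \<pi>'. cis (- (k \<bullet> (snd p - fst p))))"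
    unfolding mix_double_def
    by (rule integral_mixture(1)[OF finite_measure_axioms d, of _ 1]) auto
  also have "\<dots> = (LINT \<pi>'|F \<pi>. of_real ((cmod (fourier_measure \<pi>' k))\<^sup>2))"
    by (intro Bochner_Integration.integral_cong refl fourier_double) (simp add: Fp)
  finally show ?thesis by (simp only: integral_complex_of_real mean_power_def)
qed

lemma mean_power_measurable [measurable]: "mean_power F k \<in> borel_measurable (prob_algebra borel)"
proof -
  have "(\<lambda>\<pi>. (cmod (fourier_measure \<pi> k))\<^sup>2) \<in> borel_measurable (prob_algebra (borel :: 'a measure))" by measurable
  from measurable_compose[OF measurable_prob_algebraD[OF F] integral_measurable_subprob_algebra[OF this]]
  show ?thesis by (simp add: mean_power_def[abs_def])
qed

text \<open>Since \<open>F \<pi>\<close> averages to \<pi>, the transform of \<pi> is the mean of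
  the transforms under \<open>F \<pi>\<close>; its modulus is at most the mean modulus
  \<open>m\<close>, and the squared mean is at most the mean square.\<close>

lemma mean_power_ge:
  assumes mean: "\<And>B. B \<in> sets borel \<Longrightarrow> (\<integral>\<^sup>+\<pi>'. emeasure \<pi>' B \<partial>F \<pi>) = emeasure \<pi> B"
    and \<pi>: "\<pi> \<in> space (prob_algebra borel)"
  shows "(cmod (fourier_measure \<pi> k))\<^sup>2 \<le> mean_power F k \<pi>"
proof -
  note Fp = sets_prob_algebra_kernel[OF F \<pi>]
  interpret prob_space "F \<pi>" by (rule Fp)
  have fm [measurable]: "(\<lambda>\<pi>'. fourier_measure \<pi>' k) \<in> borel_measurable (F \<pi>)"
    using fourier_measure_measurable measurable_cong_sets[OF Fp(1) refl] by blast
  have idm: "(\<lambda>\<pi>'. \<pi>') \<in> F \<pi> \<rightarrow>\<^sub>M prob_algebra borel" by (rule measurable_ident_sets[OF Fp(1)])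
  have eq: "\<pi> = mixture (F \<pi>) (\<lambda>\<pi>'. \<pi>') borel"
    using mean by (intro measure_eqI) (auto simp: space_prob_borel[OF \<pi>] emeasure_mixture_prob[OF idm])
  have "fourier_measure \<pi> k = (LINT x|mixture (F \<pi>) (\<lambda>\<pi>'. \<pi>') borel. cis (- (k \<bullet> x)))"
    unfolding fourier_measure_def by (subst eq) simp
  also have "\<dots> = (LINT \<pi>'|F \<pi>. fourier_measure \<pi>' k)"
    unfolding fourier_measure_def by (rule integral_mixture(1)[OF finite_measure_axioms idm, of _ 1]) auto
  finally have e: "fourier_measure \<pi> k = (LINT \<pi>'|F \<pi>. fourier_measure \<pi>' k)" .
  let ?X = "\<lambda>\<pi>'. cmod (fourier_measure \<pi>' k)"
  have X1: "?X \<pi>' \<le> 1" if "\<pi>' \<in> space (F \<pi>)" for \<pi>'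
    using that space_prob_borel(3) by (intro cmod_fourier_measure_le_1) (simp add: Fp)
  have iX: "integrable (F \<pi>) ?X" by (rule integrable_const_bound[of _ 1]) (use X1 in auto)
  have iX2: "integrable (F \<pi>) (\<lambda>\<pi>'. (?X \<pi>')\<^sup>2)"
    by (rule integrable_const_bound[of _ 1]) (use X1 in \<open>auto simp: abs_square_le_1 power_le_one\<close>)
  define m where "m = (LINT \<pi>'|F \<pi>. ?X \<pi>')"
  have "0 \<le> (LINT \<pi>'|F \<pi>. (?X \<pi>' - m)\<^sup>2)" by (rule Bochner_Integration.integral_nonneg) simp
  also have "\<dots> = (LINT \<pi>'|F \<pi>. (?X \<pi>')\<^sup>2 - 2 * m * ?X \<pi>' + m\<^sup>2)"
    by (intro Bochner_Integration.integral_cong refl) (simp add: power2_diff algebra_simps)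
  also have "\<dots> = (LINT \<pi>'|F \<pi>. (?X \<pi>')\<^sup>2) - 2 * m * m + m\<^sup>2"
    using iX iX2 by (simp add: m_def prob_space)
  finally have "m\<^sup>2 \<le> mean_power F k \<pi>" by (simp add: mean_power_def power2_eq_square)
  moreover have "cmod (fourier_measure \<pi> k) \<le> m"
    unfolding e m_def by (rule integral_norm_bound)
  ultimately show ?thesis by (meson norm_ge_zero order_trans power_mono)
qed

end

locale transport_randomization = disintegrated_transport P T L
  for P :: "'w measure" and T :: "'w \<Rightarrow> ('a::euclidean_space \<times> 'a) measure" and L :: "'w \<times> 'a \<Rightarrow> 'a measure" +
  fixes F :: "'a measure \<Rightarrow> 'a measure measure"
  assumes F_measurable [measurable]: "F \<in> prob_algebra borel \<rightarrow>\<^sub>M prob_algebra (prob_algebra borel)"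
    and F_mean: "\<And>\<pi> B. \<pi> \<in> space (prob_algebra borel) \<Longrightarrow> B \<in> sets borel \<Longrightarrow>
          (\<integral>\<^sup>+\<pi>'. emeasure \<pi>' B \<partial>F \<pi>) = emeasure \<pi> B"
    and F_shift: "\<And>\<pi> x. \<pi> \<in> space (prob_algebra borel) \<Longrightarrow>
          F (shift_measure x \<pi>) = distr (F \<pi>) (prob_algebra borel) (shift_measure x)"
    and palm_moment: "(\<integral>\<^sup>+\<mu>. emeasure (first_marginal \<mu>) {0} \<partial>palm_measure P T) < \<infinity>"
begin

abbreviation DF :: "'a measure" where "DF \<equiv> difference_measure (mix_double F)"
abbreviation DL :: "'a measure" where "DL \<equiv> difference_measure double"

lemma finite_weighted: "finite_measure palm_weighted"
  by (rule finite_palm_weighted[OF palm_moment])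

lemma finite_DF: "finite_measure DF" and finite_DL: "finite_measure DL"
  by (intro finite_difference_measure finite_weighted mix_double_measurable F_measurable double_measurable)+

text \<open>The intensity cancels against the normalization of the Palm measure, and the mass at the
  origin becomes the density of \<open>palm_weighted\<close>. Bochner integrals want a real density,
  so \<open>mass0\<close> is first shown to be finite almost everywhere.\<close>

lemma eta_hat_eq:
  "eta_hat P T F k = (LINT \<mu>|palm_weighted. mean_power F k (origin_kernel_total \<mu>) - (cmod (fourier_measure (origin_kernel_total \<mu>) k))\<^sup>2)"
proof -
  define g where "g \<mu> = mean_power F k (origin_kernel_total \<mu>) - (cmod (fourier_measure (origin_kernel_total \<mu>) k))\<^sup>2" for \<mu> :: "('a \<times> 'a) measure"
  have [measurable]: "g \<in> borel_measurable lf_measures"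
    unfolding g_def using mean_power_measurable[OF F_measurable] by measurable
  define \<gamma> where "\<gamma> = enn2real (intensity P \<Phi>)"
  have \<gamma>: "0 < \<gamma>" "intensity P \<Phi> = ennreal \<gamma>"
    using intensity_pos intensity_finite by (auto simp: \<gamma>_def enn2real_positive_iff)
  have pm: "palm_measure P T = density palm_unnormalized (\<lambda>_. ennreal (1 / \<gamma>))"
    unfolding palm_measure_eq
  proof (rule measure_eqI)
    fix A assume "A \<in> sets (scale_measure (1 / intensity P \<Phi>) palm_unnormalized)"
    then have "A \<in> sets palm_unnormalized" by simp
    then show "emeasure (scale_measure (1 / intensity P \<Phi>) palm_unnormalized) A = emeasure (density palm_unnormalized (\<lambda>_. ennreal (1 / \<gamma>))) A"
      using \<gamma> by (simp add: emeasure_density_const divide_ennreal flip: ennreal_1)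
  qed simp
  have fin: "AE \<mu> in palm_unnormalized. mass0 \<mu> \<noteq> \<infinity>"
  proof (rule nn_integral_PInf_AE)
    show "mass0 \<in> borel_measurable palm_unnormalized" by simp
    interpret finite_measure palm_weighted by (rule finite_weighted)
    have "(\<integral>\<^sup>+\<mu>. mass0 \<mu> \<partial>palm_unnormalized) = (\<integral>\<^sup>+\<mu>. 1 \<partial>palm_weighted)"
      unfolding palm_weighted_def by (subst nn_integral_density) simp_all
    then show "(\<integral>\<^sup>+\<mu>. mass0 \<mu> \<partial>palm_unnormalized) \<noteq> \<infinity>" using emeasure_finite[of "space palm_weighted"] by simp
  qed
  have pw: "palm_weighted = density palm_unnormalized (\<lambda>\<mu>. ennreal (enn2real (mass0 \<mu>)))"
    unfolding palm_weighted_def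
    by (rule density_cong) (use fin in \<open>auto simp: less_top elim!: eventually_mono\<close>)
  \<comment> \<open>Where the mass at the origin is 0 or infinite, \<open>origin_kernel\<close> may
    differ from its total version, but the real weight is 0 there.\<close>
  have pt: "((LINT \<pi>|F (origin_kernel \<mu>). (cmod (fourier_measure \<pi> k))\<^sup>2) - (cmod (fourier_measure (origin_kernel \<mu>) k))\<^sup>2)
        * measure (first_marginal \<mu>) {0} = enn2real (mass0 \<mu>) * g \<mu>" if "\<mu> \<in> space lf_measures" for \<mu>
  proof (cases "0 < mass0 \<mu> \<and> mass0 \<mu> < \<infinity>")
    case True
    then show ?thesis
      using mass0_eq[OF that] by (simp add: g_def mean_power_def origin_kernel_total_def measure_def mass0_def)
  next
    case False
    then have "enn2real (mass0 \<mu>) = 0" by (auto simp: enn2real_eq_0_iff less_top zero_less_iff_neq_zero)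
    then show ?thesis by (simp add: measure_def mass0_def)
  qed
  have "eta_hat P T F k = \<gamma> * (LINT \<mu>|palm_measure P T. enn2real (mass0 \<mu>) * g \<mu>)"
    unfolding eta_hat_def \<gamma>_def
    by (rule arg_cong, rule Bochner_Integration.integral_cong[OF refl], rule pt) (simp add: pm)
  also have "\<dots> = \<gamma> * (1 / \<gamma> * (LINT \<mu>|palm_unnormalized. enn2real (mass0 \<mu>) * g \<mu>))"
    unfolding pm using \<gamma> by (subst integral_density) simp_all
  also have "\<dots> = (LINT \<mu>|palm_unnormalized. enn2real (mass0 \<mu>) * g \<mu>)" using \<gamma>(1) by simp
  also have "\<dots> = (LINT \<mu>|palm_weighted. g \<mu>)"
    unfolding pw by (subst integral_density) simp_all
  finally show ?thesis by (simp add: g_def)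
qed

text \<open>As a difference of transforms of finite measures, \<open>eta_hat\<close> is Borel,
  bounded and dual to \<open>DF\<close> minus \<open>DL\<close>; all three are drawn from this
  formula.\<close>

lemma eta_hat_fourier:
  "complex_of_real (eta_hat P T F k) = (LINT w|DF. cis (- (k \<bullet> w))) - (LINT w|DL. cis (- (k \<bullet> w)))"
proof -
  have ok: "origin_kernel_total \<mu> \<in> space (prob_algebra borel)" if "\<mu> \<in> space palm_weighted" for \<mu> :: "('a \<times> 'a) measure"
    using measurable_space[OF origin_kernel_total_measurable] that by simp
  note 1 = fourier_difference_measure[OF finite_weighted mix_double_measurable[OF F_measurable], of k]
  note 2 = fourier_difference_measure[OF finite_weighted double_measurable, of k]
  have "(LINT w|DF. cis (- (k \<bullet> w))) - (LINT w|DL. cis (- (k \<bullet> w))) =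
     (LINT \<mu>|palm_weighted. (LINT p|mix_double F (origin_kernel_total \<mu>). cis (- (k \<bullet> (snd p - fst p)))) -
        (LINT p|double (origin_kernel_total \<mu>). cis (- (k \<bullet> (snd p - fst p)))))"
    unfolding 1(1) 2(1) by (rule Bochner_Integration.integral_diff[symmetric, OF 1(2) 2(2)])
  also have "\<dots> = (LINT \<mu>|palm_weighted. complex_of_real (mean_power F k (origin_kernel_total \<mu>) - (cmod (fourier_measure (origin_kernel_total \<mu>) k))\<^sup>2))"
    by (intro Bochner_Integration.integral_cong refl) (simp add: fourier_mix_double[OF F_measurable ok] fourier_double[OF ok])
  finally show ?thesis by (simp only: integral_complex_of_real eta_hat_eq)
qed

lemma eta_hat_nonneg: "0 \<le> eta_hat P T F k"
  unfolding eta_hat_eq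
proof (rule Bochner_Integration.integral_nonneg)
  fix \<mu> :: "('a \<times> 'a) measure" assume "\<mu> \<in> space palm_weighted"
  then have ok: "origin_kernel_total \<mu> \<in> space (prob_algebra borel)"
    using measurable_space[OF origin_kernel_total_measurable] by simp
  show "0 \<le> mean_power F k (origin_kernel_total \<mu>) - (cmod (fourier_measure (origin_kernel_total \<mu>) k))\<^sup>2"
    using mean_power_ge[OF F_measurable F_mean[OF ok] ok] by simp
qed

lemma eta_hat_measurable [measurable]: "eta_hat P T F \<in> borel_measurable borel"
proof -
  interpret A: finite_measure DF by (rule finite_DF)
  interpret B: finite_measure DL by (rule finite_DL)
  have [measurable_cong]: "sets DF = sets borel" "sets DL = sets borel" by simp_all
  have "eta_hat P T F = (\<lambda>k. Re ((LINT w|DF. cis (- (k \<bullet> w))) - (LINT w|DL. cis (- (k \<bullet> w)))))"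
    by (simp add: fun_eq_iff flip: eta_hat_fourier)
  also have "\<dots> \<in> borel_measurable borel" by measurable
  finally show ?thesis .
qed

lemma eta_hat_bounded: "eta_hat P T F k \<le> measure DF UNIV + measure DL UNIV"
proof -
  interpret A: finite_measure DF by (rule finite_DF)
  interpret B: finite_measure DL by (rule finite_DL)
  have sp: "space DF = UNIV" "space DL = UNIV" by (simp_all add: difference_measure_def)
  have "eta_hat P T F k \<le> cmod (complex_of_real (eta_hat P T F k))" by simp
  also have "\<dots> \<le> cmod (LINT w|DF. cis (- (k \<bullet> w))) + cmod (LINT w|DL. cis (- (k \<bullet> w)))"
    unfolding eta_hat_fourier by (rule norm_triangle_ineq4)
  also have "\<dots> \<le> (LINT w|DF. cmod (cis (- (k \<bullet> w)))) + (LINT w|DL. cmod (cis (- (k \<bullet> w))))"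
    by (intro add_mono integral_norm_bound)
  finally show ?thesis by (simp add: sp)
qed

end

section \<open>Second moments under conditional independence\<close>

text \<open>Rectangles form an intersection-stable generator of the product sigma-field; the finite
  total weight is what uniqueness on a generator asks for.\<close>

lemma nn_integral_pair_eqI:
  fixes \<kappa>1 \<kappa>2 \<rho>1 \<rho>2 :: "'w \<Rightarrow> 'a::euclidean_space measure"
  assumes \<kappa>: "\<kappa>1 \<in> P \<rightarrow>\<^sub>M prob_algebra borel" "\<kappa>2 \<in> P \<rightarrow>\<^sub>M prob_algebra borel"
      "\<rho>1 \<in> P \<rightarrow>\<^sub>M prob_algebra borel" "\<rho>2 \<in> P \<rightarrow>\<^sub>M prob_algebra borel"
    and Z [measurable]: "Z \<in> borel_measurable P" and fin: "(\<integral>\<^sup>+\<omega>. Z \<omega> \<partial>P) < \<infinity>"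
    and eq: "\<And>A B. A \<in> sets borel \<Longrightarrow> B \<in> sets borel \<Longrightarrow>
      (\<integral>\<^sup>+\<omega>. Z \<omega> * (emeasure (\<kappa>1 \<omega>) A * emeasure (\<kappa>2 \<omega>) B) \<partial>P) = (\<integral>\<^sup>+\<omega>. Z \<omega> * (emeasure (\<rho>1 \<omega>) A * emeasure (\<rho>2 \<omega>) B) \<partial>P)"
    and H: "H \<in> borel_measurable (borel \<Otimes>\<^sub>M borel)"
  shows "(\<integral>\<^sup>+\<omega>. Z \<omega> * (\<integral>\<^sup>+p. H p \<partial>(\<kappa>1 \<omega> \<Otimes>\<^sub>M \<kappa>2 \<omega>)) \<partial>P) = (\<integral>\<^sup>+\<omega>. Z \<omega> * (\<integral>\<^sup>+p. H p \<partial>(\<rho>1 \<omega> \<Otimes>\<^sub>M \<rho>2 \<omega>)) \<partial>P)"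
proof -
  have pk: "(\<lambda>\<omega>. \<kappa>1 \<omega> \<Otimes>\<^sub>M \<kappa>2 \<omega>) \<in> density P Z \<rightarrow>\<^sub>M prob_algebra (borel \<Otimes>\<^sub>M borel)"
    "(\<lambda>\<omega>. \<rho>1 \<omega> \<Otimes>\<^sub>M \<rho>2 \<omega>) \<in> density P Z \<rightarrow>\<^sub>M prob_algebra (borel \<Otimes>\<^sub>M borel)"
    using \<kappa> by (auto intro!: pair_prob_algebra_measurable)
  have em: "emeasure (mixture (density P Z) (\<lambda>\<omega>. \<mu>1 \<omega> \<Otimes>\<^sub>M \<mu>2 \<omega>) (borel \<Otimes>\<^sub>M borel)) (A \<times> B) =
      (\<integral>\<^sup>+\<omega>. Z \<omega> * (emeasure (\<mu>1 \<omega>) A * emeasure (\<mu>2 \<omega>) B) \<partial>P)"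
    if \<mu>: "\<mu>1 \<in> P \<rightarrow>\<^sub>M prob_algebra borel" "\<mu>2 \<in> P \<rightarrow>\<^sub>M prob_algebra borel" and AB: "A \<in> sets borel" "B \<in> sets borel"
    for \<mu>1 \<mu>2 :: "'w \<Rightarrow> 'a measure" and A B
  proof -
    have k: "(\<lambda>\<omega>. \<mu>1 \<omega> \<Otimes>\<^sub>M \<mu>2 \<omega>) \<in> density P Z \<rightarrow>\<^sub>M prob_algebra (borel \<Otimes>\<^sub>M borel)"
      using \<mu> by (auto intro!: pair_prob_algebra_measurable)
    have k': "(\<lambda>\<omega>. \<mu>1 \<omega> \<Otimes>\<^sub>M \<mu>2 \<omega>) \<in> P \<rightarrow>\<^sub>M prob_algebra (borel \<Otimes>\<^sub>M borel)"
      using \<mu> by (rule pair_prob_algebra_measurable)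
    have "emeasure (mixture (density P Z) (\<lambda>\<omega>. \<mu>1 \<omega> \<Otimes>\<^sub>M \<mu>2 \<omega>) (borel \<Otimes>\<^sub>M borel)) (A \<times> B) =
        (\<integral>\<^sup>+\<omega>. Z \<omega> * emeasure (\<mu>1 \<omega> \<Otimes>\<^sub>M \<mu>2 \<omega>) (A \<times> B) \<partial>P)"
      using emeasure_prob_algebra_kernel[OF k', of "A \<times> B"] AB
      by (subst emeasure_mixture_prob[OF k]) (auto simp: nn_integral_density)
    also have "\<dots> = (\<integral>\<^sup>+\<omega>. Z \<omega> * (emeasure (\<mu>1 \<omega>) A * emeasure (\<mu>2 \<omega>) B) \<partial>P)"
    proof (rule nn_integral_cong)
      fix \<omega> assume \<omega>: "\<omega> \<in> space P"
      interpret prob_space "\<mu>2 \<omega>" by (rule sets_prob_algebra_kernel(2)[OF \<mu>(2) \<omega>])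
      show "Z \<omega> * emeasure (\<mu>1 \<omega> \<Otimes>\<^sub>M \<mu>2 \<omega>) (A \<times> B) = Z \<omega> * (emeasure (\<mu>1 \<omega>) A * emeasure (\<mu>2 \<omega>) B)"
        using AB sets_prob_algebra_kernel(1)[OF \<mu>(1) \<omega>] sets_prob_algebra_kernel(1)[OF \<mu>(2) \<omega>]
        by (subst emeasure_pair_measure_Times) auto
    qed
    finally show ?thesis .
  qed
  have "mixture (density P Z) (\<lambda>\<omega>. \<kappa>1 \<omega> \<Otimes>\<^sub>M \<kappa>2 \<omega>) (borel \<Otimes>\<^sub>M borel) = mixture (density P Z) (\<lambda>\<omega>. \<rho>1 \<omega> \<Otimes>\<^sub>M \<rho>2 \<omega>) (borel \<Otimes>\<^sub>M borel)"
    (is "?M = ?N")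
  proof (rule measure_eqI_generator_eq)
    let ?E = "{a \<times> b | a b. a \<in> sets (borel :: 'a measure) \<and> b \<in> sets (borel :: 'a measure)}"
    show "Int_stable ?E" by (rule Int_stable_pair_measure_generator)
    show "?E \<subseteq> Pow UNIV" by simp
    show "emeasure ?M X = emeasure ?N X" if XE: "X \<in> ?E" for X
    proof -
      obtain A B where X: "X = A \<times> B" "A \<in> sets borel" "B \<in> sets borel" using XE by blast
      show ?thesis unfolding X(1) em[OF \<kappa>(1,2) X(2,3)] em[OF \<kappa>(3,4) X(2,3)] by (rule eq[OF X(2,3)])
    qed
    show "sets ?M = sigma_sets UNIV ?E" "sets ?N = sigma_sets UNIV ?E" by (simp_all add: sets_pair_measure)
    have "UNIV \<times> UNIV \<in> ?E" by (rule CollectI, rule exI, rule exI, rule conjI, rule refl) auto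
    then show "range (\<lambda>_::nat. UNIV \<times> UNIV) \<subseteq> ?E" by (simp only: image_constant[OF UNIV_I] insert_subset empty_subsetI simp_thms)
    have U: "UNIV \<in> sets (borel :: 'a measure)" by simp
    have "emeasure ?M (UNIV \<times> UNIV) = (\<integral>\<^sup>+\<omega>. Z \<omega> * 1 \<partial>P)"
      unfolding em[OF \<kappa>(1,2) U U]
    proof (rule nn_integral_cong)
      fix \<omega> assume \<omega>: "\<omega> \<in> space P"
      show "Z \<omega> * (emeasure (\<kappa>1 \<omega>) UNIV * emeasure (\<kappa>2 \<omega>) UNIV) = Z \<omega> * 1"
        using prob_space.emeasure_space_1[OF sets_prob_algebra_kernel(2)[OF \<kappa>(1) \<omega>]]
          prob_space.emeasure_space_1[OF sets_prob_algebra_kernel(2)[OF \<kappa>(2) \<omega>]]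
          sets_prob_algebra_kernel(3)[OF \<kappa>(1) \<omega>] sets_prob_algebra_kernel(3)[OF \<kappa>(2) \<omega>] by simp
    qed
    then show "emeasure ?M (UNIV \<times> UNIV) \<noteq> \<infinity>" using fin by simp
  qed simp_all
  moreover have mix: "(\<integral>\<^sup>+p. H p \<partial>mixture (density P Z) (\<lambda>\<omega>. \<mu>1 \<omega> \<Otimes>\<^sub>M \<mu>2 \<omega>) (borel \<Otimes>\<^sub>M borel)) =
      (\<integral>\<^sup>+\<omega>. Z \<omega> * (\<integral>\<^sup>+p. H p \<partial>(\<mu>1 \<omega> \<Otimes>\<^sub>M \<mu>2 \<omega>)) \<partial>P)"
    if \<mu>: "\<mu>1 \<in> P \<rightarrow>\<^sub>M prob_algebra borel" "\<mu>2 \<in> P \<rightarrow>\<^sub>M prob_algebra borel" for \<mu>1 \<mu>2 :: "'w \<Rightarrow> 'a measure"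
  proof -
    have k: "(\<lambda>\<omega>. \<mu>1 \<omega> \<Otimes>\<^sub>M \<mu>2 \<omega>) \<in> density P Z \<rightarrow>\<^sub>M prob_algebra (borel \<Otimes>\<^sub>M borel)"
      using \<mu> by (auto intro!: pair_prob_algebra_measurable)
    show ?thesis
      using nn_integral_prob_algebra_kernel[OF k H]
      by (subst nn_integral_mixture_prob[OF k H]) (simp add: nn_integral_density)
  qed
  ultimately show ?thesis using mix[OF \<kappa>(1,2)] mix[OF \<kappa>(3,4)] by simp
qed

section \<open>Enumerated atoms and the conditional law of the random kernel\<close>

locale bartlett_setting = transport_randomization P T L F
  for P :: "'w measure" and T :: "'w \<Rightarrow> ('a::euclidean_space \<times> 'a) measure" and L :: "'w \<times> 'a \<Rightarrow> 'a measure"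
    and F :: "'a measure \<Rightarrow> 'a measure measure" +
  fixes K :: "'w \<times> 'a \<Rightarrow> 'a measure" and X :: "nat \<Rightarrow> 'w \<Rightarrow> 'a"
  assumes K_kernel: "prob_kernel P K"
    and enum: "enumerates_atoms P (sigma_generated P T) (\<lambda>\<omega>. first_marginal (T \<omega>)) X"
    and cond_indep: "cond_indep_family P (sigma_generated P T) (prob_algebra borel)
          (atom_indices (\<lambda>\<omega>. first_marginal (T \<omega>)) X) (\<lambda>n \<omega>. K (\<omega>, X n \<omega>))"
    and K_law: "\<And>n A. A \<in> sets (prob_algebra borel) \<Longrightarrow>
          AE \<omega> in P. n \<in> atom_indices (\<lambda>\<omega>. first_marginal (T \<omega>)) X \<omega> \<longrightarrow>
            cond_probability P (sigma_generated P T) {\<omega>\<in>space P. K (\<omega>, X n \<omega>) \<in> A} \<omega> =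
            measure (F (L (\<omega>, X n \<omega>))) A"
begin

abbreviation G :: "'w measure" where "G \<equiv> sigma_generated P T"

lemma space_G [simp]: "space G = space P"
  by (simp add: sigma_generated_def)

lemma subalgebra_G: "subalgebra P G"
  unfolding subalgebra_def using sets_image_in_sets[OF refl T_measurable] by (simp add: sigma_generated_def)

sublocale G: finite_measure_subalgebra P G
  by unfold_locales (rule subalgebra_G)

lemma T_measurable_G: "T \<in> G \<rightarrow>\<^sub>M lf_measures"
  unfolding sigma_generated_def
  by (rule measurable_vimage_algebra1) (use measurable_space[OF T_measurable] in auto)

lemma \<Phi>_measurable_G: "\<Phi> \<in> G \<rightarrow>\<^sub>M lf_measures"
  by (rule first_marginal_measurable[OF T_measurable_G]) (simp add: \<Phi>_locally_finite)

lemma K_measurable [measurable]: "K \<in> kernels"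
  using K_kernel by (simp add: prob_kernel_def)

lemma X_measurable_G: "X n \<in> borel_measurable G"
  using enum by (simp add: enumerates_atoms_def)

lemma X_measurable [measurable]: "X n \<in> borel_measurable P"
  by (rule measurable_from_subalg[OF subalgebra_G X_measurable_G])

definition mass :: "nat \<Rightarrow> 'w \<Rightarrow> ennreal" where
  "mass n \<omega> = emeasure (\<Phi> \<omega>) {X n \<omega>}"

text \<open>Writing the indicator of \<open>{Y q}\<close> at \<open>x\<close> as that of
  \<open>{0}\<close> at \<open>x - Y q\<close> makes the integrand jointly measurable in
  \<open>q\<close> and \<open>x\<close>.\<close>

lemma emeasure_singleton_measurable:
  assumes \<kappa>: "\<kappa> \<in> M \<rightarrow>\<^sub>M lf_measures" and Y [measurable]: "Y \<in> M \<rightarrow>\<^sub>M (borel :: 'a measure)"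
  shows "(\<lambda>q. emeasure (\<kappa> q) {Y q}) \<in> borel_measurable M"
proof -
  have [measurable]: "{0::'a} \<in> sets borel" by simp
  have "(\<lambda>q. \<integral>\<^sup>+x. indicator {0} (x - Y q) \<partial>\<kappa> q) \<in> borel_measurable M"
    by (rule measurable_nn_integral_lf[OF \<kappa>]) measurable
  also have "?this \<longleftrightarrow> (\<lambda>q. emeasure (\<kappa> q) {Y q}) \<in> borel_measurable M"
  proof (rule measurable_cong)
    fix q assume q: "q \<in> space M"
    have "(\<integral>\<^sup>+x. indicator {0} (x - Y q) \<partial>\<kappa> q) = (\<integral>\<^sup>+x. indicator {Y q} x \<partial>\<kappa> q)"
      by (intro nn_integral_cong) (auto simp: indicator_def)
    then show "(\<integral>\<^sup>+x. indicator {0} (x - Y q) \<partial>\<kappa> q) = emeasure (\<kappa> q) {Y q}"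
      using measurable_lfD(2)[OF \<kappa> q] by simp
  qed
  finally show ?thesis .
qed

lemma mass_measurable_G: "mass n \<in> borel_measurable G"
  unfolding mass_def[abs_def] by (rule emeasure_singleton_measurable[OF \<Phi>_measurable_G X_measurable_G])

lemma mass_measurable [measurable]: "mass n \<in> borel_measurable P"
  by (rule measurable_from_subalg[OF subalgebra_G mass_measurable_G])

lemma mass_nonzero_iff: "mass n \<omega> \<noteq> 0 \<longleftrightarrow> n \<in> atom_indices \<Phi> X \<omega>"
  by (simp add: mass_def atom_indices_def atoms_def zero_less_iff_neq_zero)

lemma mass_finite: "\<omega> \<in> space P \<Longrightarrow> mass n \<omega> < \<infinity>"
  using \<Phi>_locally_finite[of \<omega>] by (auto simp: mass_def locally_finite_measure_def)

definition atom_kernel :: "('w \<times> 'a \<Rightarrow> 'a measure) \<Rightarrow> nat \<Rightarrow> 'w \<Rightarrow> 'a measure" where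
  "atom_kernel Q n \<omega> = Q (\<omega>, X n \<omega>)"

lemma atom_kernel_measurable:
  assumes "Q \<in> kernels"
  shows "atom_kernel Q n \<in> P \<rightarrow>\<^sub>M prob_algebra borel"
proof -
  have "(\<lambda>\<omega>. (\<omega>, X n \<omega>)) \<in> P \<rightarrow>\<^sub>M P \<Otimes>\<^sub>M borel" by measurable
  from measurable_compose[OF this assms] show ?thesis by (simp add: atom_kernel_def[abs_def])
qed

lemmas atK_measurable [measurable] = atom_kernel_measurable[OF K_measurable]
lemmas atL_measurable [measurable] = atom_kernel_measurable[OF L_measurable]

lemma F_atL_measurable [measurable]: "(\<lambda>\<omega>. F (atom_kernel L n \<omega>)) \<in> P \<rightarrow>\<^sub>M prob_algebra (prob_algebra borel)"
  by (rule measurable_compose[OF atL_measurable F_measurable])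

abbreviation pair_moment :: "('w \<times> 'a \<Rightarrow> 'a measure) \<Rightarrow> ('a \<times> 'a \<Rightarrow> ennreal) \<Rightarrow> nat \<Rightarrow> nat \<Rightarrow> 'w \<Rightarrow> ennreal" where
  "pair_moment Q H n m \<omega> \<equiv> mass n \<omega> * mass m \<omega> * (\<integral>\<^sup>+p. H p \<partial>(atom_kernel Q n \<omega> \<Otimes>\<^sub>M atom_kernel Q m \<omega>))"

text \<open>The enumeration hits every atom exactly once, and indices that hit none have mass 0, so
  the sum may run over all \<open>n\<close>.\<close>

lemma AE_nn_integral_\<Phi>:
  "AE \<omega> in P. \<forall>f\<in>borel_measurable borel. (\<integral>\<^sup>+x. f x \<partial>\<Phi> \<omega>) = (\<Sum>n. mass n \<omega> * f (X n \<omega>))"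
proof -
  have "AE \<omega> in P. bij_betw (\<lambda>n. X n \<omega>) (atom_indices \<Phi> X \<omega>) (atoms (\<Phi> \<omega>))"
    using enum by (simp add: enumerates_atoms_def)
  then show ?thesis
    using AE_countable_atoms
  proof eventually_elim
    case (elim \<omega>)
    note bij = elim(1)
    have atoms: "AE x in \<Phi> \<omega>. x \<in> atoms (\<Phi> \<omega>)" using elim(2) by (auto simp: atoms_def)
    show ?case
    proof
      fix f :: "'a \<Rightarrow> ennreal" assume f [measurable]: "f \<in> borel_measurable borel"
      have mm: "g \<in> borel_measurable (\<Phi> \<omega>)" if "g \<in> borel_measurable borel" for g :: "'a \<Rightarrow> ennreal"
        using that measurable_cong_sets[OF sets_first_marginal refl] by blast
      let ?I = "atom_indices \<Phi> X \<omega>"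
      let ?t = "\<lambda>n x. f x * indicator {X n \<omega>} x * indicator ?I n"
      have "(\<integral>\<^sup>+x. f x \<partial>\<Phi> \<omega>) = (\<integral>\<^sup>+x. (\<Sum>n. ?t n x) \<partial>\<Phi> \<omega>)"
      proof (rule nn_integral_cong_AE)
        from atoms show "AE x in \<Phi> \<omega>. f x = (\<Sum>n. ?t n x)"
        proof eventually_elim
          fix x assume "x \<in> atoms (\<Phi> \<omega>)"
          then obtain m where m: "m \<in> ?I" "X m \<omega> = x" using bij unfolding bij_betw_def by (metis imageE)
          have "?t n x = (if n = m then f x else 0)" for n
            using m bij_betw_imp_inj_on[OF bij] by (auto simp: indicator_def inj_on_def)
          then have "(\<Sum>n. ?t n x) = (\<Sum>n. if n = m then f x else 0)" by simp
          also have "\<dots> = (\<Sum>n\<in>{m}. if n = m then f x else 0)" by (rule suminf_finite) auto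
          finally show "f x = (\<Sum>n. ?t n x)" by simp
        qed
      qed
      also have "\<dots> = (\<Sum>n. \<integral>\<^sup>+x. ?t n x \<partial>\<Phi> \<omega>)"
        by (rule nn_integral_suminf) (intro mm, measurable)
      also have "\<dots> = (\<Sum>n. mass n \<omega> * f (X n \<omega>))"
      proof (rule suminf_cong)
        fix n
        have "(\<integral>\<^sup>+x. ?t n x \<partial>\<Phi> \<omega>) = (\<integral>\<^sup>+x. f x * indicator {X n \<omega>} x \<partial>\<Phi> \<omega>) * indicator ?I n"
          by (rule nn_integral_multc, intro mm, measurable)
        also have "(\<integral>\<^sup>+x. f x * indicator {X n \<omega>} x \<partial>\<Phi> \<omega>) = f (X n \<omega>) * mass n \<omega>"
          unfolding mass_def by (rule nn_integral_indicator_singleton) simp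
        also have "f (X n \<omega>) * mass n \<omega> * indicator ?I n = mass n \<omega> * f (X n \<omega>)"
          using mass_nonzero_iff[of n \<omega>] by (auto simp: indicator_def mult.commute)
        finally show "(\<integral>\<^sup>+x. ?t n x \<partial>\<Phi> \<omega>) = mass n \<omega> * f (X n \<omega>)" .
      qed
      finally show "(\<integral>\<^sup>+x. f x \<partial>\<Phi> \<omega>) = (\<Sum>n. mass n \<omega> * f (X n \<omega>))" .
    qed
  qed
qed

text \<open>\<open>real_cond_exp\<close> is a difference of two nonnegative conditional expectations
  converted to reals. For an indicator the negative part is 0 and the positive part at most 1, so
  the conversion loses nothing and weights with values in \<open>ennreal\<close> become
  admissible.\<close>

lemma nn_integral_cond_probability:
  assumes A [measurable]: "A \<in> sets P" and Z: "Z \<in> borel_measurable G"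
  shows "(\<integral>\<^sup>+\<omega>. Z \<omega> * indicator A \<omega> \<partial>P) = (\<integral>\<^sup>+\<omega>. Z \<omega> * ennreal (cond_probability P G A \<omega>) \<partial>P)"
proof -
  have 0: "AE \<omega> in P. 0 = nn_cond_exp P G (\<lambda>\<omega>. ennreal (- indicator A \<omega>)) \<omega>"
  proof -
    have "(\<lambda>\<omega>. ennreal (- indicator A \<omega>)) = (\<lambda>\<omega>. 0)" by (auto simp: indicator_def fun_eq_iff ennreal_neg)
    then show ?thesis using G.nn_cond_exp_F_meas[of "\<lambda>_. 0"] by simp
  qed
  have 1: "AE \<omega> in P. nn_cond_exp P G (\<lambda>\<omega>. ennreal (indicator A \<omega>)) \<omega> \<le> 1"
  proof -
    have "AE \<omega> in P. nn_cond_exp P G (\<lambda>\<omega>. ennreal (indicator A \<omega>)) \<omega> \<le> nn_cond_exp P G (\<lambda>_. 1) \<omega>"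
      by (rule G.nn_cond_exp_mono) (auto simp: indicator_def)
    moreover have "AE \<omega> in P. 1 = nn_cond_exp P G (\<lambda>_. 1) \<omega>" by (rule G.nn_cond_exp_F_meas) simp
    ultimately show ?thesis by eventually_elim simp
  qed
  have "(\<integral>\<^sup>+\<omega>. Z \<omega> * indicator A \<omega> \<partial>P) = (\<integral>\<^sup>+\<omega>. Z \<omega> * ennreal (indicator A \<omega>) \<partial>P)"
    by (intro nn_integral_cong) (auto simp: indicator_def)
  also have "\<dots> = (\<integral>\<^sup>+\<omega>. Z \<omega> * nn_cond_exp P G (\<lambda>\<omega>. ennreal (indicator A \<omega>)) \<omega> \<partial>P)"
    by (rule G.nn_cond_exp_intg[symmetric]) (use Z in auto)
  also have "\<dots> = (\<integral>\<^sup>+\<omega>. Z \<omega> * ennreal (cond_probability P G A \<omega>) \<partial>P)"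
  proof (rule nn_integral_cong_AE)
    from 0 1 show "AE \<omega> in P. Z \<omega> * nn_cond_exp P G (\<lambda>\<omega>. ennreal (indicator A \<omega>)) \<omega> = Z \<omega> * ennreal (cond_probability P G A \<omega>)"
    proof eventually_elim
      case (elim \<omega>)
      have "nn_cond_exp P G (\<lambda>\<omega>. ennreal (indicator A \<omega>)) \<omega> < \<top>"
        using elim(2) by (rule le_less_trans) simp
      then show ?case
        unfolding cond_probability_def real_cond_exp_def elim(1)[symmetric] by simp
    qed
  qed
  finally show ?thesis .
qed

text \<open>The assumptions on the conditional law speak on the event that the indices in
  \<open>J\<close> are atoms. A weight vanishing off this event hides the rest, and measurability
  with respect to \<open>G\<close> lets it pass through the conditioning.\<close>

definition supported :: "nat set \<Rightarrow> ('w \<Rightarrow> ennreal) \<Rightarrow> bool" where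
  "supported J Z \<longleftrightarrow> Z \<in> borel_measurable G \<and> (\<forall>\<omega>. Z \<omega> \<noteq> 0 \<longrightarrow> J \<subseteq> atom_indices \<Phi> X \<omega>)"

lemma supported_measurable: "supported J Z \<Longrightarrow> Z \<in> borel_measurable P"
  unfolding supported_def using measurable_from_subalg[OF subalgebra_G] by blast

lemma atK_event [measurable]: "A \<in> sets (prob_algebra borel) \<Longrightarrow> {\<omega>\<in>space P. atom_kernel K n \<omega> \<in> A} \<in> sets P"
  using measurable_sets[OF atK_measurable[of n], of A] by (simp add: vimage_def Int_def conj_commute)

lemma emeasure_F_atL:
  "\<omega> \<in> space P \<Longrightarrow> emeasure (F (atom_kernel L n \<omega>)) A = ennreal (measure (F (atom_kernel L n \<omega>)) A)"
proof -
  assume "\<omega> \<in> space P"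
  then interpret FL: prob_space "F (atom_kernel L n \<omega>)" by (rule sets_prob_algebra_kernel(2)[OF F_atL_measurable])
  show ?thesis by (rule FL.emeasure_eq_measure)
qed

text \<open>The event is written as a Dirac kernel at the random measure, to fit the two-kernel form
  of \<open>nn_integral_kernel_eqI\<close>.\<close>

lemma law_single:
  assumes Z: "supported {n} Z" and A: "A \<in> sets (prob_algebra borel)"
  shows "(\<integral>\<^sup>+\<omega>. Z \<omega> * emeasure (return (prob_algebra borel) (atom_kernel K n \<omega>)) A \<partial>P) = (\<integral>\<^sup>+\<omega>. Z \<omega> * emeasure (F (atom_kernel L n \<omega>)) A \<partial>P)"
proof -
  let ?E = "{\<omega>\<in>space P. atom_kernel K n \<omega> \<in> A}"
  have "(\<integral>\<^sup>+\<omega>. Z \<omega> * emeasure (return (prob_algebra borel) (atom_kernel K n \<omega>)) A \<partial>P) = (\<integral>\<^sup>+\<omega>. Z \<omega> * indicator ?E \<omega> \<partial>P)"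
    using A by (intro nn_integral_cong) (auto simp: indicator_def)
  also have "\<dots> = (\<integral>\<^sup>+\<omega>. Z \<omega> * ennreal (cond_probability P G ?E \<omega>) \<partial>P)"
    using Z by (intro nn_integral_cond_probability atK_event A) (simp add: supported_def)
  also have "\<dots> = (\<integral>\<^sup>+\<omega>. Z \<omega> * emeasure (F (atom_kernel L n \<omega>)) A \<partial>P)"
  proof (rule nn_integral_cong_AE)
    from K_law[OF A, of n] AE_space
    show "AE \<omega> in P. Z \<omega> * ennreal (cond_probability P G ?E \<omega>) = Z \<omega> * emeasure (F (atom_kernel L n \<omega>)) A"
    proof eventually_elim
      case (elim \<omega>)
      show ?case
      proof (cases "Z \<omega> = 0")
        case False
        then have "n \<in> atom_indices \<Phi> X \<omega>" using Z by (auto simp: supported_def)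
        then show ?thesis using elim emeasure_F_atL[OF elim(2), of n A] by (simp add: atom_kernel_def)
      qed simp
    qed
  qed
  finally show ?thesis .
qed

text \<open>One of the two events sits in the weight and the other in a kernel, so that events can
  be replaced by functions one variable at a time.\<close>

lemma law_pair:
  assumes Z: "supported {m, n} Z" and mn: "m \<noteq> n" and A: "A \<in> sets (prob_algebra borel)" and B: "B \<in> sets (prob_algebra borel)"
  shows "(\<integral>\<^sup>+\<omega>. (Z \<omega> * indicator B (atom_kernel K n \<omega>)) * emeasure (return (prob_algebra borel) (atom_kernel K m \<omega>)) A \<partial>P) =
    (\<integral>\<^sup>+\<omega>. (Z \<omega> * emeasure (F (atom_kernel L n \<omega>)) B) * emeasure (F (atom_kernel L m \<omega>)) A \<partial>P)"
proof -
  let ?Em = "{\<omega>\<in>space P. atom_kernel K m \<omega> \<in> A}" and ?En = "{\<omega>\<in>space P. atom_kernel K n \<omega> \<in> B}"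
  let ?E = "{\<omega>\<in>space P. atom_kernel K m \<omega> \<in> A \<and> atom_kernel K n \<omega> \<in> B}"
  have E: "?E \<in> sets P"
  proof -
    have "?E = ?Em \<inter> ?En" by auto
    then show ?thesis using atK_event[OF A, of m] atK_event[OF B, of n] by auto
  qed
  have indep: "AE \<omega> in P. {m, n} \<subseteq> atom_indices \<Phi> X \<omega> \<longrightarrow>
      cond_probability P G ?E \<omega> = cond_probability P G ?Em \<omega> * cond_probability P G ?En \<omega>"
  proof -
    let ?A = "\<lambda>j. if j = m then A else B"
    have "AE \<omega> in P. {m, n} \<subseteq> atom_indices \<Phi> X \<omega> \<longrightarrow>
           cond_probability P G {\<omega>\<in>space P. \<forall>j\<in>{m, n}. K (\<omega>, X j \<omega>) \<in> ?A j} \<omega> =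
           (\<Prod>j\<in>{m, n}. cond_probability P G {\<omega>\<in>space P. K (\<omega>, X j \<omega>) \<in> ?A j} \<omega>)"
      using cond_indep A B unfolding cond_indep_family_def by (elim allE[of _ "{m, n}"] allE[of _ ?A]) auto
    then show ?thesis using mn by (simp add: atom_kernel_def)
  qed
  have "(\<integral>\<^sup>+\<omega>. (Z \<omega> * indicator B (atom_kernel K n \<omega>)) * emeasure (return (prob_algebra borel) (atom_kernel K m \<omega>)) A \<partial>P) = (\<integral>\<^sup>+\<omega>. Z \<omega> * indicator ?E \<omega> \<partial>P)"
    using A by (intro nn_integral_cong) (auto simp: indicator_def)
  also have "\<dots> = (\<integral>\<^sup>+\<omega>. Z \<omega> * ennreal (cond_probability P G ?E \<omega>) \<partial>P)"
    using Z by (intro nn_integral_cond_probability E) (simp add: supported_def)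
  also have "\<dots> = (\<integral>\<^sup>+\<omega>. (Z \<omega> * emeasure (F (atom_kernel L n \<omega>)) B) * emeasure (F (atom_kernel L m \<omega>)) A \<partial>P)"
  proof (rule nn_integral_cong_AE)
    from K_law[OF A, of m] K_law[OF B, of n] indep AE_space
    show "AE \<omega> in P. Z \<omega> * ennreal (cond_probability P G ?E \<omega>) = (Z \<omega> * emeasure (F (atom_kernel L n \<omega>)) B) * emeasure (F (atom_kernel L m \<omega>)) A"
    proof eventually_elim
      case (elim \<omega>)
      show ?case
      proof (cases "Z \<omega> = 0")
        case False
        then have "{m, n} \<subseteq> atom_indices \<Phi> X \<omega>" using Z by (auto simp: supported_def)
        then have "cond_probability P G ?E \<omega> = measure (F (atom_kernel L m \<omega>)) A * measure (F (atom_kernel L n \<omega>)) B"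
          using elim by (simp add: atom_kernel_def)
        then show ?thesis by (simp add: emeasure_F_atL[OF elim(4)] ennreal_mult mult_ac)
      qed simp
    qed
  qed
  finally show ?thesis .
qed

end

context bartlett_setting
begin

lemma return_kernel:
  "sets (return (prob_algebra borel) (atom_kernel K n \<omega>)) = sets (prob_algebra (borel :: 'a measure))"
  "B \<in> sets (prob_algebra borel) \<Longrightarrow> (\<lambda>\<omega>. emeasure (return (prob_algebra borel) (atom_kernel K n \<omega>)) B) \<in> borel_measurable P"
proof -
  show "sets (return (prob_algebra borel) (atom_kernel K n \<omega>)) = sets (prob_algebra (borel :: 'a measure))" by simp
  assume B: "B \<in> sets (prob_algebra (borel :: 'a measure))"
  have "(\<lambda>\<omega>. indicator B (atom_kernel K n \<omega>) :: ennreal) \<in> borel_measurable P"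
    by (rule measurable_compose[OF atK_measurable borel_measurable_indicator[OF B]])
  then show "(\<lambda>\<omega>. emeasure (return (prob_algebra borel) (atom_kernel K n \<omega>)) B) \<in> borel_measurable P"
    using B by simp
qed

lemma nn_integral_return_kernel:
  assumes "\<omega> \<in> space P" "f \<in> borel_measurable (prob_algebra borel)"
  shows "(\<integral>\<^sup>+\<pi>. f \<pi> \<partial>return (prob_algebra borel) (atom_kernel K n \<omega>)) = f (atom_kernel K n \<omega>)"
  using assms measurable_space[OF atK_measurable assms(1)] by (intro nn_integral_return) auto

lemmas F_kernel = sets_prob_algebra_kernel(1)[OF F_atL_measurable] emeasure_prob_algebra_kernel[OF F_atL_measurable]

lemma emeasure_eval_measurable: "A \<in> sets borel \<Longrightarrow> (\<lambda>\<pi>. emeasure \<pi> A) \<in> borel_measurable (prob_algebra (borel :: 'a measure))"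
  by (rule emeasure_prob_algebra_kernel[where \<kappa>="\<lambda>\<pi>. \<pi>"]) simp_all

lemma atL_space: "\<omega> \<in> space P \<Longrightarrow> atom_kernel L n \<omega> \<in> space (prob_algebra borel)"
  using measurable_space[OF atL_measurable] .

text \<open>As each event is extended to an evaluation of its random measure, the barycentre
  condition \<open>F_mean\<close> replaces the integral over \<open>F\<close> by the kernel
  \<open>L\<close>. Conditional independence enters through the product in
  \<open>law_pair\<close>.\<close>

lemma law_pair_function:
  assumes Z: "supported {m, n} Z" and mn: "m \<noteq> n" and A: "A \<in> sets borel" and B: "B \<in> sets borel"
  shows "(\<integral>\<^sup>+\<omega>. Z \<omega> * (emeasure (atom_kernel K m \<omega>) A * emeasure (atom_kernel K n \<omega>) B) \<partial>P) =
     (\<integral>\<^sup>+\<omega>. Z \<omega> * (emeasure (atom_kernel L m \<omega>) A * emeasure (atom_kernel L n \<omega>) B) \<partial>P)"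
proof -
  have [measurable]: "Z \<in> borel_measurable P" by (rule supported_measurable[OF Z])
  have [measurable]: "(\<lambda>\<omega>. emeasure (atom_kernel K i \<omega>) C) \<in> borel_measurable P" "(\<lambda>\<omega>. emeasure (atom_kernel L i \<omega>) C) \<in> borel_measurable P"
    if "C \<in> sets borel" for i C
    using that by (auto intro: emeasure_prob_algebra_kernel[OF atK_measurable] emeasure_prob_algebra_kernel[OF atL_measurable])
  have 1: "(\<integral>\<^sup>+\<omega>. (Z \<omega> * indicator D (atom_kernel K n \<omega>)) * emeasure (atom_kernel K m \<omega>) A \<partial>P) =
      (\<integral>\<^sup>+\<omega>. (Z \<omega> * emeasure (F (atom_kernel L n \<omega>)) D) * emeasure (atom_kernel L m \<omega>) A \<partial>P)"
    if D: "D \<in> sets (prob_algebra borel)" for D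
  proof -
    have [measurable]: "(\<lambda>\<omega>. indicator D (atom_kernel K n \<omega>) :: ennreal) \<in> borel_measurable P"
      by (rule measurable_compose[OF atK_measurable borel_measurable_indicator[OF D]])
    have [measurable]: "(\<lambda>\<omega>. emeasure (F (atom_kernel L n \<omega>)) D) \<in> borel_measurable P" by (rule F_kernel(2)[OF D])
    have "(\<integral>\<^sup>+\<omega>. (Z \<omega> * indicator D (atom_kernel K n \<omega>)) * (\<integral>\<^sup>+\<pi>. emeasure \<pi> A \<partial>return (prob_algebra borel) (atom_kernel K m \<omega>)) \<partial>P) =
      (\<integral>\<^sup>+\<omega>. (Z \<omega> * emeasure (F (atom_kernel L n \<omega>)) D) * (\<integral>\<^sup>+\<pi>. emeasure \<pi> A \<partial>F (atom_kernel L m \<omega>)) \<partial>P)"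
      by (rule nn_integral_kernel_eqI[where N="prob_algebra borel"])
         (use return_kernel F_kernel law_pair[OF Z mn _ D] emeasure_eval_measurable[OF A] in auto)
    also have "(\<integral>\<^sup>+\<omega>. (Z \<omega> * indicator D (atom_kernel K n \<omega>)) * (\<integral>\<^sup>+\<pi>. emeasure \<pi> A \<partial>return (prob_algebra borel) (atom_kernel K m \<omega>)) \<partial>P) =
        (\<integral>\<^sup>+\<omega>. (Z \<omega> * indicator D (atom_kernel K n \<omega>)) * emeasure (atom_kernel K m \<omega>) A \<partial>P)"
      by (intro nn_integral_cong) (simp add: nn_integral_return_kernel emeasure_eval_measurable[OF A])
    also have "(\<integral>\<^sup>+\<omega>. (Z \<omega> * emeasure (F (atom_kernel L n \<omega>)) D) * (\<integral>\<^sup>+\<pi>. emeasure \<pi> A \<partial>F (atom_kernel L m \<omega>)) \<partial>P) =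
        (\<integral>\<^sup>+\<omega>. (Z \<omega> * emeasure (F (atom_kernel L n \<omega>)) D) * emeasure (atom_kernel L m \<omega>) A \<partial>P)"
      by (intro nn_integral_cong) (simp add: F_mean[OF atL_space A])
    finally show ?thesis .
  qed
  have "(\<integral>\<^sup>+\<omega>. (Z \<omega> * emeasure (atom_kernel K m \<omega>) A) * (\<integral>\<^sup>+\<pi>. emeasure \<pi> B \<partial>return (prob_algebra borel) (atom_kernel K n \<omega>)) \<partial>P) =
      (\<integral>\<^sup>+\<omega>. (Z \<omega> * emeasure (atom_kernel L m \<omega>) A) * (\<integral>\<^sup>+\<pi>. emeasure \<pi> B \<partial>F (atom_kernel L n \<omega>)) \<partial>P)"
  proof (rule nn_integral_kernel_eqI[where N="prob_algebra borel"])
    fix D assume D: "D \<in> sets (prob_algebra (borel :: 'a measure))"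
    show "(\<integral>\<^sup>+\<omega>. (Z \<omega> * emeasure (atom_kernel K m \<omega>) A) * emeasure (return (prob_algebra borel) (atom_kernel K n \<omega>)) D \<partial>P) =
      (\<integral>\<^sup>+\<omega>. (Z \<omega> * emeasure (atom_kernel L m \<omega>) A) * emeasure (F (atom_kernel L n \<omega>)) D \<partial>P)"
      using 1[OF D] D by (simp add: mult_ac)
  qed (use return_kernel F_kernel emeasure_eval_measurable[OF B] A in auto)
  also have "(\<integral>\<^sup>+\<omega>. (Z \<omega> * emeasure (atom_kernel K m \<omega>) A) * (\<integral>\<^sup>+\<pi>. emeasure \<pi> B \<partial>return (prob_algebra borel) (atom_kernel K n \<omega>)) \<partial>P) =
      (\<integral>\<^sup>+\<omega>. Z \<omega> * (emeasure (atom_kernel K m \<omega>) A * emeasure (atom_kernel K n \<omega>) B) \<partial>P)"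
    by (intro nn_integral_cong) (simp add: nn_integral_return_kernel emeasure_eval_measurable[OF B] mult.assoc)
  also have "(\<integral>\<^sup>+\<omega>. (Z \<omega> * emeasure (atom_kernel L m \<omega>) A) * (\<integral>\<^sup>+\<pi>. emeasure \<pi> B \<partial>F (atom_kernel L n \<omega>)) \<partial>P) =
      (\<integral>\<^sup>+\<omega>. Z \<omega> * (emeasure (atom_kernel L m \<omega>) A * emeasure (atom_kernel L n \<omega>) B) \<partial>P)"
    by (intro nn_integral_cong) (simp add: F_mean[OF atL_space B] mult.assoc)
  finally show ?thesis .
qed

lemma supported_masses: "supported {m, n} (\<lambda>\<omega>. mass m \<omega> * mass n \<omega>)"
  unfolding supported_def
  using mass_nonzero_iff mass_measurable_G by auto

lemma pair_moment_measurable: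
  assumes Q: "Q \<in> kernels" and H: "H \<in> borel_measurable (borel \<Otimes>\<^sub>M borel)"
  shows "(\<lambda>\<omega>. \<integral>\<^sup>+p. H p \<partial>(atom_kernel Q m \<omega> \<Otimes>\<^sub>M atom_kernel Q n \<omega>)) \<in> borel_measurable P"
  by (rule nn_integral_prob_algebra_kernel[OF pair_prob_algebra_measurable H]; rule atom_kernel_measurable[OF Q])

text \<open>For two different atoms, products of evaluations have equal weighted expectations under
  \<open>K\<close> and \<open>L\<close>; rectangles determine the averaged pair law, and monotone
  convergence removes the truncation of the masses.\<close>

lemma off_diagonal_eq:
  assumes mn: "m \<noteq> n" and H: "H \<in> borel_measurable (borel \<Otimes>\<^sub>M borel)"
  shows "(\<integral>\<^sup>+\<omega>. pair_moment K H m n \<omega> \<partial>P) =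
    (\<integral>\<^sup>+\<omega>. pair_moment L H m n \<omega> \<partial>P)"
proof -
  \<comment> \<open>The product of the masses may have infinite expectation, while
    \<open>nn_integral_pair_eqI\<close> asks for a finite weight; so the product is kept where it is
    at most \<open>N\<close> and set to 0 elsewhere.\<close>
  define Z where "Z N \<omega> = mass m \<omega> * mass n \<omega> * indicator {\<omega>. mass m \<omega> * mass n \<omega> \<le> of_nat N} \<omega>" for N :: nat and \<omega>
  have [measurable]: "mass i \<in> borel_measurable G" for i by (rule mass_measurable_G)
  have ZG: "Z N \<in> borel_measurable G" for N
  proof -
    have "(\<lambda>\<omega>. if mass m \<omega> * mass n \<omega> \<le> of_nat N then mass m \<omega> * mass n \<omega> else 0) \<in> borel_measurable G"
      by measurable
    also have "(\<lambda>\<omega>. if mass m \<omega> * mass n \<omega> \<le> of_nat N then mass m \<omega> * mass n \<omega> else 0) = Z N"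
      by (auto simp: Z_def fun_eq_iff indicator_def)
    finally show ?thesis .
  qed
  have sup: "supported {m, n} (Z N)" for N
    unfolding supported_def using supported_masses[of m n] ZG by (auto simp: supported_def Z_def)
  then have [measurable]: "Z N \<in> borel_measurable P" for N by (rule supported_measurable)
  have ZN: "Z N \<omega> \<le> of_nat N" for N \<omega> by (auto simp: Z_def indicator_def)
  have fin: "(\<integral>\<^sup>+\<omega>. Z N \<omega> \<partial>P) < \<infinity>" for N
  proof -
    have "(\<integral>\<^sup>+\<omega>. Z N \<omega> \<partial>P) \<le> (\<integral>\<^sup>+\<omega>. of_nat N \<partial>P)" by (intro nn_integral_mono ZN)
    also have "\<dots> < \<infinity>" by (simp add: emeasure_space_1 of_nat_less_top)
    finally show ?thesis .
  qed
  have SUP: "(SUP N. Z N \<omega>) = mass m \<omega> * mass n \<omega>" if "\<omega> \<in> space P" for \<omega>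
  proof (rule antisym)
    show "(SUP N. Z N \<omega>) \<le> mass m \<omega> * mass n \<omega>" by (intro SUP_least) (auto simp: Z_def indicator_def)
    have "mass m \<omega> * mass n \<omega> < \<top>" using mass_finite[OF that] by (simp add: ennreal_mult_less_top)
    then obtain N :: nat where "mass m \<omega> * mass n \<omega> \<le> of_nat N"
      by (metis ennreal_Ex_less_of_nat less_imp_le)
    then have "Z N \<omega> = mass m \<omega> * mass n \<omega>" by (simp add: Z_def)
    then show "mass m \<omega> * mass n \<omega> \<le> (SUP N. Z N \<omega>)" by (metis SUP_upper UNIV_I)
  qed
  have inc: "incseq (\<lambda>N \<omega>. Z N \<omega> * g \<omega>)" for g :: "'w \<Rightarrow> ennreal"
    unfolding incseq_def le_fun_def
  proof (intro allI impI mult_right_mono)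
    fix M N :: nat and \<omega> assume "M \<le> N"
    then have "(of_nat M :: ennreal) \<le> of_nat N" by simp
    then show "Z M \<omega> \<le> Z N \<omega>" by (auto simp: Z_def indicator_def intro: order_trans)
  qed simp
  have lim: "(\<integral>\<^sup>+\<omega>. mass m \<omega> * mass n \<omega> * g \<omega> \<partial>P) = (SUP N. \<integral>\<^sup>+\<omega>. Z N \<omega> * g \<omega> \<partial>P)"
    if [measurable]: "g \<in> borel_measurable P" for g
  proof -
    have "(\<integral>\<^sup>+\<omega>. mass m \<omega> * mass n \<omega> * g \<omega> \<partial>P) = (\<integral>\<^sup>+\<omega>. (SUP N. Z N \<omega> * g \<omega>) \<partial>P)"
      by (intro nn_integral_cong) (simp add: SUP_mult_right_ennreal[symmetric] SUP)
    also have "\<dots> = (SUP N. \<integral>\<^sup>+\<omega>. Z N \<omega> * g \<omega> \<partial>P)"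
      by (rule nn_integral_monotone_convergence_SUP[OF inc]) measurable
    finally show ?thesis .
  qed
  have "(\<integral>\<^sup>+\<omega>. Z N \<omega> * (\<integral>\<^sup>+p. H p \<partial>(atom_kernel K m \<omega> \<Otimes>\<^sub>M atom_kernel K n \<omega>)) \<partial>P) =
      (\<integral>\<^sup>+\<omega>. Z N \<omega> * (\<integral>\<^sup>+p. H p \<partial>(atom_kernel L m \<omega> \<Otimes>\<^sub>M atom_kernel L n \<omega>)) \<partial>P)" for N
    by (rule nn_integral_pair_eqI[OF atK_measurable atK_measurable atL_measurable atL_measurable _ fin _ H])
       (rule supported_measurable[OF sup], rule law_pair_function[OF sup mn])
  then show ?thesis
    unfolding lim[OF pair_moment_measurable[OF K_measurable H]] lim[OF pair_moment_measurable[OF L_measurable H]] by simp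
qed

text \<open>\<open>double\<close> is quadratic in the random measure, so the barycentre does not
  determine its mean; the whole law \<open>F\<close> survives as
  \<open>mix_double F\<close>.\<close>

lemma diagonal_eq:
  assumes H: "H \<in> borel_measurable (borel \<Otimes>\<^sub>M borel)"
  shows "(\<integral>\<^sup>+\<omega>. pair_moment K H n n \<omega> \<partial>P) =
    (\<integral>\<^sup>+\<omega>. mass n \<omega> * mass n \<omega> * (\<integral>\<^sup>+p. H p \<partial>mix_double F (atom_kernel L n \<omega>)) \<partial>P)"
proof -
  have sup: "supported {n} (\<lambda>\<omega>. mass n \<omega> * mass n \<omega>)" using supported_masses[of n n] by simp
  have f: "(\<lambda>\<pi>. \<integral>\<^sup>+p. H p \<partial>double \<pi>) \<in> borel_measurable (prob_algebra borel)"
    by (rule nn_integral_prob_algebra_kernel[OF double_measurable H])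
  have "(\<integral>\<^sup>+\<omega>. mass n \<omega> * mass n \<omega> * (\<integral>\<^sup>+\<pi>. \<integral>\<^sup>+p. H p \<partial>double \<pi> \<partial>return (prob_algebra borel) (atom_kernel K n \<omega>)) \<partial>P) =
     (\<integral>\<^sup>+\<omega>. mass n \<omega> * mass n \<omega> * (\<integral>\<^sup>+\<pi>. \<integral>\<^sup>+p. H p \<partial>double \<pi> \<partial>F (atom_kernel L n \<omega>)) \<partial>P)"
    by (rule nn_integral_kernel_eqI[where N="prob_algebra borel"])
       (use return_kernel F_kernel law_single[OF sup] f in auto)
  also have "(\<integral>\<^sup>+\<omega>. mass n \<omega> * mass n \<omega> * (\<integral>\<^sup>+\<pi>. \<integral>\<^sup>+p. H p \<partial>double \<pi> \<partial>return (prob_algebra borel) (atom_kernel K n \<omega>)) \<partial>P) =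
     (\<integral>\<^sup>+\<omega>. mass n \<omega> * mass n \<omega> * (\<integral>\<^sup>+p. H p \<partial>double (atom_kernel K n \<omega>)) \<partial>P)"
    by (intro nn_integral_cong arg_cong2[where f="(*)"] refl nn_integral_return_kernel f)
  also have "(\<integral>\<^sup>+\<omega>. mass n \<omega> * mass n \<omega> * (\<integral>\<^sup>+\<pi>. \<integral>\<^sup>+p. H p \<partial>double \<pi> \<partial>F (atom_kernel L n \<omega>)) \<partial>P) =
     (\<integral>\<^sup>+\<omega>. mass n \<omega> * mass n \<omega> * (\<integral>\<^sup>+p. H p \<partial>mix_double F (atom_kernel L n \<omega>)) \<partial>P)"
    by (intro nn_integral_cong arg_cong2[where f="(*)"] refl nn_integral_mix_double[symmetric] F_measurable atL_space H)
  finally show ?thesis .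
qed

lemma diagonal_moment_sum:
  assumes R: "R \<in> prob_algebra borel \<rightarrow>\<^sub>M prob_algebra (borel \<Otimes>\<^sub>M borel)" and H: "H \<in> borel_measurable (borel \<Otimes>\<^sub>M borel)"
  shows "diagonal_moment R H = (\<Sum>n. \<integral>\<^sup>+\<omega>. mass n \<omega> * mass n \<omega> * (\<integral>\<^sup>+p. H p \<partial>R (atom_kernel L n \<omega>)) \<partial>P)"
proof -
  have RL: "(\<lambda>q. R (L q)) \<in> P \<Otimes>\<^sub>M borel \<rightarrow>\<^sub>M prob_algebra (borel \<Otimes>\<^sub>M borel)" by (rule measurable_compose[OF L_measurable R])
  have Ra: "(\<lambda>\<omega>. R (atom_kernel L n \<omega>)) \<in> P \<rightarrow>\<^sub>M prob_algebra (borel \<Otimes>\<^sub>M borel)" for n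
    by (rule measurable_compose[OF atL_measurable R])
  have [measurable]: "(\<lambda>\<omega>. \<integral>\<^sup>+p. H p \<partial>R (atom_kernel L n \<omega>)) \<in> borel_measurable P" for n
    by (rule nn_integral_prob_algebra_kernel[OF Ra H])
  have m2: "(\<lambda>q. \<integral>\<^sup>+p. H p \<partial>R (L q)) \<in> borel_measurable (P \<Otimes>\<^sub>M borel)"
    by (rule nn_integral_prob_algebra_kernel[OF RL H])
  have m1: "(\<lambda>q. emeasure (\<Phi> (fst q)) {snd q}) \<in> borel_measurable (P \<Otimes>\<^sub>M borel)"
    by (rule emeasure_singleton_measurable[OF measurable_compose[OF measurable_fst \<Phi>_measurable] measurable_snd])
  have "diagonal_moment R H = (\<integral>\<^sup>+\<omega>. (\<Sum>n. mass n \<omega> * mass n \<omega> * (\<integral>\<^sup>+p. H p \<partial>R (atom_kernel L n \<omega>))) \<partial>P)"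
    unfolding diagonal_moment_def
  proof (rule nn_integral_cong_AE)
    show "AE \<omega> in P. (\<integral>\<^sup>+x. emeasure (\<Phi> \<omega>) {x} * (\<integral>\<^sup>+p. H p \<partial>R (L (\<omega>, x))) \<partial>\<Phi> \<omega>) =
        (\<Sum>n. mass n \<omega> * mass n \<omega> * (\<integral>\<^sup>+p. H p \<partial>R (atom_kernel L n \<omega>)))"
      using AE_nn_integral_\<Phi> AE_space
    proof eventually_elim
      case (elim \<omega>)
      have "(\<lambda>x. emeasure (\<Phi> \<omega>) {x} * (\<integral>\<^sup>+p. H p \<partial>R (L (\<omega>, x)))) \<in> borel_measurable borel"
        using measurable_Pair2[OF m1 elim(2)] measurable_Pair2[OF m2 elim(2)] by simp
      with elim(1) show ?case by (simp add: mass_def atom_kernel_def mult.assoc)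
    qed
  qed
  also have "\<dots> = (\<Sum>n. \<integral>\<^sup>+\<omega>. mass n \<omega> * mass n \<omega> * (\<integral>\<^sup>+p. H p \<partial>R (atom_kernel L n \<omega>)) \<partial>P)"
    by (rule nn_integral_suminf) measurable
  finally show ?thesis .
qed

text \<open>Assembled from the atoms instead of taking the expectation of a product measure, because
  \<open>kernel_apply Q \<Phi>\<close> is not known to be \<open>\<sigma>\<close>-finite at this stage.\<close>

definition second_moment :: "('w \<times> 'a \<Rightarrow> 'a measure) \<Rightarrow> ('a \<times> 'a) measure" where
  "second_moment Q = mixture (count_space UNIV) (\<lambda>n. mixture (count_space UNIV) (\<lambda>m.
     mixture (density P (\<lambda>\<omega>. mass n \<omega> * mass m \<omega>)) (\<lambda>\<omega>. atom_kernel Q n \<omega> \<Otimes>\<^sub>M atom_kernel Q m \<omega>) (borel \<Otimes>\<^sub>M borel))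
     (borel \<Otimes>\<^sub>M borel)) (borel \<Otimes>\<^sub>M borel)"

lemma sets_second_moment [simp]: "sets (second_moment Q) = sets (borel \<Otimes>\<^sub>M borel)"
  and measurable_second_moment [simp]: "measurable (second_moment Q) N = measurable (borel \<Otimes>\<^sub>M borel) N"
  by (simp_all add: second_moment_def)

lemma nn_integral_second_moment:
  assumes Q: "Q \<in> kernels" and H: "H \<in> borel_measurable (borel \<Otimes>\<^sub>M borel)"
  shows "(\<integral>\<^sup>+p. H p \<partial>second_moment Q) =
    (\<Sum>n. \<Sum>m. \<integral>\<^sup>+\<omega>. pair_moment Q H n m \<omega> \<partial>P)"
proof -
  have k: "(\<lambda>\<omega>. atom_kernel Q n \<omega> \<Otimes>\<^sub>M atom_kernel Q m \<omega>) \<in> density P (\<lambda>\<omega>. mass n \<omega> * mass m \<omega>) \<rightarrow>\<^sub>M prob_algebra (borel \<Otimes>\<^sub>M borel)" for n m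
    using pair_prob_algebra_measurable[OF atom_kernel_measurable[OF Q, of n] atom_kernel_measurable[OF Q, of m]] by simp
  have "(\<integral>\<^sup>+p. H p \<partial>mixture (density P (\<lambda>\<omega>. mass n \<omega> * mass m \<omega>)) (\<lambda>\<omega>. atom_kernel Q n \<omega> \<Otimes>\<^sub>M atom_kernel Q m \<omega>) (borel \<Otimes>\<^sub>M borel)) =
     (\<integral>\<^sup>+\<omega>. pair_moment Q H n m \<omega> \<partial>P)" for n m
    unfolding nn_integral_mixture_prob[OF k H]
    by (rule nn_integral_density) (use pair_moment_measurable[OF Q H] in measurable)
  then show ?thesis
    unfolding second_moment_def
    by (simp add: nn_integral_mixture H nn_integral_count_space_nat)
qed

text \<open>Each side is the sum of the common off-diagonal part and both diagonals. Putting the two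
  diagonals on opposite sides avoids subtracting values that may be infinite.\<close>

theorem second_moment_identity:
  assumes H: "H \<in> borel_measurable (borel \<Otimes>\<^sub>M borel)"
  shows "(\<integral>\<^sup>+p. H p \<partial>second_moment K) + diagonal_moment double H = (\<integral>\<^sup>+p. H p \<partial>second_moment L) + diagonal_moment (mix_double F) H"
proof -
  have split: "(\<Sum>n. \<Sum>m. a n m) = (\<Sum>n. a n n) + (\<Sum>n. \<Sum>m. if n = m then 0 else a n m)" for a :: "nat \<Rightarrow> nat \<Rightarrow> ennreal"
  proof -
    have "(\<Sum>m. a n m) = a n n + (\<Sum>m. if n = m then 0 else a n m)" for n
    proof -
      have "(\<Sum>m. a n m) = (\<Sum>m. (if n = m then a n m else 0) + (if n = m then 0 else a n m))"
        by (intro suminf_cong) simp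
      also have "\<dots> = (\<Sum>m. if n = m then a n m else 0) + (\<Sum>m. if n = m then 0 else a n m)"
        by (rule suminf_add[symmetric]) simp_all
      also have "(\<Sum>m. if n = m then a n m else 0) = (\<Sum>m\<in>{n}. if n = m then a n m else 0)"
        by (rule suminf_finite) auto
      finally show ?thesis by simp
    qed
    then have "(\<Sum>n. \<Sum>m. a n m) = (\<Sum>n. a n n + (\<Sum>m. if n = m then 0 else a n m))" by simp
    also have "\<dots> = (\<Sum>n. a n n) + (\<Sum>n. \<Sum>m. if n = m then 0 else a n m)"
      by (rule suminf_add[symmetric]) simp_all
    finally show ?thesis .
  qed
  let ?a = "\<lambda>Q n m. \<integral>\<^sup>+\<omega>. pair_moment Q H n m \<omega> \<partial>P"
  have off: "(\<Sum>n. \<Sum>m. if n = m then 0 else ?a K n m) = (\<Sum>n. \<Sum>m. if n = m then 0 else ?a L n m)"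
    by (intro suminf_cong if_cong refl off_diagonal_eq H)
  have dK: "(\<Sum>n. ?a K n n) = diagonal_moment (mix_double F) H"
    unfolding diagonal_moment_sum[OF mix_double_measurable[OF F_measurable] H] by (intro suminf_cong diagonal_eq H)
  have dL: "(\<Sum>n. ?a L n n) = diagonal_moment double H"
    unfolding diagonal_moment_sum[OF double_measurable H] ..
  show ?thesis
    unfolding nn_integral_second_moment[OF K_measurable H] nn_integral_second_moment[OF L_measurable H]
    unfolding split[of "?a K"] split[of "?a L"] off dK dL by (simp add: add_ac)
qed

section \<open>Moments of the transported measures\<close>

lemma kernel_apply_sets:
  assumes Q: "Q \<in> kernels" and \<omega>: "\<omega> \<in> space P"
  shows "sets (kernel_apply Q \<Phi> \<omega>) = sets borel" "space (kernel_apply Q \<Phi> \<omega>) = UNIV"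
proof -
  show 1: "sets (kernel_apply Q \<Phi> \<omega>) = sets borel"
    unfolding kernel_apply_def
    by (rule sets_bind) (auto simp: kernel_section[OF Q \<omega>])
  show "space (kernel_apply Q \<Phi> \<omega>) = UNIV" using sets_eq_imp_space_eq[OF 1] by simp
qed

lemma nn_integral_kernel_apply:
  assumes Q: "Q \<in> kernels" and \<omega>: "\<omega> \<in> space P" and f: "f \<in> borel_measurable borel"
  shows "(\<integral>\<^sup>+u. f u \<partial>kernel_apply Q \<Phi> \<omega>) = (\<integral>\<^sup>+x. \<integral>\<^sup>+u. f u \<partial>Q (\<omega>, x) \<partial>\<Phi> \<omega>)"
  unfolding kernel_apply_def
  by (rule nn_integral_bind[OF f measurable_prob_algebraD[OF kernel_section(5)[OF Q \<omega>]]])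

lemma AE_nn_integral_kernel_apply:
  assumes Q: "Q \<in> kernels"
  shows "AE \<omega> in P. \<forall>f\<in>borel_measurable borel. (\<integral>\<^sup>+u. f u \<partial>kernel_apply Q \<Phi> \<omega>) = (\<Sum>n. mass n \<omega> * (\<integral>\<^sup>+u. f u \<partial>atom_kernel Q n \<omega>))"
  using AE_nn_integral_\<Phi> AE_space
proof eventually_elim
  case (elim \<omega>)
  show ?case
  proof
    fix f :: "'a \<Rightarrow> ennreal" assume f: "f \<in> borel_measurable borel"
    have "(\<lambda>x. \<integral>\<^sup>+u. f u \<partial>Q (\<omega>, x)) \<in> borel_measurable borel"
      by (rule nn_integral_prob_algebra_kernel[OF kernel_section(1)[OF Q elim(2)] f])
    with elim(1) show "(\<integral>\<^sup>+u. f u \<partial>kernel_apply Q \<Phi> \<omega>) = (\<Sum>n. mass n \<omega> * (\<integral>\<^sup>+u. f u \<partial>atom_kernel Q n \<omega>))"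
      unfolding nn_integral_kernel_apply[OF Q elim(2) f] by (simp add: atom_kernel_def)
  qed
qed

lemma emeasure_kernel_apply_measurable:
  assumes Q: "Q \<in> kernels" and B: "B \<in> sets borel"
  shows "(\<lambda>\<omega>. emeasure (kernel_apply Q \<Phi> \<omega>) B) \<in> borel_measurable P"
proof -
  have "(\<lambda>\<omega>. \<integral>\<^sup>+x. emeasure (Q (\<omega>, x)) B \<partial>\<Phi> \<omega>) \<in> borel_measurable P"
    by (rule measurable_nn_integral_\<Phi>) (use emeasure_prob_algebra_kernel[OF Q B] in simp)
  also have "?this \<longleftrightarrow> (\<lambda>\<omega>. emeasure (kernel_apply Q \<Phi> \<omega>) B) \<in> borel_measurable P"
  proof (rule measurable_cong)
    fix \<omega> assume \<omega>: "\<omega> \<in> space P"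
    show "(\<integral>\<^sup>+x. emeasure (Q (\<omega>, x)) B \<partial>\<Phi> \<omega>) = emeasure (kernel_apply Q \<Phi> \<omega>) B"
      using nn_integral_kernel_apply[OF Q \<omega>, of "indicator B"] B kernel_apply_sets[OF Q \<omega>] kernel_section(2)[OF Q \<omega>] by simp
  qed
  finally show ?thesis .
qed

text \<open>The functional \<open>I\<close> is abstract because it stands both for integration
  against \<open>kernel_apply Q \<Phi> \<omega>\<close> and for integration over the second
  coordinate of \<open>T \<omega>\<close>.\<close>

lemma nn_integral_double_sum:
  fixes I :: "('a \<Rightarrow> ennreal) \<Rightarrow> ennreal"
  assumes Q: "Q \<in> kernels" and \<omega>: "\<omega> \<in> space P"
    and I: "\<And>f. f \<in> borel_measurable borel \<Longrightarrow> I f = (\<Sum>n. mass n \<omega> * (\<integral>\<^sup>+u. f u \<partial>atom_kernel Q n \<omega>))"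
    and H: "H \<in> borel_measurable (borel \<Otimes>\<^sub>M borel)"
  shows "I (\<lambda>u. I (\<lambda>v. H (u, v))) = (\<Sum>n. \<Sum>m. pair_moment Q H n m \<omega>)"
proof -
  note q = sets_prob_algebra_kernel[OF atom_kernel_measurable[OF Q] \<omega>]
  have Hm: "H \<in> borel_measurable (borel \<Otimes>\<^sub>M atom_kernel Q m \<omega>)" for m
    using H measurable_cong_sets[OF sets_pair_measure_cong[OF refl q(1)] refl] by blast
  have Hnm: "H \<in> borel_measurable (atom_kernel Q n \<omega> \<Otimes>\<^sub>M atom_kernel Q m \<omega>)" for n m
    using H measurable_cong_sets[OF sets_pair_measure_cong[OF q(1) q(1)] refl] by blast
  have inner: "(\<lambda>u. \<integral>\<^sup>+v. H (u, v) \<partial>atom_kernel Q m \<omega>) \<in> borel_measurable borel" for m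
    using sigma_finite_measure.borel_measurable_nn_integral_fst[OF prob_space_imp_sigma_finite[OF q(2)] Hm] .
  have inner': "(\<lambda>u. \<integral>\<^sup>+v. H (u, v) \<partial>atom_kernel Q m \<omega>) \<in> borel_measurable (atom_kernel Q n \<omega>)" for m n
    using inner measurable_cong_sets[OF q(1) refl] by blast
  have Hu: "(\<lambda>v. H (u, v)) \<in> borel_measurable borel" for u
    using measurable_Pair2[OF H, of u] by simp
  have eq: "(\<lambda>u. I (\<lambda>v. H (u, v))) = (\<lambda>u. \<Sum>m. mass m \<omega> * (\<integral>\<^sup>+v. H (u, v) \<partial>atom_kernel Q m \<omega>))"
    using I[OF Hu] by (simp add: fun_eq_iff)
  have "I (\<lambda>u. I (\<lambda>v. H (u, v))) = (\<Sum>n. mass n \<omega> * (\<integral>\<^sup>+u. (\<Sum>m. mass m \<omega> * (\<integral>\<^sup>+v. H (u, v) \<partial>atom_kernel Q m \<omega>)) \<partial>atom_kernel Q n \<omega>))"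
    unfolding eq by (rule I) (use inner in measurable)
  also have "\<dots> = (\<Sum>n. \<Sum>m. pair_moment Q H n m \<omega>)"
  proof (rule suminf_cong)
    fix n
    have "(\<integral>\<^sup>+u. (\<Sum>m. mass m \<omega> * (\<integral>\<^sup>+v. H (u, v) \<partial>atom_kernel Q m \<omega>)) \<partial>atom_kernel Q n \<omega>) =
       (\<Sum>m. mass m \<omega> * (\<integral>\<^sup>+u. \<integral>\<^sup>+v. H (u, v) \<partial>atom_kernel Q m \<omega> \<partial>atom_kernel Q n \<omega>))"
      using inner' by (subst nn_integral_suminf) (auto intro!: suminf_cong nn_integral_cmult)
    also have "\<dots> = (\<Sum>m. mass m \<omega> * (\<integral>\<^sup>+p. H p \<partial>(atom_kernel Q n \<omega> \<Otimes>\<^sub>M atom_kernel Q m \<omega>)))"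
      using sigma_finite_measure.nn_integral_fst[OF prob_space_imp_sigma_finite[OF q(2)] Hnm] by simp
    finally show "mass n \<omega> * (\<integral>\<^sup>+u. (\<Sum>m. mass m \<omega> * (\<integral>\<^sup>+v. H (u, v) \<partial>atom_kernel Q m \<omega>)) \<partial>atom_kernel Q n \<omega>) =
       (\<Sum>m. pair_moment Q H n m \<omega>)"
      by (simp add: mult.assoc)
  qed
  finally show ?thesis .
qed

lemma nn_integral_second_moment':
  assumes Q: "Q \<in> kernels" and H: "H \<in> borel_measurable (borel \<Otimes>\<^sub>M borel)"
  shows "(\<integral>\<^sup>+p. H p \<partial>second_moment Q) =
    (\<integral>\<^sup>+\<omega>. (\<Sum>n. \<Sum>m. pair_moment Q H n m \<omega>) \<partial>P)"
proof -
  note [measurable] = pair_moment_measurable[OF Q H]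
  show ?thesis
    unfolding nn_integral_second_moment[OF Q H]
    by (subst nn_integral_suminf, measurable, intro suminf_cong, subst nn_integral_suminf, measurable)
qed

text \<open>Local finiteness makes the measure sigma-finite, which turns its product measure into
  iterated integrals.\<close>

lemma AE_nn_integral_pair_kernel_apply:
  assumes Q: "Q \<in> kernels" and H: "H \<in> borel_measurable (borel \<Otimes>\<^sub>M borel)"
  shows "AE \<omega> in P. locally_finite_measure (kernel_apply Q \<Phi> \<omega>) \<longrightarrow>
    (\<integral>\<^sup>+p. H p \<partial>(kernel_apply Q \<Phi> \<omega> \<Otimes>\<^sub>M kernel_apply Q \<Phi> \<omega>)) =
    (\<Sum>n. \<Sum>m. pair_moment Q H n m \<omega>)"
  using AE_nn_integral_kernel_apply[OF Q] AE_space
proof eventually_elim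
  case (elim \<omega>)
  let ?\<Psi> = "kernel_apply Q \<Phi> \<omega>"
  show ?case
  proof
    assume "locally_finite_measure ?\<Psi>"
    then interpret Psi: sigma_finite_measure ?\<Psi> by (rule locally_finite_measure_sigma_finite)
    have "H \<in> borel_measurable (?\<Psi> \<Otimes>\<^sub>M ?\<Psi>)"
      using H measurable_cong_sets[OF sets_pair_measure_cong[OF kernel_apply_sets(1)[OF Q elim(2)] kernel_apply_sets(1)[OF Q elim(2)]] refl] by blast
    then have "(\<integral>\<^sup>+p. H p \<partial>(?\<Psi> \<Otimes>\<^sub>M ?\<Psi>)) = (\<integral>\<^sup>+u. \<integral>\<^sup>+v. H (u, v) \<partial>?\<Psi> \<partial>?\<Psi>)"
      by (rule Psi.nn_integral_fst[symmetric])
    also have "\<dots> = (\<Sum>n. \<Sum>m. pair_moment Q H n m \<omega>)"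
      by (rule nn_integral_double_sum[OF Q elim(2), of "\<lambda>f. \<integral>\<^sup>+u. f u \<partial>?\<Psi>"]) (use elim(1) H in auto)
    finally show "(\<integral>\<^sup>+p. H p \<partial>(?\<Psi> \<Otimes>\<^sub>M ?\<Psi>)) = \<dots>" .
  qed
qed

text \<open>A product of two integrals is itself an iterated integral, so this formula is available
  before sigma-finiteness is known; square integrability is translated into a statement about
  \<open>second_moment\<close> through it.\<close>

lemma second_moment_Times:
  assumes Q: "Q \<in> kernels" and g [measurable]: "g \<in> borel_measurable borel" and h [measurable]: "h \<in> borel_measurable borel"
  shows "(\<integral>\<^sup>+\<omega>. (\<integral>\<^sup>+u. g u \<partial>kernel_apply Q \<Phi> \<omega>) * (\<integral>\<^sup>+v. h v \<partial>kernel_apply Q \<Phi> \<omega>) \<partial>P) = (\<integral>\<^sup>+p. g (fst p) * h (snd p) \<partial>second_moment Q)"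
proof -
  have H: "(\<lambda>p. g (fst p) * h (snd p)) \<in> borel_measurable (borel \<Otimes>\<^sub>M borel)" by measurable
  have "(\<integral>\<^sup>+\<omega>. (\<integral>\<^sup>+u. g u \<partial>kernel_apply Q \<Phi> \<omega>) * (\<integral>\<^sup>+v. h v \<partial>kernel_apply Q \<Phi> \<omega>) \<partial>P) =
    (\<integral>\<^sup>+\<omega>. (\<Sum>n. \<Sum>m. mass n \<omega> * mass m \<omega> * (\<integral>\<^sup>+p. g (fst p) * h (snd p) \<partial>(atom_kernel Q n \<omega> \<Otimes>\<^sub>M atom_kernel Q m \<omega>))) \<partial>P)"
  proof (rule nn_integral_cong_AE)
    show "AE \<omega> in P. (\<integral>\<^sup>+u. g u \<partial>kernel_apply Q \<Phi> \<omega>) * (\<integral>\<^sup>+v. h v \<partial>kernel_apply Q \<Phi> \<omega>) =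
       (\<Sum>n. \<Sum>m. mass n \<omega> * mass m \<omega> * (\<integral>\<^sup>+p. g (fst p) * h (snd p) \<partial>(atom_kernel Q n \<omega> \<Otimes>\<^sub>M atom_kernel Q m \<omega>)))"
      using AE_nn_integral_kernel_apply[OF Q] AE_space
    proof eventually_elim
      case (elim \<omega>)
      let ?\<Psi> = "kernel_apply Q \<Phi> \<omega>"
      have m: "f \<in> borel_measurable borel \<Longrightarrow> f \<in> borel_measurable ?\<Psi>" for f :: "'a \<Rightarrow> ennreal"
        using measurable_cong_sets[OF kernel_apply_sets(1)[OF Q elim(2)] refl] by blast
      have "(\<integral>\<^sup>+u. g u \<partial>?\<Psi>) * (\<integral>\<^sup>+v. h v \<partial>?\<Psi>) = (\<integral>\<^sup>+u. \<integral>\<^sup>+v. g u * h v \<partial>?\<Psi> \<partial>?\<Psi>)"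
        by (simp add: nn_integral_cmult nn_integral_multc m g h)
      also have "\<dots> = (\<Sum>n. \<Sum>m. mass n \<omega> * mass m \<omega> * (\<integral>\<^sup>+p. g (fst p) * h (snd p) \<partial>(atom_kernel Q n \<omega> \<Otimes>\<^sub>M atom_kernel Q m \<omega>)))"
        using nn_integral_double_sum[OF Q elim(2), of "\<lambda>f. \<integral>\<^sup>+u. f u \<partial>?\<Psi>", OF _ H] elim(1) by simp
      finally show ?case .
    qed
  qed
  also have "\<dots> = (\<integral>\<^sup>+p. g (fst p) * h (snd p) \<partial>second_moment Q)"
    by (rule nn_integral_second_moment'[OF Q H, symmetric])
  finally show ?thesis .
qed

lemma emeasure_second_moment_Times:
  assumes Q: "Q \<in> kernels" and A: "A \<in> sets borel" and B: "B \<in> sets borel"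
  shows "(\<integral>\<^sup>+\<omega>. emeasure (kernel_apply Q \<Phi> \<omega>) A * emeasure (kernel_apply Q \<Phi> \<omega>) B \<partial>P) = emeasure (second_moment Q) (A \<times> B)"
proof -
  have "(\<integral>\<^sup>+\<omega>. emeasure (kernel_apply Q \<Phi> \<omega>) A * emeasure (kernel_apply Q \<Phi> \<omega>) B \<partial>P) =
    (\<integral>\<^sup>+\<omega>. (\<integral>\<^sup>+u. indicator A u \<partial>kernel_apply Q \<Phi> \<omega>) * (\<integral>\<^sup>+v. indicator B v \<partial>kernel_apply Q \<Phi> \<omega>) \<partial>P)"
    using A B kernel_apply_sets[OF Q] by (intro nn_integral_cong) simp
  also have "\<dots> = (\<integral>\<^sup>+p. indicator A (fst p) * indicator B (snd p) \<partial>second_moment Q)"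
    by (rule second_moment_Times[OF Q]) (use A B in simp_all)
  also have "\<dots> = (\<integral>\<^sup>+p. indicator (A \<times> B) p \<partial>second_moment Q)"
    by (intro nn_integral_cong) (auto simp: indicator_def split: prod.split)
  finally show ?thesis using A B by simp
qed

end

context bartlett_setting
begin

lemma equivariant_F: "shift_equivariant (mix_double F)"
  by (rule shift_equivariant_mix_double[OF F_measurable F_shift])

lemmas mix_measurable = mix_double_measurable[OF F_measurable]

lemma locally_square_integrable_iff:
  assumes Q: "Q \<in> kernels"
  shows "locally_square_integrable P (kernel_apply Q \<Phi>) \<longleftrightarrow>
    (\<forall>B\<in>sets borel. bounded B \<longrightarrow> emeasure (second_moment Q) (B \<times> B) < \<infinity>)"
  using emeasure_second_moment_Times[OF Q] by (simp add: locally_square_integrable_def power2_eq_square)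

text \<open>The bound is the Lebesgue measure of \<open>B\<close> times the finite mass of the
  difference measure.\<close>

lemma diagonal_moment_finite:
  assumes R: "R \<in> prob_algebra borel \<rightarrow>\<^sub>M prob_algebra (borel \<Otimes>\<^sub>M borel)" and eqv: "shift_equivariant R"
    and B: "B \<in> sets borel" "bounded B"
  shows "diagonal_moment R (indicator (B \<times> B)) < \<infinity>"
proof -
  interpret D: finite_measure "difference_measure R" by (rule finite_difference_measure[OF finite_weighted R])
  have "diagonal_moment R (indicator (B \<times> B)) = (\<integral>\<^sup>+w. \<integral>\<^sup>+z. indicator (B \<times> B) (z, z + w) \<partial>lborel \<partial>difference_measure R)"
    using B by (intro diagonal_moment_eq[OF R eqv]) simp
  also have "\<dots> \<le> (\<integral>\<^sup>+w. \<integral>\<^sup>+z. indicator B (z :: 'a) \<partial>lborel \<partial>difference_measure R)"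
    by (intro nn_integral_mono) (auto simp: indicator_def)
  also have "\<dots> = emeasure lborel B * emeasure (difference_measure R) (space (difference_measure R))" using B by simp
  also have "\<dots> < \<infinity>"
  proof -
    have "emeasure (difference_measure R) (space (difference_measure R)) < \<top>"
      using D.emeasure_finite by (metis top.not_eq_extremum infinity_ennreal_def)
    then show ?thesis using emeasure_bounded_finite[OF B(2)] by (simp add: ennreal_mult_less_top)
  qed
  finally show ?thesis .
qed

text \<open>On \<open>B \<times> B\<close> with bounded \<open>B\<close> both diagonal terms are
  finite, so the identity makes the two second moments finite together. The two alternatives of the
  hypothesis thereby become one.\<close>

lemma locally_square_integrable_K_iff_L:
  "locally_square_integrable P (kernel_apply K \<Phi>) \<longleftrightarrow> locally_square_integrable P (kernel_apply L \<Phi>)"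
proof -
  have "emeasure (second_moment K) (B \<times> B) < \<infinity> \<longleftrightarrow> emeasure (second_moment L) (B \<times> B) < \<infinity>"
    if B: "B \<in> sets borel" "bounded B" for B
  proof -
    have e: "emeasure (second_moment K) (B \<times> B) + diagonal_moment double (indicator (B \<times> B)) =
        emeasure (second_moment L) (B \<times> B) + diagonal_moment (mix_double F) (indicator (B \<times> B))"
      using second_moment_identity[of "indicator (B \<times> B)"] B(1) by simp
    show ?thesis
      using arg_cong[OF e, of "\<lambda>x. x < \<infinity>"] diagonal_moment_finite[OF double_measurable shift_equivariant_double B]
        diagonal_moment_finite[OF mix_measurable equivariant_F B] by simp
  qed
  then show ?thesis
    unfolding locally_square_integrable_iff[OF K_measurable] locally_square_integrable_iff[OF L_measurable] by blast
qed

lemma finite_mean: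
  assumes Q: "Q \<in> kernels" and lsq: "locally_square_integrable P (kernel_apply Q \<Phi>)"
    and B: "B \<in> sets borel" "bounded B"
  shows "(\<integral>\<^sup>+\<omega>. emeasure (kernel_apply Q \<Phi> \<omega>) B \<partial>P) < \<infinity>"
proof -
  let ?X = "\<lambda>\<omega>. emeasure (kernel_apply Q \<Phi> \<omega>) B"
  note [measurable] = emeasure_kernel_apply_measurable[OF Q B(1)]
  have le: "x \<le> 1 + x\<^sup>2" for x :: ennreal
  proof (cases "x \<le> 1")
    case False
    then have "x * 1 \<le> x * x" by (intro mult_left_mono) auto
    then show ?thesis by (simp add: power2_eq_square add_increasing)
  qed (simp add: add_increasing2)
  have "(\<integral>\<^sup>+\<omega>. ?X \<omega> \<partial>P) \<le> (\<integral>\<^sup>+\<omega>. 1 + (?X \<omega>)\<^sup>2 \<partial>P)" by (intro nn_integral_mono le)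
  also have "\<dots> = 1 + (\<integral>\<^sup>+\<omega>. (?X \<omega>)\<^sup>2 \<partial>P)" by (subst nn_integral_add) (simp_all add: emeasure_space_1)
  also have "\<dots> < \<infinity>" using lsq B by (simp add: locally_square_integrable_def)
  finally show ?thesis .
qed

text \<open>The mean on each ball of integer radius is finite; these balls are countably many and
  absorb every bounded set, so one null set serves for all.\<close>

lemma AE_locally_finite_kernel_apply:
  assumes Q: "Q \<in> kernels" and lsq: "locally_square_integrable P (kernel_apply Q \<Phi>)"
  shows "AE \<omega> in P. locally_finite_measure (kernel_apply Q \<Phi> \<omega>)"
proof -
  have "AE \<omega> in P. emeasure (kernel_apply Q \<Phi> \<omega>) (cball 0 (real n)) \<noteq> \<infinity>" for n
    using finite_mean[OF Q lsq, of "cball 0 (real n)"]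
    by (intro nn_integral_PInf_AE emeasure_kernel_apply_measurable[OF Q]) simp_all
  then have "AE \<omega> in P. \<forall>n. emeasure (kernel_apply Q \<Phi> \<omega>) (cball 0 (real n)) \<noteq> \<infinity>" by (simp add: AE_all_countable)
  with AE_space show ?thesis
  proof eventually_elim
    case (elim \<omega>)
    note s = kernel_apply_sets[OF Q elim(1)]
    show ?case
      unfolding locally_finite_measure_def
    proof (intro conjI ballI impI s(1))
      fix B :: "'a set" assume B: "B \<in> sets borel" "bounded B"
      then obtain r where r: "\<And>x. x \<in> B \<Longrightarrow> norm x \<le> r" by (auto simp: bounded_iff)
      obtain n :: nat where n: "r \<le> real n" using real_arch_simple by blast
      have "emeasure (kernel_apply Q \<Phi> \<omega>) B \<le> emeasure (kernel_apply Q \<Phi> \<omega>) (cball 0 (real n))"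
        using r n s(1) by (intro emeasure_mono) (auto intro!: order_trans[OF r n])
      also have "\<dots> < \<infinity>" using elim(2) by (metis top.not_eq_extremum infinity_ennreal_def)
      finally show "emeasure (kernel_apply Q \<Phi> \<omega>) B < \<infinity>" .
    qed
  qed
qed

subsection \<open>Reduced second moments\<close>

text \<open>The reduced second moment taken from \<open>second_moment\<close>. It is a measure by
  construction; the agreement with the set function in \<open>reduced_second_moment\<close> is shown
  under square integrability.\<close>

definition \<alpha> :: "('w \<times> 'a \<Rightarrow> 'a measure) \<Rightarrow> 'a measure" where
  "\<alpha> Q = distr (density (second_moment Q) (\<lambda>p. indicator unit_cube (fst p))) borel (\<lambda>p. snd p - fst p)"

lemma sets_\<alpha> [simp]: "sets (\<alpha> Q) = sets borel" and space_\<alpha> [simp]: "space (\<alpha> Q) = UNIV"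
  by (simp_all add: \<alpha>_def)

lemma nn_integral_\<alpha>:
  assumes f [measurable]: "f \<in> borel_measurable borel"
  shows "(\<integral>\<^sup>+y. f y \<partial>\<alpha> Q) = (\<integral>\<^sup>+p. indicator unit_cube (fst p) * f (snd p - fst p) \<partial>second_moment Q)"
proof -
  have d: "(\<lambda>p. snd p - fst p :: 'a) \<in> borel \<Otimes>\<^sub>M borel \<rightarrow>\<^sub>M borel" by measurable
  have i: "(\<lambda>p. indicator unit_cube (fst p :: 'a) :: ennreal) \<in> borel_measurable (borel \<Otimes>\<^sub>M (borel :: 'a measure))" by measurable
  have "(\<integral>\<^sup>+y. f y \<partial>\<alpha> Q) = (\<integral>\<^sup>+p. f (snd p - fst p) \<partial>density (second_moment Q) (\<lambda>p. indicator unit_cube (fst p)))"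
    unfolding \<alpha>_def by (rule nn_integral_distr') (use d f in simp_all)
  also have "\<dots> = (\<integral>\<^sup>+p. indicator unit_cube (fst p) * f (snd p - fst p) \<partial>second_moment Q)"
    by (rule nn_integral_density) (use i measurable_compose[OF d f] in simp_all)
  finally show ?thesis .
qed

lemma reduced_second_moment_eq:
  assumes Q: "Q \<in> kernels" and lsq: "locally_square_integrable P (kernel_apply Q \<Phi>)"
  shows "reduced_second_moment P (kernel_apply Q \<Phi>) = \<alpha> Q"
proof -
  have "reduced_second_moment P (kernel_apply Q \<Phi>) = measure_of UNIV (sets borel) (emeasure (\<alpha> Q))"
    unfolding reduced_second_moment_def
  proof (rule measure_of_eq)
    fix B :: "'a set" assume "B \<in> sigma_sets UNIV (sets borel)"
    then have B [measurable]: "B \<in> sets borel" using sets.sigma_sets_eq[of "borel :: 'a measure"] by simp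
    let ?H = "\<lambda>p. indicator unit_cube (fst p) * indicator B (snd p - fst p) :: ennreal"
    have H: "?H \<in> borel_measurable (borel \<Otimes>\<^sub>M borel)" by measurable
    have "(\<integral>\<^sup>+\<omega>. (\<integral>\<^sup>+(x, y). indicator unit_cube x * indicator B (y - x) \<partial>(kernel_apply Q \<Phi> \<omega> \<Otimes>\<^sub>M kernel_apply Q \<Phi> \<omega>)) \<partial>P) =
      (\<integral>\<^sup>+\<omega>. (\<Sum>n. \<Sum>m. mass n \<omega> * mass m \<omega> * (\<integral>\<^sup>+p. ?H p \<partial>(atom_kernel Q n \<omega> \<Otimes>\<^sub>M atom_kernel Q m \<omega>))) \<partial>P)"
    proof (rule nn_integral_cong_AE)
      show "AE \<omega> in P. (\<integral>\<^sup>+(x, y). indicator unit_cube x * indicator B (y - x) \<partial>(kernel_apply Q \<Phi> \<omega> \<Otimes>\<^sub>M kernel_apply Q \<Phi> \<omega>)) =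
        (\<Sum>n. \<Sum>m. mass n \<omega> * mass m \<omega> * (\<integral>\<^sup>+p. ?H p \<partial>(atom_kernel Q n \<omega> \<Otimes>\<^sub>M atom_kernel Q m \<omega>)))"
        using AE_nn_integral_pair_kernel_apply[OF Q H] AE_locally_finite_kernel_apply[OF Q lsq]
        by eventually_elim (simp add: case_prod_beta')
    qed
    also have "\<dots> = (\<integral>\<^sup>+y. indicator B y \<partial>\<alpha> Q)"
      unfolding nn_integral_\<alpha>[OF borel_measurable_indicator[OF B]] by (rule nn_integral_second_moment'[OF Q H, symmetric])
    finally show "(\<integral>\<^sup>+\<omega>. (\<integral>\<^sup>+(x, y). indicator unit_cube x * indicator B (y - x) \<partial>(kernel_apply Q \<Phi> \<omega> \<Otimes>\<^sub>M kernel_apply Q \<Phi> \<omega>)) \<partial>P) = emeasure (\<alpha> Q) B"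
      by simp
  qed simp
  also have "\<dots> = \<alpha> Q" using measure_of_of_measure[of "\<alpha> Q"] by simp
  finally show ?thesis .
qed

text \<open>In a diagonal term the first point is distributed by Lebesgue measure, which gives the
  unit cube mass 1, so the diagonals reduce exactly to the two difference measures.\<close>

lemma \<alpha>_identity:
  assumes f [measurable]: "f \<in> borel_measurable borel"
  shows "(\<integral>\<^sup>+y. f y \<partial>\<alpha> K) + (\<integral>\<^sup>+y. f y \<partial>DL) = (\<integral>\<^sup>+y. f y \<partial>\<alpha> L) + (\<integral>\<^sup>+y. f y \<partial>DF)"
proof -
  let ?H = "\<lambda>p. indicator unit_cube (fst p) * f (snd p - fst p)"
  have H: "?H \<in> borel_measurable (borel \<Otimes>\<^sub>M borel)" by measurable
  have 1: "(\<integral>\<^sup>+z. ?H (z, z + w) \<partial>lborel) = f w" for w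
  proof -
    have "(\<integral>\<^sup>+z. ?H (z, z + w) \<partial>lborel) = (\<integral>\<^sup>+z. indicator unit_cube (z :: 'a) \<partial>lborel) * f w"
      by (simp add: nn_integral_multc)
    also have "(\<integral>\<^sup>+z. indicator unit_cube (z :: 'a) \<partial>lborel) = (1 :: ennreal)"
      by (simp add: unit_cube_def emeasure_lborel_cbox_eq)
    finally show ?thesis by simp
  qed
  show ?thesis
    using second_moment_identity[OF H]
    unfolding nn_integral_\<alpha>[OF f] diagonal_moment_eq[OF double_measurable shift_equivariant_double H]
      diagonal_moment_eq[OF mix_measurable equivariant_F H] 1 .
qed

text \<open>The mean of a single random kernel involves its barycentre alone. Equal intensities give
  both processes the same constant \<open>c\<close> in \<open>gauss_dual\<close>.\<close>

lemma intensity_K_eq_L: "intensity P (kernel_apply K \<Phi>) = intensity P (kernel_apply L \<Phi>)"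
proof -
  have e: "intensity P (kernel_apply Q \<Phi>) = (\<Sum>n. \<integral>\<^sup>+\<omega>. mass n \<omega> * emeasure (atom_kernel Q n \<omega>) unit_cube \<partial>P)"
    if Q: "Q \<in> kernels" for Q
  proof -
    have [measurable]: "(\<lambda>\<omega>. emeasure (atom_kernel Q n \<omega>) unit_cube) \<in> borel_measurable P" for n
      by (rule emeasure_prob_algebra_kernel[OF atom_kernel_measurable[OF Q]]) simp
    have "intensity P (kernel_apply Q \<Phi>) = (\<integral>\<^sup>+\<omega>. (\<Sum>n. mass n \<omega> * emeasure (atom_kernel Q n \<omega>) unit_cube) \<partial>P)"
      unfolding intensity_def
    proof (rule nn_integral_cong_AE)
      show "AE \<omega> in P. emeasure (kernel_apply Q \<Phi> \<omega>) unit_cube = (\<Sum>n. mass n \<omega> * emeasure (atom_kernel Q n \<omega>) unit_cube)"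
        using AE_nn_integral_kernel_apply[OF Q] AE_space
      proof eventually_elim
        case (elim \<omega>)
        show ?case
          using elim(1)[rule_format, of "indicator unit_cube"] kernel_apply_sets[OF Q elim(2)]
            sets_prob_algebra_kernel[OF atom_kernel_measurable[OF Q] elim(2)] by simp
      qed
    qed
    then show ?thesis by (simp add: nn_integral_suminf)
  qed
  have "(\<integral>\<^sup>+\<omega>. mass n \<omega> * emeasure (atom_kernel K n \<omega>) unit_cube \<partial>P) = (\<integral>\<^sup>+\<omega>. mass n \<omega> * emeasure (atom_kernel L n \<omega>) unit_cube \<partial>P)" for n
  proof -
    have sup: "supported {n} (mass n)" unfolding supported_def using mass_nonzero_iff mass_measurable_G by auto
    have "(\<integral>\<^sup>+\<omega>. mass n \<omega> * (\<integral>\<^sup>+\<pi>. emeasure \<pi> unit_cube \<partial>return (prob_algebra borel) (atom_kernel K n \<omega>)) \<partial>P) =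
       (\<integral>\<^sup>+\<omega>. mass n \<omega> * (\<integral>\<^sup>+\<pi>. emeasure \<pi> unit_cube \<partial>F (atom_kernel L n \<omega>)) \<partial>P)"
      by (rule nn_integral_kernel_eqI[where N="prob_algebra borel"])
         (use return_kernel F_kernel law_single[OF sup] emeasure_eval_measurable[OF unit_cube_sets] in auto)
    also have "(\<integral>\<^sup>+\<omega>. mass n \<omega> * (\<integral>\<^sup>+\<pi>. emeasure \<pi> unit_cube \<partial>return (prob_algebra borel) (atom_kernel K n \<omega>)) \<partial>P) =
       (\<integral>\<^sup>+\<omega>. mass n \<omega> * emeasure (atom_kernel K n \<omega>) unit_cube \<partial>P)"
      by (intro nn_integral_cong) (simp add: nn_integral_return_kernel emeasure_eval_measurable[OF unit_cube_sets])
    also have "(\<integral>\<^sup>+\<omega>. mass n \<omega> * (\<integral>\<^sup>+\<pi>. emeasure \<pi> unit_cube \<partial>F (atom_kernel L n \<omega>)) \<partial>P) =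
       (\<integral>\<^sup>+\<omega>. mass n \<omega> * emeasure (atom_kernel L n \<omega>) unit_cube \<partial>P)"
      by (intro nn_integral_cong) (simp add: F_mean[OF atL_space unit_cube_sets])
    finally show ?thesis .
  qed
  then show ?thesis by (simp add: e[OF K_measurable] e[OF L_measurable])
qed

end

text \<open>Averaging over shifts of the unit cube once more, now without marks; this is the
  uniqueness of Lebesgue measure among translation-invariant measures.\<close>

lemma nn_integral_translation_invariant:
  fixes M :: "'a::euclidean_space measure"
  assumes "sigma_finite_measure M" and s: "sets M = sets borel"
    and inv: "\<And>z f. f \<in> borel_measurable borel \<Longrightarrow> (\<integral>\<^sup>+x. f (x + z) \<partial>M) = (\<integral>\<^sup>+x. f x \<partial>M)"
    and u [measurable]: "u \<in> borel_measurable borel"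
  shows "(\<integral>\<^sup>+x. u x \<partial>M) = emeasure M unit_cube * (\<integral>\<^sup>+x. u x \<partial>lborel)"
proof -
  interpret M: sigma_finite_measure M by fact
  interpret pair_sigma_finite lborel M ..
  have sm: "sets (lborel \<Otimes>\<^sub>M M) = sets (borel \<Otimes>\<^sub>M borel)" by (intro sets_pair_measure_cong) (auto simp: s)
  note m = measurable_cong_sets[OF sm refl, THEN equalityD2, THEN subsetD]
  have mM: "f \<in> borel_measurable borel \<Longrightarrow> f \<in> borel_measurable M" for f :: "'a \<Rightarrow> ennreal"
    using measurable_cong_sets[OF s refl] by blast
  have "(\<integral>\<^sup>+x. u x \<partial>M) = (\<integral>\<^sup>+x. \<integral>\<^sup>+y. indicator unit_cube (x - y) * u x \<partial>lborel \<partial>M)"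
    by (subst nn_integral_multc) (auto simp: nn_integral_unit_cube)
  also have "\<dots> = (\<integral>\<^sup>+y. \<integral>\<^sup>+x. indicator unit_cube (x - y) * u x \<partial>M \<partial>lborel)"
    by (rule Fubini', rule m) measurable
  also have "\<dots> = (\<integral>\<^sup>+y. \<integral>\<^sup>+x. indicator unit_cube x * u (x + y) \<partial>M \<partial>lborel)"
  proof (rule nn_integral_cong)
    fix y :: 'a
    have [measurable]: "(\<lambda>x. indicator unit_cube (x - y) * u x) \<in> borel_measurable borel" by measurable
    show "(\<integral>\<^sup>+x. indicator unit_cube (x - y) * u x \<partial>M) = (\<integral>\<^sup>+x. indicator unit_cube x * u (x + y) \<partial>M)"
      by (subst inv[symmetric, of _ y]) simp_all
  qed
  also have "\<dots> = (\<integral>\<^sup>+x. \<integral>\<^sup>+y. indicator unit_cube x * u (x + y) \<partial>lborel \<partial>M)"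
    by (rule Fubini'[symmetric], rule m) measurable
  also have "\<dots> = (\<integral>\<^sup>+x. indicator unit_cube x * (\<integral>\<^sup>+y. u y \<partial>lborel) \<partial>M)"
    using nn_integral_lborel_subst(1)[OF u] by (simp add: nn_integral_cmult add.commute)
  also have "\<dots> = emeasure M unit_cube * (\<integral>\<^sup>+y. u y \<partial>lborel)"
    by (subst nn_integral_multc) (simp_all add: mM s)
  finally show ?thesis .
qed

context bartlett_setting
begin

lemma AE_nn_integral_snd_T:
  "AE \<omega> in P. \<forall>f\<in>borel_measurable borel. (\<integral>\<^sup>+p. f (snd p) \<partial>T \<omega>) = (\<Sum>n. mass n \<omega> * (\<integral>\<^sup>+u. f u \<partial>atom_kernel L n \<omega>))"
  using AE_nn_integral_T AE_nn_integral_\<Phi> AE_space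
proof eventually_elim
  case (elim \<omega>)
  show ?case
  proof
    fix f :: "'a \<Rightarrow> ennreal" assume f [measurable]: "f \<in> borel_measurable borel"
    have "(\<lambda>p. f (snd p)) \<in> borel_measurable (borel :: ('a \<times> 'a) measure)" by measurable
    with elim(1) have "(\<integral>\<^sup>+p. f (snd p) \<partial>T \<omega>) = (\<integral>\<^sup>+x. \<integral>\<^sup>+y. f y \<partial>L (\<omega>, x) \<partial>\<Phi> \<omega>)" by auto
    also have "\<dots> = (\<Sum>n. mass n \<omega> * (\<integral>\<^sup>+u. f u \<partial>atom_kernel L n \<omega>))"
      using elim(2) nn_integral_prob_algebra_kernel[OF kernel_section(1)[OF L_measurable elim(3)] f]
      by (simp add: atom_kernel_def)
    finally show "(\<integral>\<^sup>+p. f (snd p) \<partial>T \<omega>) = (\<Sum>n. mass n \<omega> * (\<integral>\<^sup>+u. f u \<partial>atom_kernel L n \<omega>))" .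
  qed
qed

text \<open>L\<Phi> is the second marginal of \<open>T\<close>, so its second moment is the mean of
  a functional of \<open>T\<close> alone, to which stationarity applies.\<close>

lemma nn_integral_second_moment_T:
  assumes H: "H \<in> borel_measurable (borel \<Otimes>\<^sub>M borel)"
  shows "(\<integral>\<^sup>+p. H p \<partial>second_moment L) = (\<integral>\<^sup>+\<omega>. \<integral>\<^sup>+p. \<integral>\<^sup>+q. H (snd p, snd q) \<partial>T \<omega> \<partial>T \<omega> \<partial>P)"
  unfolding nn_integral_second_moment'[OF L_measurable H]
proof (rule nn_integral_cong_AE)
  show "AE \<omega> in P. (\<Sum>n. \<Sum>m. pair_moment L H n m \<omega>) =
     (\<integral>\<^sup>+p. \<integral>\<^sup>+q. H (snd p, snd q) \<partial>T \<omega> \<partial>T \<omega>)"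
    using AE_nn_integral_snd_T AE_space
  proof eventually_elim
    case (elim \<omega>)
    show ?case
      using nn_integral_double_sum[OF L_measurable elim(2), of "\<lambda>f. \<integral>\<^sup>+p. f (snd p) \<partial>T \<omega>", OF _ H] elim(1) by simp
  qed
qed

lemma second_moment_shift:
  assumes H [measurable]: "H \<in> borel_measurable (borel \<Otimes>\<^sub>M borel)"
  shows "(\<integral>\<^sup>+p. H (fst p - x, snd p - x) \<partial>second_moment L) = (\<integral>\<^sup>+p. H p \<partial>second_moment L)"
proof -
  define V where "V \<mu> = (\<integral>\<^sup>+p. \<integral>\<^sup>+q. H (snd p, snd q) \<partial>\<mu> \<partial>\<mu>)" for \<mu> :: "('a \<times> 'a) measure"
  have inner: "(\<lambda>(\<mu>, p). \<integral>\<^sup>+q. H (snd p, snd q) \<partial>\<mu>) \<in> borel_measurable ((lf_measures :: ('a \<times> 'a) measure measure) \<Otimes>\<^sub>M (borel :: ('a \<times> 'a) measure))"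
    unfolding case_prod_beta'
    by (rule measurable_nn_integral_lf) measurable
  have V: "V \<in> borel_measurable lf_measures"
    unfolding V_def by (rule measurable_nn_integral_lf[OF _ inner]) simp
  have Hx: "(\<lambda>p. H (fst p - x, snd p - x)) \<in> borel_measurable (borel \<Otimes>\<^sub>M borel)" by measurable
  have "(\<integral>\<^sup>+p. H p \<partial>second_moment L) = (\<integral>\<^sup>+\<omega>. V (T \<omega>) \<partial>P)"
    unfolding V_def by (rule nn_integral_second_moment_T[OF H])
  also have "\<dots> = (\<integral>\<^sup>+\<omega>. V (diag_shift x (T \<omega>)) \<partial>P)" by (rule nn_integral_stationary[OF V, symmetric])
  also have "\<dots> = (\<integral>\<^sup>+\<omega>. \<integral>\<^sup>+p. \<integral>\<^sup>+q. H (snd p - x, snd q - x) \<partial>T \<omega> \<partial>T \<omega> \<partial>P)"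
  proof (rule nn_integral_cong)
    fix \<omega> assume \<omega>: "\<omega> \<in> space P"
    let ?\<mu> = "diag_shift x (T \<omega>)"
    have "?\<mu> \<in> space lf_measures" using measurable_space[OF diag_shift_T_measurable \<omega>] .
    from measurable_Pair2[OF inner this] have "(\<lambda>p :: 'a \<times> 'a. \<integral>\<^sup>+q. H (snd p, snd q) \<partial>?\<mu>) \<in> borel_measurable borel" by simp
    then have "V ?\<mu> = (\<integral>\<^sup>+p. \<integral>\<^sup>+q. H (snd (fst p - x, snd p - x), snd q) \<partial>?\<mu> \<partial>T \<omega>)"
      unfolding V_def by (rule nn_integral_diag_shift[OF sets_T[OF \<omega>]])
    also have "\<dots> = (\<integral>\<^sup>+p. \<integral>\<^sup>+q. H (snd p - x, snd q - x) \<partial>T \<omega> \<partial>T \<omega>)"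
    proof (rule nn_integral_cong)
      fix p :: "'a \<times> 'a"
      have "(\<lambda>q. H (snd (fst p - x, snd p - x), snd q)) \<in> borel_measurable (borel :: ('a \<times> 'a) measure)" by measurable
      from nn_integral_diag_shift[OF sets_T[OF \<omega>] this, of x]
      show "(\<integral>\<^sup>+q. H (snd (fst p - x, snd p - x), snd q) \<partial>?\<mu>) = (\<integral>\<^sup>+q. H (snd p - x, snd q - x) \<partial>T \<omega>)" by simp
    qed
    finally show "V ?\<mu> = (\<integral>\<^sup>+p. \<integral>\<^sup>+q. H (snd p - x, snd q - x) \<partial>T \<omega> \<partial>T \<omega>)" .
  qed
  also have "\<dots> = (\<integral>\<^sup>+p. H (fst p - x, snd p - x) \<partial>second_moment L)"
    using nn_integral_second_moment_T[OF Hx] by simp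
  finally show ?thesis ..
qed

text \<open>The summation indices and the factors of the product are exchanged together. For
  \<open>L\<close> this leads to symmetry of the reduced measure and hence to a real
  transform.\<close>

lemma second_moment_swap:
  assumes Q: "Q \<in> kernels" and H: "H \<in> borel_measurable (borel \<Otimes>\<^sub>M borel)"
  shows "(\<integral>\<^sup>+p. H (snd p, fst p) \<partial>second_moment Q) = (\<integral>\<^sup>+p. H p \<partial>second_moment Q)"
proof -
  have Hs: "(\<lambda>p. H (snd p, fst p)) \<in> borel_measurable (borel \<Otimes>\<^sub>M borel)" using H by measurable
  have swap: "(\<Sum>n. \<Sum>m. a n m) = (\<Sum>m. \<Sum>n. a n m)" for a :: "nat \<Rightarrow> nat \<Rightarrow> ennreal"
    using nn_integral_suminf[of "\<lambda>m n. a n m" "count_space UNIV"] by (simp add: nn_integral_count_space_nat)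
  have e: "(\<integral>\<^sup>+p. H (snd p, fst p) \<partial>(atom_kernel Q n \<omega> \<Otimes>\<^sub>M atom_kernel Q m \<omega>)) = (\<integral>\<^sup>+p. H p \<partial>(atom_kernel Q m \<omega> \<Otimes>\<^sub>M atom_kernel Q n \<omega>))"
    if \<omega>: "\<omega> \<in> space P" for n m \<omega>
  proof -
    note q = sets_prob_algebra_kernel[OF atom_kernel_measurable[OF Q] \<omega>]
    interpret A: prob_space "atom_kernel Q m \<omega>" by (rule q)
    interpret B: prob_space "atom_kernel Q n \<omega>" by (rule q)
    interpret pair_sigma_finite "atom_kernel Q m \<omega>" "atom_kernel Q n \<omega>" ..
    have "H \<in> borel_measurable (atom_kernel Q m \<omega> \<Otimes>\<^sub>M atom_kernel Q n \<omega>)"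
      using H measurable_cong_sets[OF sets_pair_measure_cong[OF q(1) q(1)] refl] by blast
    then show ?thesis
      by (subst distr_pair_swap, subst nn_integral_distr) (auto simp: case_prod_beta' measurable_pair_swap')
  qed
  have "(\<integral>\<^sup>+p. H (snd p, fst p) \<partial>second_moment Q) =
     (\<Sum>n. \<Sum>m. \<integral>\<^sup>+\<omega>. pair_moment Q H m n \<omega> \<partial>P)"
    unfolding nn_integral_second_moment[OF Q Hs] by (intro suminf_cong nn_integral_cong) (simp add: e mult.commute)
  also have "\<dots> = (\<integral>\<^sup>+p. H p \<partial>second_moment Q)"
    unfolding nn_integral_second_moment[OF Q H] by (rule swap)
  finally show ?thesis .
qed

end

locale bartlett_square_integrable = bartlett_setting P T L F K X
  for P :: "'w measure" and T :: "'w \<Rightarrow> ('a::euclidean_space \<times> 'a) measure" and L :: "'w \<times> 'a \<Rightarrow> 'a measure"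
    and F :: "'a measure \<Rightarrow> 'a measure measure" and K :: "'w \<times> 'a \<Rightarrow> 'a measure" and X :: "nat \<Rightarrow> 'w \<Rightarrow> 'a" +
  assumes square_integrable: "locally_square_integrable P (kernel_apply L \<Phi>)"
begin

lemma square_integrable_K: "locally_square_integrable P (kernel_apply K \<Phi>)"
  by (simp add: locally_square_integrable_K_iff_L square_integrable)

text \<open>In the coordinates of first point and difference, a diagonal shift moves the first
  coordinate alone, so \<open>nn_integral_shift_invariant\<close> factors the second moment into
  Lebesgue measure and \<open>\<alpha> L\<close>.\<close>

theorem nn_integral_second_moment_disintegrate:
  assumes H [measurable]: "H \<in> borel_measurable (borel \<Otimes>\<^sub>M borel)"
  shows "(\<integral>\<^sup>+p. H p \<partial>second_moment L) = (\<integral>\<^sup>+w. \<integral>\<^sup>+z. H (z, z + w) \<partial>lborel \<partial>\<alpha> L)"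
proof -
  let ?B = "borel \<Otimes>\<^sub>M borel :: ('a \<times> 'a) measure"
  let ?h = "\<lambda>p. (fst p, snd p - fst p) :: 'a \<times> 'a"
  define M where "M = distr (second_moment L) ?B ?h"
  have h: "?h \<in> second_moment L \<rightarrow>\<^sub>M ?B" unfolding measurable_second_moment by measurable
  have sM: "sets M = sets ?B" by (simp add: M_def)
  have nM: "(\<integral>\<^sup>+p. f p \<partial>M) = (\<integral>\<^sup>+p. f (?h p) \<partial>second_moment L)" if "f \<in> borel_measurable ?B" for f
    unfolding M_def by (rule nn_integral_distr'[OF h that])
  have "sigma_finite_measure M"
  proof
    \<comment> \<open>In the original coordinates these sets are squares of balls, where square
      integrability gives finite mass.\<close>
    let ?A = "\<lambda>n::nat. {q. fst q \<in> cball 0 (real n) \<and> fst q + snd q \<in> cball (0::'a) (real n)}"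
    have A: "?A n \<in> sets ?B" for n
    proof -
      have [measurable]: "cball (0::'a) (real n) \<in> sets borel" by simp
      have "{q \<in> space ?B. fst q \<in> cball 0 (real n) \<and> fst q + snd q \<in> cball (0::'a) (real n)} \<in> sets ?B" by measurable
      then show ?thesis by (simp add: space_pair_measure)
    qed
    show "\<exists>A. countable A \<and> A \<subseteq> sets M \<and> \<Union>A = space M \<and> (\<forall>a\<in>A. emeasure M a \<noteq> \<infinity>)"
    proof (intro exI conjI ballI)
      show "countable (range ?A)" by simp
      show "range ?A \<subseteq> sets M" using A sM by auto
      have "\<exists>n::nat. norm (fst q) \<le> real n \<and> norm (fst q + snd q) \<le> real n" for q :: "'a \<times> 'a"
        using real_arch_simple[of "max (norm (fst q)) (norm (fst q + snd q))"] by auto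
      then show "\<Union>(range ?A) = space M" using sets_eq_imp_space_eq[OF sM] by (auto simp: space_pair_measure)
      fix a assume "a \<in> range ?A"
      then obtain n where a: "a = ?A n" by blast
      have "emeasure M a = (\<integral>\<^sup>+p. indicator (?A n) (?h p) \<partial>second_moment L)"
        unfolding a using nM[of "indicator (?A n)"] A sM by simp
      also have "\<dots> = (\<integral>\<^sup>+p. indicator (cball 0 (real n) \<times> cball 0 (real n)) p \<partial>second_moment L)"
        by (intro nn_integral_cong) (auto simp: indicator_def)
      also have "\<dots> < \<infinity>"
        using square_integrable by (simp add: locally_square_integrable_iff[OF L_measurable])
      finally show "emeasure M a \<noteq> \<infinity>" by simp
    qed
  qed
  moreover have "distr M ?B (\<lambda>(x, s). (x + z, s)) = M" for z
  proof (rule measure_eqI)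
    fix A assume "A \<in> sets (distr M ?B (\<lambda>(x, s). (x + z, s)))"
    then have A [measurable]: "A \<in> sets ?B" by simp
    have i: "(\<lambda>p. indicator A (?h p) :: ennreal) \<in> borel_measurable ?B" by measurable
    have i': "(\<lambda>p. indicator A (fst p + z, snd p) :: ennreal) \<in> borel_measurable ?B" by measurable
    have z: "(\<lambda>(x, s). (x + z, s)) \<in> M \<rightarrow>\<^sub>M ?B" unfolding measurable_cong_sets[OF sM refl] by measurable
    have "emeasure (distr M ?B (\<lambda>(x, s). (x + z, s))) A = (\<integral>\<^sup>+p. indicator A p \<partial>distr M ?B (\<lambda>(x, s). (x + z, s)))" by simp
    also have "\<dots> = (\<integral>\<^sup>+p. indicator A (fst p + z, snd p) \<partial>M)"
      using nn_integral_distr'[OF z, of "indicator A"] by (simp add: case_prod_beta')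
    also have "\<dots> = (\<integral>\<^sup>+p. indicator A (?h (fst p - (- z), snd p - (- z))) \<partial>second_moment L)"
      unfolding nM[OF i'] by simp
    also have "\<dots> = (\<integral>\<^sup>+p. indicator A (?h p) \<partial>second_moment L)" by (rule second_moment_shift[OF i])
    also have "\<dots> = emeasure M A" using nM[of "indicator A"] sM by simp
    finally show "emeasure (distr M ?B (\<lambda>(x, s). (x + z, s))) A = emeasure M A" .
  qed (simp add: sM)
  moreover have u: "(\<lambda>p. H (fst p, fst p + snd p)) \<in> borel_measurable ?B" by measurable
  ultimately have "(\<integral>\<^sup>+p. H (fst p, fst p + snd p) \<partial>M) = (\<integral>\<^sup>+p. indicator unit_cube (fst p) * (\<integral>\<^sup>+z. H (z, z + snd p) \<partial>lborel) \<partial>M)"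
    using nn_integral_shift_invariant[OF _ sM _ u] by simp
  moreover have g: "(\<lambda>w. \<integral>\<^sup>+z. H (z, z + w) \<partial>lborel) \<in> borel_measurable borel" by measurable
  moreover have "(\<lambda>p. indicator unit_cube (fst p) * (\<integral>\<^sup>+z. H (z, z + snd p) \<partial>lborel)) \<in> borel_measurable ?B"
    using measurable_compose[OF measurable_snd g] by measurable
  ultimately show ?thesis
    using nM[OF u] nM[of "\<lambda>p. indicator unit_cube (fst p) * (\<integral>\<^sup>+z. H (z, z + snd p) \<partial>lborel)"] by (simp add: nn_integral_\<alpha>)
qed

text \<open>The mean measure of L\<Phi> is translation invariant and finite on bounded sets, hence a
  multiple of Lebesgue measure, and the unit cube determines the factor.\<close>

lemma nn_integral_mean:
  assumes f [measurable]: "f \<in> borel_measurable borel"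
  shows "(\<integral>\<^sup>+\<omega>. \<integral>\<^sup>+u. f u \<partial>kernel_apply L \<Phi> \<omega> \<partial>P) = intensity P (kernel_apply L \<Phi>) * (\<integral>\<^sup>+x. f x \<partial>lborel)"
proof -
  define M where "M = mixture P (kernel_apply L \<Phi>) borel"
  note k = kernel_apply_sets(1)[OF L_measurable] emeasure_kernel_apply_measurable[OF L_measurable]
  have nM: "(\<integral>\<^sup>+x. g x \<partial>M) = (\<integral>\<^sup>+\<omega>. \<integral>\<^sup>+u. g u \<partial>kernel_apply L \<Phi> \<omega> \<partial>P)" if "g \<in> borel_measurable borel" for g
    unfolding M_def by (rule nn_integral_mixture) (use k that in auto)
  have eM: "emeasure M B = (\<integral>\<^sup>+\<omega>. emeasure (kernel_apply L \<Phi> \<omega>) B \<partial>P)" if "B \<in> sets borel" for B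
    unfolding M_def by (rule emeasure_mixture) (use k that in auto)
  have sM: "sets M = sets borel" by (simp add: M_def)
  have "locally_finite_measure M"
    using finite_mean[OF L_measurable square_integrable] by (simp add: locally_finite_measure_def sM eM)
  then have "sigma_finite_measure M" by (rule locally_finite_measure_sigma_finite)
  moreover have "(\<integral>\<^sup>+x. g (x + z) \<partial>M) = (\<integral>\<^sup>+x. g x \<partial>M)" if g [measurable]: "g \<in> borel_measurable borel" for z g
  proof -
    have nT: "(\<integral>\<^sup>+x. g x \<partial>M) = (\<integral>\<^sup>+\<omega>. \<integral>\<^sup>+p. g (snd p) \<partial>T \<omega> \<partial>P)" if g: "g \<in> borel_measurable borel" for g
      unfolding nM[OF g]
    proof (rule nn_integral_cong_AE)
      show "AE \<omega> in P. (\<integral>\<^sup>+u. g u \<partial>kernel_apply L \<Phi> \<omega>) = (\<integral>\<^sup>+p. g (snd p) \<partial>T \<omega>)"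
        using AE_nn_integral_snd_T AE_nn_integral_kernel_apply[OF L_measurable] by eventually_elim (simp add: g)
    qed
    have V: "(\<lambda>\<mu>. \<integral>\<^sup>+p. g (snd p) \<partial>\<mu>) \<in> borel_measurable (lf_measures :: ('a \<times> 'a) measure measure)"
      by (rule measurable_nn_integral_lf) measurable
    have gz: "(\<lambda>x. g (x + z)) \<in> borel_measurable borel" by measurable
    have "(\<integral>\<^sup>+x. g x \<partial>M) = (\<integral>\<^sup>+\<omega>. \<integral>\<^sup>+p. g (snd p) \<partial>diag_shift (- z) (T \<omega>) \<partial>P)"
      unfolding nT[OF g] by (rule nn_integral_stationary[OF V, symmetric])
    also have "\<dots> = (\<integral>\<^sup>+\<omega>. \<integral>\<^sup>+p. g (snd p + z) \<partial>T \<omega> \<partial>P)"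
    proof (rule nn_integral_cong)
      fix \<omega> assume \<omega>: "\<omega> \<in> space P"
      have "(\<lambda>p. g (snd p)) \<in> borel_measurable (borel :: ('a \<times> 'a) measure)" by measurable
      from nn_integral_diag_shift[OF sets_T[OF \<omega>] this, of "- z"]
      show "(\<integral>\<^sup>+p. g (snd p) \<partial>diag_shift (- z) (T \<omega>)) = (\<integral>\<^sup>+p. g (snd p + z) \<partial>T \<omega>)" by simp
    qed
    also have "\<dots> = (\<integral>\<^sup>+x. g (x + z) \<partial>M)" by (rule nT[OF gz, symmetric])
    finally show ?thesis ..
  qed
  ultimately have "(\<integral>\<^sup>+x. f x \<partial>M) = emeasure M unit_cube * (\<integral>\<^sup>+x. f x \<partial>lborel)"
    by (intro nn_integral_translation_invariant sM f)
  then show ?thesis by (simp add: nM eM intensity_def)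
qed

end

text \<open>Within distance 1 a Gaussian grows by at most a constant factor if its rate is halved.
  Averaging over the unit ball around each point and exchanging integrals leaves a Lebesgue integral
  of a Gaussian times the uniform bound \<open>C\<close>.\<close>

lemma tempered_translation_bounded:
  fixes \<mu> :: "'a::euclidean_space measure"
  assumes s: "sets \<mu> = sets borel" and C: "\<And>w. emeasure \<mu> (ball w 1) \<le> C" "C < \<infinity>"
  shows "tempered \<mu>"
  unfolding tempered_def
proof (intro conjI allI impI s)
  fix t :: real assume t: "0 < t"
  obtain D :: "'a set" where D: "countable D" "\<And>X. open X \<Longrightarrow> X \<noteq> {} \<Longrightarrow> \<exists>d\<in>D. d \<in> X"
    using countable_dense_setE by blast
  interpret M: sigma_finite_measure \<mu>
  proof
    show "\<exists>A. countable A \<and> A \<subseteq> sets \<mu> \<and> \<Union>A = space \<mu> \<and> (\<forall>a\<in>A. emeasure \<mu> a \<noteq> \<infinity>)"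
    proof (intro exI conjI ballI)
      show "countable ((\<lambda>d. ball d 1) ` D)" using D(1) by simp
      show "(\<lambda>d. ball d 1) ` D \<subseteq> sets \<mu>" unfolding s by (rule image_subsetI) simp
      have "\<exists>d\<in>D. x \<in> ball d 1" for x :: 'a
      proof -
        have "ball x 1 \<noteq> {}" by simp
        then obtain d where "d \<in> D" "d \<in> ball x 1" using D(2)[OF open_ball] by blast
        then show ?thesis by (metis mem_ball dist_commute)
      qed
      then show "\<Union>((\<lambda>d. ball d 1) ` D) = space \<mu>" unfolding sets_eq_imp_space_eq[OF s] space_borel by blast
      show "emeasure \<mu> a \<noteq> \<infinity>" if aD: "a \<in> (\<lambda>d. ball d 1) ` D" for a
      proof -
        obtain d where "a = ball d 1" using aD by blast
        then show ?thesis using le_less_trans[OF C, of d] by simp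
      qed
    qed
  qed
  interpret pair_sigma_finite lborel \<mu> ..
  have sm: "sets (lborel \<Otimes>\<^sub>M \<mu>) = sets (borel \<Otimes>\<^sub>M borel)" by (intro sets_pair_measure_cong) (auto simp: s)
  note m = measurable_cong_sets[OF sm refl, THEN equalityD2, THEN subsetD]
  have mM: "f \<in> borel_measurable borel \<Longrightarrow> f \<in> borel_measurable \<mu>" for f :: "'a \<Rightarrow> ennreal"
    using measurable_cong_sets[OF s refl] by blast
  define V where "V = emeasure lborel (ball (0::'a) 1)"
  have V: "(\<integral>\<^sup>+z. indicator (ball w 1) z \<partial>lborel) = V" for w :: 'a
  proof -
    have [measurable]: "ball (0::'a) 1 \<in> sets borel" by simp
    have "(\<integral>\<^sup>+z. indicator (ball w 1) z \<partial>lborel) = (\<integral>\<^sup>+z. indicator (ball 0 1) (z - w) \<partial>lborel :: ennreal)"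
      by (intro nn_integral_cong) (simp add: indicator_def dist_norm norm_minus_commute)
    also have "\<dots> = (\<integral>\<^sup>+z. indicator (ball (0::'a) 1) z \<partial>lborel :: ennreal)"
      by (rule nn_integral_lborel_subst(2)) measurable
    also have "\<dots> = V" unfolding V_def by (rule nn_integral_indicator) simp
    finally show ?thesis .
  qed
  have le: "gauss t w * indicator (ball w 1) z \<le> exp (t / 2) * gauss (t / 2) z * indicator (ball w 1) z" for w z :: 'a
    using gauss_shift_le[of "z - w" 1 t z] t by (auto simp: indicator_def dist_norm norm_minus_commute)
  have inner: "(\<integral>\<^sup>+z. ennreal (gauss t w) * indicator (ball w 1) z \<partial>lborel) = ennreal (gauss t w) * V" for w :: 'a
    unfolding V[of w, symmetric] by (rule nn_integral_cmult) (simp add: borel_measurable_indicator)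
  have "(\<integral>\<^sup>+w. gauss t w \<partial>\<mu>) * V = (\<integral>\<^sup>+w. ennreal (gauss t w) * V \<partial>\<mu>)"
    by (rule nn_integral_multc[symmetric], rule mM) measurable
  also have "\<dots> = (\<integral>\<^sup>+w. \<integral>\<^sup>+z. ennreal (gauss t w) * indicator (ball w 1) z \<partial>lborel \<partial>\<mu>)"
    by (simp only: inner)
  also have "\<dots> \<le> (\<integral>\<^sup>+w. \<integral>\<^sup>+z. ennreal (exp (t / 2) * gauss (t / 2) z) * indicator (ball z 1) w \<partial>lborel \<partial>\<mu>)"
  proof (intro nn_integral_mono)
    fix w z :: 'a
    show "ennreal (gauss t w) * indicator (ball w 1) z \<le> ennreal (exp (t / 2) * gauss (t / 2) z) * indicator (ball z 1) w"
      using le[of w z] by (auto simp: indicator_def dist_commute intro!: ennreal_leI)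
  qed
  also have "\<dots> = (\<integral>\<^sup>+z. \<integral>\<^sup>+w. ennreal (exp (t / 2) * gauss (t / 2) z) * indicator (ball z 1) w \<partial>\<mu> \<partial>lborel)"
  proof (rule Fubini', rule m)
    have "{p :: 'a \<times> 'a. dist (fst p) (snd p) < 1} \<in> sets borel"
      by (intro borel_open open_Collect_less continuous_intros)
    then have [measurable]: "{p :: 'a \<times> 'a. dist (fst p) (snd p) < 1} \<in> sets (borel \<Otimes>\<^sub>M borel)" by (simp only: borel_prod)
    have "(\<lambda>p. ennreal (exp (t / 2) * gauss (t / 2) (fst p)) * indicator {p. dist (fst p) (snd p) < 1} p) \<in> borel_measurable ((borel :: 'a measure) \<Otimes>\<^sub>M (borel :: 'a measure))"
      by measurable
    then show "(\<lambda>(z, w). ennreal (exp (t / 2) * gauss (t / 2) z) * indicator (ball z 1) w) \<in> borel_measurable ((borel :: 'a measure) \<Otimes>\<^sub>M (borel :: 'a measure))"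
      by (simp add: case_prod_beta' indicator_def)
  qed
  also have "\<dots> = (\<integral>\<^sup>+z. ennreal (exp (t / 2) * gauss (t / 2) z) * emeasure \<mu> (ball z 1) \<partial>lborel)"
    by (simp add: nn_integral_cmult_indicator s)
  also have "\<dots> \<le> (\<integral>\<^sup>+z. ennreal (exp (t / 2) * gauss (t / 2) (z::'a)) * C \<partial>lborel)"
    by (intro nn_integral_mono mult_left_mono C) simp
  also have "\<dots> = ennreal (exp (t / 2)) * (\<integral>\<^sup>+z. gauss (t / 2) (z::'a) \<partial>lborel) * C"
    by (simp add: nn_integral_multc nn_integral_cmult ennreal_mult)
  also have "\<dots> < \<infinity>" using C(2) t by (simp add: nn_integral_gauss ennreal_mult_less_top)
  finally have *: "(\<integral>\<^sup>+w. gauss t w \<partial>\<mu>) * V < \<infinity>" .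
  have "V \<noteq> 0" unfolding V_def using content_ball_pos[of 1 "0::'a"] by (auto simp: measure_def)
  with * show "(\<integral>\<^sup>+w. gauss t w \<partial>\<mu>) < \<infinity>" by (auto simp: ennreal_mult_less_top)
qed

text \<open>The sine part is odd, so it integrates to 0 against a symmetric measure.\<close>

lemma integral_cis_symmetric:
  fixes \<mu> :: "'a::euclidean_space measure"
  assumes \<mu>: "tempered \<mu>" and sym: "distr \<mu> borel uminus = \<mu>" and \<epsilon>: "0 < \<epsilon>"
  shows "(LINT x|\<mu>. cis (- (k \<bullet> x)) * of_real (gauss \<epsilon> x)) = of_real (LINT x|\<mu>. cos (k \<bullet> x) * gauss \<epsilon> x)"
proof -
  have mM: "f \<in> borel_measurable borel \<Longrightarrow> f \<in> borel_measurable \<mu>" for f :: "'a \<Rightarrow> 'b::topological_space"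
    using measurable_cong_sets[OF tempered_sets(1)[OF \<mu>] refl] by blast
  note g = tempered_integrable[OF \<mu> \<epsilon>]
  have ic: "integrable \<mu> (\<lambda>x. cos (k \<bullet> x) * gauss \<epsilon> x)" and si: "integrable \<mu> (\<lambda>x. sin (k \<bullet> x) * gauss \<epsilon> x)"
    by (rule integrable_dominated[OF g], intro mM, measurable, simp add: abs_mult mult_left_le_one_le)+
  have "(LINT x|\<mu>. sin (k \<bullet> x) * gauss \<epsilon> x) = (LINT x|distr \<mu> borel uminus. sin (k \<bullet> x) * gauss \<epsilon> x)" by (simp add: sym)
  also have "\<dots> = (LINT x|\<mu>. sin (k \<bullet> (- x)) * gauss \<epsilon> (- x))"
  proof (rule integral_distr)
    show "uminus \<in> \<mu> \<rightarrow>\<^sub>M borel" by (rule mM) measurable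
  qed measurable
  also have "\<dots> = - (LINT x|\<mu>. sin (k \<bullet> x) * gauss \<epsilon> x)" by simp
  finally have 0: "(LINT x|\<mu>. sin (k \<bullet> x) * gauss \<epsilon> x) = 0" by simp
  have "(LINT x|\<mu>. cis (- (k \<bullet> x)) * of_real (gauss \<epsilon> x)) =
      (LINT x|\<mu>. complex_of_real (cos (k \<bullet> x) * gauss \<epsilon> x) - \<i> * complex_of_real (sin (k \<bullet> x) * gauss \<epsilon> x))"
    by (intro Bochner_Integration.integral_cong refl) (simp add: complex_eq_iff)
  also have "\<dots> = (LINT x|\<mu>. complex_of_real (cos (k \<bullet> x) * gauss \<epsilon> x)) - (LINT x|\<mu>. \<i> * complex_of_real (sin (k \<bullet> x) * gauss \<epsilon> x))"
    by (rule Bochner_Integration.integral_diff) (use ic si in \<open>simp_all del: of_real_mult\<close>)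
  also have "\<dots> = of_real (LINT x|\<mu>. cos (k \<bullet> x) * gauss \<epsilon> x)"
    by (simp add: 0 del: of_real_mult)
  finally show ?thesis .
qed

text \<open>Completing the square about the midpoint: the squared norms of \<open>z\<close> and
  \<open>z + w\<close> add up to twice that of \<open>z + (1/2) *\<^sub>R w\<close> plus half that
  of \<open>w\<close>. Integrating over \<open>z\<close> then leaves a Gaussian in the
  difference.\<close>

lemma gauss_mult_shift: "gauss s z * gauss s (z + w) = gauss (2 * s) (z + (1/2) *\<^sub>R w) * gauss (s / 2) (w :: 'a::euclidean_space)"
proof -
  have "(norm z)\<^sup>2 + (norm (z + w))\<^sup>2 = 2 * (norm (z + (1/2) *\<^sub>R w))\<^sup>2 + (norm w)\<^sup>2 / 2"
    by (simp add: power2_norm_eq_inner inner_add_left inner_add_right inner_commute)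
  then have "- (s / 2) * ((norm z)\<^sup>2 + (norm (z + w))\<^sup>2) = - (s / 2) * (2 * (norm (z + (1/2) *\<^sub>R w))\<^sup>2 + (norm w)\<^sup>2 / 2)"
    by (rule arg_cong)
  then have "- (s * (norm z)\<^sup>2 / 2) + - (s * (norm (z + w))\<^sup>2 / 2) = - (2 * s * (norm (z + (1/2) *\<^sub>R w))\<^sup>2 / 2) + - (s / 2 * (norm w)\<^sup>2 / 2)"
    by (simp only: distrib_left) (simp add: field_simps)?
  then show ?thesis by (simp add: gauss_def flip: exp_add)
qed

lemma integral_gauss_cos_sin:
  assumes t: "0 < t"
  shows "(LINT x|lborel. cos (k \<bullet> x) * gauss t x) = sqrt (2 * pi / t) ^ DIM('a) * gauss (1 / t) (k :: 'a::euclidean_space)"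
    and "(LINT x|lborel. sin (k \<bullet> x) * gauss t x) = 0"
proof -
  note b = has_bochner_integral_gauss[OF t, of k]
  have e: "(LINT x|lborel. cis (k \<bullet> x) * of_real (gauss t x)) = of_real (sqrt (2 * pi / t) ^ DIM('a) * gauss (1 / t) k)"
    and i: "integrable lborel (\<lambda>x. cis (k \<bullet> x) * of_real (gauss t x))"
    using has_bochner_integral_integral_eq[OF b] b by (auto simp: has_bochner_integral_iff)
  have "(LINT x|lborel. Re (cis (k \<bullet> x) * of_real (gauss t x))) = sqrt (2 * pi / t) ^ DIM('a) * gauss (1 / t) k"
    "(LINT x|lborel. Im (cis (k \<bullet> x) * of_real (gauss t x))) = 0"
    using integral_Re[OF i] integral_Im[OF i] e by (simp_all del: of_real_mult of_real_power)
  then show "(LINT x|lborel. cos (k \<bullet> x) * gauss t x) = sqrt (2 * pi / t) ^ DIM('a) * gauss (1 / t) k"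
    "(LINT x|lborel. sin (k \<bullet> x) * gauss t x) = 0" by simp_all
qed

context bartlett_square_integrable
begin

text \<open>Swapping the two points reverses the difference and moves the unit cube to the other
  point; after disintegration the shifted cube still has Lebesgue measure 1.\<close>

lemma distr_\<alpha>_minus: "distr (\<alpha> L) borel uminus = \<alpha> L"
proof (rule measure_eqI)
  fix B assume "B \<in> sets (distr (\<alpha> L) borel uminus)"
  then have B [measurable]: "B \<in> sets borel" by simp
  let ?H = "\<lambda>p. indicator unit_cube (fst p) * indicator B (snd p - fst p) :: ennreal"
  have H: "?H \<in> borel_measurable (borel \<Otimes>\<^sub>M borel)" by measurable
  have Hs: "(\<lambda>p. ?H (snd p, fst p)) \<in> borel_measurable (borel \<Otimes>\<^sub>M borel)" by measurable
  have u: "uminus \<in> \<alpha> L \<rightarrow>\<^sub>M borel" unfolding measurable_cong_sets[OF sets_\<alpha> refl] by measurable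
  have cube: "(\<integral>\<^sup>+z. indicator unit_cube (z + w) \<partial>lborel) = (1 :: ennreal)" for w :: 'a
  proof -
    have "(\<integral>\<^sup>+z. indicator unit_cube (z + w) \<partial>lborel) = (\<integral>\<^sup>+z. indicator unit_cube (z::'a) \<partial>lborel :: ennreal)"
      by (rule nn_integral_lborel_subst(1)) measurable
    then show ?thesis by (simp add: unit_cube_def emeasure_lborel_cbox_eq)
  qed
  have "emeasure (\<alpha> L) B = (\<integral>\<^sup>+p. ?H p \<partial>second_moment L)"
    using nn_integral_\<alpha>[OF borel_measurable_indicator[OF B]] by simp
  also have "\<dots> = (\<integral>\<^sup>+p. ?H (snd p, fst p) \<partial>second_moment L)" by (rule second_moment_swap[OF L_measurable H, symmetric])
  also have "\<dots> = (\<integral>\<^sup>+w. \<integral>\<^sup>+z. indicator unit_cube (z + w) * indicator B (- w) \<partial>lborel \<partial>\<alpha> L)"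
    using nn_integral_second_moment_disintegrate[OF Hs] by simp
  also have "\<dots> = (\<integral>\<^sup>+w. indicator B (- w) \<partial>\<alpha> L)" by (simp add: nn_integral_multc cube)
  also have "\<dots> = emeasure (distr (\<alpha> L) borel uminus) B"
    using nn_integral_distr'[OF u borel_measurable_indicator[OF B]] by simp
  finally show "emeasure (distr (\<alpha> L) borel uminus) B = emeasure (\<alpha> L) B" ..
qed simp

lemma emeasure_second_moment_le:
  assumes A: "A \<in> sets borel" and B: "B \<in> sets borel"
  shows "emeasure (second_moment L) (A \<times> B) \<le> emeasure (second_moment L) (A \<times> A) + emeasure (second_moment L) (B \<times> B)"
proof -
  have le: "x * y \<le> x * x + y * y" for x y :: ennreal
  proof (cases "x \<le> y")
    case True
    then have "x * y \<le> y * y" by (intro mult_right_mono) auto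
    then show ?thesis by (simp add: add_increasing)
  next
    case False
    then have "x * y \<le> x * x" by (intro mult_left_mono) auto
    then show ?thesis by (simp add: add_increasing2)
  qed
  note [measurable] = emeasure_kernel_apply_measurable[OF L_measurable A] emeasure_kernel_apply_measurable[OF L_measurable B]
  let ?\<Psi> = "kernel_apply L \<Phi>"
  have "emeasure (second_moment L) (A \<times> B) = (\<integral>\<^sup>+\<omega>. emeasure (?\<Psi> \<omega>) A * emeasure (?\<Psi> \<omega>) B \<partial>P)"
    by (rule emeasure_second_moment_Times[OF L_measurable A B, symmetric])
  also have "\<dots> \<le> (\<integral>\<^sup>+\<omega>. emeasure (?\<Psi> \<omega>) A * emeasure (?\<Psi> \<omega>) A + emeasure (?\<Psi> \<omega>) B * emeasure (?\<Psi> \<omega>) B \<partial>P)"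
    by (intro nn_integral_mono le)
  also have "\<dots> = (\<integral>\<^sup>+\<omega>. emeasure (?\<Psi> \<omega>) A * emeasure (?\<Psi> \<omega>) A \<partial>P) + (\<integral>\<^sup>+\<omega>. emeasure (?\<Psi> \<omega>) B * emeasure (?\<Psi> \<omega>) B \<partial>P)"
    by (rule nn_integral_add) measurable
  finally show ?thesis
    by (simp only: emeasure_second_moment_Times[OF L_measurable A A] emeasure_second_moment_Times[OF L_measurable B B])
qed

text \<open>Pairs with first point in the unit cube and difference near \<open>w\<close> lie in a
  product of two balls, one around 0 and one around \<open>w\<close>. The mixed second moment is
  bounded by the two pure ones, which by stationarity do not depend on \<open>w\<close>.\<close>

theorem tempered_\<alpha>_L: "tempered (\<alpha> L)"
proof -
  obtain r where r: "\<And>x. x \<in> (unit_cube :: 'a set) \<Longrightarrow> norm x \<le> r"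
    using bounded_cbox[of "0::'a" One] by (auto simp: bounded_iff unit_cube_def)
  \<comment> \<open>The radius \<open>r + 1\<close> allows \<open>r\<close> for the position in the
    cube and 1 for the deviation of the difference from \<open>w\<close>.\<close>
  define A where "A w = cball (w::'a) (r + 1)" for w
  have [measurable]: "A w \<in> sets borel" for w by (simp add: A_def)
  have AA: "emeasure (second_moment L) (A w \<times> A w) = emeasure (second_moment L) (A 0 \<times> A 0)" for w
  proof -
    have "emeasure (second_moment L) (A w \<times> A w) = (\<integral>\<^sup>+p. indicator (A w \<times> A w) p \<partial>second_moment L)" by simp
    also have "\<dots> = (\<integral>\<^sup>+p. indicator (A 0 \<times> A 0) (fst p - w, snd p - w) \<partial>second_moment L)"
      by (intro nn_integral_cong) (auto simp: indicator_def A_def dist_norm norm_minus_commute split: prod.split)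
    also have "\<dots> = (\<integral>\<^sup>+p. indicator (A 0 \<times> A 0) p \<partial>second_moment L)"
      by (rule second_moment_shift) measurable
    finally show ?thesis by simp
  qed
  show ?thesis
  proof (rule tempered_translation_bounded)
    show "sets (\<alpha> L) = sets borel" by simp
    show "emeasure (second_moment L) (A 0 \<times> A 0) + emeasure (second_moment L) (A 0 \<times> A 0) < \<infinity>"
      using square_integrable by (simp add: locally_square_integrable_iff[OF L_measurable] A_def)
    fix w :: 'a
    have b: "ball w 1 \<in> sets borel" by simp
    have "emeasure (\<alpha> L) (ball w 1) = (\<integral>\<^sup>+p. indicator unit_cube (fst p) * indicator (ball w 1) (snd p - fst p) \<partial>second_moment L)"
      using nn_integral_\<alpha>[OF borel_measurable_indicator[OF b]] by simp
    also have "\<dots> \<le> (\<integral>\<^sup>+p. indicator (A 0 \<times> A w) p \<partial>second_moment L)"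
    proof (rule nn_integral_mono)
      fix p :: "'a \<times> 'a"
      have "p \<in> A 0 \<times> A w" if "fst p \<in> unit_cube" "snd p - fst p \<in> ball w 1"
      proof -
        have "norm (snd p - w) \<le> norm (snd p - fst p - w) + norm (fst p)" using norm_triangle_ineq[of "snd p - fst p - w" "fst p"] by (simp add: algebra_simps)
        then show ?thesis using that r[of "fst p"] by (auto simp: A_def dist_norm norm_minus_commute mem_Times_iff)
      qed
      then show "indicator unit_cube (fst p) * indicator (ball w 1) (snd p - fst p) \<le> (indicator (A 0 \<times> A w) p :: ennreal)"
        by (auto simp: indicator_def)
    qed
    also have "\<dots> = emeasure (second_moment L) (A 0 \<times> A w)" by simp
    also have "\<dots> \<le> emeasure (second_moment L) (A 0 \<times> A 0) + emeasure (second_moment L) (A w \<times> A w)"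
      by (rule emeasure_second_moment_le) measurable
    finally show "emeasure (\<alpha> L) (ball w 1) \<le> emeasure (second_moment L) (A 0 \<times> A 0) + emeasure (second_moment L) (A 0 \<times> A 0)"
      unfolding AA[of w] .
  qed
qed

end

section \<open>Nonnegative variances of Gaussian linear statistics\<close>

context bartlett_square_integrable
begin

definition \<gamma> :: real where
  "\<gamma> = enn2real (intensity P (kernel_apply L \<Phi>))"

lemma intensity_L: "intensity P (kernel_apply L \<Phi>) = ennreal \<gamma>"
  using finite_mean[OF L_measurable square_integrable unit_cube_sets]
  by (simp add: \<gamma>_def intensity_def unit_cube_def bounded_cbox)

lemma \<gamma>_nonneg [simp]: "0 \<le> \<gamma>"
  by (simp add: \<gamma>_def)

lemma nn_integral_L_measurable:
  assumes "f \<in> borel_measurable borel"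
  shows "(\<lambda>\<omega>. \<integral>\<^sup>+u. f u \<partial>kernel_apply L \<Phi> \<omega>) \<in> borel_measurable P"
  by (rule measurable_nn_integral_kernel[OF kernel_apply_sets(1)[OF L_measurable] emeasure_kernel_apply_measurable[OF L_measurable] assms])

text \<open>By \<open>gauss_mult_shift\<close> the weight at the two points splits into a Gaussian
  around their midpoint, integrated away by the disintegration, and one in their difference. This
  ties second moments of Gaussian statistics to damped integrals of
  \<open>\<alpha> L\<close>.\<close>

lemma nn_integral_gauss_pair:
  assumes f [measurable]: "f \<in> borel_measurable borel" and s: "0 < s"
  shows "(\<integral>\<^sup>+p. ennreal (gauss s (fst p) * gauss s (snd p)) * f (snd p - fst p) \<partial>second_moment L) =
    (\<integral>\<^sup>+w. ennreal (sqrt (2 * pi / (2 * s)) ^ DIM('a) * gauss (s / 2) w) * f w \<partial>\<alpha> L)"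
proof -
  have H: "(\<lambda>p. ennreal (gauss s (fst p) * gauss s (snd p)) * f (snd p - fst p)) \<in> borel_measurable (borel \<Otimes>\<^sub>M borel)"
    by measurable
  have "(\<integral>\<^sup>+z. ennreal (gauss s z * gauss s (z + w)) * f w \<partial>lborel) = ennreal (sqrt (2 * pi / (2 * s)) ^ DIM('a) * gauss (s / 2) w) * f w" for w :: 'a
  proof -
    have "(\<integral>\<^sup>+z. ennreal (gauss s z * gauss s (z + w)) * f w \<partial>lborel) =
      (\<integral>\<^sup>+z. ennreal (gauss (2 * s) (z + (1/2) *\<^sub>R w)) * (ennreal (gauss (s / 2) w) * f w) \<partial>lborel)"
      by (intro nn_integral_cong) (simp add: gauss_mult_shift ennreal_mult mult.assoc)
    also have "\<dots> = (\<integral>\<^sup>+z. ennreal (gauss (2 * s) (z + (1/2) *\<^sub>R w)) \<partial>lborel) * (ennreal (gauss (s / 2) w) * f w)"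
      by (rule nn_integral_multc) measurable
    also have "(\<integral>\<^sup>+z. ennreal (gauss (2 * s) (z + (1/2) *\<^sub>R w)) \<partial>lborel) = (\<integral>\<^sup>+z. ennreal (gauss (2 * s) (z :: 'a)) \<partial>lborel)"
      by (rule nn_integral_lborel_subst(1)) measurable
    also have "\<dots> = ennreal (sqrt (2 * pi / (2 * s)) ^ DIM('a))" using s by (intro nn_integral_gauss) simp
    finally show ?thesis using s by (simp add: ennreal_mult mult.assoc)
  qed
  then show ?thesis unfolding nn_integral_second_moment_disintegrate[OF H] by simp
qed

text \<open>The nonnegative version is read as equality of two measures; this carries it to signed
  \<open>f\<close>.\<close>

lemma integral_gauss_pair:
  fixes f :: "'a \<Rightarrow> real"
  assumes f [measurable]: "f \<in> borel_measurable borel" and s: "0 < s"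
  shows "(LINT p|second_moment L. gauss s (fst p) * gauss s (snd p) * f (snd p - fst p)) =
    sqrt (2 * pi / (2 * s)) ^ DIM('a) * (LINT w|\<alpha> L. gauss (s / 2) w * f w)"
proof -
  let ?A = "sqrt (2 * pi / (2 * s)) ^ DIM('a)"
  let ?g = "\<lambda>p :: 'a \<times> 'a. gauss s (fst p) * gauss s (snd p)"
  have A: "0 \<le> ?A" using s by simp
  have g: "?g \<in> borel_measurable (second_moment L)" unfolding measurable_second_moment by measurable
  have d: "(\<lambda>p. snd p - fst p) \<in> density (second_moment L) (\<lambda>p. ennreal (?g p)) \<rightarrow>\<^sub>M (borel :: 'a measure)"
    unfolding measurable_cong_sets[OF sets_density refl] measurable_second_moment by measurable
  have fd: "(\<lambda>p. f (snd p - fst p)) \<in> borel_measurable (second_moment L)" unfolding measurable_second_moment by measurable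
  have f\<alpha>: "f \<in> borel_measurable (\<alpha> L)" and g\<alpha>: "(\<lambda>w. ?A * gauss (s / 2) w) \<in> borel_measurable (\<alpha> L)"
    unfolding measurable_cong_sets[OF sets_\<alpha> refl] by measurable
  have "distr (density (second_moment L) (\<lambda>p. ennreal (?g p))) borel (\<lambda>p. snd p - fst p) = density (\<alpha> L) (\<lambda>w. ennreal (?A * gauss (s / 2) w))" (is "?M = ?N")
  proof (rule measure_eqI)
    fix B assume "B \<in> sets ?M"
    then have B [measurable]: "B \<in> sets borel" by simp
    have i: "(\<lambda>p. indicator B (snd p - fst p) :: ennreal) \<in> borel_measurable (second_moment L)"
      unfolding measurable_second_moment by measurable
    have "emeasure ?M B = (\<integral>\<^sup>+p. indicator B (snd p - fst p) \<partial>density (second_moment L) (\<lambda>p. ennreal (?g p)))"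
      using nn_integral_distr'[OF d borel_measurable_indicator[OF B]] by simp
    also have "\<dots> = (\<integral>\<^sup>+p. ennreal (?g p) * indicator B (snd p - fst p) \<partial>second_moment L)"
      by (rule nn_integral_density) (use g i in auto)
    also have "\<dots> = (\<integral>\<^sup>+w. ennreal (?A * gauss (s / 2) w) * indicator B w \<partial>\<alpha> L)"
      by (rule nn_integral_gauss_pair[OF borel_measurable_indicator[OF B] s])
    also have "\<dots> = emeasure ?N B" using g\<alpha> by (intro emeasure_density[symmetric]) auto
    finally show "emeasure ?M B = emeasure ?N B" .
  qed simp
  then have "(LINT w|?M. f w) = (LINT w|?N. f w)" by simp
  moreover have "(LINT w|?M. f w) = (LINT p|second_moment L. ?g p * f (snd p - fst p))"
    unfolding integral_distr[OF d f] using integral_density[OF fd g] by simp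
  moreover have "(LINT w|?N. f w) = ?A * (LINT w|\<alpha> L. gauss (s / 2) w * f w)"
    using integral_density[OF f\<alpha> g\<alpha>] A by (simp add: mult.assoc)
  ultimately show ?thesis by simp
qed

text \<open>Nonnegativity keeps the statistic an integral in \<open>ennreal\<close>, and the
  Gaussian bound makes its second moment finite; signed functions enter as differences of
  such.\<close>

definition admissible :: "real \<Rightarrow> ('a \<Rightarrow> real) \<Rightarrow> bool" where
  "admissible s g \<longleftrightarrow> 0 < s \<and> g \<in> borel_measurable borel \<and> (\<forall>x. 0 \<le> g x \<and> g x \<le> gauss s x)"

definition linear_statistic :: "('a \<Rightarrow> real) \<Rightarrow> 'w \<Rightarrow> real" where
  "linear_statistic g \<omega> = enn2real (\<integral>\<^sup>+u. ennreal (g u) \<partial>kernel_apply L \<Phi> \<omega>)"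

lemma linear_statistic_measurable:
  "admissible s g \<Longrightarrow> linear_statistic g \<in> borel_measurable P"
  unfolding linear_statistic_def admissible_def
  by (intro borel_measurable_enn2real nn_integral_L_measurable) auto

lemma admissible_integrable: "admissible s g \<Longrightarrow> integrable lborel g"
  by (rule integrable_dominated[OF integrable_gauss]) (auto simp: admissible_def)

lemma nn_integral_linear_statistic:
  assumes g: "admissible s g"
  shows "(\<integral>\<^sup>+\<omega>. \<integral>\<^sup>+u. ennreal (g u) \<partial>kernel_apply L \<Phi> \<omega> \<partial>P) = ennreal (\<gamma> * (LINT x|lborel. g x))"
proof -
  have m: "(\<lambda>u. ennreal (g u)) \<in> borel_measurable borel" using g by (simp add: admissible_def)
  have "(\<integral>\<^sup>+x. ennreal (g x) \<partial>lborel) = ennreal (LINT x|lborel. g x)"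
    using g by (intro nn_integral_eq_integral admissible_integrable[OF g]) (simp add: admissible_def)
  then show ?thesis using g by (simp add: nn_integral_mean[OF m] intensity_L ennreal_mult admissible_def)
qed

lemma AE_linear_statistic:
  assumes g: "admissible s g"
  shows "AE \<omega> in P. ennreal (linear_statistic g \<omega>) = (\<integral>\<^sup>+u. ennreal (g u) \<partial>kernel_apply L \<Phi> \<omega>)"
proof -
  have m: "(\<lambda>u. ennreal (g u)) \<in> borel_measurable borel" using g by (simp add: admissible_def)
  have "AE \<omega> in P. (\<integral>\<^sup>+u. ennreal (g u) \<partial>kernel_apply L \<Phi> \<omega>) \<noteq> \<infinity>"
    by (rule nn_integral_PInf_AE[OF nn_integral_L_measurable[OF m]]) (simp add: nn_integral_linear_statistic[OF g])
  then show ?thesis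
  proof eventually_elim
    case (elim \<omega>)
    then have "(\<integral>\<^sup>+u. ennreal (g u) \<partial>kernel_apply L \<Phi> \<omega>) < \<top>" by (metis top.not_eq_extremum infinity_ennreal_def)
    then show ?case by (simp add: linear_statistic_def)
  qed
qed

lemma integral_linear_statistic:
  assumes g: "admissible s g"
  shows "integrable P (linear_statistic g)" and "(LINT \<omega>|P. linear_statistic g \<omega>) = \<gamma> * (LINT x|lborel. g x)"
proof -
  have n: "(\<integral>\<^sup>+\<omega>. ennreal (linear_statistic g \<omega>) \<partial>P) = ennreal (\<gamma> * (LINT x|lborel. g x))"
    using AE_linear_statistic[OF g] nn_integral_linear_statistic[OF g] by (simp cong: nn_integral_cong_AE)
  have p: "0 \<le> linear_statistic g \<omega>" for \<omega> by (simp add: linear_statistic_def)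
  show "integrable P (linear_statistic g)"
    by (rule integrableI_nonneg[OF linear_statistic_measurable[OF g]]) (use n p in auto)
  have "0 \<le> (LINT x|lborel. g x)" using g by (intro Bochner_Integration.integral_nonneg) (simp add: admissible_def)
  then show "(LINT \<omega>|P. linear_statistic g \<omega>) = \<gamma> * (LINT x|lborel. g x)"
    using n p by (subst integral_eq_nn_integral[OF linear_statistic_measurable[OF g]]) auto
qed

lemma integrable_gauss_pair:
  assumes s: "0 < s"
  shows "integrable (second_moment L) (\<lambda>p. gauss s (fst p) * gauss s (snd p))"
proof (rule integrableI_nonneg)
  let ?A = "sqrt (2 * pi / (2 * s)) ^ DIM('a)"
  have g: "gauss (s / 2) \<in> borel_measurable (\<alpha> L)" unfolding measurable_cong_sets[OF sets_\<alpha> refl] by measurable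
  have "(\<integral>\<^sup>+p. ennreal (gauss s (fst p) * gauss s (snd p)) \<partial>second_moment L) = (\<integral>\<^sup>+w. ennreal (?A * gauss (s / 2) w) \<partial>\<alpha> L)"
    using nn_integral_gauss_pair[of "\<lambda>_. 1", OF _ s] by simp
  also have "\<dots> = ennreal ?A * (\<integral>\<^sup>+w. ennreal (gauss (s / 2) w) \<partial>\<alpha> L)"
    using s g by (simp add: ennreal_mult nn_integral_cmult)
  also have "\<dots> < \<infinity>" using tempered_\<alpha>_L s by (simp add: tempered_def ennreal_mult_less_top)
  finally show "(\<integral>\<^sup>+p. ennreal (gauss s (fst p) * gauss s (snd p)) \<partial>second_moment L) < \<infinity>" .
  show "(\<lambda>p. gauss s (fst p) * gauss s (snd p)) \<in> borel_measurable (second_moment L)" unfolding measurable_second_moment by measurable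
qed simp

lemma integrable_pair_dominated:
  assumes s: "0 < s" and [measurable]: "g \<in> borel_measurable borel" "h \<in> borel_measurable borel"
    and b: "\<And>x. \<bar>g x\<bar> \<le> gauss s x" "\<And>x. \<bar>h x\<bar> \<le> gauss s x"
  shows "integrable (second_moment L) (\<lambda>p. g (fst p) * h (snd p))"
proof (rule integrable_dominated[OF integrable_gauss_pair[OF s]])
  show "(\<lambda>p. g (fst p) * h (snd p)) \<in> borel_measurable (second_moment L)" unfolding measurable_second_moment by measurable
  show "norm (g (fst p) * h (snd p)) \<le> gauss s (fst p) * gauss s (snd p)" for p
    by (simp add: abs_mult b mult_mono)
qed

lemma integral_linear_statistic_mult:
  assumes g: "admissible s g" and h: "admissible s h"
  shows "integrable P (\<lambda>\<omega>. linear_statistic g \<omega> * linear_statistic h \<omega>)"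
    and "(LINT \<omega>|P. linear_statistic g \<omega> * linear_statistic h \<omega>) = (LINT p|second_moment L. g (fst p) * h (snd p))"
    and "integrable (second_moment L) (\<lambda>p. g (fst p) * h (snd p))"
proof -
  have s: "0 < s" and [measurable]: "g \<in> borel_measurable borel" "h \<in> borel_measurable borel"
    and nn: "\<And>x. 0 \<le> g x" "\<And>x. 0 \<le> h x" and b: "\<And>x. \<bar>g x\<bar> \<le> gauss s x" "\<And>x. \<bar>h x\<bar> \<le> gauss s x"
    using g h by (auto simp: admissible_def)
  show i: "integrable (second_moment L) (\<lambda>p. g (fst p) * h (snd p))"
    by (rule integrable_pair_dominated[OF s _ _ b]) measurable
  have m: "(\<lambda>\<omega>. linear_statistic g \<omega> * linear_statistic h \<omega>) \<in> borel_measurable P"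
    by (intro borel_measurable_times linear_statistic_measurable[OF g] linear_statistic_measurable[OF h])
  have p: "0 \<le> linear_statistic g \<omega> * linear_statistic h \<omega>" for \<omega> by (simp add: linear_statistic_def)
  have "(\<integral>\<^sup>+\<omega>. ennreal (linear_statistic g \<omega> * linear_statistic h \<omega>) \<partial>P) =
      (\<integral>\<^sup>+\<omega>. (\<integral>\<^sup>+u. ennreal (g u) \<partial>kernel_apply L \<Phi> \<omega>) * (\<integral>\<^sup>+u. ennreal (h u) \<partial>kernel_apply L \<Phi> \<omega>) \<partial>P)"
  proof (rule nn_integral_cong_AE)
    show "AE \<omega> in P. ennreal (linear_statistic g \<omega> * linear_statistic h \<omega>) =
      (\<integral>\<^sup>+u. ennreal (g u) \<partial>kernel_apply L \<Phi> \<omega>) * (\<integral>\<^sup>+u. ennreal (h u) \<partial>kernel_apply L \<Phi> \<omega>)"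
      using AE_linear_statistic[OF g] AE_linear_statistic[OF h]
      by eventually_elim (simp add: ennreal_mult linear_statistic_def[of _ "_ :: 'w"] del: ennreal_enn2real)
  qed
  also have "\<dots> = (\<integral>\<^sup>+p. ennreal (g (fst p)) * ennreal (h (snd p)) \<partial>second_moment L)"
    by (rule second_moment_Times[OF L_measurable]) measurable
  also have "\<dots> = (\<integral>\<^sup>+p. ennreal (g (fst p) * h (snd p)) \<partial>second_moment L)" by (simp add: ennreal_mult nn)
  also have "\<dots> = ennreal (LINT p|second_moment L. g (fst p) * h (snd p))"
    by (rule nn_integral_eq_integral[OF i]) (simp add: nn)
  finally have n: "(\<integral>\<^sup>+\<omega>. ennreal (linear_statistic g \<omega> * linear_statistic h \<omega>) \<partial>P) = ennreal (LINT p|second_moment L. g (fst p) * h (snd p))" .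
  show "integrable P (\<lambda>\<omega>. linear_statistic g \<omega> * linear_statistic h \<omega>)"
    by (rule integrableI_nonneg[OF m]) (use n p in auto)
  have "0 \<le> (LINT p|second_moment L. g (fst p) * h (snd p))" by (intro Bochner_Integration.integral_nonneg) (simp add: nn)
  then show "(LINT \<omega>|P. linear_statistic g \<omega> * linear_statistic h \<omega>) = (LINT p|second_moment L. g (fst p) * h (snd p))"
    using n p by (subst integral_eq_nn_integral[OF m]) auto
qed

text \<open>Positive and negative part of \<open>f\<close> are admissible, so the statistic of
  \<open>f\<close> is a difference of two square-integrable variables, and the inequality expresses
  that its variance is nonnegative.\<close>

lemma variance_inequality:
  assumes [measurable]: "f \<in> borel_measurable borel" and f: "\<And>x. \<bar>f x\<bar> \<le> gauss s x" and s: "0 < s"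
  shows "(\<gamma> * (LINT x|lborel. f x))\<^sup>2 \<le> (LINT p|second_moment L. f (fst p) * f (snd p))"
proof -
  let ?g = "\<lambda>x. max 0 (f x)" and ?h = "\<lambda>x. max 0 (- f x)"
  have g: "admissible s ?g" and h: "admissible s ?h"
    using s f by (auto simp: admissible_def abs_le_iff)
  have fe: "f x = ?g x - ?h x" for x by auto
  let ?X = "linear_statistic ?g" and ?Y = "linear_statistic ?h"
  note i = integral_linear_statistic[OF g] integral_linear_statistic[OF h]
  note gg = integral_linear_statistic_mult[OF g g] and gh = integral_linear_statistic_mult[OF g h]
    and hg = integral_linear_statistic_mult[OF h g] and hh = integral_linear_statistic_mult[OF h h]
  have sq: "(?X \<omega> - ?Y \<omega>)\<^sup>2 = ?X \<omega> * ?X \<omega> - ?X \<omega> * ?Y \<omega> - (?Y \<omega> * ?X \<omega> - ?Y \<omega> * ?Y \<omega>)" for \<omega>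
    by (simp add: power2_eq_square algebra_simps)
  have fsq: "f x * f y = ?g x * ?g y - ?g x * ?h y - (?h x * ?g y - ?h x * ?h y)" for x y
    by (auto simp: max_def)
  have int: "integrable P (\<lambda>\<omega>. ?X \<omega> - ?Y \<omega>)" using i by simp
  have int2: "integrable P (\<lambda>\<omega>. (?X \<omega> - ?Y \<omega>)\<^sup>2)"
    unfolding sq by (intro Bochner_Integration.integrable_diff gg gh hg hh)
  have mean: "expectation (\<lambda>\<omega>. ?X \<omega> - ?Y \<omega>) = \<gamma> * (LINT x|lborel. f x)"
  proof -
    have "(LINT x|lborel. f x) = (LINT x|lborel. ?g x - ?h x)"
      by (rule Bochner_Integration.integral_cong[OF refl fe])
    also have "\<dots> = (LINT x|lborel. ?g x) - (LINT x|lborel. ?h x)"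
      by (rule Bochner_Integration.integral_diff[OF admissible_integrable[OF g] admissible_integrable[OF h]])
    finally have "(LINT x|lborel. f x) = (LINT x|lborel. ?g x) - (LINT x|lborel. ?h x)" .
    then show ?thesis using i by (simp add: Bochner_Integration.integral_diff right_diff_distrib)
  qed
  have "0 \<le> expectation (\<lambda>\<omega>. (?X \<omega> - ?Y \<omega>)\<^sup>2) - (expectation (\<lambda>\<omega>. ?X \<omega> - ?Y \<omega>))\<^sup>2"
    by (subst variance_eq[OF int int2, symmetric]) (rule variance_positive)
  also have "expectation (\<lambda>\<omega>. (?X \<omega> - ?Y \<omega>)\<^sup>2) = (LINT p|second_moment L. f (fst p) * f (snd p))"
  proof -
    have "expectation (\<lambda>\<omega>. (?X \<omega> - ?Y \<omega>)\<^sup>2) = (LINT p|second_moment L. ?g (fst p) * ?g (snd p)) - (LINT p|second_moment L. ?g (fst p) * ?h (snd p)) -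
        ((LINT p|second_moment L. ?h (fst p) * ?g (snd p)) - (LINT p|second_moment L. ?h (fst p) * ?h (snd p)))"
      unfolding sq by (simp only: Bochner_Integration.integral_diff Bochner_Integration.integrable_diff gg gh hg hh)
    also have "\<dots> = (LINT p|second_moment L. ?g (fst p) * ?g (snd p) - ?g (fst p) * ?h (snd p) - (?h (fst p) * ?g (snd p) - ?h (fst p) * ?h (snd p)))"
      by (simp only: Bochner_Integration.integral_diff Bochner_Integration.integrable_diff gg(3) gh(3) hg(3) hh(3))
    also have "\<dots> = (LINT p|second_moment L. f (fst p) * f (snd p))"
      by (rule Bochner_Integration.integral_cong[OF refl fsq[symmetric]])
    finally show ?thesis .
  qed
  finally show ?thesis unfolding mean by simp
qed

text \<open>The variance inequality is applied to the Gaussian times cosine and times sine. The two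
  products add up to the cosine of the difference of the points, and the mean of the sine statistic
  vanishes.\<close>

lemma \<alpha>_positive:
  assumes \<epsilon>: "0 < \<epsilon>"
  shows "0 \<le> (LINT x|\<alpha> L. cos (k \<bullet> x) * gauss \<epsilon> x) - \<gamma>\<^sup>2 * (LINT x|lborel. cos (k \<bullet> x) * gauss \<epsilon> x)"
proof -
  \<comment> \<open>Rate \<open>s\<close> at both points leaves rate \<open>s / 2\<close> in their
    difference, so twice \<epsilon> is taken.\<close>
  define s where "s = 2 * \<epsilon>"
  have s: "0 < s" "s / 2 = \<epsilon>" using \<epsilon> by (auto simp: s_def)
  let ?f = "\<lambda>x. cos (k \<bullet> x) * gauss s x" and ?h = "\<lambda>x. sin (k \<bullet> x) * gauss s x"
  let ?A = "sqrt (2 * pi / (2 * s)) ^ DIM('a)"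
  have A: "0 < ?A" using s by simp
  have b: "\<bar>?f x\<bar> \<le> gauss s x" "\<bar>?h x\<bar> \<le> gauss s x" for x by (simp_all add: abs_mult mult_left_le_one_le)
  have m: "?f \<in> borel_measurable borel" "?h \<in> borel_measurable borel" by measurable
  have "(\<gamma> * (LINT x|lborel. ?f x))\<^sup>2 + (\<gamma> * (LINT x|lborel. ?h x))\<^sup>2 \<le>
      (LINT p|second_moment L. ?f (fst p) * ?f (snd p)) + (LINT p|second_moment L. ?h (fst p) * ?h (snd p))"
    by (intro add_mono variance_inequality[OF m(1) b(1) s(1)] variance_inequality[OF m(2) b(2) s(1)])
  also have "\<dots> = (LINT p|second_moment L. ?f (fst p) * ?f (snd p) + ?h (fst p) * ?h (snd p))"
    by (rule Bochner_Integration.integral_add[symmetric])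
       (rule integrable_pair_dominated[OF s(1) m(1) m(1) b(1) b(1)], rule integrable_pair_dominated[OF s(1) m(2) m(2) b(2) b(2)])
  also have "\<dots> = (LINT p|second_moment L. gauss s (fst p) * gauss s (snd p) * cos (k \<bullet> (snd p - fst p)))"
    by (intro Bochner_Integration.integral_cong refl) (simp add: inner_diff_right cos_diff algebra_simps)
  also have "\<dots> = ?A * (LINT x|\<alpha> L. cos (k \<bullet> x) * gauss \<epsilon> x)"
    using integral_gauss_pair[of "\<lambda>x. cos (k \<bullet> x)", OF _ s(1)] s by (simp add: mult.commute)
  finally have 1: "\<gamma>\<^sup>2 * (LINT x|lborel. ?f x)\<^sup>2 \<le> ?A * (LINT x|\<alpha> L. cos (k \<bullet> x) * gauss \<epsilon> x)"
    using integral_gauss_cos_sin(2)[OF s(1), of k] by (simp add: power_mult_distrib)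
  \<comment> \<open>The squared mean matches the Lebesgue term with the same constant
    \<open>?A\<close>, because \<open>s = 2 * \<epsilon>\<close>; the common factor then
    cancels.\<close>
  have "(LINT x|lborel. ?f x)\<^sup>2 = ?A * (LINT x|lborel. cos (k \<bullet> x) * gauss \<epsilon> x)"
  proof -
    have r: "sqrt (2 * pi / s) * sqrt (2 * pi / s) = sqrt (2 * pi / (2 * s)) * sqrt (2 * pi / \<epsilon>)"
      using real_sqrt_abs2[of "pi / \<epsilon>"] \<epsilon> by (simp add: s_def flip: real_sqrt_mult)
    have g: "gauss (1 / s) k * gauss (1 / s) k = gauss (1 / \<epsilon>) k"
      using gauss_add[of "1 / s" "1 / s" k] \<epsilon> by (simp add: s_def)
    have "(LINT x|lborel. ?f x)\<^sup>2 = (sqrt (2 * pi / s) * sqrt (2 * pi / s)) ^ DIM('a) * (gauss (1 / s) k * gauss (1 / s) k)"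
      unfolding integral_gauss_cos_sin(1)[OF s(1)] by (simp only: power2_eq_square power_mult_distrib mult_ac)
    also have "\<dots> = ?A * (LINT x|lborel. cos (k \<bullet> x) * gauss \<epsilon> x)"
      unfolding r g integral_gauss_cos_sin(1)[OF \<epsilon>] by (simp only: power_mult_distrib mult_ac)
    finally show ?thesis .
  qed
  with 1 have "?A * (\<gamma>\<^sup>2 * (LINT x|lborel. cos (k \<bullet> x) * gauss \<epsilon> x)) \<le> ?A * (LINT x|\<alpha> L. cos (k \<bullet> x) * gauss \<epsilon> x)"
    by (simp add: mult.left_commute)
  then show ?thesis using A by (simp add: mult_le_cancel_left_pos)
qed

theorem gauss_dual_L: "\<exists>\<nu>. tempered \<nu> \<and> gauss_dual (\<alpha> L) (\<gamma>\<^sup>2) \<nu>"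
proof (rule gauss_dual_exists[OF tempered_\<alpha>_L])
  fix \<epsilon> :: real and k :: 'a
  assume \<epsilon>: "0 < \<epsilon>"
  let ?h = "(LINT x|\<alpha> L. cos (k \<bullet> x) * gauss \<epsilon> x) - \<gamma>\<^sup>2 * (LINT x|lborel. cos (k \<bullet> x) * gauss \<epsilon> x)"
  have "complex_of_real ?h = (LINT x|\<alpha> L. cis (- (k \<bullet> x)) * of_real (gauss \<epsilon> x)) - of_real (\<gamma>\<^sup>2) * (LINT x|lborel. cis (- (k \<bullet> x)) * of_real (gauss \<epsilon> x))"
    unfolding integral_cis_symmetric[OF tempered_\<alpha>_L distr_\<alpha>_minus \<epsilon>] integral_cis_symmetric[OF tempered_lborel distr_lborel_minus \<epsilon>]
    by simp
  with \<alpha>_positive[OF \<epsilon>, of k]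
  show "\<exists>h\<ge>0. complex_of_real h = (LINT x|\<alpha> L. cis (- (k \<bullet> x)) * of_real (gauss \<epsilon> x)) - of_real (\<gamma>\<^sup>2) * (LINT x|lborel. cis (- (k \<bullet> x)) * of_real (gauss \<epsilon> x))"
    by blast
qed

end

section \<open>The spectral measures\<close>

lemma integral_sum_measure:
  fixes \<mu> \<nu> \<rho> :: "'a::euclidean_space measure"
  assumes sets: "sets \<mu> = sets borel" "sets \<nu> = sets borel" "sets \<rho> = sets borel"
    and nn: "\<And>f. f \<in> borel_measurable borel \<Longrightarrow> (\<integral>\<^sup>+x. f x \<partial>\<rho>) = (\<integral>\<^sup>+x. f x \<partial>\<mu>) + (\<integral>\<^sup>+x. f x \<partial>\<nu>)"
    and f [measurable]: "(f :: 'a \<Rightarrow> real) \<in> borel_measurable borel" and i: "integrable \<mu> f" "integrable \<nu> f"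
  shows "integrable \<rho> f" and "(LINT x|\<rho>. f x) = (LINT x|\<mu>. f x) + (LINT x|\<nu>. f x)"
proof -
  have fm: "f \<in> borel_measurable \<rho>" using f measurable_cong_sets[OF sets(3) refl] by blast
  have 1: "(\<integral>\<^sup>+x. ennreal (norm (f x)) \<partial>\<rho>) = (\<integral>\<^sup>+x. ennreal (norm (f x)) \<partial>\<mu>) + (\<integral>\<^sup>+x. ennreal (norm (f x)) \<partial>\<nu>)"
    by (rule nn) measurable
  show r: "integrable \<rho> f"
    unfolding integrable_iff_bounded 1 using fm i by (simp add: integrable_iff_bounded)
  have le: "(\<integral>\<^sup>+x. ennreal (f x) \<partial>M) < \<top>" "(\<integral>\<^sup>+x. ennreal (- f x) \<partial>M) < \<top>" if "integrable M f" for M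
  proof -
    have b: "(\<integral>\<^sup>+x. ennreal (norm (f x)) \<partial>M) < \<top>" using that by (simp add: integrable_iff_bounded)
    have "(\<integral>\<^sup>+x. ennreal (f x) \<partial>M) \<le> (\<integral>\<^sup>+x. ennreal (norm (f x)) \<partial>M)" "(\<integral>\<^sup>+x. ennreal (- f x) \<partial>M) \<le> (\<integral>\<^sup>+x. ennreal (norm (f x)) \<partial>M)"
      by (intro nn_integral_mono ennreal_leI; simp)+
    with b show "(\<integral>\<^sup>+x. ennreal (f x) \<partial>M) < \<top>" "(\<integral>\<^sup>+x. ennreal (- f x) \<partial>M) < \<top>" by (auto intro: le_less_trans)
  qed
  have p: "(\<integral>\<^sup>+x. ennreal (f x) \<partial>\<rho>) = (\<integral>\<^sup>+x. ennreal (f x) \<partial>\<mu>) + (\<integral>\<^sup>+x. ennreal (f x) \<partial>\<nu>)"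
    and q: "(\<integral>\<^sup>+x. ennreal (- f x) \<partial>\<rho>) = (\<integral>\<^sup>+x. ennreal (- f x) \<partial>\<mu>) + (\<integral>\<^sup>+x. ennreal (- f x) \<partial>\<nu>)"
    by (rule nn, measurable)+
  show "(LINT x|\<rho>. f x) = (LINT x|\<mu>. f x) + (LINT x|\<nu>. f x)"
    unfolding real_lebesgue_integral_def[OF r] real_lebesgue_integral_def[OF i(1)] real_lebesgue_integral_def[OF i(2)] p q
    using le[OF i(1)] le[OF i(2)] by (simp add: enn2real_plus)
qed

lemma integral_cis_gauss:
  fixes \<mu> :: "'a::euclidean_space measure"
  assumes \<mu>: "tempered \<mu>" and t: "0 < t"
  shows "integrable \<mu> (\<lambda>k. cos (k \<bullet> y) * gauss t k)" "integrable \<mu> (\<lambda>k. sin (k \<bullet> y) * gauss t k)"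
    and "(LINT k|\<mu>. cis (k \<bullet> y) * of_real (gauss t k)) =
      Complex (LINT k|\<mu>. cos (k \<bullet> y) * gauss t k) (LINT k|\<mu>. sin (k \<bullet> y) * gauss t k)"
proof -
  have mM: "f \<in> borel_measurable borel \<Longrightarrow> f \<in> borel_measurable \<mu>" for f :: "'a \<Rightarrow> 'b::topological_space"
    using measurable_cong_sets[OF tempered_sets(1)[OF \<mu>] refl] by blast
  note g = tempered_integrable[OF \<mu> t]
  show "integrable \<mu> (\<lambda>k. cos (k \<bullet> y) * gauss t k)" "integrable \<mu> (\<lambda>k. sin (k \<bullet> y) * gauss t k)"
    by (rule integrable_dominated[OF g], intro mM, measurable, simp add: abs_mult mult_left_le_one_le)+
  have i: "integrable \<mu> (\<lambda>k. cis (k \<bullet> y) * of_real (gauss t k))"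
    by (rule integrable_dominated[OF g], intro mM, measurable, simp add: norm_mult)
  show "(LINT k|\<mu>. cis (k \<bullet> y) * of_real (gauss t k)) =
      Complex (LINT k|\<mu>. cos (k \<bullet> y) * gauss t k) (LINT k|\<mu>. sin (k \<bullet> y) * gauss t k)"
    using integral_Re[OF i] integral_Im[OF i] by (simp add: complex_eq_iff)
qed

text \<open>A sum of two measures is their mixture over a two-point counting space.\<close>

lemma sum_measure_exists:
  assumes "sets \<mu> = sets borel" "sets \<nu> = sets borel"
  shows "\<exists>\<rho>. sets \<rho> = sets borel \<and> (\<forall>f\<in>borel_measurable borel. (\<integral>\<^sup>+x. f x \<partial>\<rho>) = (\<integral>\<^sup>+x. f x \<partial>\<mu>) + (\<integral>\<^sup>+x. f x \<partial>\<nu>))"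
proof (intro exI conjI ballI)
  let ?\<rho> = "mixture (count_space UNIV) (\<lambda>b. if b then \<mu> else \<nu>) borel"
  show "sets ?\<rho> = sets borel" by simp
  fix f :: "'a \<Rightarrow> ennreal" assume f: "f \<in> borel_measurable borel"
  have "(\<integral>\<^sup>+x. f x \<partial>?\<rho>) = (\<integral>\<^sup>+b. \<integral>\<^sup>+x. f x \<partial>(if b then \<mu> else \<nu>) \<partial>count_space UNIV)"
    by (rule nn_integral_mixture) (use assms f in auto)
  also have "\<dots> = (\<integral>\<^sup>+x. f x \<partial>\<mu>) + (\<integral>\<^sup>+x. f x \<partial>\<nu>)"
    by (simp add: nn_integral_count_space_finite UNIV_bool add.commute)
  finally show "(\<integral>\<^sup>+x. f x \<partial>?\<rho>) = (\<integral>\<^sup>+x. f x \<partial>\<mu>) + (\<integral>\<^sup>+x. f x \<partial>\<nu>)" .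
qed

context bartlett_square_integrable
begin

lemma tempered_DF: "tempered DF" and tempered_DL: "tempered DL"
  by (intro tempered_finite finite_DF finite_DL sets_difference_measure)+

lemma tempered_\<alpha>_K: "tempered (\<alpha> K)"
  unfolding tempered_def
proof (intro conjI allI impI)
  fix s :: real assume s: "0 < s"
  have "(\<integral>\<^sup>+x. gauss s x \<partial>\<alpha> K) \<le> (\<integral>\<^sup>+x. gauss s x \<partial>\<alpha> K) + (\<integral>\<^sup>+x. gauss s x \<partial>DL)" by (simp add: add_increasing2)
  also have "\<dots> = (\<integral>\<^sup>+x. gauss s x \<partial>\<alpha> L) + (\<integral>\<^sup>+x. gauss s x \<partial>DF)" by (rule \<alpha>_identity) measurable
  also have "\<dots> < \<infinity>" using tempered_\<alpha>_L tempered_DF s by (simp add: tempered_def)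
  finally show "(\<integral>\<^sup>+x. gauss s x \<partial>\<alpha> K) < \<infinity>" .
qed simp

text \<open>All four terms are finite for Gaussians, so the extended-valued identity becomes one of
  reals, where terms can be moved across.\<close>

lemma \<alpha>_identity_gauss:
  assumes s: "0 < s"
  shows "(LINT x|\<alpha> K. gauss s (x - y)) + (LINT x|DL. gauss s (x - y)) = (LINT x|\<alpha> L. gauss s (x - y)) + (LINT x|DF. gauss s (x - y))"
proof -
  have e: "(\<integral>\<^sup>+x. ennreal (gauss s (x - y)) \<partial>\<mu>) = ennreal (LINT x|\<mu>. gauss s (x - y))" if "tempered \<mu>" for \<mu> :: "'a measure"
    by (intro nn_integral_eq_integral integral_gauss_le_bounded[OF that s]) simp
  have p: "0 \<le> (LINT x|\<mu>. gauss s (x - y))" for \<mu> :: "'a measure" by (intro Bochner_Integration.integral_nonneg) simp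
  have "(\<integral>\<^sup>+x. ennreal (gauss s (x - y)) \<partial>\<alpha> K) + (\<integral>\<^sup>+x. ennreal (gauss s (x - y)) \<partial>DL) =
      (\<integral>\<^sup>+x. ennreal (gauss s (x - y)) \<partial>\<alpha> L) + (\<integral>\<^sup>+x. ennreal (gauss s (x - y)) \<partial>DF)"
    by (rule \<alpha>_identity) measurable
  then have "ennreal ((LINT x|\<alpha> K. gauss s (x - y)) + (LINT x|DL. gauss s (x - y))) =
      ennreal ((LINT x|\<alpha> L. gauss s (x - y)) + (LINT x|DF. gauss s (x - y)))"
    unfolding e[OF tempered_\<alpha>_K] e[OF tempered_DL] e[OF tempered_\<alpha>_L] e[OF tempered_DF] by (simp only: ennreal_plus p)
  then show ?thesis by (subst (asm) ennreal_inj) (intro add_nonneg_nonneg p)+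
qed

text \<open>The Gaussian duality implies the defining identity for all bounded test functions, and
  uniqueness then evaluates the definite description.\<close>

lemma bartlett_spectral_measure_eqI:
  assumes Q: "Q \<in> kernels" and lsq: "locally_square_integrable P (kernel_apply Q \<Phi>)"
    and int: "intensity P (kernel_apply Q \<Phi>) = ennreal \<gamma>"
    and \<alpha>: "tempered (\<alpha> Q)" and \<nu>: "tempered \<nu>" and dual: "gauss_dual (\<alpha> Q) (\<gamma>\<^sup>2) \<nu>"
  shows "bartlett_spectral_measure P (kernel_apply Q \<Phi>) = \<nu>"
proof -
  have b: "is_bartlett_spectral_measure P (kernel_apply Q \<Phi>) \<nu>"
    unfolding is_bartlett_spectral_measure_def covariance_integral_def reduced_second_moment_eq[OF Q lsq] int
    using gauss_dual_spectral[OF \<alpha> \<nu> dual] by (auto intro: tempered_locally_finite[OF \<nu>])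
  show ?thesis
    unfolding bartlett_spectral_measure_def
    by (rule the_equality[where P="is_bartlett_spectral_measure P (kernel_apply Q \<Phi>)", OF b is_bartlett_spectral_measure_unique[OF _ b]])
qed

text \<open>\<open>gauss_dual\<close> is additive: a dual of \<open>\<alpha> L\<close> plus the dual
  of \<open>DF\<close> minus \<open>DL\<close> is dual to \<open>\<alpha> K\<close>, by the identity
  of reduced second moments and the equal intensities. The sum is first built as a measure and then
  identified with the spectral measure.\<close>

theorem bartlett_spectral_measure_K:
  assumes B: "B \<in> sets borel"
  shows "emeasure (bartlett_spectral_measure P (kernel_apply K \<Phi>)) B =
    emeasure (bartlett_spectral_measure P (kernel_apply L \<Phi>)) B + emeasure (density lborel (\<lambda>k. ennreal (eta_hat P T F k))) B"
proof -
  obtain \<nu> where \<nu>: "tempered \<nu>" "gauss_dual (\<alpha> L) (\<gamma>\<^sup>2) \<nu>" using gauss_dual_L by blast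
  let ?\<eta> = "density lborel (\<lambda>k. ennreal (eta_hat P T F k))"
  have \<eta>: "tempered ?\<eta>" by (rule tempered_density_bounded[OF eta_hat_measurable eta_hat_bounded])
  obtain \<rho> where s: "sets \<rho> = sets borel"
    and nn: "\<And>f. f \<in> borel_measurable borel \<Longrightarrow> (\<integral>\<^sup>+x. f x \<partial>\<rho>) = (\<integral>\<^sup>+x. f x \<partial>\<nu>) + (\<integral>\<^sup>+x. f x \<partial>?\<eta>)"
    using sum_measure_exists[OF tempered_sets(1)[OF \<nu>(1)] tempered_sets(1)[OF \<eta>]] by blast
  have \<rho>: "tempered \<rho>"
    unfolding tempered_def
  proof (intro conjI allI impI s)
    fix t :: real assume t: "0 < t"
    have "(\<integral>\<^sup>+x. gauss t x \<partial>\<rho>) = (\<integral>\<^sup>+x. gauss t x \<partial>\<nu>) + (\<integral>\<^sup>+x. gauss t x \<partial>?\<eta>)" by (rule nn) measurable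
    also have "\<dots> < \<infinity>" using \<nu>(1) \<eta> t unfolding tempered_def by (simp del: nn_integral_density)
    finally show "(\<integral>\<^sup>+x. gauss t x \<partial>\<rho>) < \<infinity>" .
  qed
  have "gauss_dual (\<alpha> K) (\<gamma>\<^sup>2) \<rho>"
    unfolding gauss_dual_def
  proof (intro allI impI)
    fix t :: real and y :: 'a assume t: "0 < t"
    let ?c = "sqrt (2 * pi / t) ^ DIM('a)"
    let ?g = "\<lambda>\<mu>. LINT x|\<mu>. gauss (1 / t) (x - y)"
    have m: "(\<lambda>k. cos (k \<bullet> y) * gauss t k) \<in> borel_measurable borel" "(\<lambda>k. sin (k \<bullet> y) * gauss t k) \<in> borel_measurable borel"
      by measurable
    note add = integral_sum_measure(2)[OF tempered_sets(1)[OF \<nu>(1)] tempered_sets(1)[OF \<eta>] s nn]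
    have "(LINT k|\<rho>. cis (k \<bullet> y) * of_real (gauss t k)) =
        (LINT k|\<nu>. cis (k \<bullet> y) * of_real (gauss t k)) + (LINT k|?\<eta>. cis (k \<bullet> y) * of_real (gauss t k))"
      unfolding integral_cis_gauss(3)[OF \<rho> t] integral_cis_gauss(3)[OF \<nu>(1) t] integral_cis_gauss(3)[OF \<eta> t]
        add[OF _ m(1) integral_cis_gauss(1)[OF \<nu>(1) t] integral_cis_gauss(1)[OF \<eta> t], simplified]
        add[OF _ m(2) integral_cis_gauss(2)[OF \<nu>(1) t] integral_cis_gauss(2)[OF \<eta> t], simplified] by (rule complex_eqI) simp_all
    also have "(LINT k|\<nu>. cis (k \<bullet> y) * of_real (gauss t k)) = of_real (?c * (?g (\<alpha> L) - \<gamma>\<^sup>2 * ?g lborel))"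
      using \<nu>(2) t unfolding gauss_dual_def by blast
    also have "(LINT k|?\<eta>. cis (k \<bullet> y) * of_real (gauss t k)) = of_real (?c * (?g DF - 1 * ?g DL))"
      by (rule finite_fourier_dual[OF finite_DF finite_DL sets_difference_measure sets_difference_measure eta_hat_measurable eta_hat_nonneg _ t])
         (simp add: eta_hat_fourier)
    also have "of_real (?c * (?g (\<alpha> L) - \<gamma>\<^sup>2 * ?g lborel)) + of_real (?c * (?g DF - 1 * ?g DL)) =
        complex_of_real (?c * (?g (\<alpha> K) - \<gamma>\<^sup>2 * ?g lborel))"
    proof -
      have "?g (\<alpha> L) = ?g (\<alpha> K) + ?g DL - ?g DF" using \<alpha>_identity_gauss[of "1 / t" y] t by simp
      then show ?thesis unfolding of_real_add[symmetric] by (simp only: of_real_eq_iff) (simp add: algebra_simps)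
    qed
    finally show "(LINT k|\<rho>. cis (k \<bullet> y) * of_real (gauss t k)) = complex_of_real (?c * (?g (\<alpha> K) - \<gamma>\<^sup>2 * ?g lborel))" .
  qed
  then have "bartlett_spectral_measure P (kernel_apply K \<Phi>) = \<rho>"
    using intensity_K_eq_L intensity_L
    by (intro bartlett_spectral_measure_eqI[OF K_measurable square_integrable_K _ tempered_\<alpha>_K \<rho>]) simp_all
  moreover have "bartlett_spectral_measure P (kernel_apply L \<Phi>) = \<nu>"
    by (rule bartlett_spectral_measure_eqI[OF L_measurable square_integrable intensity_L tempered_\<alpha>_L \<nu>])
  moreover have "emeasure \<rho> B = emeasure \<nu> B + emeasure ?\<eta> B"
    using nn[OF borel_measurable_indicator[OF B]] B s tempered_sets(1)[OF \<nu>(1)] by simp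
  ultimately show ?thesis by simp
qed

end

theorem theorem4p5:
  fixes P :: "'w measure"
    and T :: "'w \<Rightarrow> ('a::euclidean_space \<times> 'a) measure"
    and \<Phi> :: "'w \<Rightarrow> 'a measure"
    and L K :: "'w \<times> 'a \<Rightarrow> 'a measure"
    and F :: "'a measure \<Rightarrow> 'a measure measure"
    and X :: "nat \<Rightarrow> 'w \<Rightarrow> 'a"
  defines "\<Phi> \<equiv> \<lambda>\<omega>. first_marginal (T \<omega>)"
  assumes "prob_space P"
    and "stationary_transport P T"
    and "purely_discrete P \<Phi>"
    and "0 < intensity P \<Phi>" and "intensity P \<Phi> < \<infinity>"
    and "prob_kernel P L"
    and "disintegrates P T L \<Phi>"
    and F_measurable: "F \<in> prob_algebra borel \<rightarrow>\<^sub>M prob_algebra (prob_algebra borel)"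
    and F_mean: "\<And>\<pi> B. \<pi> \<in> space (prob_algebra borel) \<Longrightarrow> B \<in> sets borel \<Longrightarrow>
          (\<integral>\<^sup>+\<pi>'. emeasure \<pi>' B \<partial>F \<pi>) = emeasure \<pi> B"
    and F_shift: "\<And>\<pi> x. \<pi> \<in> space (prob_algebra borel) \<Longrightarrow>
          F (shift_measure x \<pi>) = distr (F \<pi>) (prob_algebra borel) (shift_measure x)"
    and "prob_kernel P K"
    and "enumerates_atoms P (sigma_generated P T) \<Phi> X"
    and "cond_indep_family P (sigma_generated P T) (prob_algebra borel)
          (atom_indices \<Phi> X) (\<lambda>n \<omega>. K (\<omega>, X n \<omega>))"
    and K_law: "\<And>n A. A \<in> sets (prob_algebra borel) \<Longrightarrow>
          AE \<omega> in P. n \<in> atom_indices \<Phi> X \<omega> \<longrightarrow>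
            cond_probability P (sigma_generated P T) {\<omega>\<in>space P. K (\<omega>, X n \<omega>) \<in> A} \<omega> =
            measure (F (L (\<omega>, X n \<omega>))) A"
    and "(\<integral>\<^sup>+\<mu>. emeasure (first_marginal \<mu>) {0} \<partial>palm_measure P T) < \<infinity>"
    and "locally_square_integrable P (kernel_apply K \<Phi>) \<or>
         locally_square_integrable P (kernel_apply L \<Phi>)"
  shows "\<forall>B\<in>sets borel.
           emeasure (bartlett_spectral_measure P (kernel_apply K \<Phi>)) B =
           emeasure (bartlett_spectral_measure P (kernel_apply L \<Phi>)) B +
           emeasure (density lborel (\<lambda>k. ennreal (eta_hat P T F k))) B"
proof
  fix B :: "'a set" assume B: "B \<in> sets borel"
  interpret prob_space P by fact
  note facts = assms[unfolded \<Phi>_def] F_mean F_shift K_law[unfolded \<Phi>_def]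
  interpret setting: bartlett_setting P T L F K X
    by unfold_locales (fact facts)+
  \<comment> \<open>Either alternative of the hypothesis gives square integrability of
    L\<Phi>.\<close>
  have "locally_square_integrable P (kernel_apply L (\<lambda>\<omega>. first_marginal (T \<omega>)))"
    using facts setting.locally_square_integrable_K_iff_L by blast
  then interpret bartlett_square_integrable P T L F K X
    by unfold_locales
  show "emeasure (bartlett_spectral_measure P (kernel_apply K \<Phi>)) B =
           emeasure (bartlett_spectral_measure P (kernel_apply L \<Phi>)) B +
           emeasure (density lborel (\<lambda>k. ennreal (eta_hat P T F k))) B"
    unfolding \<Phi>_def by (rule bartlett_spectral_measure_K[OF B])
qed

end
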